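(* Let $U=\{U_\varphi\}_{\varphi\in\mathcal D_d}\in\mathcal D'_d(\mathscr H)$ be a multivariate second order random distribution field. (a) If $U$ is $\mathbb R^d$-stationary, then the mapping $$\mathscr H_{(U)}\ni U_\varphi\mapsto\mathcal F_d\varphi\in L^2(\nu_U),\qquad\varphi\in\mathcal D_d,$$ can be extended to a Hilbert space isomorphism (unitary operator) between $\mathscr H_{(U)}$ and $L^2(\nu_U)$. (b) If $U$ is operator $\mathbb R^d$-stationary, then the mapping $$\mathscr H_U\ni U_\varphi\mapsto(\mathcal F_d\varphi)I_H\in L^2(F_U),\qquad\varphi\in\mathcal D_d,$$ can be extended to a normal Hilbert $\mathcal B(H)$-module isomorphism (gramian unitary operator, i.e. a $\mathcal B(H)$-linear, gramian preserving bijection) of $\mathscr H_U$ onto $L^2(F_U)$.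
   Context: $d\ge1$ is a fixed natural number, $H$ is a separable infinite dimensional complex Hilbert space with identity operator $I_H$, $\mathcal B(H)$ its bounded operators, $\mathscr C_1(H)$ its trace class operators, and $(\Omega,\mathscr A,\wp)$ is a probability space. $\mathscr H:=L^2_{s,0}[\wp,H]$ is the space of (classes of) strongly measurable $H$-valued random variables $X$ with $\int\|X\|_H^2\,d\wp<\infty$ and zero mean. It is a left $\mathcal B(H)$-module by $(aX)(\omega)=a(X(\omega))$, with $\mathscr C_1(H)$-valued gramian $([X,Y]_{\mathscr H}h,k)_H=\int (h,Y(\omega))_H\,(X(\omega),k)_H\,d\wp(\omega)$, $h,k\in H$, and scalar product $(X,Y)_{\mathscr H}=\operatorname{tr}[X,Y]_{\mathscr H}$ (a normal Hilbert $\mathcal B(H)$-module). $\mathcal D_d$ is the space of complex valued test functions ($C^\infty$ with compact support) on $\mathbb R^d$; $\mathcal D'_d(E)$ is the space of continuous linear maps $\mathcal D_d\to E$. Elements $U=\{U_\varphi\}_{\varphi\in\mathcal D_d}$ of $\mathcal D'_d(\mathscr H)$ are called multivariate second order random distribution fields. With $(\tau_x\varphi)(y)=\varphi(y-x)$, $U$ is operator $\mathbb R^d$-stationary if $[U_{\tau_x\varphi},U_{\tau_x\psi}]_{\mathscr H}=[U_\varphi,U_\psi]_{\mathscr H}$ for all $x\in\mathbb R^d$, $\varphi,\psi\in\mathcal D_d$, and $\mathbb R^d$-stationary if the same holds with $(\cdot,\cdot)_{\mathscr H}$ in place of $[\cdot,\cdot]_{\mathscr H}$. Time domains: $\mathscr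 H_{(U)}$ (vector time domain) is the closed linear span of $\{U_\varphi:\varphi\in\mathcal D_d\}$ in $\mathscr H$; $\mathscr H_U$ (modular time domain) is the closed $\mathcal B(H)$-submodule of $\mathscr H$ generated by $\{U_\varphi:\varphi\in\mathcal D_d\}$, i.e. the closed linear span of $\{aU_\varphi:a\in\mathcal B(H),\varphi\in\mathcal D_d\}$. Representing measures: $(\mathcal F_d\varphi)(t)=\int e^{-2\pi i\langle x,t\rangle}\varphi(x)\,dx$ and $\widetilde\varphi(x)=\overline{\varphi(-x)}$. If $U$ is $\mathbb R^d$-stationary, $\nu_U$ is the positive tempered measure on $\mathbb R^d$ such that $(U_\varphi,U_\psi)_{\mathscr H}=k_U(\varphi*\widetilde\psi)$ with $k_U(\varphi)=\int\mathcal F_d\varphi\,d\nu_U$, $\varphi,\psi\in\mathcal D_d$. If $U$ is operator $\mathbb R^d$-stationary, $F_U$ is the $\mathscr C_1(H)$-valued positive tempered measure on $\mathbb R^d$ such that $[U_\varphi,U_\psi]_{\mathscr H}=K_U(\varphi*\widetilde\psi)$ with $K_U(\varphi)=\int\mathcal F_d\varphi\,dF_U$, $\varphi,\psi\in\mathcal D_d$. (A positive, respectively $\mathscr C_1(H)$-valued positive, tempered measure is a countably additive set function on the bounded Borel sets with values in $[0,\infty)$, respectively in the positive trace class operators, which defines by integration of Schwartz functions a tempered distribution.) The space $L^2(F)$ for such an operator measure $F$: let $\mu=\operatorname{tr}F$ and let $F'=dF/d\mu$ be the positive $\mathscr C_1(H)$-valued density. $L^2(F)$ consists of the functions $\Phi$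 on $\mathbb R^d$ whose values are (possibly unbounded) linear operators in $H$ such that $\Phi(t)F'(t)^{1/2}$ is defined and Hilbert–Schmidt for $\mu$-a.e. $t$ and $t\mapsto\Phi(t)F'(t)^{1/2}$ belongs to $L^2(\mu)$ with values in the Hilbert–Schmidt class; $\Phi,\Psi$ are identified when $\Phi F'^{1/2}=\Psi F'^{1/2}$ $\mu$-a.e. It is a normal Hilbert $\mathcal B(H)$-module under left multiplication by operators, with gramian $[\Phi,\Psi]_{L^2(F)}=\int\Phi\,dF\,\Psi^*:=\int(\Phi F'^{1/2})(\Psi F'^{1/2})^*\,d\mu\in\mathscr C_1(H)$. *)

theory Defs
  imports "HOL-Probability.Probability"
begin

section \<open>Complex Hilbert spaces and operators\<close>

text \<open>The scalar product is linear in its first argument. A separable Hilbert space is a type of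
  sort \<open>{complex_hilbert, second_countable_topology}\<close>.\<close>

class complex_hilbert = banach +
  fixes scaleC :: "complex \<Rightarrow> 'a \<Rightarrow> 'a"  (infixr "*\<^sub>C" 75)
    and cinner :: "'a \<Rightarrow> 'a \<Rightarrow> complex"
  assumes scaleC_add_right: "c *\<^sub>C (x + y) = c *\<^sub>C x + c *\<^sub>C y"
    and scaleC_add_left: "(b + c) *\<^sub>C x = b *\<^sub>C x + c *\<^sub>C x"
    and scaleC_scaleC: "b *\<^sub>C c *\<^sub>C x = (b * c) *\<^sub>C x"
    and scaleR_eq_scaleC: "scaleR r x = complex_of_real r *\<^sub>C x"
    and cinner_commute: "cinner x y = cnj (cinner y x)"
    and cinner_add_left: "cinner (x + y) z = cinner x z + cinner y z"
    and cinner_scaleC_left: "cinner (c *\<^sub>C x) y = c * cinner x y"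
    and power2_norm_eq_cinner: "(norm x)\<^sup>2 = Re (cinner x x)"

definition bounded_clinear :: "('h::complex_hilbert \<Rightarrow> 'h) \<Rightarrow> bool" where
  "bounded_clinear T \<longleftrightarrow> bounded_linear T \<and> (\<forall>c h. T (c *\<^sub>C h) = c *\<^sub>C T h)"

definition positive_op :: "('h::complex_hilbert \<Rightarrow> 'h) \<Rightarrow> bool" where
  "positive_op T \<longleftrightarrow> bounded_clinear T \<and> (\<forall>h. cinner (T h) h \<in> \<real> \<and> 0 \<le> Re (cinner (T h) h))"

definition adj :: "('h::complex_hilbert \<Rightarrow> 'h) \<Rightarrow> 'h \<Rightarrow> 'h" where
  "adj T = (THE S. \<forall>h k. cinner (T h) k = cinner h (S k))"

definition op_sqrt :: "('h::complex_hilbert \<Rightarrow> 'h) \<Rightarrow> 'h \<Rightarrow> 'h" where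
  "op_sqrt T = (THE S. positive_op S \<and> S \<circ> S = T)"

definition op_abs :: "('h::complex_hilbert \<Rightarrow> 'h) \<Rightarrow> 'h \<Rightarrow> 'h" where
  "op_abs T = op_sqrt (adj T \<circ> T)"

definition is_onb :: "'h::complex_hilbert set \<Rightarrow> bool" where
  "is_onb B \<longleftrightarrow> (\<forall>e\<in>B. \<forall>f\<in>B. cinner e f = (if e = f then 1 else 0))
     \<and> closure (module.span (*\<^sub>C) B) = UNIV"

text \<open>An arbitrary orthonormal basis; trace, trace class and Hilbert--Schmidt class do not depend
  on this choice.\<close>

definition hbasis :: "'h::complex_hilbert set" where
  "hbasis = (SOME B. is_onb B)"

definition trace_op :: "('h::complex_hilbert \<Rightarrow> 'h) \<Rightarrow> complex" where
  "trace_op T = (\<Sum>\<^sub>\<infinity>e\<in>hbasis. cinner (T e) e)"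

definition trace_class :: "('h::complex_hilbert \<Rightarrow> 'h) \<Rightarrow> bool" where
  "trace_class T \<longleftrightarrow> bounded_clinear T \<and> (\<lambda>e. cinner (op_abs T e) e) summable_on hbasis"

definition trace_norm :: "('h::complex_hilbert \<Rightarrow> 'h) \<Rightarrow> real" where
  "trace_norm T = Re (trace_op (op_abs T))"

definition hilbert_schmidt :: "('h::complex_hilbert \<Rightarrow> 'h) \<Rightarrow> bool" where
  "hilbert_schmidt T \<longleftrightarrow> bounded_clinear T \<and> (\<lambda>e. (norm (T e))\<^sup>2) summable_on hbasis"

definition hs_norm :: "('h::complex_hilbert \<Rightarrow> 'h) \<Rightarrow> real" where
  "hs_norm T = sqrt (\<Sum>\<^sub>\<infinity>e\<in>hbasis. (norm (T e))\<^sup>2)"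

text \<open>Borel \<open>\<sigma>\<close>-algebra of the Hilbert--Schmidt class with its norm topology. For separable \<open>'h\<close>
  this class is separable, so measurability for it is strong measurability.\<close>

definition hs_borel :: "('h::complex_hilbert \<Rightarrow> 'h) measure" where
  "hs_borel = sigma (Collect hilbert_schmidt)
     {W. W \<subseteq> Collect hilbert_schmidt \<and>
         (\<forall>T\<in>W. \<exists>r>0. \<forall>S. hilbert_schmidt S \<and> hs_norm (\<lambda>h. S h - T h) < r \<longrightarrow> S \<in> W)}"

section \<open>Abstract inner product spaces and Hilbert modules\<close>

record 'x ip_space =
  carrier :: "'x set"
  vadd :: "'x \<Rightarrow> 'x \<Rightarrow> 'x"
  vscale :: "complex \<Rightarrow> 'x \<Rightarrow> 'x"
  ip :: "'x \<Rightarrow> 'x \<Rightarrow> complex"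

text \<open>\<open>act\<close> is the action of the bounded operators on \<open>'h\<close>.\<close>

record ('x, 'h) hilbert_module = "'x ip_space" +
  act :: "('h \<Rightarrow> 'h) \<Rightarrow> 'x \<Rightarrow> 'x"
  gram :: "'x \<Rightarrow> 'x \<Rightarrow> 'h \<Rightarrow> 'h"

definition ip_dist :: "('x, 'm) ip_space_scheme \<Rightarrow> 'x \<Rightarrow> 'x \<Rightarrow> real" where
  "ip_dist E p q = (let r = vadd E p (vscale E (- 1) q) in sqrt (Re (ip E r r)))"

text \<open>Linear span, for a nonempty set of generators.\<close>

inductive_set lin_span :: "('x, 'm) ip_space_scheme \<Rightarrow> 'x set \<Rightarrow> 'x set"
  for E :: "('x, 'm) ip_space_scheme" and A :: "'x set" where
  base: "p \<in> A \<Longrightarrow> p \<in> lin_span E A"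
| add: "p \<in> lin_span E A \<Longrightarrow> q \<in> lin_span E A \<Longrightarrow> vadd E p q \<in> lin_span E A"
| scale: "p \<in> lin_span E A \<Longrightarrow> vscale E c p \<in> lin_span E A"

definition closed_span :: "('x, 'm) ip_space_scheme \<Rightarrow> 'x set \<Rightarrow> 'x set" where
  "closed_span E A = {p \<in> carrier E. \<forall>e>0. \<exists>q\<in>lin_span E A. ip_dist E q p < e}"

definition unitary_iso ::
  "('x, 'm) ip_space_scheme \<Rightarrow> ('y, 'n) ip_space_scheme \<Rightarrow> ('x \<Rightarrow> 'y) \<Rightarrow> bool" where
  "unitary_iso E1 E2 W \<longleftrightarrow> bij_betw W (carrier E1) (carrier E2)
     \<and> (\<forall>p\<in>carrier E1. \<forall>q\<in>carrier E1. W (vadd E1 p q) = vadd E2 (W p) (W q))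
     \<and> (\<forall>c. \<forall>p\<in>carrier E1. W (vscale E1 c p) = vscale E2 c (W p))
     \<and> (\<forall>p\<in>carrier E1. \<forall>q\<in>carrier E1. ip E2 (W p) (W q) = ip E1 p q)"

definition gramian_unitary_iso ::
  "('x, 'h::complex_hilbert) hilbert_module \<Rightarrow> ('y, 'h) hilbert_module \<Rightarrow> ('x \<Rightarrow> 'y) \<Rightarrow> bool" where
  "gramian_unitary_iso E1 E2 W \<longleftrightarrow> bij_betw W (carrier E1) (carrier E2)
     \<and> (\<forall>p\<in>carrier E1. \<forall>q\<in>carrier E1. W (vadd E1 p q) = vadd E2 (W p) (W q))
     \<and> (\<forall>c. \<forall>p\<in>carrier E1. W (vscale E1 c p) = vscale E2 c (W p))
     \<and> (\<forall>a. bounded_clinear a \<longrightarrow> (\<forall>p\<in>carrier E1. W (act E1 a p) = act E2 a (W p)))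
     \<and> (\<forall>p\<in>carrier E1. \<forall>q\<in>carrier E1. gram E2 (W p) (W q) = gram E1 p q)"

definition rep :: "'x set \<Rightarrow> 'x" where
  "rep p = (SOME x. x \<in> p)"

section \<open>Second order random variables\<close>

text \<open>For separable \<open>'h\<close>, Borel measurability is strong measurability.\<close>

definition rv2 :: "'w measure \<Rightarrow> ('w \<Rightarrow> 'h::{complex_hilbert, second_countable_topology}) set" where
  "rv2 M = {X \<in> borel_measurable M. integrable M (\<lambda>\<omega>. (norm (X \<omega>))\<^sup>2) \<and> (\<integral>\<omega>. X \<omega> \<partial>M) = 0}"

definition rv2_rel ::
  "'w measure \<Rightarrow> (('w \<Rightarrow> 'h::{complex_hilbert, second_countable_topology}) \<times> ('w \<Rightarrow> 'h)) set" where
  "rv2_rel M = {(X, Y). X \<in> rv2 M \<and> Y \<in> rv2 M \<and> (AE \<omega> in M. X \<omega> = Y \<omega>)}"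

definition rv_gramian ::
  "'w measure \<Rightarrow> ('w \<Rightarrow> 'h::complex_hilbert) \<Rightarrow> ('w \<Rightarrow> 'h) \<Rightarrow> 'h \<Rightarrow> 'h" where
  "rv_gramian M X Y =
     (THE T. \<forall>h k. cinner (T h) k = (\<integral>\<omega>. cinner h (Y \<omega>) * cinner (X \<omega>) k \<partial>M))"

definition RV2 :: "'w measure \<Rightarrow>
    (('w \<Rightarrow> 'h::{complex_hilbert, second_countable_topology}) set, 'h) hilbert_module" where
  "RV2 M = \<lparr>
     carrier = rv2 M // rv2_rel M,
     vadd = (\<lambda>p q. rv2_rel M `` {\<lambda>\<omega>. rep p \<omega> + rep q \<omega>}),
     vscale = (\<lambda>c p. rv2_rel M `` {\<lambda>\<omega>. c *\<^sub>C rep p \<omega>}),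
     ip = (\<lambda>p q. trace_op (rv_gramian M (rep p) (rep q))),
     act = (\<lambda>a p. rv2_rel M `` {\<lambda>\<omega>. a (rep p \<omega>)}),
     gram = (\<lambda>p q. rv_gramian M (rep p) (rep q)) \<rparr>"

section \<open>Test functions and distributions\<close>

text \<open>Iterated partial derivatives; a multi-index is given as a list of coordinates.\<close>

primrec ipartial :: "'d::finite list \<Rightarrow> (real^'d \<Rightarrow> complex) \<Rightarrow> real^'d \<Rightarrow> complex" where
  "ipartial [] f = f"
| "ipartial (i # is) f = (\<lambda>x. frechet_derivative (ipartial is f) (at x) (axis i 1))"

definition smooth :: "(real^'d::finite \<Rightarrow> complex) \<Rightarrow> bool" where
  "smooth f \<longleftrightarrow> (\<forall>is x. ipartial is f differentiable (at x))"

definition supp :: "(real^'d::finite \<Rightarrow> complex) \<Rightarrow> (real^'d) set" where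
  "supp f = closure {x. f x \<noteq> 0}"

definition test_funs :: "(real^'d::finite \<Rightarrow> complex) set" where
  "test_funs = {\<phi>. smooth \<phi> \<and> compact (supp \<phi>)}"

definition schwartz :: "(real^'d::finite \<Rightarrow> complex) set" where
  "schwartz = {\<phi>. smooth \<phi> \<and>
     (\<forall>is k. bounded (range (\<lambda>x. complex_of_real ((1 + norm x) ^ k) * ipartial is \<phi> x)))}"

text \<open>Neighbourhood bases of zero: for the strict inductive limit topology of the test functions
  (the finest locally convex topology for which all inclusions of the spaces of test functions
  supported in a fixed compact set are continuous), and for the Schwartz space.\<close>

definition test_nhds :: "(real^'d::finite \<Rightarrow> complex) set set" where
  "test_nhds = {V. V \<subseteq> test_funs
     \<and> (\<forall>\<phi>\<in>V. \<forall>\<psi>\<in>V. \<forall>a b. cmod a + cmod b \<le> 1 \<longrightarrow> (\<lambda>x. a * \<phi> x + b * \<psi> x) \<in> V)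
     \<and> (\<forall>K. compact K \<longrightarrow> (\<exists>n. \<exists>\<epsilon>>0. {\<phi> \<in> test_funs. supp \<phi> \<subseteq> K \<and>
            (\<forall>is x. length is \<le> n \<longrightarrow> cmod (ipartial is \<phi> x) < \<epsilon>)} \<subseteq> V))}"

definition schwartz_nhds :: "(real^'d::finite \<Rightarrow> complex) set set" where
  "schwartz_nhds = {{\<phi> \<in> schwartz. \<forall>is x. length is \<le> n \<longrightarrow>
       (1 + norm x) ^ n * cmod (ipartial is \<phi> x) < \<epsilon>} | n \<epsilon>. 0 < \<epsilon>}"

text \<open>Continuity on a space \<open>D\<close> of functions with neighbourhood base \<open>N\<close> of zero, with values in a
  space with distance \<open>dst\<close>.\<close>

definition continuous_wrt ::
  "('a \<Rightarrow> complex) set \<Rightarrow> ('a \<Rightarrow> complex) set set \<Rightarrow> ('y \<Rightarrow> 'y \<Rightarrow> real) \<Rightarrow> (('a \<Rightarrow> complex) \<Rightarrow> 'y) \<Rightarrow> bool"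
  where
  "continuous_wrt D N dst L \<longleftrightarrow>
     (\<forall>\<phi>\<in>D. \<forall>e>0. \<exists>V\<in>N. \<forall>\<psi>\<in>V. dst (L (\<lambda>x. \<phi> x + \<psi> x)) (L \<phi>) < e)"

definition distributions ::
  "('x, 'm) ip_space_scheme \<Rightarrow> ((real^'d::finite \<Rightarrow> complex) \<Rightarrow> 'x) set" where
  "distributions E = {U. (\<forall>\<phi>\<in>test_funs. U \<phi> \<in> carrier E)
     \<and> (\<forall>\<phi>\<in>test_funs. \<forall>\<psi>\<in>test_funs. U (\<lambda>x. \<phi> x + \<psi> x) = vadd E (U \<phi>) (U \<psi>))
     \<and> (\<forall>c. \<forall>\<phi>\<in>test_funs. U (\<lambda>x. c * \<phi> x) = vscale E c (U \<phi>))
     \<and> continuous_wrt test_funs test_nhds (ip_dist E) U}"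

definition translate :: "real^'d::finite \<Rightarrow> (real^'d \<Rightarrow> complex) \<Rightarrow> real^'d \<Rightarrow> complex" where
  "translate x \<phi> = (\<lambda>y. \<phi> (y - x))"

definition tilde :: "(real^'d::finite \<Rightarrow> complex) \<Rightarrow> real^'d \<Rightarrow> complex" where
  "tilde \<phi> = (\<lambda>x. cnj (\<phi> (- x)))"

definition convol ::
  "(real^'d::finite \<Rightarrow> complex) \<Rightarrow> (real^'d \<Rightarrow> complex) \<Rightarrow> real^'d \<Rightarrow> complex" where
  "convol \<phi> \<psi> = (\<lambda>x. \<integral>y. \<phi> y * \<psi> (x - y) \<partial>lborel)"

definition fourier :: "(real^'d::finite \<Rightarrow> complex) \<Rightarrow> real^'d \<Rightarrow> complex" where
  "fourier \<phi> = (\<lambda>t. \<integral>x. cis (- 2 * pi * (x \<bullet> t)) * \<phi> x \<partial>lborel)"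

section \<open>Tempered measures\<close>

text \<open>A positive countably additive set function on the bounded Borel sets is identified with its
  unique extension to a Borel measure.\<close>

definition tempered_measure :: "(real^'d::finite) measure \<Rightarrow> bool" where
  "tempered_measure \<nu> \<longleftrightarrow> sets \<nu> = sets borel
     \<and> (\<forall>A\<in>sets borel. bounded A \<longrightarrow> emeasure \<nu> A < \<infinity>)
     \<and> (\<forall>\<phi>\<in>schwartz. integrable \<nu> \<phi>)
     \<and> continuous_wrt schwartz schwartz_nhds dist (\<lambda>\<phi>. \<integral>t. \<phi> t \<partial>\<nu>)"

text \<open>The Borel measure extending a positive countably additive function on the bounded Borel
  sets.\<close>

definition borel_ext :: "((real^'d::finite) set \<Rightarrow> real) \<Rightarrow> (real^'d) measure" where
  "borel_ext m =
     measure_of UNIV (sets borel) (\<lambda>A. SUP n. ennreal (m (A \<inter> cball 0 (real (n::nat)))))"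

definition trace_measure ::
  "((real^'d::finite) set \<Rightarrow> 'h::complex_hilbert \<Rightarrow> 'h) \<Rightarrow> (real^'d) measure" where
  "trace_measure F = borel_ext (\<lambda>A. Re (trace_op (F A)))"

definition positive_op_measure ::
  "((real^'d::finite) set \<Rightarrow> 'h::complex_hilbert \<Rightarrow> 'h) \<Rightarrow> bool" where
  "positive_op_measure F \<longleftrightarrow>
     (\<forall>A\<in>sets borel. bounded A \<longrightarrow> positive_op (F A) \<and> trace_class (F A))
     \<and> (\<forall>A::nat \<Rightarrow> (real^'d) set. range A \<subseteq> sets borel \<and> disjoint_family A \<and> bounded (\<Union>i. A i) \<longrightarrow>
          (\<lambda>n. trace_norm (\<lambda>h. F (\<Union>i. A i) h - (\<Sum>i<n. F (A i) h))) \<longlonglongrightarrow> 0)"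

text \<open>The integral of a scalar function is the operator \<open>T\<close> with
  \<open>(T h, h) = \<integral>\<phi> d(F(\<cdot>)h, h)\<close>; by polarization this determines all \<open>(T h, k)\<close>.\<close>

definition op_integral ::
  "((real^'d::finite) set \<Rightarrow> 'h::complex_hilbert \<Rightarrow> 'h) \<Rightarrow> (real^'d \<Rightarrow> complex) \<Rightarrow> 'h \<Rightarrow> 'h" where
  "op_integral F \<phi> = (THE T. bounded_clinear T \<and>
     (\<forall>h. cinner (T h) h = (\<integral>t. \<phi> t \<partial>borel_ext (\<lambda>A. Re (cinner (F A h) h)))))"

text \<open>For positive values the trace norm is the trace, so \<open>trace_measure F\<close> is the total variation
  of \<open>F\<close>.\<close>

definition tempered_op_measure ::
  "((real^'d::finite) set \<Rightarrow> 'h::complex_hilbert \<Rightarrow> 'h) \<Rightarrow> bool" where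
  "tempered_op_measure F \<longleftrightarrow> positive_op_measure F
     \<and> (\<forall>\<phi>\<in>schwartz. integrable (trace_measure F) \<phi> \<and> trace_class (op_integral F \<phi>))
     \<and> continuous_wrt schwartz schwartz_nhds (\<lambda>S T. trace_norm (\<lambda>h. S h - T h)) (op_integral F)"

text \<open>\<open>F'\<close> is a version of the density of \<open>F\<close> with respect to its trace. The trace class is
  separable for separable \<open>'h\<close>, so it suffices to require measurability weakly, and the integrals
  are determined by their sesquilinear forms.\<close>

definition is_trace_density ::
  "((real^'d::finite) set \<Rightarrow> 'h::complex_hilbert \<Rightarrow> 'h) \<Rightarrow> (real^'d \<Rightarrow> 'h \<Rightarrow> 'h) \<Rightarrow> bool" where
  "is_trace_density F F' \<longleftrightarrow>
     (\<forall>t. positive_op (F' t) \<and> trace_class (F' t))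
     \<and> (\<forall>h k. (\<lambda>t. cinner (F' t h) k) \<in> borel_measurable (trace_measure F))
     \<and> (\<forall>A\<in>sets borel. bounded A \<longrightarrow>
          integrable (trace_measure F) (\<lambda>t. indicator A t * trace_norm (F' t))
          \<and> (\<forall>h k. cinner (F A h) k =
               (\<integral>t. indicator A t * cinner (F' t h) k \<partial>trace_measure F)))"

section \<open>The spaces \<open>L\<^sup>2\<close>\<close>

definition l2 :: "'t measure \<Rightarrow> ('t \<Rightarrow> complex) set" where
  "l2 \<nu> = {f \<in> borel_measurable \<nu>. integrable \<nu> (\<lambda>t. (cmod (f t))\<^sup>2)}"

definition l2_rel :: "'t measure \<Rightarrow> (('t \<Rightarrow> complex) \<times> ('t \<Rightarrow> complex)) set" where
  "l2_rel \<nu> = {(f, g). f \<in> l2 \<nu> \<and> g \<in> l2 \<nu> \<and> (AE t in \<nu>. f t = g t)}"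

definition L2 :: "'t measure \<Rightarrow> ('t \<Rightarrow> complex) set ip_space" where
  "L2 \<nu> = \<lparr>
     carrier = l2 \<nu> // l2_rel \<nu>,
     vadd = (\<lambda>p q. l2_rel \<nu> `` {\<lambda>t. rep p t + rep q t}),
     vscale = (\<lambda>c p. l2_rel \<nu> `` {\<lambda>t. c * rep p t}),
     ip = (\<lambda>p q. \<integral>t. rep p t * cnj (rep q t) \<partial>\<nu>) \<rparr>"

text \<open>Possibly unbounded linear operators are partial functions whose domain is a subspace.\<close>

definition partial_clinear :: "('h::complex_hilbert \<rightharpoonup> 'h) \<Rightarrow> bool" where
  "partial_clinear A \<longleftrightarrow> module.subspace (*\<^sub>C) (dom A)
     \<and> (\<forall>x\<in>dom A. \<forall>y\<in>dom A. the (A (x + y)) = the (A x) + the (A y))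
     \<and> (\<forall>c. \<forall>x\<in>dom A. the (A (c *\<^sub>C x)) = c *\<^sub>C the (A x))"

definition partial_add :: "('h::complex_hilbert \<rightharpoonup> 'h) \<Rightarrow> ('h \<rightharpoonup> 'h) \<Rightarrow> 'h \<rightharpoonup> 'h" where
  "partial_add A B = (\<lambda>h. if h \<in> dom A \<inter> dom B then Some (the (A h) + the (B h)) else None)"

definition l2_hs :: "'t measure \<Rightarrow> ('t \<Rightarrow> 'h::complex_hilbert \<Rightarrow> 'h) set" where
  "l2_hs \<mu> = {G \<in> measurable \<mu> hs_borel. integrable \<mu> (\<lambda>t. (hs_norm (G t))\<^sup>2)}"

text \<open>The product \<open>\<Phi>(t) F'(t)\<^sup>1\<^sup>/\<^sup>2\<close>, meaningful where the range of the square root lies in the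
  domain of \<open>\<Phi>(t)\<close>.\<close>

definition times_sqrt ::
  "(real^'d::finite \<Rightarrow> 'h::complex_hilbert \<Rightarrow> 'h) \<Rightarrow> (real^'d \<Rightarrow> 'h \<rightharpoonup> 'h) \<Rightarrow> real^'d \<Rightarrow> 'h \<Rightarrow> 'h" where
  "times_sqrt F' \<Phi> t = (\<lambda>h. the (\<Phi> t (op_sqrt (F' t) h)))"

definition l2_op ::
  "((real^'d::finite) set \<Rightarrow> 'h::complex_hilbert \<Rightarrow> 'h) \<Rightarrow> (real^'d \<Rightarrow> 'h \<Rightarrow> 'h) \<Rightarrow>
    (real^'d \<Rightarrow> 'h \<rightharpoonup> 'h) set" where
  "l2_op F F' = {\<Phi>. (\<forall>t. partial_clinear (\<Phi> t)) \<and>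
     (\<exists>G\<in>l2_hs (trace_measure F). AE t in trace_measure F.
        range (op_sqrt (F' t)) \<subseteq> dom (\<Phi> t) \<and> times_sqrt F' \<Phi> t = G t)}"

definition l2_op_rel ::
  "((real^'d::finite) set \<Rightarrow> 'h::complex_hilbert \<Rightarrow> 'h) \<Rightarrow> (real^'d \<Rightarrow> 'h \<Rightarrow> 'h) \<Rightarrow>
    ((real^'d \<Rightarrow> 'h \<rightharpoonup> 'h) \<times> (real^'d \<Rightarrow> 'h \<rightharpoonup> 'h)) set" where
  "l2_op_rel F F' = {(\<Phi>, \<Psi>). \<Phi> \<in> l2_op F F' \<and> \<Psi> \<in> l2_op F F' \<and>
     (AE t in trace_measure F. times_sqrt F' \<Phi> t = times_sqrt F' \<Psi> t)}"

text \<open>\<open>\<integral>\<Phi> dF \<Psi>\<^sup>*\<close>, in the weak sense. The completion makes the integrand measurable also when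
  \<open>times_sqrt F' \<Phi>\<close> agrees with a measurable function only almost everywhere.\<close>

definition op_gramian ::
  "((real^'d::finite) set \<Rightarrow> 'h::complex_hilbert \<Rightarrow> 'h) \<Rightarrow> (real^'d \<Rightarrow> 'h \<Rightarrow> 'h) \<Rightarrow>
    (real^'d \<Rightarrow> 'h \<rightharpoonup> 'h) \<Rightarrow> (real^'d \<Rightarrow> 'h \<rightharpoonup> 'h) \<Rightarrow> 'h \<Rightarrow> 'h" where
  "op_gramian F F' \<Phi> \<Psi> = (THE T. \<forall>h k. cinner (T h) k =
     (\<integral>t. cinner (times_sqrt F' \<Phi> t (adj (times_sqrt F' \<Psi> t) h)) k \<partial>completion (trace_measure F)))"

definition L2op ::
  "((real^'d::finite) set \<Rightarrow> 'h::complex_hilbert \<Rightarrow> 'h) \<Rightarrow> (real^'d \<Rightarrow> 'h \<Rightarrow> 'h) \<Rightarrow>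
    ((real^'d \<Rightarrow> 'h \<rightharpoonup> 'h) set, 'h) hilbert_module" where
  "L2op F F' = \<lparr>
     carrier = l2_op F F' // l2_op_rel F F',
     vadd = (\<lambda>p q. l2_op_rel F F' `` {\<lambda>t. partial_add (rep p t) (rep q t)}),
     vscale = (\<lambda>c p. l2_op_rel F F' `` {\<lambda>t h. map_option ((*\<^sub>C) c) (rep p t h)}),
     ip = (\<lambda>p q. trace_op (op_gramian F F' (rep p) (rep q))),
     act = (\<lambda>a p. l2_op_rel F F' `` {\<lambda>t h. map_option a (rep p t h)}),
     gram = (\<lambda>p q. op_gramian F F' (rep p) (rep q)) \<rparr>"

section \<open>Stationary fields\<close>

type_synonym ('d, 'w, 'h) field = "(real^'d \<Rightarrow> complex) \<Rightarrow> ('w \<Rightarrow> 'h) set"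

definition stationary ::
  "'w measure \<Rightarrow> ('d::finite, 'w, 'h::{complex_hilbert, second_countable_topology}) field \<Rightarrow> bool" where
  "stationary M U \<longleftrightarrow> (\<forall>x. \<forall>\<phi>\<in>test_funs. \<forall>\<psi>\<in>test_funs.
     ip (RV2 M) (U (translate x \<phi>)) (U (translate x \<psi>)) = ip (RV2 M) (U \<phi>) (U \<psi>))"

definition operator_stationary ::
  "'w measure \<Rightarrow> ('d::finite, 'w, 'h::{complex_hilbert, second_countable_topology}) field \<Rightarrow> bool" where
  "operator_stationary M U \<longleftrightarrow> (\<forall>x. \<forall>\<phi>\<in>test_funs. \<forall>\<psi>\<in>test_funs.
     gram (RV2 M) (U (translate x \<phi>)) (U (translate x \<psi>)) = gram (RV2 M) (U \<phi>) (U \<psi>))"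

definition representing_measure ::
  "'w measure \<Rightarrow> ('d::finite, 'w, 'h::{complex_hilbert, second_countable_topology}) field \<Rightarrow>
    (real^'d) measure \<Rightarrow> bool" where
  "representing_measure M U \<nu> \<longleftrightarrow> tempered_measure \<nu> \<and>
     (\<forall>\<phi>\<in>test_funs. \<forall>\<psi>\<in>test_funs.
        ip (RV2 M) (U \<phi>) (U \<psi>) = (\<integral>t. fourier (convol \<phi> (tilde \<psi>)) t \<partial>\<nu>))"

definition representing_op_measure ::
  "'w measure \<Rightarrow> ('d::finite, 'w, 'h::{complex_hilbert, second_countable_topology}) field \<Rightarrow>
    ((real^'d) set \<Rightarrow> 'h \<Rightarrow> 'h) \<Rightarrow> bool" where
  "representing_op_measure M U F \<longleftrightarrow> tempered_op_measure F \<and>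
     (\<forall>\<phi>\<in>test_funs. \<forall>\<psi>\<in>test_funs.
        gram (RV2 M) (U \<phi>) (U \<psi>) = op_integral F (fourier (convol \<phi> (tilde \<psi>))))"

text \<open>The vector and the modular time domain, with the structure inherited from \<open>RV2 M\<close>.\<close>

definition vector_domain ::
  "'w measure \<Rightarrow> ('d::finite, 'w, 'h::{complex_hilbert, second_countable_topology}) field \<Rightarrow>
    (('w \<Rightarrow> 'h) set, 'h) hilbert_module" where
  "vector_domain M U = (RV2 M)\<lparr>carrier := closed_span (RV2 M) {U \<phi> | \<phi>. \<phi> \<in> test_funs}\<rparr>"

definition modular_domain ::
  "'w measure \<Rightarrow> ('d::finite, 'w, 'h::{complex_hilbert, second_countable_topology}) field \<Rightarrow>
    (('w \<Rightarrow> 'h) set, 'h) hilbert_module" where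
  "modular_domain M U = (RV2 M)\<lparr>carrier := closed_span (RV2 M)
     {act (RV2 M) a (U \<phi>) | a \<phi>. bounded_clinear a \<and> \<phi> \<in> test_funs}\<rparr>"

end

theory Submission
  imports Defs "HOL-Real_Asymp.Real_Asymp"
begin

text \<open>By the exchange formula \<open>\<F>(\<phi> * \<psi>\<^sup>~) = \<F>\<phi> \<sqdot> cnj (\<F>\<psi>)\<close>, the representing measure turns
  scalar products (gramians) of the \<open>U\<^sub>\<phi>\<close> into those of the \<open>\<F>\<phi>\<close>, so \<open>U\<^sub>\<phi> \<mapsto> \<F>\<phi>\<close> extends isometrically to
  closed spans, and only density of the image needs an argument. If \<open>g\<close> is orthogonal to all \<open>\<F>\<phi>\<close>,
  replacing \<open>\<phi>\<close> by its translates shows that the Fourier transform of the complex measure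
  \<open>\<F>\<phi> \<sqdot> g d\<nu>\<close> vanishes; hence \<open>\<F>\<phi> \<sqdot> g = 0\<close> almost everywhere for all \<open>\<phi>\<close>, and \<open>g = 0\<close>.

  For operators, \<open>\<Phi> \<mapsto> \<Phi> F'\<^sup>1\<^sup>/\<^sup>2\<close> embeds \<open>L\<^sup>2(F)\<close> into the square integrable Hilbert--Schmidt valued
  functions. If \<open>G = \<Phi> F'\<^sup>1\<^sup>/\<^sup>2\<close> is orthogonal to all \<open>a (\<F>\<phi>) F'\<^sup>1\<^sup>/\<^sup>2\<close>, rank one operators \<open>a\<close> and the scalar
  case give \<open>F'\<^sup>1\<^sup>/\<^sup>2 G\<^sup>* = 0\<close>. As \<open>G\<close> vanishes on the kernel of \<open>F'\<^sup>1\<^sup>/\<^sup>2\<close>, also \<open>G G\<^sup>* = 0\<close>, so \<open>G = 0\<close>.\<close>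

section \<open>Complex Hilbert spaces\<close>

text \<open>The main obstacle is the completeness of \<open>L2op\<close>, whose elements are
  unbounded operators. Recording an operator function by its columns
  \<open>\<Phi> t (S t e)\<close>, with \<open>e\<close> in an orthonormal basis, turns it into a
  vector valued function on the product of the basis with the space of frequencies. Random
  variables, scalar functions and operator functions thus become three instances of one model of
  square integrable functions with one gramian formula, and Riesz--Fischer is proved only once. What
  remains specific to each of them is that the admissible functions form a closed subspace; for
  operator functions this means that vanishing on the kernel of the square root passes to limits.
  Acting with rank one operators recovers the gramian from scalar products, so an isometric module
  map preserves gramians as well. The density has trace one almost everywhere. This is derived from
  \<open>is_trace_density\<close>, which does not state it; it makes the density a contraction,
  whose square root is a limit of measurable iterates.\<close>

lemma scaleC_one [simp]: "1 *\<^sub>C (x::'a::complex_hilbert) = x"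
  using scaleR_eq_scaleC[of 1 x] by simp

interpretation scaleC: vector_space "(*\<^sub>C) :: complex \<Rightarrow> 'a \<Rightarrow> 'a::complex_hilbert"
  by unfold_locales (auto simp: scaleC_add_right scaleC_add_left scaleC_scaleC)

lemma cinner_add_right: "cinner x (y + z) = cinner x y + cinner x (z::'a::complex_hilbert)"
  by (metis cinner_add_left cinner_commute complex_cnj_add)

lemma cinner_scaleC_right: "cinner x (c *\<^sub>C y) = cnj c * cinner x (y::'a::complex_hilbert)"
  by (metis cinner_scaleC_left cinner_commute complex_cnj_mult)

lemma cinner_zero_left [simp]: "cinner 0 (x::'a::complex_hilbert) = 0"
  using cinner_scaleC_left[of 0 x x] by simp

lemma cinner_zero_right [simp]: "cinner x (0::'a::complex_hilbert) = 0"
  by (metis cinner_zero_left cinner_commute complex_cnj_zero)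

lemma cinner_minus_left: "cinner (- x) (y::'a::complex_hilbert) = - cinner x y"
  using cinner_scaleC_left[of "-1" x y] by simp

lemma cinner_minus_right: "cinner x (- y::'a::complex_hilbert) = - cinner x y"
  using cinner_scaleC_right[of x "-1" y] by simp

lemma cinner_diff_left: "cinner (x - y) (z::'a::complex_hilbert) = cinner x z - cinner y z"
  using cinner_add_left[of x "-y" z] by (simp add: cinner_minus_left)

lemma cinner_diff_right: "cinner x (y - z::'a::complex_hilbert) = cinner x y - cinner x z"
  using cinner_add_right[of x y "-z"] by (simp add: cinner_minus_right)

lemma cinner_self: "cinner x x = complex_of_real ((norm (x::'a::complex_hilbert))\<^sup>2)"
proof -
  have "Im (cinner x x) = 0"
    using arg_cong[OF cinner_commute[of x x], of Im] by simp
  then show ?thesis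
    by (simp add: complex_eq_iff power2_norm_eq_cinner)
qed

lemma norm_scaleC: "norm (c *\<^sub>C (x::'a::complex_hilbert)) = cmod c * norm x"
proof -
  have "cinner (c *\<^sub>C x) (c *\<^sub>C x) = (c * cnj c) * cinner x x"
    by (simp add: cinner_scaleC_left cinner_scaleC_right)
  also have "c * cnj c = complex_of_real ((cmod c)\<^sup>2)"
    by (simp only: complex_norm_square)
  finally have "(norm (c *\<^sub>C x))\<^sup>2 = (cmod c)\<^sup>2 * (norm x)\<^sup>2"
    unfolding cinner_self by (simp only: of_real_mult[symmetric] of_real_eq_iff)
  then show ?thesis
    by (metis mult_nonneg_nonneg norm_ge_zero power2_eq_imp_eq power_mult_distrib)
qed

text \<open>A nonnegative quadratic polynomial has no positive discriminant. The formulation with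
  numbers serves scalar products, forms of positive operators and the record spaces alike, and by
  including \<open>b = 0\<close> it needs no definiteness. With \<open>a = 0\<close> it turns a
  minimality condition into orthogonality.\<close>

lemma hermitian_Cauchy_Schwarz:
  fixes a b :: real and c :: complex
  assumes pos: "\<And>l. 0 \<le> a + 2 * Re (l * c) + (cmod l)\<^sup>2 * b" and b: "0 \<le> b"
  shows "(cmod c)\<^sup>2 \<le> a * b"
proof (cases "b = 0")
  case True
  have "c = 0"
  proof (rule ccontr)
    assume "c \<noteq> 0"
    then have c2: "(cmod c)\<^sup>2 > 0" by simp
    \<comment> \<open>With this \<open>t\<close> the polynomial has the value
      \<open>a - (a + 1)\<close> at \<open>- t * cnj c\<close>, which is negative.\<close>
    define t where "t = (a + 1) / (2 * (cmod c)\<^sup>2)"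
    have "Re (- of_real t * cnj c * c) = - t * (cmod c)\<^sup>2"
      by (simp add: mult.assoc complex_norm_square[symmetric] mult.commute[of "cnj c"] flip: of_real_power)
    then have "0 \<le> a - 2 * t * (cmod c)\<^sup>2"
      using pos[of "- of_real t * cnj c"] True by simp
    also have "2 * t * (cmod c)\<^sup>2 = a + 1"
      using c2 by (simp add: t_def)
    finally show False by simp
  qed
  then show ?thesis using True by simp
next
  case False
  then have b: "b > 0" using b by simp
  \<comment> \<open>The polynomial attains its minimum at \<open>- cnj c / b\<close>.\<close>
  have "Re (- cnj c / of_real b * c) = - ((cmod c)\<^sup>2 / b)"
    by (simp add: complex_norm_square[symmetric] mult.commute[of "cnj c"] flip: of_real_power of_real_divide)
  moreover have "(cmod (- cnj c / of_real b))\<^sup>2 * b = (cmod c)\<^sup>2 / b"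
    using b by (simp add: norm_divide power_divide power2_eq_square)
  ultimately have "0 \<le> a - (cmod c)\<^sup>2 / b"
    using pos[of "- cnj c / of_real b"] by (simp only:)
  then show ?thesis
    using b by (simp add: field_simps)
qed

lemma cinner_expand:
  "Re (cinner (x + l *\<^sub>C y) (x + l *\<^sub>C y)) =
     Re (cinner x x) + 2 * Re (l * cinner y x) + (cmod l)\<^sup>2 * Re (cinner y (y::'a::complex_hilbert))"
proof -
  have "cinner (x + l *\<^sub>C y) (x + l *\<^sub>C y) =
      cinner x x + (l * cinner y x + cnj (l * cinner y x)) + (l * cnj l) * cinner y y"
    unfolding cinner_add_left cinner_add_right cinner_scaleC_left cinner_scaleC_right complex_cnj_mult
      cinner_commute[of y x, symmetric] by (simp add: cinner_commute[of x y] algebra_simps)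
  also have "l * cnj l = complex_of_real ((cmod l)\<^sup>2)"
    by (simp only: complex_norm_square)
  finally show ?thesis
    by (simp only: plus_complex.sel complex_add_cnj Re_complex_of_real Im_complex_of_real
        times_complex.sel mult_zero_left diff_zero)
qed

lemma norm_cinner_le: "cmod (cinner x y) \<le> norm x * norm (y::'a::complex_hilbert)"
proof -
  have "(cmod (cinner y x))\<^sup>2 \<le> (norm x)\<^sup>2 * (norm y)\<^sup>2"
  proof (rule hermitian_Cauchy_Schwarz)
    fix l :: complex
    show "0 \<le> (norm x)\<^sup>2 + 2 * Re (l * cinner y x) + (cmod l)\<^sup>2 * (norm y)\<^sup>2"
      using cinner_expand[of x l y] unfolding power2_norm_eq_cinner[symmetric]
      by (metis zero_le_power2)
  qed simp
  moreover have "cmod (cinner y x) = cmod (cinner x y)"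
    by (metis cinner_commute complex_mod_cnj)
  ultimately show ?thesis
    by (metis mult_nonneg_nonneg norm_ge_zero power2_le_imp_le power_mult_distrib)
qed

section \<open>Continuity and measurability of the scalar product\<close>

lemma bounded_bilinear_cinner: "bounded_bilinear (cinner :: 'a \<Rightarrow> 'a::complex_hilbert \<Rightarrow> complex)"
proof
  show "\<exists>K. \<forall>(a::'a) b. norm (cinner a b) \<le> norm a * norm b * K"
    by (rule exI[of _ 1]) (simp add: norm_cinner_le)
qed (simp_all add: cinner_add_left cinner_add_right cinner_scaleC_left
    cinner_scaleC_right scaleR_eq_scaleC[where 'a = 'a] scaleR_conv_of_real)

lemma bounded_bilinear_scaleC: "bounded_bilinear ((*\<^sub>C) :: complex \<Rightarrow> 'a \<Rightarrow> 'a::complex_hilbert)"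
proof
  show "\<exists>K. \<forall>a (b::'a). norm (a *\<^sub>C b) \<le> norm a * norm b * K"
    by (rule exI[of _ 1]) (simp add: norm_scaleC)
qed (simp_all add: scaleC_add_left scaleC_add_right scaleR_eq_scaleC[where 'a = 'a] scaleC_scaleC
    scaleR_conv_of_real mult.commute)

lemmas bounded_linear_cinner_left = bounded_bilinear.bounded_linear_left[OF bounded_bilinear_cinner]
lemmas bounded_linear_cinner_right = bounded_bilinear.bounded_linear_right[OF bounded_bilinear_cinner]
lemmas bounded_linear_scaleC_right = bounded_bilinear.bounded_linear_right[OF bounded_bilinear_scaleC]
lemmas tendsto_cinner [tendsto_intros] = bounded_bilinear.tendsto[OF bounded_bilinear_cinner]
lemmas tendsto_scaleC [tendsto_intros] = bounded_bilinear.tendsto[OF bounded_bilinear_scaleC]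
lemmas continuous_on_cinner [continuous_intros] = bounded_bilinear.continuous_on[OF bounded_bilinear_cinner]
lemmas continuous_on_scaleC [continuous_intros] = bounded_bilinear.continuous_on[OF bounded_bilinear_scaleC]
lemmas cinner_sum_left = bounded_bilinear.sum_left[OF bounded_bilinear_cinner]
lemmas cinner_sum_right = bounded_bilinear.sum_right[OF bounded_bilinear_cinner]

lemma cinner_extensionality:
  "(\<And>k. cinner x k = cinner y k) \<Longrightarrow> x = (y::'a::complex_hilbert)"
  using cinner_self[of "x - y"] by (simp add: cinner_diff_left)

lemma borel_measurable_cinner [measurable]:
  fixes f g :: "'t \<Rightarrow> 'a::{complex_hilbert, second_countable_topology}"
  assumes "f \<in> borel_measurable N" "g \<in> borel_measurable N"
  shows "(\<lambda>t. cinner (f t) (g t)) \<in> borel_measurable N"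
  by (rule borel_measurable_continuous_Pair[OF assms]) (intro continuous_intros)

lemma borel_measurable_scaleC [measurable]:
  fixes f :: "'t \<Rightarrow> 'a::{complex_hilbert, second_countable_topology}"
  assumes "c \<in> borel_measurable N" "f \<in> borel_measurable N"
  shows "(\<lambda>t. c t *\<^sub>C f t) \<in> borel_measurable N"
  by (rule borel_measurable_continuous_Pair[OF assms]) (intro continuous_intros)

text \<open>Scalar functions become a case of vector functions, so that the general results on
  square integrable functions apply to \<open>L2\<close> as well.\<close>

instantiation complex :: complex_hilbert
begin

definition scaleC_complex :: "complex \<Rightarrow> complex \<Rightarrow> complex" where
  "scaleC_complex c x = c * x"

definition cinner_complex :: "complex \<Rightarrow> complex \<Rightarrow> complex" where
  "cinner_complex x y = x * cnj y"

instance
  by standard (auto simp: scaleC_complex_def cinner_complex_def algebra_simps scaleR_conv_of_real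
      complex_mult_cnj power2_eq_square norm_complex_def)

end

subsection \<open>Orthonormal bases\<close>

definition orthonormal :: "'a::complex_hilbert set \<Rightarrow> bool" where
  "orthonormal B \<longleftrightarrow> (\<forall>e\<in>B. \<forall>f\<in>B. cinner e f = (if e = f then 1 else 0))"

lemma orthonormal_norm: "orthonormal B \<Longrightarrow> e \<in> B \<Longrightarrow> norm e = 1"
  using power2_norm_eq_cinner[of e] norm_ge_zero[of e]
  by (simp add: orthonormal_def power2_eq_1_iff)

lemma orthonormal_cinner_sum:
  assumes "orthonormal B" "finite F" "F \<subseteq> B" "e \<in> B"
  shows "cinner (\<Sum>f\<in>F. a f *\<^sub>C f) e = (if e \<in> F then a e else 0)"
proof -
  have "cinner (\<Sum>f\<in>F. a f *\<^sub>C f) e = (\<Sum>f\<in>F. if f = e then a f else 0)"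
    unfolding cinner_sum_left using assms
    by (intro sum.cong) (auto simp: cinner_scaleC_left orthonormal_def subset_iff)
  then show ?thesis using assms by simp
qed

lemma orthonormal_norm_sum:
  assumes "orthonormal B" "finite F" "F \<subseteq> B"
  shows "(norm (\<Sum>f\<in>F. a f *\<^sub>C f))\<^sup>2 = (\<Sum>f\<in>F. (cmod (a f))\<^sup>2)"
proof -
  have "cinner (\<Sum>f\<in>F. a f *\<^sub>C f) (\<Sum>f\<in>F. a f *\<^sub>C f) = (\<Sum>g\<in>F. cnj (a g) * a g)"
    unfolding cinner_sum_right using assms
    by (intro sum.cong) (auto simp: cinner_scaleC_right orthonormal_cinner_sum subset_iff)
  also have "\<dots> = of_real (\<Sum>f\<in>F. (cmod (a f))\<^sup>2)"
    by (simp only: of_real_sum complex_norm_square mult.commute)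
  finally show ?thesis
    unfolding power2_norm_eq_cinner by simp
qed

text \<open>By Pythagoras the squared distance of two nested partial sums is a difference of partial
  sums of the numerical series, so the partial sums form a Cauchy filter.\<close>

lemma orthonormal_summable:
  assumes B: "orthonormal B" and a: "(\<lambda>e. (cmod (a e))\<^sup>2) summable_on B"
  shows "(\<lambda>e. a e *\<^sub>C e) summable_on B"
proof -
  let ?f = "\<lambda>e. a e *\<^sub>C e"
  obtain L where L: "((\<lambda>e. (cmod (a e))\<^sup>2) has_sum L) B"
    by (rule that[OF has_sum_infsum[OF a]])
  have *: "\<exists>P. eventually P (finite_subsets_at_top B) \<and>
              (\<forall>F F'. P F \<and> P F' \<longrightarrow> dist (sum ?f F) (sum ?f F') < e)" if "e > 0" for e
  proof -
    \<comment> \<open>Two numbers this close to \<open>L\<close> differ by less than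
      \<open>(e/2)\<^sup>2\<close>, so every partial sum over a set containing \<open>X\<close> is
      within \<open>e/2\<close> of the one over \<open>X\<close>.\<close>
    have "\<forall>\<^sub>F F in finite_subsets_at_top B. dist (\<Sum>e\<in>F. (cmod (a e))\<^sup>2) L < (e/2)\<^sup>2 / 2"
      by (rule tendstoD[OF L[unfolded has_sum_def]]) (rule half_gt_zero, rule zero_less_power, rule half_gt_zero, rule that)
    then have "\<exists>X. finite X \<and> X \<subseteq> B \<and> (\<forall>Y. finite Y \<and> X \<subseteq> Y \<and> Y \<subseteq> B \<longrightarrow>
        dist (\<Sum>e\<in>Y. (cmod (a e))\<^sup>2) L < (e/2)\<^sup>2 / 2)"
      by (simp only: eventually_finite_subsets_at_top)
    then obtain X where X: "finite X" "X \<subseteq> B" and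
      XY: "\<And>Y. finite Y \<Longrightarrow> X \<subseteq> Y \<Longrightarrow> Y \<subseteq> B \<Longrightarrow> dist (\<Sum>e\<in>Y. (cmod (a e))\<^sup>2) L < (e/2)\<^sup>2 / 2"
      by metis
    have near: "dist (sum ?f Y) (sum ?f X) < e / 2" if Y: "finite Y" "X \<subseteq> Y" "Y \<subseteq> B" for Y
    proof -
      have "sum ?f Y - sum ?f X = sum ?f (Y - X)"
        using X Y by (simp add: sum_diff)
      then have "(dist (sum ?f Y) (sum ?f X))\<^sup>2 = (\<Sum>e\<in>Y - X. (cmod (a e))\<^sup>2)"
        using orthonormal_norm_sum[OF B, of "Y - X" a] Y X by (simp add: dist_norm subset_iff)
      also have "\<dots> = (\<Sum>e\<in>Y. (cmod (a e))\<^sup>2) - (\<Sum>e\<in>X. (cmod (a e))\<^sup>2)"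
        using X Y by (simp add: sum_diff)
      also have "\<dots> < (e/2)\<^sup>2"
        using XY[OF Y] XY[OF X(1) order_refl X(2)] unfolding dist_real_def by linarith
      finally show ?thesis
        using that \<open>e > 0\<close> by (meson half_gt_zero less_le power2_less_imp_less)
    qed
    show ?thesis
    proof (intro exI[of _ "\<lambda>Y. finite Y \<and> X \<subseteq> Y \<and> Y \<subseteq> B"] conjI allI impI)
      show "\<forall>\<^sub>F Y in finite_subsets_at_top B. finite Y \<and> X \<subseteq> Y \<and> Y \<subseteq> B"
        using X by (auto simp: eventually_finite_subsets_at_top)
    next
      fix F F' assume *: "(finite F \<and> X \<subseteq> F \<and> F \<subseteq> B) \<and> (finite F' \<and> X \<subseteq> F' \<and> F' \<subseteq> B)"
      then have "dist (sum ?f F) (sum ?f X) < e / 2" "dist (sum ?f F') (sum ?f X) < e / 2"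
        using near by auto
      then show "dist (sum ?f F) (sum ?f F') < e"
        by (metis dist_triangle_half_l)
    qed
  qed
  then have "cauchy_filter (filtermap (sum ?f) (finite_subsets_at_top B))"
    by (simp add: cauchy_filter_metric_filtermap)
  then obtain L' where "(sum ?f \<longlongrightarrow> L') (finite_subsets_at_top B)"
    using cauchy_filter_complete_converges[of "filtermap (sum ?f) (finite_subsets_at_top B)" UNIV]
    by (auto simp: filterlim_def complete_UNIV filtermap_bot_iff)
  then show ?thesis
    unfolding summable_on_def has_sum_def by blast
qed

text \<open>The squared distance of \<open>x\<close> to its projection onto the span of finitely
  many members is nonnegative, which bounds the finite sums by the squared norm of
  \<open>x\<close>.\<close>

lemma bessel_summable:
  assumes B: "orthonormal B"
  shows "(\<lambda>e. (cmod (cinner x e))\<^sup>2) summable_on B"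
proof (rule nonneg_bdd_above_summable_on)
  show "bdd_above (sum (\<lambda>e. (cmod (cinner x e))\<^sup>2) ` {F. F \<subseteq> B \<and> finite F})"
  proof (rule bdd_aboveI2)
    fix F assume "F \<in> {F. F \<subseteq> B \<and> finite F}"
    then have F: "finite F" "F \<subseteq> B" by auto
    define s where "s = (\<Sum>f\<in>F. cinner x f *\<^sub>C f)"
    have "cinner s s = (\<Sum>f\<in>F. cinner s (cinner x f *\<^sub>C f))"
      unfolding s_def cinner_sum_right ..
    have xs: "cinner x s = (\<Sum>e\<in>F. of_real ((cmod (cinner x e))\<^sup>2))"
      unfolding s_def cinner_sum_right
      by (simp only: cinner_scaleC_right complex_norm_square mult.commute)
    have ss: "cinner s s = (\<Sum>e\<in>F. of_real ((cmod (cinner x e))\<^sup>2))"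
      unfolding cinner_self s_def orthonormal_norm_sum[OF B F] by simp
    have sx: "cinner s x = cinner x s"
      by (subst cinner_commute) (simp add: xs)
    have "cinner (x - s) (x - s) = cinner x x - (\<Sum>e\<in>F. of_real ((cmod (cinner x e))\<^sup>2))"
      unfolding cinner_diff_left cinner_diff_right sx xs ss by simp
    then have "(norm (x - s))\<^sup>2 = (norm x)\<^sup>2 - (\<Sum>e\<in>F. (cmod (cinner x e))\<^sup>2)"
      unfolding power2_norm_eq_cinner by simp
    then show "(\<Sum>e\<in>F. (cmod (cinner x e))\<^sup>2) \<le> (norm x)\<^sup>2"
      by (metis diff_ge_0_iff_ge zero_le_power2)
  qed
qed simp

lemma orthonormal_residual:
  assumes B: "orthonormal B"
  shows "\<exists>y. ((\<lambda>e. cinner x e *\<^sub>C e) has_sum y) B \<and> (\<forall>e\<in>B. cinner (x - y) e = 0)"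
proof -
  obtain y where y: "((\<lambda>e. cinner x e *\<^sub>C e) has_sum y) B"
    by (rule that[OF has_sum_infsum[OF orthonormal_summable[OF B bessel_summable[OF B, of x]]]])
  have "cinner (x - y) e = 0" if e: "e \<in> B" for e
  proof -
    have "((\<lambda>f. cinner (cinner x f *\<^sub>C f) e) has_sum cinner y e) B"
      using has_sum_bounded_linear[OF bounded_linear_cinner_left y] .
    moreover have "((\<lambda>f. cinner (cinner x f *\<^sub>C f) e) has_sum cinner x e) B"
      by (rule has_sum_finite_neutralI[of "{e}"])
        (use B e in \<open>auto simp: cinner_scaleC_left orthonormal_def\<close>)
    ultimately have "cinner y e = cinner x e"
      by (rule has_sum_unique)
    then show ?thesis by (simp add: cinner_diff_left)
  qed
  with y show ?thesis by blast
qed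

text \<open>Zorn's lemma yields a maximal orthonormal set. A nonzero residual of some
  \<open>x\<close> would, when normalised, enlarge it, so every vector is the sum of its
  expansion.\<close>

lemma exists_is_onb: "\<exists>B::'a::complex_hilbert set. is_onb B"
proof -
  have "\<exists>M\<in>Collect orthonormal. \<forall>X\<in>Collect (orthonormal :: 'a set \<Rightarrow> bool). M \<subseteq> X \<longrightarrow> X = M"
  proof (rule subset_Zorn_nonempty)
    show "Collect (orthonormal :: 'a set \<Rightarrow> bool) \<noteq> {}"
      using orthonormal_def[of "{}"] by blast
  next
    fix C :: "'a set set" assume C: "C \<noteq> {}" "subset.chain (Collect orthonormal) C"
    have "cinner e f = (if e = f then 1 else 0)" if ef: "e \<in> \<Union>C" "f \<in> \<Union>C" for e f
    proof -
      obtain X Y where "X \<in> C" "e \<in> X" "Y \<in> C" "f \<in> Y" using ef by blast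
      then obtain Z where "Z \<in> C" "e \<in> Z" "f \<in> Z"
        using C(2) unfolding subset.chain_def by blast
      then show ?thesis
        using C(2) unfolding subset.chain_def orthonormal_def by blast
    qed
    then show "\<Union>C \<in> Collect orthonormal" by (auto simp: orthonormal_def)
  qed
  then obtain B :: "'a set" where B: "orthonormal B" and max: "\<And>X. orthonormal X \<Longrightarrow> B \<subseteq> X \<Longrightarrow> X = B"
    by blast
  have "x \<in> closure (scaleC.span B)" for x
  proof -
    obtain y where y: "((\<lambda>e. cinner x e *\<^sub>C e) has_sum y) B" "\<And>e. e \<in> B \<Longrightarrow> cinner (x - y) e = 0"
      using orthonormal_residual[OF B, of x] by metis
    have "x = y"
    proof (rule ccontr)
      assume "x \<noteq> y"
      define u where "u = complex_of_real (1 / norm (x - y)) *\<^sub>C (x - y)"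
      have u1: "cinner u u = 1"
        using \<open>x \<noteq> y\<close> unfolding u_def cinner_self norm_scaleC by (simp add: norm_divide)
      have uB: "cinner u e = 0" "cinner e u = 0" if "e \<in> B" for e
      proof -
        show "cinner u e = 0"
          using y(2)[OF that] by (simp add: u_def cinner_scaleC_left)
        then show "cinner e u = 0"
          by (metis cinner_commute complex_cnj_zero)
      qed
      have "orthonormal (insert u B)"
        using B u1 uB unfolding orthonormal_def by fastforce
      then have "u \<in> B" using max by blast
      then show False using u1 uB by auto
    qed
    have "\<exists>z\<in>scaleC.span B. dist z x < e" if "e > 0" for e
    proof -
      obtain F where F: "finite F" "F \<subseteq> B" "dist (\<Sum>e\<in>F. cinner x e *\<^sub>C e) x \<le> e / 2"
        using has_sum_finite_approximation[OF y(1), of "e/2"] \<open>e > 0\<close> \<open>x = y\<close> by auto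
      have "(\<Sum>e\<in>F. cinner x e *\<^sub>C e) \<in> scaleC.span B"
        using F by (intro scaleC.span_sum scaleC.span_scale scaleC.span_base) auto
      then show ?thesis using F \<open>e > 0\<close> by (intro bexI) auto
    qed
    then show ?thesis by (auto simp: closure_approachable)
  qed
  then have "is_onb B"
    using B by (auto simp: is_onb_def orthonormal_def)
  then show ?thesis ..
qed

lemma is_onb_hbasis: "is_onb hbasis"
  unfolding hbasis_def using someI_ex[OF exists_is_onb] .

lemma orthonormal_hbasis: "orthonormal hbasis"
  using is_onb_hbasis unfolding is_onb_def orthonormal_def by blast

text \<open>The residual is orthogonal to the basis, hence to the closure of its span, which is the
  whole space, hence to itself.\<close>

lemma is_onb_has_sum:
  assumes "is_onb B"
  shows "((\<lambda>e. cinner x e *\<^sub>C e) has_sum x) B"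
proof -
  have B: "orthonormal B" using assms unfolding is_onb_def orthonormal_def by blast
  obtain y where y: "((\<lambda>e. cinner x e *\<^sub>C e) has_sum y) B" "\<And>e. e \<in> B \<Longrightarrow> cinner (x - y) e = 0"
    using orthonormal_residual[OF B, of x] by metis
  have "{z. cinner (x - y) z = 0} \<supseteq> scaleC.span B"
  proof
    fix z assume "z \<in> scaleC.span B"
    then show "z \<in> {z. cinner (x - y) z = 0}"
      by (induction rule: scaleC.span_induct_alt) (auto simp: cinner_add_right cinner_scaleC_right y)
  qed
  moreover have "closed {z. cinner (x - y) z = 0}"
    by (intro closed_Collect_eq continuous_intros)
  ultimately have "closure (scaleC.span B) \<subseteq> {z. cinner (x - y) z = 0}"
    by (rule closure_minimal)
  then have "cinner (x - y) (x - y) = 0"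
    using assms by (auto simp: is_onb_def)
  then show ?thesis using y by (simp add: cinner_self)
qed

lemmas hbasis_has_sum = is_onb_has_sum[OF is_onb_hbasis]

lemma hbasis_ext_zero:
  fixes x :: "'h::{complex_hilbert, second_countable_topology}"
  assumes "\<And>e. e \<in> hbasis \<Longrightarrow> cinner x e = 0"
  shows "x = 0"
proof -
  have "((\<lambda>e. cinner x e *\<^sub>C e) has_sum 0) hbasis"
    by (rule has_sum_0) (simp add: assms)
  then show ?thesis using has_sum_unique[OF hbasis_has_sum[of x]] by blast
qed

lemma cinner_hbasis_has_sum:
  "((\<lambda>e. cinner x e * cinner e y) has_sum cinner x (y::'a::complex_hilbert)) hbasis"
  using has_sum_bounded_linear[OF bounded_linear_cinner_left hbasis_has_sum, of x y]
  by (simp add: cinner_scaleC_left)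

lemma norm_hbasis_has_sum:
  "((\<lambda>e. (cmod (cinner x e))\<^sup>2) has_sum (norm (x::'a::complex_hilbert))\<^sup>2) hbasis"
proof -
  have "((\<lambda>e. Re (cinner x e * cinner e x)) has_sum Re (cinner x x)) hbasis"
    by (rule has_sum_bounded_linear[OF bounded_linear_Re cinner_hbasis_has_sum])
  moreover have "Re (cinner x e * cinner e x) = (cmod (cinner x e))\<^sup>2" for e
    by (subst (2) cinner_commute) (simp flip: complex_norm_square of_real_power)
  ultimately show ?thesis by (simp add: power2_norm_eq_cinner)
qed

text \<open>Distinct members are at distance at least one, so the balls of radius \<open>1/2\<close>
  around them are disjoint open sets, of which a second countable space has only countably many.
  Countability of the basis later allows the exceptional null sets of the single basis vectors to be
  united.\<close>

lemma countable_orthonormal: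
  assumes B: "orthonormal (B :: 'a::{complex_hilbert, second_countable_topology} set)"
  shows "countable B"
proof -
  have dist: "dist e f \<ge> 1" if "e \<in> B" "f \<in> B" "e \<noteq> f" for e f
  proof -
    have "cinner (e - f) (e - f) = 2"
      using B that by (simp add: orthonormal_def cinner_diff_left cinner_diff_right)
    then have "(norm (e - f))\<^sup>2 = 2"
      by (simp add: power2_norm_eq_cinner)
    then show ?thesis
      unfolding dist_norm by (smt (verit) norm_ge_zero power2_less_imp_less power_one)
  qed
  have disj: "ball e (1/2) \<inter> ball f (1/2) = {}" if "e \<in> B" "f \<in> B" "e \<noteq> f" for e f
    using dist[OF that] by (intro disjoint_ballI) auto
  have "countable ((\<lambda>e. ball e (1/2)) ` B)"
    by (rule countable_disjoint_open_subsets) (use disj in \<open>auto simp: pairwise_def disjnt_def\<close>)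
  moreover have "inj_on (\<lambda>e. ball e (1/2)) B"
    using disj by (intro inj_onI) (metis Int_absorb centre_in_ball half_gt_zero_iff empty_iff zero_less_one)
  ultimately show ?thesis
    by (rule countable_image_inj_on)
qed

lemma countable_hbasis: "countable (hbasis :: 'a::{complex_hilbert, second_countable_topology} set)"
  by (rule countable_orthonormal[OF orthonormal_hbasis])

subsection \<open>Positive operators and their square roots\<close>

lemma bounded_clinearD:
  assumes "bounded_clinear T"
  shows "T (x + y) = T x + T y" "T (x - y) = T x - T y" "T (c *\<^sub>C x) = c *\<^sub>C T x" "T 0 = 0"
    "T (r *\<^sub>R x) = r *\<^sub>R T x" "bounded_linear T"
  using assms linear_simps[of T] unfolding bounded_clinear_def by auto

lemma bounded_clinear_bound:
  assumes "bounded_clinear T"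
  obtains K where "K > 0" "\<And>x. norm (T x) \<le> K * norm x"
proof -
  obtain K where K: "\<And>x. norm (T x) \<le> norm x * K"
    using bounded_linear.bounded[OF bounded_clinearD(6)[OF assms]] by blast
  have "norm (T x) \<le> (max K 1) * norm x" for x
    using K[of x] mult_left_mono[of K "max K 1" "norm x"] by (simp add: mult.commute)
  then show ?thesis using that[of "max K 1"] by simp
qed

lemma bounded_clinearI:
  assumes "\<And>x y. T (x + y) = T x + T y" "\<And>c x. T (c *\<^sub>C x) = c *\<^sub>C T x"
    "\<And>x. norm (T x) \<le> norm x * K"
  shows "bounded_clinear T"
  unfolding bounded_clinear_def using assms
  by (auto intro!: bounded_linear_intro[where K = K] simp: scaleR_eq_scaleC)

lemma bounded_clinear_compose:
  "bounded_clinear S \<Longrightarrow> bounded_clinear T \<Longrightarrow> bounded_clinear (\<lambda>x. S (T x))"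
  unfolding bounded_clinear_def by (auto intro: bounded_linear_compose)

lemma bounded_clinear_add:
  "bounded_clinear S \<Longrightarrow> bounded_clinear T \<Longrightarrow> bounded_clinear (\<lambda>x. S x + T x)"
  unfolding bounded_clinear_def by (auto intro: bounded_linear_add simp: scaleC_add_right)

lemma bounded_clinear_diff:
  "bounded_clinear S \<Longrightarrow> bounded_clinear T \<Longrightarrow> bounded_clinear (\<lambda>x. S x - T x)"
  unfolding bounded_clinear_def by (auto intro: bounded_linear_sub simp: scaleC.scale_right_diff_distrib)

lemma bounded_clinear_scaleC: "bounded_clinear S \<Longrightarrow> bounded_clinear (\<lambda>x. c *\<^sub>C S x)"
  unfolding bounded_clinear_def
  by (auto intro: bounded_linear_compose[OF bounded_linear_scaleC_right] simp: scaleC_scaleC mult.commute)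

lemma bounded_clinear_ident: "bounded_clinear (\<lambda>x. x)"
  by (simp add: bounded_clinear_def)

lemma bounded_clinear_zero: "bounded_clinear (\<lambda>x. 0)"
  by (simp add: bounded_clinear_def)

lemma bounded_clinear_rank_one: "bounded_clinear (\<lambda>x. cinner x k *\<^sub>C h)"
proof (rule bounded_clinearI)
  show "norm (cinner x k *\<^sub>C h) \<le> norm x * (norm k * norm h)" for x
    unfolding norm_scaleC by (metis mult.assoc mult_right_mono norm_cinner_le norm_ge_zero)
qed (auto simp: cinner_add_left cinner_scaleC_left scaleC_add_left scaleC_scaleC)

text \<open>Polarization: the form is real at \<open>h + k\<close> and at
  \<open>h + \<i> *\<^sub>C k\<close>, which settles the imaginary and the real part of the
  identity.\<close>

lemma positive_op_symmetric:
  assumes "positive_op T"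
  shows "cinner (T h) k = cinner h (T k)"
proof -
  note lin = bounded_clinearD[OF assms[unfolded positive_op_def, THEN conjunct1]]
  have im: "Im (cinner (T x) x) = 0" for x
    using assms by (simp add: positive_op_def complex_is_Real_iff)
  have "Im (cinner (T h) k + cinner (T k) h) = 0"
    using im[of "h + k"] im[of h] im[of k] by (simp add: lin cinner_add_left cinner_add_right)
  moreover have "Im (\<i> * cinner (T k) h - \<i> * cinner (T h) k) = 0"
    using im[of "h + \<i> *\<^sub>C k"] im[of h] im[of k]
    by (simp add: lin cinner_add_left cinner_add_right cinner_scaleC_left cinner_scaleC_right)
  ultimately have "cinner (T h) k = cnj (cinner (T k) h)"
    by (simp add: complex_eq_iff)
  then show ?thesis using cinner_commute by metis
qed

lemma positive_op_Cauchy_Schwarz: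
  assumes "positive_op T"
  shows "(cmod (cinner (T h) k))\<^sup>2 \<le> Re (cinner (T h) h) * Re (cinner (T k) k)"
proof -
  note lin = bounded_clinearD[OF assms[unfolded positive_op_def, THEN conjunct1]]
  have pos: "Re (cinner (T x) x) \<ge> 0" for x using assms by (simp add: positive_op_def)
  have "(cmod (cinner (T h) k))\<^sup>2 \<le> Re (cinner (T k) k) * Re (cinner (T h) h)"
  proof (rule hermitian_Cauchy_Schwarz)
    fix l :: complex
    have sym: "cinner (T k) h = cnj (cinner (T h) k)"
      using positive_op_symmetric[OF assms, of k h] cinner_commute by metis
    have ll: "l * cnj l = complex_of_real ((cmod l)\<^sup>2)"
      by (simp only: complex_norm_square)
    have "cinner (T (k + l *\<^sub>C h)) (k + l *\<^sub>C h) =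
        cinner (T k) k + (l * cinner (T h) k + cnj (l * cinner (T h) k)) + (l * cnj l) * cinner (T h) h"
      by (simp add: lin cinner_add_left cinner_add_right cinner_scaleC_left cinner_scaleC_right sym algebra_simps)
    then have "Re (cinner (T (k + l *\<^sub>C h)) (k + l *\<^sub>C h)) =
        Re (cinner (T k) k) + 2 * Re (l * cinner (T h) k) + (cmod l)\<^sup>2 * Re (cinner (T h) h)"
      unfolding ll by (simp only: plus_complex.sel complex_add_cnj Re_complex_of_real Im_complex_of_real
        times_complex.sel mult_zero_left diff_zero)
    then show "0 \<le> Re (cinner (T k) k) + 2 * Re (l * cinner (T h) k) + (cmod l)\<^sup>2 * Re (cinner (T h) h)"
      using pos by metis
  qed (rule pos)
  then show ?thesis by (simp add: mult.commute)
qed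

lemma positive_op_null:
  assumes T: "positive_op T" and 0: "cinner (T u) u = 0"
  shows "T u = 0"
proof -
  have "(cmod (cinner (T u) (T u)))\<^sup>2 \<le> 0"
    using positive_op_Cauchy_Schwarz[OF T, of u "T u"] 0 by simp
  then show ?thesis by (simp add: cinner_self)
qed

lemma adj_unique:
  assumes "\<And>h k. cinner (T h) k = cinner h (S k)"
  shows "adj T = S"
  unfolding adj_def
proof (rule the_equality)
  fix S' assume *: "\<forall>h k. cinner (T h) k = cinner h (S' k)"
  have "S' k = S k" for k
  proof (rule cinner_extensionality)
    fix x show "cinner (S' k) x = cinner (S k) x"
      using * assms cinner_commute by metis
  qed
  then show "S' = S" by auto
qed (use assms in blast)

lemma adj_positive_op: "positive_op T \<Longrightarrow> adj T = T"
  by (intro adj_unique positive_op_symmetric)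

text \<open>Polarization again. The definition of \<open>op_integral\<close> prescribes only a
  quadratic form, and this lemma is what identifies its value.\<close>

lemma quadratic_form_unique:
  assumes S: "bounded_clinear S" and T: "bounded_clinear T"
    and eq: "\<And>h. cinner (S h) h = cinner (T h) h"
  shows "S = T"
proof
  fix h
  define D where "D x = S x - T x" for x
  have zero: "cinner (D x) x = 0" for x by (simp add: D_def cinner_diff_left eq)
  note lin = bounded_clinearD[OF bounded_clinear_diff[OF S T], folded D_def]
  have Dk: "cinner (D h) k = 0" for k
  proof -
    have "cinner (D h) k + cinner (D k) h = 0"
      using zero[of "h + k"] by (simp add: lin cinner_add_left cinner_add_right zero add.commute)
    moreover have "\<i> * cinner (D k) h - \<i> * cinner (D h) k = 0"
      using zero[of "h + \<i> *\<^sub>C k"]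
      by (simp add: lin cinner_add_left cinner_add_right cinner_scaleC_left cinner_scaleC_right zero)
    then have "cinner (D k) h = cinner (D h) k" by simp
    ultimately show ?thesis by simp
  qed
  have "D h = 0" by (rule cinner_extensionality) (simp add: Dk)
  then show "S h = T h" by (simp add: D_def)
qed

text \<open>The square root of \<open>T\<close> with \<open>0 \<le> T \<le> 1\<close> is \<open>1 - Y\<close>, where \<open>Y\<close> is the limit of the iteration
  \<open>Y\<^sub>n\<^sub>+\<^sub>1 = (A + Y\<^sub>n\<^sup>2) / 2\<close> for \<open>A = 1 - T\<close>. The same iteration for the number \<open>1\<close> instead of \<open>A\<close>
  dominates the increments.\<close>

primrec sqrt_iter :: "('h::complex_hilbert \<Rightarrow> 'h) \<Rightarrow> nat \<Rightarrow> 'h \<Rightarrow> 'h" where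
  "sqrt_iter A 0 h = 0"
| "sqrt_iter A (Suc n) h = (1/2) *\<^sub>R (A h + sqrt_iter A n (sqrt_iter A n h))"

primrec sqrt_bound :: "nat \<Rightarrow> real" where
  "sqrt_bound 0 = 0"
| "sqrt_bound (Suc n) = (1 + (sqrt_bound n)\<^sup>2) / 2"

lemma sqrt_bound_bounds: "0 \<le> sqrt_bound n" "sqrt_bound n \<le> 1"
proof -
  have "0 \<le> sqrt_bound n \<and> sqrt_bound n \<le> 1"
    by (induction n) (auto simp: power_le_one)
  then show "0 \<le> sqrt_bound n" "sqrt_bound n \<le> 1" by auto
qed

lemma sqrt_bound_mono: "sqrt_bound n \<le> sqrt_bound (Suc n)"
  \<comment> \<open>The increment of \<open>sqrt_bound\<close> equals
    \<open>(sqrt_bound n - 1)\<^sup>2 / 2\<close>.\<close>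
  using sum_squares_ge_zero[of "sqrt_bound n - 1" 0]
  by (simp add: power2_eq_square algebra_simps)

context
  fixes A :: "'h::complex_hilbert \<Rightarrow> 'h"
  assumes A: "bounded_clinear A" and contr: "\<And>h. norm (A h) \<le> norm h"
begin

lemma sqrt_iter_linear:
  "sqrt_iter A n (x + y) = sqrt_iter A n x + sqrt_iter A n y"
  "sqrt_iter A n (c *\<^sub>C x) = c *\<^sub>C sqrt_iter A n x"
proof (induction n arbitrary: x y)
  case (Suc n)
  {
    case 1
    then show ?case by (simp add: Suc bounded_clinearD[OF A] algebra_simps)
  next
    case 2
    then show ?case
      by (simp add: Suc bounded_clinearD[OF A] scaleR_eq_scaleC scaleC_add_right scaleC_scaleC mult.commute)
  }
qed auto

lemma sqrt_iter_real_linear: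
  "sqrt_iter A n (x - y) = sqrt_iter A n x - sqrt_iter A n y"
  "sqrt_iter A n (r *\<^sub>R x) = r *\<^sub>R sqrt_iter A n x"
proof -
  have *: "x - y = x + (-1) *\<^sub>C y" by simp
  show "sqrt_iter A n (x - y) = sqrt_iter A n x - sqrt_iter A n y"
    unfolding * sqrt_iter_linear by simp
qed (simp add: scaleR_eq_scaleC sqrt_iter_linear)

lemma sqrt_iter_norm: "norm (sqrt_iter A n h) \<le> sqrt_bound n * norm h"
proof (induction n arbitrary: h)
  case (Suc n)
  have "norm (sqrt_iter A n (sqrt_iter A n h)) \<le> sqrt_bound n * (sqrt_bound n * norm h)"
    using Suc[of "sqrt_iter A n h"] Suc[of h] mult_left_mono[OF Suc[of h] sqrt_bound_bounds(1)[of n]]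
    by linarith
  moreover have "norm (sqrt_iter A (Suc n) h) \<le> (1/2) * (norm (A h) + norm (sqrt_iter A n (sqrt_iter A n h)))"
    using norm_triangle_ineq[of "A h" "sqrt_iter A n (sqrt_iter A n h)"] by simp
  ultimately show ?case using contr[of h]
    by (simp add: power2_eq_square algebra_simps)
qed simp

text \<open>The iterates are polynomials in \<open>A\<close>, so whatever commutes with
  \<open>A\<close> commutes with them. Assuming only additivity and real homogeneity of
  \<open>S\<close> lets the iterates themselves be taken for \<open>S\<close>.\<close>

lemma sqrt_iter_commute:
  assumes S: "\<And>x y. S (x + y) = S x + S y" "\<And>r x. S (r *\<^sub>R x) = r *\<^sub>R S x"
    and SA: "\<And>x. S (A x) = A (S x)"
  shows "S (sqrt_iter A n x) = sqrt_iter A n (S x)"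
proof (induction n arbitrary: x)
  case 0
  show ?case using S(2)[of 0] by simp
qed (simp add: S SA)

lemma sqrt_iter_commute_iter: "sqrt_iter A m (sqrt_iter A n x) = sqrt_iter A n (sqrt_iter A m x)"
proof (rule sqrt_iter_commute)
  have "A (sqrt_iter A m x) = sqrt_iter A m (A x)" for x
    by (rule sqrt_iter_commute) (auto simp: bounded_clinearD[OF A])
  then show "sqrt_iter A m (A x) = A (sqrt_iter A m x)" for x by simp
qed (auto simp: sqrt_iter_linear sqrt_iter_real_linear)

text \<open>As the iterates commute, an increment is half the sum of the two preceding iterates
  applied to the preceding increment. The numbers \<open>sqrt_bound\<close> satisfy the same
  identity and bound the norms of the iterates, so the estimate passes from \<open>n\<close> to
  \<open>Suc n\<close>.\<close>

lemma sqrt_iter_diff: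
  "norm (sqrt_iter A (Suc n) h - sqrt_iter A n h) \<le> (sqrt_bound (Suc n) - sqrt_bound n) * norm h"
proof (induction n arbitrary: h)
  case 0
  show ?case using contr[of h] by simp
next
  case (Suc n)
  let ?Y = "sqrt_iter A"
  define u where "u = ?Y (Suc n) h - ?Y n h"
  define d where "d = sqrt_bound (Suc n) - sqrt_bound n"
  have "?Y (Suc (Suc n)) h - ?Y (Suc n) h =
      (1/2) *\<^sub>R (?Y (Suc n) (?Y (Suc n) h) - ?Y n (?Y n h))"
    unfolding sqrt_iter.simps(2)[of A "Suc n"] by (simp add: algebra_simps)
  also have "?Y (Suc n) (?Y (Suc n) h) - ?Y n (?Y n h) = ?Y (Suc n) u + ?Y n u"
    unfolding u_def sqrt_iter_real_linear using sqrt_iter_commute_iter[of "Suc n" n h] by simp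
  finally have "norm (?Y (Suc (Suc n)) h - ?Y (Suc n) h) \<le> (1/2) * (norm (?Y (Suc n) u) + norm (?Y n u))"
    using norm_triangle_ineq[of "?Y (Suc n) u" "?Y n u"] by simp
  also have "\<dots> \<le> (1/2) * (sqrt_bound (Suc n) * norm u + sqrt_bound n * norm u)"
    using sqrt_iter_norm[of "Suc n" u] sqrt_iter_norm[of n u] by (intro mult_left_mono add_mono) auto
  also have "\<dots> = (1/2) * (sqrt_bound (Suc n) + sqrt_bound n) * norm u"
    by (simp add: algebra_simps)
  also have "\<dots> \<le> (1/2) * (sqrt_bound (Suc n) + sqrt_bound n) * (d * norm h)"
    using Suc[of h] sqrt_bound_bounds[of n] sqrt_bound_bounds[of "Suc n"]
    unfolding u_def d_def by (intro mult_left_mono) auto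
  also have "(1/2) * (sqrt_bound (Suc n) + sqrt_bound n) * (d * norm h) =
      (((sqrt_bound (Suc n))\<^sup>2 - (sqrt_bound n)\<^sup>2) / 2) * norm h"
    unfolding d_def by (simp add: power2_eq_square algebra_simps del: sqrt_bound.simps)
  also have "((sqrt_bound (Suc n))\<^sup>2 - (sqrt_bound n)\<^sup>2) / 2 = sqrt_bound (Suc (Suc n)) - sqrt_bound (Suc n)"
    unfolding sqrt_bound.simps(2)[of "Suc n"] by (subst (3) sqrt_bound.simps(2)) (simp add: field_simps del: sqrt_bound.simps)
  finally show ?case .
qed

text \<open>The increments are dominated by those of the bounded increasing sequence
  \<open>sqrt_bound\<close>, which form a convergent telescoping series.\<close>

lemma sqrt_iter_convergent: "convergent (\<lambda>n. sqrt_iter A n h)"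
proof -
  have "incseq sqrt_bound" using sqrt_bound_mono by (rule incseq_SucI)
  then have "\<exists>L. sqrt_bound \<longlonglongrightarrow> L"
    using incseq_convergent[of sqrt_bound 1] sqrt_bound_bounds(2) by metis
  then have "summable (\<lambda>n. sqrt_bound (Suc n) - sqrt_bound n)"
    using telescope_summable by blast
  then have "summable (\<lambda>n. (sqrt_bound (Suc n) - sqrt_bound n) * norm h)"
    by (rule summable_mult2)
  then have "summable (\<lambda>n. sqrt_iter A (Suc n) h - sqrt_iter A n h)"
    by (rule summable_comparison_test'[where N = 0]) (rule sqrt_iter_diff)
  then have "convergent (\<lambda>n. \<Sum>i<n. sqrt_iter A (Suc i) h - sqrt_iter A i h)"
    unfolding summable_iff_convergent .
  then show ?thesis
    unfolding sum_lessThan_telescope[of "\<lambda>n. sqrt_iter A n h"] by simp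
qed

definition sqrt_lim :: "'h \<Rightarrow> 'h" where
  "sqrt_lim h = lim (\<lambda>n. sqrt_iter A n h)"

lemma sqrt_iter_tendsto: "(\<lambda>n. sqrt_iter A n h) \<longlonglongrightarrow> sqrt_lim h"
  using sqrt_iter_convergent unfolding sqrt_lim_def convergent_LIMSEQ_iff .

lemma sqrt_lim_norm: "norm (sqrt_lim h) \<le> norm h"
proof (rule LIMSEQ_le_const2[OF tendsto_norm[OF sqrt_iter_tendsto]])
  have "norm (sqrt_iter A n h) \<le> norm h" for n
    using sqrt_iter_norm[of n h] mult_right_mono[OF sqrt_bound_bounds(2)[of n], of "norm h"] by simp
  then show "\<exists>N. \<forall>n\<ge>N. norm (sqrt_iter A n h) \<le> norm h" by blast
qed

lemma sqrt_lim_bounded_clinear: "bounded_clinear sqrt_lim"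
proof (rule bounded_clinearI[where K = 1])
  show "sqrt_lim (x + y) = sqrt_lim x + sqrt_lim y" for x y
    using tendsto_add[OF sqrt_iter_tendsto[of x] sqrt_iter_tendsto[of y]] sqrt_iter_tendsto[of "x + y"]
    by (auto simp: sqrt_iter_linear intro: LIMSEQ_unique)
  show "sqrt_lim (c *\<^sub>C x) = c *\<^sub>C sqrt_lim x" for c x
    using tendsto_scaleC[OF tendsto_const[of c] sqrt_iter_tendsto[of x]] sqrt_iter_tendsto[of "c *\<^sub>C x"]
    by (auto simp: sqrt_iter_linear intro: LIMSEQ_unique)
qed (simp add: sqrt_lim_norm)

lemma sqrt_lim_commute:
  assumes S: "bounded_clinear S" and SA: "\<And>x. S (A x) = A (S x)"
  shows "S (sqrt_lim x) = sqrt_lim (S x)"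
proof -
  have "(\<lambda>n. S (sqrt_iter A n x)) \<longlonglongrightarrow> S (sqrt_lim x)"
    by (rule bounded_linear.tendsto[OF bounded_clinearD(6)[OF S] sqrt_iter_tendsto])
  moreover have "S (sqrt_iter A n x) = sqrt_iter A n (S x)" for n
    by (rule sqrt_iter_commute) (auto simp: bounded_clinearD[OF S] SA)
  ultimately have "(\<lambda>n. sqrt_iter A n (S x)) \<longlonglongrightarrow> S (sqrt_lim x)"
    by simp
  then show ?thesis
    by (rule LIMSEQ_unique[OF _ sqrt_iter_tendsto])
qed

lemma sqrt_lim_eq: "2 *\<^sub>R sqrt_lim h = A h + sqrt_lim (sqrt_lim h)"
proof -
  \<comment> \<open>The outer iterate varies with \<open>n\<close> as well. Since all iterates are
    contractions, replacing the argument by its limit causes an error that tends to zero.\<close>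
  have "(\<lambda>n. sqrt_iter A n (sqrt_iter A n h)) \<longlonglongrightarrow> sqrt_lim (sqrt_lim h)"
  proof -
    have "(\<lambda>n. sqrt_iter A n (sqrt_iter A n h - sqrt_lim h)) \<longlonglongrightarrow> 0"
    proof (rule Lim_null_comparison)
      show "\<forall>\<^sub>F n in sequentially. norm (sqrt_iter A n (sqrt_iter A n h - sqrt_lim h)) \<le>
          norm (sqrt_iter A n h - sqrt_lim h)"
      proof (intro always_eventually allI)
        fix n
        show "norm (sqrt_iter A n (sqrt_iter A n h - sqrt_lim h)) \<le> norm (sqrt_iter A n h - sqrt_lim h)"
          using sqrt_iter_norm[of n "sqrt_iter A n h - sqrt_lim h"]
            mult_right_mono[OF sqrt_bound_bounds(2)[of n], of "norm (sqrt_iter A n h - sqrt_lim h)"] by simp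
      qed
      show "(\<lambda>n. norm (sqrt_iter A n h - sqrt_lim h)) \<longlonglongrightarrow> 0"
        using sqrt_iter_tendsto[of h] by (simp add: LIM_zero tendsto_norm_zero)
    qed
    from tendsto_add[OF this sqrt_iter_tendsto[of "sqrt_lim h"]] show ?thesis
      by (simp add: sqrt_iter_real_linear)
  qed
  from tendsto_add[OF tendsto_const[of "A h"] this]
  have "(\<lambda>n. 2 *\<^sub>R sqrt_iter A (Suc n) h) \<longlonglongrightarrow> A h + sqrt_lim (sqrt_lim h)"
    by simp
  moreover have "(\<lambda>n. 2 *\<^sub>R sqrt_iter A (Suc n) h) \<longlonglongrightarrow> 2 *\<^sub>R sqrt_lim h"
    by (intro tendsto_intros LIMSEQ_Suc sqrt_iter_tendsto)
  ultimately show ?thesis by (rule LIMSEQ_unique[rotated])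
qed

lemma sqrt_lim_symmetric:
  assumes "\<And>x y. cinner (A x) y = cinner x (A y)"
  shows "cinner (sqrt_lim x) y = cinner x (sqrt_lim y)"
proof -
  have "cinner (sqrt_iter A n x) y = cinner x (sqrt_iter A n y)" for n
  proof (induction n arbitrary: x y)
    case (Suc n)
    then show ?case
      by (simp add: scaleR_eq_scaleC cinner_scaleC_left cinner_scaleC_right cinner_add_left cinner_add_right assms)
  qed simp
  moreover have "(\<lambda>n. cinner (sqrt_iter A n x) y) \<longlonglongrightarrow> cinner (sqrt_lim x) y"
    by (intro tendsto_intros sqrt_iter_tendsto)
  ultimately have "(\<lambda>n. cinner x (sqrt_iter A n y)) \<longlonglongrightarrow> cinner (sqrt_lim x) y"
    by simp
  moreover have "(\<lambda>n. cinner x (sqrt_iter A n y)) \<longlonglongrightarrow> cinner x (sqrt_lim y)"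
    by (intro tendsto_intros sqrt_iter_tendsto)
  ultimately show ?thesis by (rule LIMSEQ_unique)
qed

end

text \<open>For \<open>u = S h - R h\<close> the equality of the squares gives
  \<open>S u + R u = 0\<close>. Both forms are nonnegative, so each vanishes at \<open>u\<close>,
  hence \<open>S u = R u = 0\<close>, and by symmetry the squared norm of \<open>u\<close> is
  zero.\<close>

lemma commuting_positive_sqrt_unique:
  assumes S: "positive_op S" and R: "positive_op R" and SR: "\<And>x. S (R x) = R (S x)"
    and eq: "\<And>x. S (S x) = R (R x)"
  shows "S = R"
proof
  fix h
  note linS = bounded_clinearD[OF S[unfolded positive_op_def, THEN conjunct1]]
  note linR = bounded_clinearD[OF R[unfolded positive_op_def, THEN conjunct1]]
  define u where "u = S h - R h"
  have "S u + R u = 0"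
    unfolding u_def by (simp add: linS linR SR eq)
  then have "cinner (S u) u + cinner (R u) u = 0"
    by (simp flip: cinner_add_left)
  moreover have "Re (cinner (S u) u) \<ge> 0" "Re (cinner (R u) u) \<ge> 0"
    "Im (cinner (S u) u) = 0" "Im (cinner (R u) u) = 0"
    using S R by (auto simp: positive_op_def complex_is_Real_iff)
  ultimately have "cinner (S u) u = 0" "cinner (R u) u = 0"
    by (auto simp: complex_eq_iff)
  then have "S u = 0" "R u = 0"
    using positive_op_null S R by auto
  then have "cinner u u = 0"
    by (subst (1) u_def) (simp add: cinner_diff_left positive_op_symmetric[OF S] positive_op_symmetric[OF R])
  then show "S h = R h"
    by (simp add: cinner_self u_def)
qed

text \<open>Cauchy--Schwarz for the form of the positive operator \<open>A = 1 - T\<close>, taken at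
  \<open>h\<close> and \<open>A h\<close>, turns a bound on the quadratic form into a bound on the
  norm of \<open>A h\<close>.\<close>

lemma positive_contraction_complement:
  assumes T: "positive_op T" and le: "\<And>h. Re (cinner (T h) h) \<le> (norm h)\<^sup>2"
  shows "bounded_clinear (\<lambda>h. h - T h)" "\<And>h. norm (h - T h) \<le> norm h"
    "\<And>x y. cinner (x - T x) y = cinner x (y - T y)"
proof -
  let ?A = "\<lambda>h. h - T h"
  show bA: "bounded_clinear ?A"
    using T by (intro bounded_clinear_diff bounded_clinear_ident) (simp add: positive_op_def)
  have im: "Im (cinner (T h) h) = 0" for h
    using T by (simp add: positive_op_def complex_is_Real_iff)
  have A: "positive_op ?A"
    using bA le im by (simp add: positive_op_def cinner_diff_left complex_is_Real_iff cinner_self)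
  show "cinner (x - T x) y = cinner x (y - T y)" for x y
    using positive_op_symmetric[OF A] .
  have Ale: "Re (cinner (?A h) h) \<le> (norm h)\<^sup>2" for h
    using T by (simp add: positive_op_def cinner_diff_left cinner_self)
  show "norm (h - T h) \<le> norm h" for h
  proof -
    let ?n = "norm (?A h)"
    have "(?n\<^sup>2)\<^sup>2 \<le> Re (cinner (?A h) h) * Re (cinner (?A (?A h)) (?A h))"
      using positive_op_Cauchy_Schwarz[OF A, of h "?A h"] by (simp add: cinner_self norm_power)
    also have "\<dots> \<le> (norm h)\<^sup>2 * ?n\<^sup>2"
      using A by (intro mult_mono Ale) (auto simp: positive_op_def)
    finally have "?n\<^sup>2 * ?n\<^sup>2 \<le> (norm h)\<^sup>2 * ?n\<^sup>2"
      by (simp add: power2_eq_square)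
    then have "?n\<^sup>2 \<le> (norm h)\<^sup>2"
      by (metis mult_right_le_imp_le zero_le_power2 zero_less_power2 zero_eq_power2)
    then show ?thesis by (rule power2_le_imp_le) simp
  qed
qed

text \<open>With \<open>Y\<close> the limit of the iteration for \<open>A = 1 - T\<close>, the fixed
  point equation \<open>2 Y = A + Y\<^sup>2\<close> reads
  \<open>(1 - Y)\<^sup>2 = 1 - A = T\<close>. The commutation property prepares the uniqueness of
  the root.\<close>

lemma positive_contraction_sqrt:
  assumes T: "positive_op T" and le: "\<And>h. Re (cinner (T h) h) \<le> (norm h)\<^sup>2"
    and S_def: "S = (\<lambda>h. h - sqrt_lim (\<lambda>h. h - T h) h)"
  shows "positive_op S" "\<And>h. S (S h) = T h"
    "\<And>V x. bounded_clinear V \<Longrightarrow> (\<And>x. V (T x) = T (V x)) \<Longrightarrow> V (S x) = S (V x)"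
proof -
  let ?A = "\<lambda>h. h - T h"
  note A = positive_contraction_complement[OF T le]
  let ?Y = "sqrt_lim ?A"
  note Y = sqrt_lim_bounded_clinear[OF A(1,2)]
  show SS: "S (S h) = T h" for h
    using sqrt_lim_eq[OF A(1,2), of h]
    by (simp add: S_def bounded_clinearD[OF Y] algebra_simps scaleR_2)
  show "V (S x) = S (V x)" if "bounded_clinear V" "\<And>x. V (T x) = T (V x)" for V x
    using sqrt_lim_commute[OF A(1,2) that(1), of x] that
    by (simp add: S_def bounded_clinearD[OF that(1)])
  have "cinner (?Y h) h \<in> \<real>" for h
  proof -
    have "cinner (?Y h) h = cnj (cinner (?Y h) h)"
      using sqrt_lim_symmetric[OF A(1,2,3), of h h] cinner_commute by metis
    then show ?thesis by (simp add: complex_is_Real_iff complex_eq_iff)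
  qed
  moreover have "Re (cinner (?Y h) h) \<le> (norm h)\<^sup>2" for h
  proof -
    have "Re (cinner (?Y h) h) \<le> norm (?Y h) * norm h"
      using norm_cinner_le[of "?Y h" h] complex_Re_le_cmod[of "cinner (?Y h) h"] by linarith
    also have "\<dots> \<le> norm h * norm h"
      using sqrt_lim_norm[OF A(1,2), of h] by (intro mult_right_mono) auto
    finally show ?thesis by (simp add: power2_eq_square)
  qed
  ultimately show "positive_op S"
    unfolding positive_op_def S_def
    by (auto intro!: bounded_clinear_diff bounded_clinear_ident Y simp: cinner_diff_left cinner_self)
qed

lemma positive_op_scale:
  assumes "positive_op T" "0 \<le> r"
  shows "positive_op (\<lambda>h. complex_of_real r *\<^sub>C T h)"
  using assms unfolding positive_op_def
  by (auto intro!: bounded_clinear_scaleC simp: cinner_scaleC_left)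

text \<open>Division by a norm bound \<open>K\<close> reduces to contractions, and the root is
  multiplied by \<open>sqrt K\<close> afterwards. The last clause applies to every other root of
  \<open>T\<close>, since a root commutes with its square.\<close>

lemma positive_sqrt_exists:
  assumes T: "positive_op T"
  shows "\<exists>S. positive_op S \<and> (\<forall>h. S (S h) = T h) \<and>
    (\<forall>V x. bounded_clinear V \<longrightarrow> (\<forall>x. V (T x) = T (V x)) \<longrightarrow> V (S x) = S (V x))"
proof -
  have bT: "bounded_clinear T" using T by (simp add: positive_op_def)
  obtain K where K: "K > 0" "\<And>x. norm (T x) \<le> K * norm x"
    using bounded_clinear_bound[OF bT] by blast
  define T' where "T' h = complex_of_real (1 / K) *\<^sub>C T h" for h
  have T': "positive_op T'"
    unfolding T'_def using K by (intro positive_op_scale T) simp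
  have le: "Re (cinner (T' h) h) \<le> (norm h)\<^sup>2" for h
  proof -
    have "Re (cinner (T h) h) \<le> norm (T h) * norm h"
      using norm_cinner_le[of "T h" h] complex_Re_le_cmod[of "cinner (T h) h"] by linarith
    also have "\<dots> \<le> K * norm h * norm h"
      using K by (intro mult_right_mono) auto
    finally show ?thesis
      using K by (simp add: T'_def cinner_scaleC_left divide_simps power2_eq_square algebra_simps)
  qed
  define S' where "S' = (\<lambda>h. h - sqrt_lim (\<lambda>h. h - T' h) h)"
  note S' = positive_contraction_sqrt[OF T' le S'_def]
  note linS' = bounded_clinearD[OF S'(1)[unfolded positive_op_def, THEN conjunct1]]
  define S where "S h = complex_of_real (sqrt K) *\<^sub>C S' h" for h
  have "positive_op S"
    unfolding S_def using K by (intro positive_op_scale S') simp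
  moreover have "S (S h) = T h" for h
  proof -
    have "S (S h) = (complex_of_real (sqrt K) * complex_of_real (sqrt K)) *\<^sub>C T' h"
      using S'(2)[of h] by (simp add: S_def linS'(3))
    also have "complex_of_real (sqrt K) * complex_of_real (sqrt K) = complex_of_real K"
      using K by (simp flip: of_real_mult)
    finally show ?thesis using K by (simp add: T'_def scaleC_scaleC)
  qed
  moreover have "V (S x) = S (V x)" if V: "bounded_clinear V" "\<forall>x. V (T x) = T (V x)" for V x
  proof -
    have "V (T' x) = T' (V x)" for x
      using V by (simp add: T'_def bounded_clinearD[OF V(1)])
    then show ?thesis
      using S'(3)[OF V(1)] by (simp add: S_def bounded_clinearD[OF V(1)])
  qed
  ultimately show ?thesis by blast
qed

text \<open>A positive root \<open>S'\<close> commutes with \<open>T\<close>, hence with the root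
  \<open>R\<close> from the iteration, and commuting positive roots agree. So every positive root
  coincides with \<open>R\<close>.\<close>

lemma op_sqrt_unique:
  assumes S: "positive_op S" "\<And>h. S (S h) = T h"
  shows "op_sqrt T = S"
  unfolding op_sqrt_def
proof (rule the_equality)
  have bS: "bounded_clinear S" using S by (simp add: positive_op_def)
  have T: "positive_op T"
  proof -
    have "T = (\<lambda>h. S (S h))" using S(2) by auto
    then show ?thesis
      using bounded_clinear_compose[OF bS bS]
      by (auto simp: positive_op_def positive_op_symmetric[OF S(1), of "S _"] cinner_self)
  qed
  obtain R where R: "positive_op R" "\<And>h. R (R h) = T h"
    "\<And>V x. bounded_clinear V \<Longrightarrow> (\<And>x. V (T x) = T (V x)) \<Longrightarrow> V (R x) = R (V x)"
    using positive_sqrt_exists[OF T] by metis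
  have uniq: "S' = R" if S': "positive_op S'" "S' \<circ> S' = T" for S'
  proof (rule commuting_positive_sqrt_unique[OF S'(1) R(1)])
    have S'S': "S' (S' x) = T x" for x using S'(2) by (auto simp: o_def fun_eq_iff)
    show "S' (S' x) = R (R x)" for x by (simp add: S'S' R)
    show "S' (R x) = R (S' x)" for x
      using S' by (intro R(3)) (auto simp: positive_op_def simp flip: S'S')
  qed
  show "positive_op S \<and> S \<circ> S = T"
    using S by (auto simp: o_def)
  then show "S' = S" if "positive_op S' \<and> S' \<circ> S' = T" for S'
    using uniq that by metis
qed

lemma op_sqrt:
  assumes "positive_op T"
  shows "positive_op (op_sqrt T)" "op_sqrt T (op_sqrt T h) = T h"
  using positive_sqrt_exists[OF assms] op_sqrt_unique by metis+

lemma norm_op_sqrt: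
  assumes "positive_op T"
  shows "(norm (op_sqrt T h))\<^sup>2 = Re (cinner (T h) h)"
  using positive_op_symmetric[OF op_sqrt(1)[OF assms], of "op_sqrt T h" h] op_sqrt(2)[OF assms, of h]
  by (simp add: power2_norm_eq_cinner)

lemma op_abs_positive: "positive_op T \<Longrightarrow> op_abs T = T"
  unfolding op_abs_def by (auto intro!: op_sqrt_unique simp: adj_positive_op)

lemma trace_class_positive:
  "positive_op T \<Longrightarrow> trace_class T \<longleftrightarrow> (\<lambda>e. cinner (T e) e) summable_on hbasis"
  unfolding trace_class_def by (simp add: op_abs_positive) (simp add: positive_op_def)

lemma trace_norm_positive: "positive_op T \<Longrightarrow> trace_norm T = Re (trace_op T)"
  unfolding trace_norm_def by (simp add: op_abs_positive)

subsection \<open>Adjoints\<close>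

lemma bounded_clinear_sum:
  assumes T: "bounded_clinear T"
  shows "T (\<Sum>e\<in>F. a e *\<^sub>C f e) = (\<Sum>e\<in>F. a e *\<^sub>C T (f e))"
  by (induction F rule: infinite_finite_induct) (simp_all add: bounded_clinearD[OF T])

lemma bounded_clinear_has_sum:
  assumes T: "bounded_clinear T"
  shows "((\<lambda>e. cinner h e *\<^sub>C T e) has_sum T h) hbasis"
  using has_sum_bounded_linear[OF bounded_clinearD(6)[OF T] hbasis_has_sum[of h]]
  by (simp add: bounded_clinearD[OF T])

lemma bounded_clinear_ext:
  assumes "bounded_clinear S" "bounded_clinear T" "\<And>e. e \<in> hbasis \<Longrightarrow> S e = T e"
  shows "S = T"
proof
  fix h
  have "((\<lambda>e. cinner h e *\<^sub>C T e) has_sum S h) hbasis"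
    using bounded_clinear_has_sum[OF assms(1), of h] assms(3) by (simp cong: has_sum_cong)
  then show "S h = T h" using bounded_clinear_has_sum[OF assms(2)] by (rule has_sum_unique)
qed

text \<open>For the finite sum \<open>y\<close> of the vectors
  \<open>cinner k (T e) *\<^sub>C e\<close> the squared norm equals \<open>cinner k (T y)\<close>,
  which is at most \<open>norm k * (K * norm y)\<close>. Cancelling one factor \<open>norm y\<close>
  bounds the partial sums independently of \<open>F\<close>.\<close>

lemma adjoint_coefficients_summable:
  assumes T: "bounded_clinear T"
  shows "(\<lambda>e. (cmod (cinner k (T e)))\<^sup>2) summable_on hbasis"
proof (rule nonneg_bdd_above_summable_on)
  obtain K where K: "K > 0" "\<And>x. norm (T x) \<le> K * norm x" using bounded_clinear_bound[OF T] by blast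
  show "bdd_above (sum (\<lambda>e. (cmod (cinner k (T e)))\<^sup>2) ` {F. F \<subseteq> hbasis \<and> finite F})"
  proof (rule bdd_aboveI2)
    fix F assume "F \<in> {F. F \<subseteq> (hbasis :: 'a set) \<and> finite F}"
    then have F: "finite F" "F \<subseteq> hbasis" by auto
    define s where "s = (\<Sum>e\<in>F. (cmod (cinner k (T e)))\<^sup>2)"
    define y where "y = (\<Sum>e\<in>F. cinner k (T e) *\<^sub>C e)"
    have s0: "s \<ge> 0" unfolding s_def by (rule sum_nonneg) simp
    have y: "(norm y)\<^sup>2 = s" unfolding y_def s_def by (rule orthonormal_norm_sum[OF orthonormal_hbasis F])
    have "cinner k (T y) = (\<Sum>e\<in>F. cnj (cinner k (T e)) * cinner k (T e))"
      unfolding y_def bounded_clinear_sum[OF T] cinner_sum_right by (simp add: cinner_scaleC_right)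
    also have "\<dots> = complex_of_real s"
      unfolding s_def of_real_sum by (intro sum.cong refl) (simp only: complex_norm_square mult.commute)
    finally have "s \<le> norm k * norm (T y)"
      using norm_cinner_le[of k "T y"] s0 by simp
    also have "\<dots> \<le> norm k * (K * norm y)" by (intro mult_left_mono K) simp
    finally have le: "norm y * norm y \<le> (K * norm k) * norm y"
      using y by (simp add: power2_eq_square mult_ac)
    have "norm y \<le> K * norm k"
    proof (cases "norm y = 0")
      case True
      then show ?thesis using K(1) by simp
    next
      case False
      then show ?thesis using le by (intro mult_right_le_imp_le[OF le]) simp
    qed
    then have "(norm y)\<^sup>2 \<le> (K * norm k)\<^sup>2" by (intro power_mono) auto
    then show "(\<Sum>e\<in>F. (cmod (cinner k (T e)))\<^sup>2) \<le> (K * norm k)\<^sup>2" using y s_def by simp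
  qed
qed simp

text \<open>The adjoint is constructed by its expansion in the basis, with coefficients
  \<open>cinner k (T e)\<close>, whose square summability makes the series converge.\<close>

lemma cinner_adj:
  assumes T: "bounded_clinear T"
  shows "cinner (T h) k = cinner h (adj T k)"
proof -
  define S where "S k = (\<Sum>\<^sub>\<infinity>e\<in>hbasis. cinner k (T e) *\<^sub>C e)" for k
  have S: "cinner (T h) k = cinner h (S k)" for h k
  proof -
    have "((\<lambda>e. cinner k (T e) *\<^sub>C e) has_sum S k) hbasis"
      unfolding S_def by (rule has_sum_infsum[OF orthonormal_summable[OF orthonormal_hbasis adjoint_coefficients_summable[OF T]]])
    from has_sum_bounded_linear[OF bounded_linear_cinner_right this, of h]
    have "((\<lambda>e. cnj (cinner k (T e)) * cinner h e) has_sum cinner h (S k)) hbasis"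
      by (simp add: cinner_scaleC_right)
    moreover have "((\<lambda>e. cinner h e * cinner (T e) k) has_sum cinner (T h) k) hbasis"
      using has_sum_bounded_linear[OF bounded_linear_cinner_left bounded_clinear_has_sum[OF T]]
      by (simp add: cinner_scaleC_left)
    moreover have "cnj (cinner k (T e)) * cinner h e = cinner h e * cinner (T e) k" for e
      using cinner_commute[of "T e" k] by simp
    ultimately show ?thesis using has_sum_unique by fastforce
  qed
  then have "adj T = S" by (rule adj_unique)
  then show ?thesis by (simp add: S)
qed

section \<open>Hilbert spaces given by records\<close>

text \<open>The carriers consist of classes with arbitrarily chosen representatives. Equations
  between vectors are therefore avoided in favour of computations with scalar products, and
  \<open>dist_definite\<close> yields equality where it is wanted.\<close>

locale hilb =
  fixes E :: "('x, 'm) ip_space_scheme"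
  assumes add_closed: "p \<in> carrier E \<Longrightarrow> q \<in> carrier E \<Longrightarrow> vadd E p q \<in> carrier E"
    and scale_closed: "p \<in> carrier E \<Longrightarrow> vscale E c p \<in> carrier E"
    and ip_add: "p \<in> carrier E \<Longrightarrow> q \<in> carrier E \<Longrightarrow> r \<in> carrier E \<Longrightarrow> ip E (vadd E p q) r = ip E p r + ip E q r"
    and ip_scale: "p \<in> carrier E \<Longrightarrow> q \<in> carrier E \<Longrightarrow> ip E (vscale E c p) q = c * ip E p q"
    and ip_commute: "p \<in> carrier E \<Longrightarrow> q \<in> carrier E \<Longrightarrow> ip E p q = cnj (ip E q p)"
    and ip_nonneg: "p \<in> carrier E \<Longrightarrow> 0 \<le> Re (ip E p p)"
    and dist_definite: "p \<in> carrier E \<Longrightarrow> q \<in> carrier E \<Longrightarrow> ip_dist E p q = 0 \<Longrightarrow> p = q"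
    and complete: "(\<And>n::nat. s n \<in> carrier E) \<Longrightarrow>
        (\<And>e. e > 0 \<Longrightarrow> \<exists>N. \<forall>m\<ge>N. \<forall>n\<ge>N. ip_dist E (s m) (s n) < e) \<Longrightarrow>
        \<exists>p\<in>carrier E. (\<lambda>n. ip_dist E (s n) p) \<longlonglongrightarrow> 0"
begin

lemma ip_add_right:
  "p \<in> carrier E \<Longrightarrow> q \<in> carrier E \<Longrightarrow> r \<in> carrier E \<Longrightarrow> ip E r (vadd E p q) = ip E r p + ip E r q"
  using ip_add[of p q r] by (metis add_closed complex_cnj_add ip_commute)

lemma ip_scale_right:
  "p \<in> carrier E \<Longrightarrow> q \<in> carrier E \<Longrightarrow> ip E q (vscale E c p) = cnj c * ip E q p"
  using ip_scale[of p q c] by (metis complex_cnj_mult ip_commute scale_closed)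

lemma ip_self: "p \<in> carrier E \<Longrightarrow> ip E p p = complex_of_real (Re (ip E p p))"
  using ip_commute[of p p] by (simp add: complex_eq_iff)

lemmas ip_simps = ip_add ip_add_right ip_scale ip_scale_right add_closed scale_closed

section \<open>Norm, distance and the triangle inequality\<close>

definition nrm :: "'x \<Rightarrow> real" where "nrm p = sqrt (Re (ip E p p))"

definition sub :: "'x \<Rightarrow> 'x \<Rightarrow> 'x" where "sub p q = vadd E p (vscale E (-1) q)"

lemma sub_closed: "p \<in> carrier E \<Longrightarrow> q \<in> carrier E \<Longrightarrow> sub p q \<in> carrier E"
  by (simp add: sub_def ip_simps)

lemma ip_sub:
  assumes "p \<in> carrier E" "q \<in> carrier E" "r \<in> carrier E"
  shows "ip E (sub p q) r = ip E p r - ip E q r" "ip E r (sub p q) = ip E r p - ip E r q"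
  using assms by (simp_all add: sub_def ip_simps)

lemma dist_eq: "ip_dist E p q = nrm (sub p q)"
  by (simp add: ip_dist_def nrm_def sub_def Let_def)

lemma nrm_sq: "p \<in> carrier E \<Longrightarrow> (nrm p)\<^sup>2 = Re (ip E p p)"
  by (simp add: nrm_def ip_nonneg)

lemma nrm_nonneg: "p \<in> carrier E \<Longrightarrow> 0 \<le> nrm p"
  by (simp add: nrm_def ip_nonneg)

lemma dist_nonneg: "p \<in> carrier E \<Longrightarrow> q \<in> carrier E \<Longrightarrow> 0 \<le> ip_dist E p q"
  by (simp add: dist_eq nrm_nonneg sub_closed)

lemma Re_ip_commute: "p \<in> carrier E \<Longrightarrow> q \<in> carrier E \<Longrightarrow> Re (ip E p q) = Re (ip E q p)"
  by (subst ip_commute) auto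

lemma dist_sq:
  assumes "p \<in> carrier E" "q \<in> carrier E"
  shows "(ip_dist E p q)\<^sup>2 = Re (ip E p p) - 2 * Re (ip E p q) + Re (ip E q q)"
  using assms Re_ip_commute[of q p] by (simp add: dist_eq nrm_sq sub_closed ip_sub)

lemma dist_self: "p \<in> carrier E \<Longrightarrow> ip_dist E p p = 0"
  using dist_sq[of p p] by simp

lemma dist_commute: "p \<in> carrier E \<Longrightarrow> q \<in> carrier E \<Longrightarrow> ip_dist E p q = ip_dist E q p"
  using dist_sq[of p q] dist_sq[of q p] Re_ip_commute[of p q] dist_nonneg[of p q] dist_nonneg[of q p]
  by (metis add.commute add_diff_eq diff_add_eq power2_eq_imp_eq)

lemma ip_Cauchy_Schwarz:
  assumes p: "p \<in> carrier E" and q: "q \<in> carrier E"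
  shows "cmod (ip E p q) \<le> nrm p * nrm q"
proof -
  have "(cmod (ip E p q))\<^sup>2 \<le> Re (ip E q q) * Re (ip E p p)"
  proof (rule hermitian_Cauchy_Schwarz)
    fix l :: complex
    let ?r = "vadd E q (vscale E l p)"
    have ll: "l * cnj l = complex_of_real ((cmod l)\<^sup>2)"
      by (simp only: complex_norm_square)
    have "ip E ?r ?r = ip E q q + (l * ip E p q + cnj (l * ip E p q)) + (l * cnj l) * ip E p p"
      using p q ip_commute[OF q p] by (simp add: ip_simps algebra_simps)
    then have "Re (ip E ?r ?r) = Re (ip E q q) + 2 * Re (l * ip E p q) + (cmod l)\<^sup>2 * Re (ip E p p)"
      unfolding ll by (simp only: plus_complex.sel complex_add_cnj Re_complex_of_real Im_complex_of_real
        times_complex.sel mult_zero_left diff_zero)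
    then show "0 \<le> Re (ip E q q) + 2 * Re (l * ip E p q) + (cmod l)\<^sup>2 * Re (ip E p p)"
      using ip_nonneg[of ?r] p q by (simp only: ip_simps)
  qed (use p in \<open>rule ip_nonneg\<close>)
  also have "\<dots> = (nrm p * nrm q)\<^sup>2"
    using p q by (simp add: power_mult_distrib nrm_sq)
  finally show ?thesis
    by (rule power2_le_imp_le) (use p q in \<open>simp add: nrm_nonneg\<close>)
qed

lemma nrm_triangle:
  assumes p: "p \<in> carrier E" and q: "q \<in> carrier E"
  shows "nrm (vadd E p q) \<le> nrm p + nrm q"
proof (rule power2_le_imp_le)
  have "(nrm (vadd E p q))\<^sup>2 = (nrm p)\<^sup>2 + 2 * Re (ip E p q) + (nrm q)\<^sup>2"
    using p q Re_ip_commute[OF p q] by (simp add: nrm_sq ip_simps)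
  also have "Re (ip E p q) \<le> nrm p * nrm q"
    using ip_Cauchy_Schwarz[OF p q] complex_Re_le_cmod[of "ip E p q"] by linarith
  finally show "(nrm (vadd E p q))\<^sup>2 \<le> (nrm p + nrm q)\<^sup>2"
    by (simp add: power2_sum)
qed (use assms in \<open>simp add: nrm_nonneg\<close>)

text \<open>It stands in for equations between vectors: when two expressions agree formally, their
  scalar products with themselves are computed by \<open>ip_simps\<close> and compared.\<close>

lemma nrm_cong:
  "ip E p p = ip E q q \<Longrightarrow> nrm p = nrm q"
  by (simp add: nrm_def)

lemma dist_triangle:
  assumes "p \<in> carrier E" "q \<in> carrier E" "r \<in> carrier E"
  shows "ip_dist E p r \<le> ip_dist E p q + ip_dist E q r"
proof -
  have "nrm (sub p r) = nrm (vadd E (sub p q) (sub q r))"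
    using assms by (intro nrm_cong) (simp add: ip_simps ip_sub sub_closed)
  then show ?thesis
    using nrm_triangle[of "sub p q" "sub q r"] assms by (simp add: dist_eq sub_closed)
qed

lemma dist_add:
  assumes "p \<in> carrier E" "q \<in> carrier E" "p' \<in> carrier E" "q' \<in> carrier E"
  shows "ip_dist E (vadd E p q) (vadd E p' q') \<le> ip_dist E p p' + ip_dist E q q'"
proof -
  have "nrm (sub (vadd E p q) (vadd E p' q')) = nrm (vadd E (sub p p') (sub q q'))"
    using assms by (intro nrm_cong) (simp add: ip_simps ip_sub sub_closed)
  then show ?thesis
    using nrm_triangle[of "sub p p'" "sub q q'"] assms by (simp add: dist_eq sub_closed)
qed

lemma nrm_scale: "p \<in> carrier E \<Longrightarrow> nrm (vscale E c p) = cmod c * nrm p"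
proof -
  assume p: "p \<in> carrier E"
  have "ip E (vscale E c p) (vscale E c p) = (c * cnj c) * complex_of_real (Re (ip E p p))"
    using p by (simp add: ip_simps ip_self[symmetric])
  also have "c * cnj c = complex_of_real ((cmod c)\<^sup>2)"
    by (simp only: complex_norm_square)
  finally show ?thesis
    by (simp add: nrm_def real_sqrt_mult flip: of_real_mult of_real_power)
qed

lemma dist_scale:
  assumes "p \<in> carrier E" "q \<in> carrier E"
  shows "ip_dist E (vscale E c p) (vscale E c q) = cmod c * ip_dist E p q"
proof -
  have "nrm (sub (vscale E c p) (vscale E c q)) = nrm (vscale E c (sub p q))"
    using assms by (intro nrm_cong) (simp add: ip_simps ip_sub sub_closed algebra_simps)
  then show ?thesis
    using assms by (simp add: dist_eq nrm_scale sub_closed)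
qed

section \<open>Convergent sequences\<close>

definition converges :: "(nat \<Rightarrow> 'x) \<Rightarrow> 'x \<Rightarrow> bool" where
  "converges s p \<longleftrightarrow> p \<in> carrier E \<and> (\<forall>n. s n \<in> carrier E) \<and> (\<lambda>n. ip_dist E (s n) p) \<longlonglongrightarrow> 0"

lemma converges_const: "p \<in> carrier E \<Longrightarrow> converges (\<lambda>n. p) p"
  by (simp add: converges_def dist_self)

lemma converges_add:
  assumes "converges s p" "converges t q"
  shows "converges (\<lambda>n. vadd E (s n) (t n)) (vadd E p q)"
proof -
  have "(\<lambda>n. ip_dist E (vadd E (s n) (t n)) (vadd E p q)) \<longlonglongrightarrow> 0"
  proof (rule Lim_null_comparison)
    show "\<forall>\<^sub>F n in sequentially. norm (ip_dist E (vadd E (s n) (t n)) (vadd E p q)) \<le> ip_dist E (s n) p + ip_dist E (t n) q"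
      using assms by (auto simp: converges_def dist_add dist_nonneg add_closed)
    show "(\<lambda>n. ip_dist E (s n) p + ip_dist E (t n) q) \<longlonglongrightarrow> 0"
      using assms by (auto simp: converges_def intro!: tendsto_eq_intros)
  qed
  then show ?thesis using assms by (simp add: converges_def add_closed)
qed

lemma converges_scale:
  assumes "converges s p"
  shows "converges (\<lambda>n. vscale E c (s n)) (vscale E c p)"
  using assms by (auto simp: converges_def scale_closed dist_scale intro!: tendsto_eq_intros)

lemma converges_ip:
  assumes s: "converges s p" and t: "converges t q"
  shows "(\<lambda>n. ip E (s n) (t n)) \<longlonglongrightarrow> ip E p q"
proof -
  note c = s[unfolded converges_def] t[unfolded converges_def]
  have "(\<lambda>n. ip E (s n) (t n) - ip E p q) \<longlonglongrightarrow> 0"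
  proof (rule Lim_null_comparison)
    show "\<forall>\<^sub>F n in sequentially. norm (ip E (s n) (t n) - ip E p q) \<le>
        ip_dist E (s n) p * (ip_dist E (t n) q + nrm q) + nrm p * ip_dist E (t n) q"
    proof (intro always_eventually allI)
      fix n
      have cl: "s n \<in> carrier E" "t n \<in> carrier E" "p \<in> carrier E" "q \<in> carrier E" using c by auto
      have "nrm (t n) = nrm (vadd E (sub (t n) q) q)"
        using cl by (intro nrm_cong) (simp add: ip_simps ip_sub sub_closed)
      then have tn: "nrm (t n) \<le> ip_dist E (t n) q + nrm q"
        using nrm_triangle[of "sub (t n) q" q] cl by (simp add: dist_eq sub_closed)
      have "ip E (s n) (t n) - ip E p q = ip E (sub (s n) p) (t n) + ip E p (sub (t n) q)"
        using cl by (simp add: ip_sub)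
      also have "cmod \<dots> \<le> nrm (sub (s n) p) * nrm (t n) + nrm p * nrm (sub (t n) q)"
        by (intro order_trans[OF norm_triangle_ineq] add_mono ip_Cauchy_Schwarz sub_closed cl)
      also have "\<dots> \<le> ip_dist E (s n) p * (ip_dist E (t n) q + nrm q) + nrm p * ip_dist E (t n) q"
        using tn cl by (auto simp: dist_eq nrm_nonneg sub_closed intro!: add_mono mult_left_mono)
      finally show "norm (ip E (s n) (t n) - ip E p q) \<le>
        ip_dist E (s n) p * (ip_dist E (t n) q + nrm q) + nrm p * ip_dist E (t n) q" .
    qed
    have "(\<lambda>n. ip_dist E (s n) p * (ip_dist E (t n) q + nrm q) + nrm p * ip_dist E (t n) q)
        \<longlonglongrightarrow> 0 * (0 + nrm q) + nrm p * 0"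
      using c by (intro tendsto_intros) auto
    then show "(\<lambda>n. ip_dist E (s n) p * (ip_dist E (t n) q + nrm q) + nrm p * ip_dist E (t n) q) \<longlonglongrightarrow> 0"
      by simp
  qed
  then show ?thesis by (simp add: LIM_zero_iff)
qed

lemma converges_dist:
  assumes s: "converges s p" and t: "converges t q"
  shows "(\<lambda>n. ip_dist E (s n) (t n)) \<longlonglongrightarrow> ip_dist E p q"
proof -
  have c: "s n \<in> carrier E" "t n \<in> carrier E" "p \<in> carrier E" "q \<in> carrier E" for n
    using assms by (auto simp: converges_def)
  have "ip_dist E x y = sqrt (Re (ip E x x) - 2 * Re (ip E x y) + Re (ip E y y))"
    if "x \<in> carrier E" "y \<in> carrier E" for x y
    using dist_sq[OF that] dist_nonneg[OF that] by (metis real_sqrt_unique)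
  then show ?thesis
    using c by (auto intro!: tendsto_intros converges_ip assms)
qed

lemma converges_Cauchy:
  assumes s: "converges s p" and "e > 0"
  shows "\<exists>N. \<forall>m\<ge>N. \<forall>n\<ge>N. ip_dist E (s m) (s n) < e"
proof -
  have cl: "s n \<in> carrier E" "p \<in> carrier E" for n using s by (auto simp: converges_def)
  have "(\<lambda>n. ip_dist E (s n) p) \<longlonglongrightarrow> 0" using s by (simp add: converges_def)
  then obtain N where N: "\<And>n. n \<ge> N \<Longrightarrow> ip_dist E (s n) p < e / 2"
    using \<open>e > 0\<close> dist_nonneg[OF cl] unfolding LIMSEQ_def by (metis dist_0_norm dist_commute_lessI half_gt_zero real_norm_def abs_of_nonneg)
  have "ip_dist E (s m) (s n) < e" if "m \<ge> N" "n \<ge> N" for m n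
    using dist_triangle[OF cl(1)[of m] cl(2) cl(1)[of n]] dist_commute[OF cl(1)[of n] cl(2)]
      N[OF that(1)] N[OF that(2)] by linarith
  then show ?thesis by blast
qed

section \<open>Closed spans and orthogonal complements\<close>

lemma lin_span_closed: "A \<subseteq> carrier E \<Longrightarrow> p \<in> lin_span E A \<Longrightarrow> p \<in> carrier E"
  by (rotate_tac, induction rule: lin_span.induct) (auto simp: ip_simps)

lemma closed_span_iff:
  assumes "A \<subseteq> carrier E"
  shows "p \<in> closed_span E A \<longleftrightarrow> (\<exists>s. (\<forall>n. s n \<in> lin_span E A) \<and> converges s p)"
proof
  assume p: "p \<in> closed_span E A"
  then have *: "\<forall>e>0. \<exists>q\<in>lin_span E A. ip_dist E q p < e" and pE: "p \<in> carrier E"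
    unfolding closed_span_def by simp_all
  have "\<forall>n. \<exists>q. q \<in> lin_span E A \<and> ip_dist E q p < inverse (real (Suc n))"
    using * by (metis inverse_positive_iff_positive of_nat_0_less_iff zero_less_Suc)
  from choice[OF this] obtain s where
    "\<forall>n. s n \<in> lin_span E A \<and> ip_dist E (s n) p < inverse (real (Suc n))" ..
  then have s: "\<And>n. s n \<in> lin_span E A" "\<And>n. ip_dist E (s n) p < inverse (real (Suc n))"
    by simp_all
  have cl: "s n \<in> carrier E" "p \<in> carrier E" for n
    using s(1)[of n] lin_span_closed[OF assms] pE by simp_all
  have "(\<lambda>n. ip_dist E (s n) p) \<longlonglongrightarrow> 0"
  proof (rule Lim_null_comparison[OF _ LIMSEQ_inverse_real_of_nat], intro always_eventually allI)
    show "norm (ip_dist E (s n) p) \<le> inverse (real (Suc n))" for n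
      using s(2)[of n] dist_nonneg[OF cl, of n] by simp
  qed
  then show "\<exists>s. (\<forall>n. s n \<in> lin_span E A) \<and> converges s p"
    using s cl by (auto simp: converges_def)
next
  assume "\<exists>s. (\<forall>n. s n \<in> lin_span E A) \<and> converges s p"
  then obtain s where s: "\<And>n. s n \<in> lin_span E A" "converges s p" by blast
  have "\<exists>q\<in>lin_span E A. ip_dist E q p < e" if "e > 0" for e
  proof -
    have "\<forall>\<^sub>F n in sequentially. ip_dist E (s n) p < e"
      using s that by (auto simp: converges_def intro: order_tendstoD)
    then show ?thesis using s by (auto simp: eventually_sequentially)
  qed
  then show "p \<in> closed_span E A"
    using s by (simp add: closed_span_def converges_def)
qed

text \<open>This is the parallelogram law for the differences of \<open>p\<close> and
  \<open>q\<close> from \<open>x\<close>.\<close>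

lemma midpoint_dist:
  assumes p: "p \<in> carrier E" and q: "q \<in> carrier E" and x: "x \<in> carrier E"
  shows "(ip_dist E p q)\<^sup>2 = 2 * (ip_dist E p x)\<^sup>2 + 2 * (ip_dist E q x)\<^sup>2
    - 4 * (ip_dist E (vscale E (1/2) (vadd E p q)) x)\<^sup>2"
  using assms Re_ip_commute[OF p q]
  by (simp add: dist_sq ip_simps algebra_simps)

text \<open>The nearest point argument: a sequence in the span that minimises the distance to a
  point \<open>x\<close> outside the closed span is Cauchy by the parallelogram law, and
  \<open>x\<close> minus its limit is orthogonal to the generators.\<close>

lemma exists_orthogonal:
  assumes A: "A \<subseteq> carrier E" "A \<noteq> {}" and ne: "closed_span E A \<noteq> carrier E"
  shows "\<exists>z\<in>carrier E. nrm z \<noteq> 0 \<and> (\<forall>a\<in>A. ip E a z = 0)"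
proof -
  obtain x where x: "x \<in> carrier E" "x \<notin> closed_span E A"
    using ne by (auto simp: closed_span_def)
  let ?S = "lin_span E A"
  have Scl: "y \<in> carrier E" if "y \<in> ?S" for y using lin_span_closed[OF A(1) that] .
  define D where "D = (\<lambda>y. ip_dist E y x) ` ?S"
  define \<delta> where "\<delta> = Inf D"
  have D0: "d \<ge> 0" if "d \<in> D" for d using that x Scl by (auto simp: D_def dist_nonneg)
  have Dne: "D \<noteq> {}" using A by (auto simp: D_def intro: lin_span.base)
  have bdd: "bdd_below D" using D0 by (rule bdd_belowI)
  have lower: "\<delta> \<le> ip_dist E y x" if "y \<in> ?S" for y
    unfolding \<delta>_def using that by (intro cInf_lower bdd) (auto simp: D_def)
  have \<delta>0: "\<delta> \<ge> 0" unfolding \<delta>_def using Dne D0 by (intro cInf_greatest)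
  have "\<exists>y\<in>?S. ip_dist E y x < \<delta> + inverse (real (Suc n))" for n
    using cInf_lessD[OF Dne, of "\<delta> + inverse (real (Suc n))"] by (auto simp: \<delta>_def D_def)
  then obtain y where y: "\<And>n. y n \<in> ?S" "\<And>n. ip_dist E (y n) x < \<delta> + inverse (real (Suc n))"
    by metis
  have ycl: "y n \<in> carrier E" for n using Scl y by blast
  have lim: "(\<lambda>n. ip_dist E (y n) x) \<longlonglongrightarrow> \<delta>"
  proof (rule real_tendsto_sandwich)
    show "\<forall>\<^sub>F n in sequentially. \<delta> \<le> ip_dist E (y n) x"
      by (intro always_eventually allI lower y)
    show "\<forall>\<^sub>F n in sequentially. ip_dist E (y n) x \<le> \<delta> + inverse (real (Suc n))"
      by (intro always_eventually allI less_imp_le y)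
    show "(\<lambda>n. \<delta> + inverse (real (Suc n))) \<longlonglongrightarrow> \<delta>"
      using tendsto_add[OF tendsto_const LIMSEQ_inverse_real_of_nat, of \<delta>] by simp
  qed simp
  have cauchy_bound: "(ip_dist E (y m) (y n))\<^sup>2 \<le> 2 * (ip_dist E (y m) x)\<^sup>2 + 2 * (ip_dist E (y n) x)\<^sup>2 - 4 * \<delta>\<^sup>2" for m n
  proof -
    \<comment> \<open>The midpoint of two members of the span is again in the span, so its distance
      from \<open>x\<close> is at least \<open>\<delta>\<close>.\<close>
    have "\<delta>\<^sup>2 \<le> (ip_dist E (vscale E (1/2) (vadd E (y m) (y n))) x)\<^sup>2"
      by (intro power_mono lower lin_span.scale lin_span.add y \<delta>0)
    then show ?thesis using midpoint_dist[OF ycl ycl x(1), of m n] by linarith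
  qed
  have "\<exists>N. \<forall>m\<ge>N. \<forall>n\<ge>N. ip_dist E (y m) (y n) < e" if "e > 0" for e
  proof -
    have "(\<lambda>n. (ip_dist E (y n) x)\<^sup>2) \<longlonglongrightarrow> \<delta>\<^sup>2" by (intro tendsto_intros lim)
    then have "\<forall>\<^sub>F n in sequentially. (ip_dist E (y n) x)\<^sup>2 < \<delta>\<^sup>2 + e\<^sup>2 / 4"
      by (rule order_tendstoD) (use that in simp)
    then obtain N where N: "\<And>n. n \<ge> N \<Longrightarrow> (ip_dist E (y n) x)\<^sup>2 < \<delta>\<^sup>2 + e\<^sup>2 / 4"
      by (auto simp: eventually_sequentially)
    have "ip_dist E (y m) (y n) < e" if "m \<ge> N" "n \<ge> N" for m n
    proof (rule power2_less_imp_less)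
      show "(ip_dist E (y m) (y n))\<^sup>2 < e\<^sup>2"
        using cauchy_bound[of m n] N[OF that(1)] N[OF that(2)] by linarith
    qed (use \<open>e > 0\<close> in simp)
    then show ?thesis by blast
  qed
  from complete[OF ycl this] obtain y0 where y0: "y0 \<in> carrier E" "(\<lambda>n. ip_dist E (y n) y0) \<longlonglongrightarrow> 0"
    by blast
  have conv: "converges y y0" using y0 ycl by (simp add: converges_def)
  then have d0: "ip_dist E y0 x = \<delta>"
    using converges_dist[OF conv converges_const[OF x(1)]] lim LIMSEQ_unique by blast
  have "y0 \<in> closed_span E A" using closed_span_iff[OF A(1)] y conv by blast
  then have "y0 \<noteq> x" using x by blast
  then have "nrm (sub x y0) \<noteq> 0"
    using dist_definite[OF x(1) y0(1)] by (auto simp: dist_eq)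
  moreover have "ip E a (sub x y0) = 0" if a: "a \<in> A" for a
  proof -
    have acl: "a \<in> carrier E" using a A by blast
    let ?z = "sub x y0"
    \<comment> \<open>Moving the nearest point \<open>y0\<close> by \<open>- l\<close> times
      \<open>a\<close> does not decrease the distance to \<open>x\<close>. The polynomial expressing
      this has constant term zero, which forces its linear coefficient to vanish.\<close>
    have "(cmod (ip E a ?z))\<^sup>2 \<le> 0 * Re (ip E a a)"
    proof (rule hermitian_Cauchy_Schwarz)
      fix l :: complex
      \<comment> \<open>The shifted point need not lie in the span, but it is a limit of points that
        do, so the lower bound \<open>\<delta>\<close> carries over.\<close>
      have "converges (\<lambda>n. vadd E (y n) (vscale E (- l) a)) (vadd E y0 (vscale E (- l) a))"
        by (intro converges_add conv converges_const scale_closed acl)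
      from converges_dist[OF this converges_const[OF x(1)]]
      have "\<delta> \<le> ip_dist E (vadd E y0 (vscale E (- l) a)) x"
        by (rule LIMSEQ_le_const) (intro exI allI impI lower lin_span.intros a y)
      then have "(ip_dist E y0 x)\<^sup>2 \<le> (ip_dist E (vadd E y0 (vscale E (- l) a)) x)\<^sup>2"
        unfolding d0 using \<delta>0 by (intro power_mono)
      also have "\<dots> = (ip_dist E y0 x)\<^sup>2 + 2 * Re (l * ip E a ?z) + Re ((l * cnj l) * ip E a a)"
        using acl y0(1) x(1) ip_commute[OF y0(1) acl]
        by (simp add: dist_sq ip_simps ip_sub algebra_simps)
      also have "l * cnj l = complex_of_real ((cmod l)\<^sup>2)"
        by (simp only: complex_norm_square)
      finally show "0 \<le> 0 + 2 * Re (l * ip E a ?z) + (cmod l)\<^sup>2 * Re (ip E a a)"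
        by simp
    qed (use acl in \<open>rule ip_nonneg\<close>)
    then show ?thesis by simp
  qed
  ultimately show ?thesis using sub_closed[OF x(1) y0(1)] by blast
qed

end

subsection \<open>Extension of isometries\<close>

text \<open>Density concerns \<open>E2\<close> only: in \<open>E1\<close> the domain of the
  extension is by construction the closed span of the family.\<close>

locale isometric_families =
  E1: hilb E1 + E2: hilb E2
  for E1 :: "('x, 'm) ip_space_scheme" and E2 :: "('y, 'n) ip_space_scheme" +
  fixes I :: "'i set" and u :: "'i \<Rightarrow> 'x" and v :: "'i \<Rightarrow> 'y"
  assumes u_closed: "u ` I \<subseteq> carrier E1" and v_closed: "v ` I \<subseteq> carrier E2"
    and ip_eq: "i \<in> I \<Longrightarrow> j \<in> I \<Longrightarrow> ip E1 (u i) (u j) = ip E2 (v i) (v j)"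
    and dense: "closed_span E2 (v ` I) = carrier E2"
begin

text \<open>A vector may have many representations as a linear combination, so the linear extension
  starts as a relation. That it is single valued follows from the isometry property and not from a
  choice of coefficients.\<close>

inductive span_graph :: "'x \<Rightarrow> 'y \<Rightarrow> bool" where
  base: "i \<in> I \<Longrightarrow> span_graph (u i) (v i)"
| add: "span_graph p q \<Longrightarrow> span_graph p' q' \<Longrightarrow> span_graph (vadd E1 p p') (vadd E2 q q')"
| scale: "span_graph p q \<Longrightarrow> span_graph (vscale E1 c p) (vscale E2 c q)"

lemma span_graph_closed: "span_graph p q \<Longrightarrow> p \<in> carrier E1 \<and> q \<in> carrier E2"
  by (induction rule: span_graph.induct) (use u_closed v_closed in \<open>auto simp: E1.ip_simps E2.ip_simps\<close>)

lemma span_graph_span: "span_graph p q \<Longrightarrow> p \<in> lin_span E1 (u ` I) \<and> q \<in> lin_span E2 (v ` I)"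
  by (induction rule: span_graph.induct) (auto intro: lin_span.intros)

lemma span_graph_left: "p \<in> lin_span E1 (u ` I) \<Longrightarrow> \<exists>q. span_graph p q"
  by (induction rule: lin_span.induct) (auto intro: span_graph.intros)

lemma span_graph_right: "q \<in> lin_span E2 (v ` I) \<Longrightarrow> \<exists>p. span_graph p q"
  by (induction rule: lin_span.induct) (auto intro: span_graph.intros)

lemma span_graph_ip:
  assumes "span_graph p q" "span_graph p' q'"
  shows "ip E1 p p' = ip E2 q q'"
  using assms
proof (induction arbitrary: p' q' rule: span_graph.induct)
  case (base i)
  from base(2,1) show ?case
  proof (induction rule: span_graph.induct)
    case (add p q p' q')
    then show ?case
      using span_graph_closed span_graph.base[OF add.prems] by (simp add: E1.ip_add_right E2.ip_add_right)
  next
    case (scale p q c)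
    then show ?case
      using span_graph_closed span_graph.base[OF scale.prems] by (simp add: E1.ip_scale_right E2.ip_scale_right)
  qed (auto simp: ip_eq)
next
  case (add p q p1 q1)
  then show ?case using span_graph_closed by (simp add: E1.ip_add E2.ip_add)
next
  case (scale p q c)
  then show ?case using span_graph_closed by (simp add: E1.ip_scale E2.ip_scale)
qed

lemma span_graph_dist:
  assumes "span_graph p q" "span_graph p' q'"
  shows "ip_dist E1 p p' = ip_dist E2 q q'"
proof -
  have cl: "p \<in> carrier E1" "p' \<in> carrier E1" "q \<in> carrier E2" "q' \<in> carrier E2"
    using assms span_graph_closed by auto
  have "(ip_dist E1 p p')\<^sup>2 = (ip_dist E2 q q')\<^sup>2"
    using cl span_graph_ip[OF assms(1,1)] span_graph_ip[OF assms] span_graph_ip[OF assms(2,2)]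
    by (simp add: E1.dist_sq E2.dist_sq)
  then show ?thesis
    by (rule power2_eq_imp_eq) (use cl in \<open>auto simp: E1.dist_nonneg E2.dist_nonneg\<close>)
qed

definition graph :: "'x \<Rightarrow> 'y \<Rightarrow> bool" where
  "graph p q \<longleftrightarrow> (\<exists>s t. (\<forall>n. span_graph (s n) (t n)) \<and> E1.converges s p \<and> E2.converges t q)"

lemma graph_closed: "graph p q \<Longrightarrow> p \<in> carrier E1 \<and> q \<in> carrier E2"
  by (auto simp: graph_def E1.converges_def E2.converges_def)

lemma span_graph_imp_graph: "span_graph p q \<Longrightarrow> graph p q"
  unfolding graph_def using span_graph_closed E1.converges_const E2.converges_const
  by (intro exI[of _ "\<lambda>n. p"] exI[of _ "\<lambda>n. q"]) auto

lemma graph_add: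
  assumes "graph p q" "graph p' q'"
  shows "graph (vadd E1 p p') (vadd E2 q q')"
proof -
  obtain s t where st: "\<forall>n. span_graph (s n) (t n)" "E1.converges s p" "E2.converges t q"
    using assms(1) unfolding graph_def by blast
  obtain s' t' where st': "\<forall>n. span_graph (s' n) (t' n)" "E1.converges s' p'" "E2.converges t' q'"
    using assms(2) unfolding graph_def by blast
  show ?thesis
    unfolding graph_def
    by (intro exI[of _ "\<lambda>n. vadd E1 (s n) (s' n)"] exI[of _ "\<lambda>n. vadd E2 (t n) (t' n)"] conjI allI
        span_graph.add E1.converges_add E2.converges_add) (use st st' in auto)
qed

lemma graph_scale:
  assumes "graph p q"
  shows "graph (vscale E1 c p) (vscale E2 c q)"
proof -
  obtain s t where st: "\<forall>n. span_graph (s n) (t n)" "E1.converges s p" "E2.converges t q"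
    using assms(1) unfolding graph_def by blast
  show ?thesis
    unfolding graph_def
    by (intro exI[of _ "\<lambda>n. vscale E1 c (s n)"] exI[of _ "\<lambda>n. vscale E2 c (t n)"] conjI allI
        span_graph.scale E1.converges_scale E2.converges_scale) (use st in auto)
qed

lemma graph_ip:
  assumes "graph p q" "graph p' q'"
  shows "ip E1 p p' = ip E2 q q'"
proof -
  obtain s t where st: "\<And>n. span_graph (s n) (t n)" "E1.converges s p" "E2.converges t q"
    using assms(1) unfolding graph_def by blast
  obtain s' t' where st': "\<And>n. span_graph (s' n) (t' n)" "E1.converges s' p'" "E2.converges t' q'"
    using assms(2) unfolding graph_def by blast
  have "(\<lambda>n. ip E2 (t n) (t' n)) \<longlonglongrightarrow> ip E1 p p'"
    using E1.converges_ip[OF st(2) st'(2)] span_graph_ip[OF st(1) st'(1)] by simp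
  then show ?thesis
    by (rule LIMSEQ_unique) (rule E2.converges_ip[OF st(3) st'(3)])
qed

lemma graph_dist:
  assumes "graph p q" "graph p' q'"
  shows "ip_dist E1 p p' = ip_dist E2 q q'"
proof -
  have cl: "p \<in> carrier E1" "p' \<in> carrier E1" "q \<in> carrier E2" "q' \<in> carrier E2"
    using assms graph_closed by auto
  have "(ip_dist E1 p p')\<^sup>2 = (ip_dist E2 q q')\<^sup>2"
    using cl graph_ip[OF assms(1,1)] graph_ip[OF assms] graph_ip[OF assms(2,2)]
    by (simp add: E1.dist_sq E2.dist_sq)
  then show ?thesis
    by (rule power2_eq_imp_eq) (use cl in \<open>auto simp: E1.dist_nonneg E2.dist_nonneg\<close>)
qed

text \<open>Related pairs have equal distances, so two values of the same \<open>p\<close> are at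
  distance zero.\<close>

lemma graph_functional: "graph p q \<Longrightarrow> graph p q' \<Longrightarrow> q = q'"
  using graph_dist[of p q p q'] graph_closed[of p q] graph_closed[of p q'] E1.dist_self E2.dist_definite
  by simp

lemma graph_injective: "graph p q \<Longrightarrow> graph p' q \<Longrightarrow> p = p'"
  using graph_dist[of p q p' q] graph_closed[of p q] graph_closed[of p' q] E2.dist_self E1.dist_definite
  by simp

lemma graph_left:
  assumes "p \<in> closed_span E1 (u ` I)"
  shows "\<exists>q. graph p q"
proof -
  obtain s where s: "\<And>n. s n \<in> lin_span E1 (u ` I)" "E1.converges s p"
    using assms E1.closed_span_iff[OF u_closed] by blast
  have "\<forall>n. \<exists>q. span_graph (s n) q" using span_graph_left[OF s(1)] by blast
  from choice[OF this] obtain t where t: "\<And>n. span_graph (s n) (t n)" by blast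
  have tcl: "t n \<in> carrier E2" for n using span_graph_closed[OF t] by blast
  have "\<exists>N. \<forall>m\<ge>N. \<forall>n\<ge>N. ip_dist E2 (t m) (t n) < e" if "e > 0" for e
    using E1.converges_Cauchy[OF s(2) that] span_graph_dist[OF t t] by simp
  from E2.complete[OF tcl this] obtain q where "q \<in> carrier E2" "(\<lambda>n. ip_dist E2 (t n) q) \<longlonglongrightarrow> 0"
    by blast
  then have "E2.converges t q" using tcl by (simp add: E2.converges_def)
  then show ?thesis unfolding graph_def using t s(2) by blast
qed

text \<open>Preimages of approximations from the dense span form a Cauchy sequence because distances
  are preserved, and completeness of \<open>E1\<close> supplies their limit.\<close>

lemma graph_right:
  assumes "q \<in> carrier E2"
  shows "\<exists>p. graph p q"
proof -
  obtain t where t: "\<And>n. t n \<in> lin_span E2 (v ` I)" "E2.converges t q"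
    using assms E2.closed_span_iff[OF v_closed] dense by blast
  have "\<forall>n. \<exists>p. span_graph p (t n)" using span_graph_right[OF t(1)] by blast
  from choice[OF this] obtain s where s: "\<And>n. span_graph (s n) (t n)" by blast
  have scl: "s n \<in> carrier E1" for n using span_graph_closed[OF s] by blast
  have "\<exists>N. \<forall>m\<ge>N. \<forall>n\<ge>N. ip_dist E1 (s m) (s n) < e" if "e > 0" for e
    using E2.converges_Cauchy[OF t(2) that] span_graph_dist[OF s s] by simp
  from E1.complete[OF scl this] obtain p where "p \<in> carrier E1" "(\<lambda>n. ip_dist E1 (s n) p) \<longlonglongrightarrow> 0"
    by blast
  then have "E1.converges s p" using scl by (simp add: E1.converges_def)
  then show ?thesis unfolding graph_def using s t(2) by blast
qed

lemma graph_in_closed_span: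
  assumes "graph p q"
  shows "p \<in> closed_span E1 (u ` I)"
proof -
  obtain s t where st: "\<And>n. span_graph (s n) (t n)" "E1.converges s p"
    using assms(1) unfolding graph_def by blast
  have "s n \<in> lin_span E1 (u ` I)" for n using span_graph_span[OF st(1)] by blast
  then show ?thesis using E1.closed_span_iff[OF u_closed] st(2) by blast
qed

definition W :: "'x \<Rightarrow> 'y" where "W p = (THE q. graph p q)"

lemma W_eq: "graph p q \<Longrightarrow> W p = q"
  unfolding W_def using graph_functional by blast

lemma W_graph: "p \<in> closed_span E1 (u ` I) \<Longrightarrow> graph p (W p)"
  using graph_left W_eq by metis

lemma W_base: "i \<in> I \<Longrightarrow> W (u i) = v i"
  by (intro W_eq span_graph_imp_graph span_graph.base)

lemma W_bij: "bij_betw W (closed_span E1 (u ` I)) (carrier E2)"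
  unfolding bij_betw_def
proof (intro conjI inj_onI equalityI subsetI)
  fix p p' assume "p \<in> closed_span E1 (u ` I)" "p' \<in> closed_span E1 (u ` I)" "W p = W p'"
  then show "p = p'" using W_graph graph_injective by metis
next
  fix q assume "q \<in> W ` closed_span E1 (u ` I)"
  then show "q \<in> carrier E2" using W_graph graph_closed by blast
next
  fix q assume "q \<in> carrier E2"
  then obtain p where p: "graph p q" using graph_right by blast
  show "q \<in> W ` closed_span E1 (u ` I)"
    using W_eq[OF p] graph_in_closed_span[OF p] by blast
qed

text \<open>\<open>E1'\<close> stands for \<open>E1\<close> with its carrier cut down to the closed
  span.\<close>

lemma W_unitary:
  assumes "carrier E1' = closed_span E1 (u ` I)" "vadd E1' = vadd E1" "vscale E1' = vscale E1" "ip E1' = ip E1"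
  shows "unitary_iso E1' E2 W"
  unfolding unitary_iso_def assms
  using W_bij W_eq[OF graph_add[OF W_graph W_graph]] W_eq[OF graph_scale[OF W_graph]]
    graph_ip[OF W_graph W_graph] by simp

end

section \<open>Square integrable functions\<close>

definition sq_int :: "'n measure \<Rightarrow> ('n \<Rightarrow> 'b::{complex_hilbert, second_countable_topology}) \<Rightarrow> bool" where
  "sq_int N f \<longleftrightarrow> f \<in> borel_measurable N \<and> integrable N (\<lambda>x. (norm (f x))\<^sup>2)"

lemma sq_int_measurable [measurable_dest]: "sq_int N f \<Longrightarrow> f \<in> borel_measurable N"
  by (simp add: sq_int_def)

lemma sq_int_integrable: "sq_int N f \<Longrightarrow> integrable N (\<lambda>x. (norm (f x))\<^sup>2)"
  by (simp add: sq_int_def)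

lemma sq_int_bound:
  assumes g: "sq_int N g" and f: "f \<in> borel_measurable N" and le: "AE x in N. norm (f x) \<le> K * norm (g x)"
  shows "sq_int N f"
  unfolding sq_int_def
proof
  show "integrable N (\<lambda>x. (norm (f x))\<^sup>2)"
  proof (rule Bochner_Integration.integrable_bound)
    show "integrable N (\<lambda>x. K\<^sup>2 * (norm (g x))\<^sup>2)"
      using sq_int_integrable[OF g] by simp
    show "AE x in N. norm ((norm (f x))\<^sup>2) \<le> norm (K\<^sup>2 * (norm (g x))\<^sup>2)"
      using le
    proof eventually_elim
      case (elim x)
      from power_mono[OF this, of 2] show ?case by (simp add: power_mult_distrib)
    qed
  qed (use f in measurable)
qed (rule f)

lemma sq_int_cong_AE:
  assumes "sq_int N g" "f \<in> borel_measurable N" "AE x in N. f x = g x"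
  shows "sq_int N f"
  by (rule sq_int_bound[OF assms(1,2), of 1]) (use assms(3) in eventually_elim, simp)

lemma norm_add_sq_le: "(norm (x + y))\<^sup>2 \<le> 2 * (norm x)\<^sup>2 + 2 * (norm (y::'a::real_normed_vector))\<^sup>2"
proof -
  have "(norm (x + y))\<^sup>2 \<le> (norm x + norm y)\<^sup>2"
    by (intro power_mono norm_triangle_ineq norm_ge_zero)
  also have "\<dots> \<le> 2 * (norm x)\<^sup>2 + 2 * (norm y)\<^sup>2"
    using zero_le_power2[of "norm x - norm y"] by (simp add: power2_eq_square algebra_simps)
  finally show ?thesis .
qed

lemma sq_int_add:
  assumes "sq_int N f" "sq_int N g"
  shows "sq_int N (\<lambda>x. f x + g x)"
  unfolding sq_int_def
proof
  note [measurable] = sq_int_measurable[OF assms(1)] sq_int_measurable[OF assms(2)]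
  show "(\<lambda>x. f x + g x) \<in> borel_measurable N" by measurable
  show "integrable N (\<lambda>x. (norm (f x + g x))\<^sup>2)"
  proof (rule Bochner_Integration.integrable_bound)
    show "integrable N (\<lambda>x. 2 * (norm (f x))\<^sup>2 + 2 * (norm (g x))\<^sup>2)"
      using assms by (auto simp: sq_int_def)
    show "AE x in N. norm ((norm (f x + g x))\<^sup>2) \<le> norm (2 * (norm (f x))\<^sup>2 + 2 * (norm (g x))\<^sup>2)"
      using norm_add_sq_le[of "f _" "g _"] by (intro always_eventually) auto
  qed measurable
qed

lemma sq_int_bounded_clinear:
  assumes f: "sq_int N f" and a: "bounded_clinear a"
  shows "sq_int N (\<lambda>x. a (f x))"
proof -
  obtain K where K: "\<And>x. norm (a x) \<le> K * norm x"
    using bounded_clinear_bound[OF a] by blast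
  have "(\<lambda>x. a (f x)) \<in> borel_measurable N"
    using linear_continuous_on[OF bounded_clinearD(6)[OF a]] sq_int_measurable[OF f]
    by (rule borel_measurable_continuous_on)
  then show ?thesis
    by (rule sq_int_bound[OF f]) (use K in auto)
qed

lemma sq_int_scaleC: "sq_int N f \<Longrightarrow> sq_int N (\<lambda>x. c *\<^sub>C f x)"
  using sq_int_bounded_clinear[OF _ bounded_clinear_scaleC[OF bounded_clinear_ident]] by blast

lemma sq_int_diff: "sq_int N f \<Longrightarrow> sq_int N g \<Longrightarrow> sq_int N (\<lambda>x. f x - g x)"
  using sq_int_add[OF _ sq_int_scaleC[of N g "-1"], of f] by simp

lemma norm_mult_le_sq: "norm x * norm y \<le> (norm x)\<^sup>2 + (norm y)\<^sup>2"
  using zero_le_power2[of "norm x - norm y"] zero_le_power2[of "norm x"] zero_le_power2[of "norm y"]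
  unfolding power2_diff by linarith

lemma sq_int_integrable_mult:
  fixes h :: "'n \<Rightarrow> 'c::{banach, second_countable_topology}"
  assumes f: "sq_int N f" and g: "sq_int N g" and h: "h \<in> borel_measurable N"
    and le: "\<And>x. norm (h x) \<le> K * (norm (f x) * norm (g x))" and K: "K \<ge> 0"
  shows "integrable N h"
proof (rule Bochner_Integration.integrable_bound)
  show "integrable N (\<lambda>x. K * ((norm (f x))\<^sup>2 + (norm (g x))\<^sup>2))"
    using assms by (auto simp: sq_int_def)
  have "norm (h x) \<le> K * ((norm (f x))\<^sup>2 + (norm (g x))\<^sup>2)" for x
    using le[of x] mult_left_mono[OF norm_mult_le_sq[of "f x" "g x"] K] by linarith
  then show "AE x in N. norm (h x) \<le> norm (K * ((norm (f x))\<^sup>2 + (norm (g x))\<^sup>2))"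
    using K by (intro always_eventually allI) (simp add: abs_of_nonneg)
qed (rule h)

lemma sq_int_cinner:
  assumes "sq_int N f" "sq_int N g"
  shows "integrable N (\<lambda>x. cinner (f x) (g x))"
  by (rule sq_int_integrable_mult[OF assms, of _ 1])
    (use sq_int_measurable[OF assms(1)] sq_int_measurable[OF assms(2)] norm_cinner_le in auto)

lemma integral_cinner_self:
  assumes "sq_int N f"
  shows "(\<integral>x. cinner (f x) (f x) \<partial>N) = complex_of_real (\<integral>x. (norm (f x))\<^sup>2 \<partial>N)"
  by (simp add: cinner_self del: of_real_power)

text \<open>Riesz--Fischer: \<open>\<Sum>\<^sub>i 2\<^sup>i |D\<^sub>i|\<^sup>2\<close> is integrable for the increments \<open>D\<^sub>i\<close> of a rapidly converging
  subsequence, and \<open>|D\<^sub>i| \<le> 2\<^sup>-\<^sup>i + 2\<^sup>i |D\<^sub>i|\<^sup>2\<close>.\<close>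

lemma sq_int_complete:
  fixes f :: "nat \<Rightarrow> 'n \<Rightarrow> 'b::{complex_hilbert, second_countable_topology}"
  assumes f: "\<And>n. sq_int N (f n)"
    and cauchy: "\<And>e. e > 0 \<Longrightarrow> \<exists>K. \<forall>m\<ge>K. \<forall>n\<ge>K. (\<integral>x. (norm (f m x - f n x))\<^sup>2 \<partial>N) < e"
  shows "\<exists>g. sq_int N g \<and> (\<lambda>n. \<integral>x. (norm (f n x - g x))\<^sup>2 \<partial>N) \<longlonglongrightarrow> 0"
proof -
  note [measurable] = sq_int_measurable[OF f]
  let ?I = "\<lambda>m n. \<integral>x. (norm (f m x - f n x))\<^sup>2 \<partial>N"
  have int: "integrable N (\<lambda>x. (norm (f m x - f n x))\<^sup>2)" for m n
    using sq_int_diff[OF f f] by (rule sq_int_integrable)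
  have nn: "(\<integral>\<^sup>+x. ennreal ((norm (f m x - f n x))\<^sup>2) \<partial>N) = ennreal (?I m n)" for m n
    using int by (intro nn_integral_eq_integral) auto
  \<comment> \<open>The base \<open>1/4\<close> beats the weight \<open>2^i\<close> of the
    increments and leaves a geometric series of ratio \<open>1/2\<close>.\<close>
  have "\<forall>i. \<exists>K. \<forall>m\<ge>K. \<forall>n\<ge>K. ?I m n < (1/4)^i"
    using cauchy by simp
  from choice[OF this] obtain k where k: "\<And>i m n. m \<ge> k i \<Longrightarrow> n \<ge> k i \<Longrightarrow> ?I m n < (1/4)^i"
    by blast
  \<comment> \<open>The summand \<open>i\<close> makes the indices tend to infinity, and the sum
    makes both \<open>K i\<close> and \<open>K (Suc i)\<close> at least \<open>k i\<close>, so that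
    consecutive terms of the subsequence are close.\<close>
  define K where "K i = i + (\<Sum>j\<le>i. k j)" for i
  have Kk: "K i \<ge> k i" "K (Suc i) \<ge> k i" "K i \<ge> i" for i
  proof -
    show "K i \<ge> k i" using member_le_sum[of i "{..i}" k] by (simp add: K_def)
    then show "K (Suc i) \<ge> k i" by (simp add: K_def)
  qed (simp add: K_def)
  define D where "D i x = norm (f (K (Suc i)) x - f (K i) x)" for i x
  have [measurable]: "D i \<in> borel_measurable N" for i unfolding D_def by measurable
  have "(\<integral>\<^sup>+x. (\<Sum>i. ennreal (2^i * (D i x)\<^sup>2)) \<partial>N) = (\<Sum>i. \<integral>\<^sup>+x. ennreal (2^i * (D i x)\<^sup>2) \<partial>N)"
    by (intro nn_integral_suminf) measurable
  also have "\<dots> \<le> (\<Sum>i. ennreal ((1/2)^i))"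
  proof (intro suminf_le)
    fix i
    have "(\<integral>\<^sup>+x. ennreal (2^i * (D i x)\<^sup>2) \<partial>N) = ennreal (2^i) * ennreal (?I (K (Suc i)) (K i))"
      unfolding nn[symmetric] D_def by (subst nn_integral_cmult[symmetric]) (auto simp: ennreal_mult)
    also have "\<dots> \<le> ennreal (2^i * (1/4)^i)"
      using k[OF Kk(2) Kk(1), of i] by (subst ennreal_mult[symmetric]) (auto intro!: ennreal_leI)
    also have "2^i * (1/4)^i = (1/2 :: real)^i" by (simp add: power_mult_distrib[symmetric])
    finally show "(\<integral>\<^sup>+x. ennreal (2^i * (D i x)\<^sup>2) \<partial>N) \<le> ennreal ((1/2)^i)" .
  qed auto
  also have "\<dots> < \<infinity>" by (simp add: ennreal_suminf_neq_top less_top)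
  finally have "AE x in N. (\<Sum>i. ennreal (2^i * (D i x)\<^sup>2)) \<noteq> \<infinity>"
    by (intro nn_integral_PInf_AE) auto
  then have conv: "AE x in N. convergent (\<lambda>i. f (K i) x)"
  proof eventually_elim
    case (elim x)
    have "summable (\<lambda>i. 2^i * (D i x)\<^sup>2)"
      by (rule summable_suminf_not_top) (use elim in auto)
    then have "summable (\<lambda>i. (1/2)^i + 2^i * (D i x)\<^sup>2)"
      by (intro summable_add summable_geometric) auto
    then have "summable (\<lambda>i. f (K (Suc i)) x - f (K i) x)"
    proof (rule summable_comparison_test'[where N = 0])
      fix i :: nat
      show "norm (f (K (Suc i)) x - f (K i) x) \<le> (1/2)^i + 2^i * (D i x)\<^sup>2"
      proof (cases "D i x \<le> (1/2)^i")
        case True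
        then show ?thesis by (simp add: D_def add_increasing2)
      next
        case False
        then have "1 \<le> 2^i * D i x" by (simp add: power_divide field_simps)
        then have "D i x * 1 \<le> D i x * (2^i * D i x)"
          by (intro mult_left_mono) (auto simp: D_def)
        then have "D i x \<le> 2^i * (D i x)\<^sup>2" by (simp add: power2_eq_square mult_ac)
        then show ?thesis by (intro add_increasing) (auto simp: D_def)
      qed
    qed
    then have "convergent (\<lambda>n. \<Sum>i<n. f (K (Suc i)) x - f (K i) x)"
      unfolding summable_iff_convergent .
    then have "convergent (\<lambda>n. f (K n) x - f (K 0) x)"
      unfolding sum_lessThan_telescope[of "\<lambda>n. f (K n) x"] .
    then show ?case
      using convergent_diff_const_right_iff by blast
  qed
  define g where "g x = lim (\<lambda>i. f (K i) x)" for x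
  have [measurable]: "g \<in> borel_measurable N" unfolding g_def by measurable
  have lim: "AE x in N. (\<lambda>i. f (K i) x) \<longlonglongrightarrow> g x"
    using conv by eventually_elim (simp add: g_def convergent_LIMSEQ_iff)
  \<comment> \<open>Fatou's lemma along the subsequence carries the Cauchy estimate over to the
    limit, for every late term of the original sequence.\<close>
  have bound: "(\<integral>\<^sup>+x. ennreal ((norm (f n x - g x))\<^sup>2) \<partial>N) \<le> ennreal e"
    if e: "\<forall>m\<ge>L. \<forall>n\<ge>L. ?I m n < e" and n: "n \<ge> L" for n L e
  proof -
    have "(\<integral>\<^sup>+x. ennreal ((norm (f n x - g x))\<^sup>2) \<partial>N) =
        (\<integral>\<^sup>+x. liminf (\<lambda>i. ennreal ((norm (f n x - f (K i) x))\<^sup>2)) \<partial>N)"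
    proof (rule nn_integral_cong_AE, use lim in eventually_elim)
      case (elim x)
      have "(\<lambda>i. ennreal ((norm (f n x - f (K i) x))\<^sup>2)) \<longlonglongrightarrow> ennreal ((norm (f n x - g x))\<^sup>2)"
        by (intro tendsto_ennrealI tendsto_intros elim)
      then show ?case by (rule lim_imp_Liminf[OF sequentially_bot, symmetric])
    qed
    also have "\<dots> \<le> liminf (\<lambda>i. \<integral>\<^sup>+x. ennreal ((norm (f n x - f (K i) x))\<^sup>2) \<partial>N)"
      by (rule nn_integral_liminf) measurable
    also have "\<dots> \<le> ennreal e"
      unfolding nn
    proof (rule Liminf_le)
      show "\<forall>\<^sub>F i in sequentially. ennreal (?I n (K i)) \<le> ennreal e"
        using eventually_ge_at_top[of L]
      proof eventually_elim
        case (elim i)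
        then have "K i \<ge> L" using Kk(3)[of i] by simp
        then show ?case using e n by (intro ennreal_leI less_imp_le) auto
      qed
    qed simp
    finally show ?thesis .
  qed
  have intg: "integrable N (\<lambda>x. (norm (f n x - g x))\<^sup>2)" if "n \<ge> K'" "\<forall>m\<ge>K'. \<forall>n\<ge>K'. ?I m n < 1" for n K'
    using bound[OF that(2,1)] by (intro integrableI_nonneg) (auto simp: top.extremum_strict intro: le_less_trans)
  obtain L1 where L1: "\<forall>m\<ge>L1. \<forall>n\<ge>L1. ?I m n < 1" using cauchy[of 1] by auto
  \<comment> \<open>\<open>g\<close> itself is then \<open>f L1\<close> minus this difference, hence
    square integrable.\<close>
  have "sq_int N (\<lambda>x. f L1 x - g x)"
    using intg[OF order_refl L1] by (simp add: sq_int_def)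
  from sq_int_diff[OF f[of L1] this] have g: "sq_int N g" by simp
  have ig: "integrable N (\<lambda>x. (norm (f n x - g x))\<^sup>2)" for n
    using sq_int_diff[OF f g] by (rule sq_int_integrable)
  have "(\<lambda>n. \<integral>x. (norm (f n x - g x))\<^sup>2 \<partial>N) \<longlonglongrightarrow> 0"
  proof (rule LIMSEQ_I)
    fix e :: real assume e: "e > 0"
    obtain L where L: "\<forall>m\<ge>L. \<forall>n\<ge>L. ?I m n < e/2" using cauchy[of "e/2"] e by auto
    have "norm ((\<integral>x. (norm (f n x - g x))\<^sup>2 \<partial>N) - 0) < e" if n: "n \<ge> L" for n
    proof -
      have "ennreal (\<integral>x. (norm (f n x - g x))\<^sup>2 \<partial>N) \<le> ennreal (e/2)"
        using bound[OF L n] ig[of n] by (simp add: nn_integral_eq_integral)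
      then have "(\<integral>x. (norm (f n x - g x))\<^sup>2 \<partial>N) \<le> e/2"
        using e by (subst (asm) ennreal_le_iff) auto
      moreover have "0 \<le> (\<integral>x. (norm (f n x - g x))\<^sup>2 \<partial>N)" by (intro Bochner_Integration.integral_nonneg) auto
      ultimately show ?thesis using e by simp
    qed
    then show "\<exists>L. \<forall>n\<ge>L. norm ((\<integral>x. (norm (f n x - g x))\<^sup>2 \<partial>N) - 0) < e" by blast
  qed
  with g show ?thesis by blast
qed

subsection \<open>Gramians\<close>

text \<open>Sums over the basis become integrals over a counting measure, which makes the theorems
  of Tonelli and Fubini available for traces and Hilbert--Schmidt norms.\<close>

lemma nn_integral_count_space_has_sum:
  assumes g: "(g has_sum s) B" and nonneg: "\<And>e. e \<in> B \<Longrightarrow> (0::real) \<le> g e"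
  shows "(\<integral>\<^sup>+e. ennreal (g e) \<partial>count_space B) = ennreal s"
proof -
  have "g summable_on B" using g by (auto simp: summable_on_def)
  then have "(\<lambda>e. norm (g e)) summable_on B"
    using summable_on_iff_abs_summable_on_real by blast
  then have abs: "Infinite_Set_Sum.abs_summable_on g B"
    using abs_summable_equivalent by blast
  then have "integrable (count_space B) g" by (simp add: Infinite_Set_Sum.abs_summable_on_def)
  moreover have "integral\<^sup>L (count_space B) g = s"
    using infsetsum_infsum[OF abs] infsumI[OF g] by (simp add: infsetsum_def)
  ultimately show ?thesis
    using nonneg by (subst nn_integral_eq_integral) (auto simp: AE_count_space)
qed

lemma integral_count_space_has_sum:
  fixes g :: "'a \<Rightarrow> 'b::{banach, second_countable_topology}"
  assumes g: "integrable (count_space B) g"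
  shows "(g has_sum (\<integral>e. g e \<partial>count_space B)) B"
proof -
  have abs: "Infinite_Set_Sum.abs_summable_on g B" using g by (simp add: Infinite_Set_Sum.abs_summable_on_def)
  then have "(\<lambda>e. norm (g e)) summable_on B" using abs_summable_equivalent by blast
  then have "g summable_on B" by (rule abs_summable_summable)
  then show ?thesis
    using infsetsum_infsum[OF abs] by (simp add: infsetsum_def)
qed

text \<open>The measure is arbitrary, since the same gramian serves random variables on the
  probability space and column functions on the product of the basis with the frequencies. The
  Bochner integral has the required sesquilinear form, and the form determines the operator.\<close>

lemma rv_gramian_eq:
  fixes X Y :: "'n \<Rightarrow> 'h::{complex_hilbert, second_countable_topology}"
  assumes X: "sq_int N X" and Y: "sq_int N Y"
  shows "rv_gramian N X Y = (\<lambda>h. \<integral>x. cinner h (Y x) *\<^sub>C X x \<partial>N)"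
    and "cinner (rv_gramian N X Y h) k = (\<integral>x. cinner h (Y x) * cinner (X x) k \<partial>N)"
proof -
  note [measurable] = sq_int_measurable[OF X] sq_int_measurable[OF Y]
  let ?T = "\<lambda>h. \<integral>x. cinner h (Y x) *\<^sub>C X x \<partial>N"
  have int: "integrable N (\<lambda>x. cinner h (Y x) *\<^sub>C X x)" for h
  proof (rule sq_int_integrable_mult[OF X Y, of _ "norm h"])
    show "norm (cinner h (Y x) *\<^sub>C X x) \<le> norm h * (norm (X x) * norm (Y x))" for x
      using mult_right_mono[OF norm_cinner_le[of h "Y x"] norm_ge_zero[of "X x"]]
      by (simp add: norm_scaleC mult_ac)
  qed measurable
  have T: "cinner (?T h) k = (\<integral>x. cinner h (Y x) * cinner (X x) k \<partial>N)" for h k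
    using integral_bounded_linear[OF bounded_linear_cinner_left int, of h k]
    by (simp add: cinner_scaleC_left)
  show eq: "rv_gramian N X Y = ?T"
    unfolding rv_gramian_def
  proof (rule the_equality)
    fix S assume S: "\<forall>h k. cinner (S h) k = (\<integral>x. cinner h (Y x) * cinner (X x) k \<partial>N)"
    show "S = ?T"
    proof
      show "S h = ?T h" for h
        by (rule cinner_extensionality) (simp add: S T)
    qed
  qed (use T in blast)
  show "cinner (rv_gramian N X Y h) k = (\<integral>x. cinner h (Y x) * cinner (X x) k \<partial>N)"
    unfolding eq by (rule T)
qed

text \<open>By Parseval the inner sum over the basis is \<open>(norm (X x))\<^sup>2\<close>, so
  Tonelli reduces the claim to the square integrability of \<open>X\<close>.\<close>

lemma integrable_coefficients:
  fixes X :: "'n \<Rightarrow> 'h::{complex_hilbert, second_countable_topology}"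
  assumes X: "sq_int N X" and N: "sigma_finite_measure N"
  shows "integrable (count_space (hbasis :: 'h set) \<Otimes>\<^sub>M N) (\<lambda>(e, x). (cmod (cinner (X x) e))\<^sup>2)"
proof -
  note [measurable] = sq_int_measurable[OF X]
  interpret N: sigma_finite_measure N by fact
  interpret B: sigma_finite_measure "count_space (hbasis :: 'h set)"
    by (rule sigma_finite_measure_count_space_countable[OF countable_hbasis])
  interpret pair_sigma_finite "count_space (hbasis :: 'h set)" N ..
  have meas: "(\<lambda>(e, x). (cmod (cinner (X x) e))\<^sup>2) \<in> borel_measurable (count_space (hbasis :: 'h set) \<Otimes>\<^sub>M N)"
    by (rule measurable_pair_measure_countable1[OF countable_hbasis]) simp
  have "(\<integral>\<^sup>+z. ennreal (case z of (e, x) \<Rightarrow> (cmod (cinner (X x) e))\<^sup>2) \<partial>(count_space (hbasis :: 'h set) \<Otimes>\<^sub>M N)) =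
      (\<integral>\<^sup>+x. \<integral>\<^sup>+e. ennreal ((cmod (cinner (X x) e))\<^sup>2) \<partial>count_space hbasis \<partial>N)"
    using nn_integral_snd[of "\<lambda>z. ennreal (case z of (e, x) \<Rightarrow> (cmod (cinner (X x) e))\<^sup>2)"] meas by simp
  also have "\<dots> = (\<integral>\<^sup>+x. ennreal ((norm (X x))\<^sup>2) \<partial>N)"
    by (intro nn_integral_cong nn_integral_count_space_has_sum norm_hbasis_has_sum) auto
  also have "\<dots> < \<infinity>"
    using sq_int_integrable[OF X] by (simp add: nn_integral_eq_integral)
  finally show ?thesis
    using meas by (intro integrableI_nonneg) (auto simp: split_beta')
qed

lemma rv_gramian_integrable:
  fixes X Y :: "'n \<Rightarrow> 'h::{complex_hilbert, second_countable_topology}"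
  assumes X: "sq_int N X" and Y: "sq_int N Y"
  shows "integrable N (\<lambda>x. cinner h (Y x) * cinner (X x) k)"
proof (rule sq_int_integrable_mult[OF Y X, of _ "norm h * norm k"])
  show "norm (cinner h (Y x) * cinner (X x) k) \<le> norm h * norm k * (norm (Y x) * norm (X x))" for x
    using mult_mono[OF norm_cinner_le[of h "Y x"] norm_cinner_le[of "X x" k]]
    by (simp add: norm_mult mult_ac)
qed (use sq_int_measurable[OF X] sq_int_measurable[OF Y] in auto)

lemma bounded_clinear_rv_gramian:
  fixes X Y :: "'n \<Rightarrow> 'h::{complex_hilbert, second_countable_topology}"
  assumes X: "sq_int N X" and Y: "sq_int N Y"
  shows "bounded_clinear (rv_gramian N X Y)"
proof (rule bounded_clinearI)
  note int = rv_gramian_integrable[OF X Y]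
  show "rv_gramian N X Y (h + h') = rv_gramian N X Y h + rv_gramian N X Y h'" for h h'
    by (rule cinner_extensionality)
      (simp add: cinner_add_left rv_gramian_eq(2)[OF X Y] distrib_right Bochner_Integration.integral_add[OF int int])
  show "rv_gramian N X Y (c *\<^sub>C h) = c *\<^sub>C rv_gramian N X Y h" for c h
    by (rule cinner_extensionality)
      (simp add: cinner_scaleC_left rv_gramian_eq(2)[OF X Y] mult.assoc)
  have XY: "integrable N (\<lambda>x. norm (X x) * norm (Y x))"
    by (rule sq_int_integrable_mult[OF X Y, of _ 1])
      (use sq_int_measurable[OF X] sq_int_measurable[OF Y] in auto)
  show "norm (rv_gramian N X Y h) \<le> norm h * (\<integral>x. norm (X x) * norm (Y x) \<partial>N)" for h
  proof -
    have le: "norm (cinner h (Y x) *\<^sub>C X x) \<le> norm h * (norm (X x) * norm (Y x))" for x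
      using mult_right_mono[OF norm_cinner_le[of h "Y x"], of "norm (X x)"]
      by (simp add: norm_scaleC mult_ac)
    have "norm (rv_gramian N X Y h) \<le> (\<integral>x. norm h * (norm (X x) * norm (Y x)) \<partial>N)"
      unfolding rv_gramian_eq(1)[OF X Y]
      by (rule order_trans[OF integral_norm_bound integral_mono']) (use XY le in auto)
    then show ?thesis by simp
  qed
qed

lemma rv_gramian_cong_AE:
  fixes X Y :: "'n \<Rightarrow> 'h::{complex_hilbert, second_countable_topology}"
  assumes X: "sq_int N X" "sq_int N X'" "AE x in N. X x = X' x"
    and Y: "sq_int N Y" "sq_int N Y'" "AE x in N. Y x = Y' x"
  shows "rv_gramian N X Y = rv_gramian N X' Y'"
proof
  fix h
  show "rv_gramian N X Y h = rv_gramian N X' Y' h"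
  proof (rule cinner_extensionality)
    fix k
    note [measurable] = sq_int_measurable[OF X(1)] sq_int_measurable[OF X(2)] sq_int_measurable[OF Y(1)]
      sq_int_measurable[OF Y(2)]
    have "(\<integral>x. cinner h (Y x) * cinner (X x) k \<partial>N) = (\<integral>x. cinner h (Y' x) * cinner (X' x) k \<partial>N)"
    proof (rule integral_cong_AE)
      show "AE x in N. cinner h (Y x) * cinner (X x) k = cinner h (Y' x) * cinner (X' x) k"
        using X(3) Y(3) by eventually_elim simp
    qed measurable
    then show "cinner (rv_gramian N X Y h) k = cinner (rv_gramian N X' Y' h) k"
      by (simp only: rv_gramian_eq(2)[OF X(1) Y(1)] rv_gramian_eq(2)[OF X(2) Y(2)])
  qed
qed

text \<open>The diagonal entries of the gramian are integrals. Exchanging their sum with the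
  integral leaves the Parseval expansion of \<open>cinner (X x) (Y x)\<close> inside; the squares of
  the coefficients of \<open>X\<close> and \<open>Y\<close> dominate.\<close>

lemma trace_rv_gramian:
  fixes X Y :: "'n \<Rightarrow> 'h::{complex_hilbert, second_countable_topology}"
  assumes X: "sq_int N X" and Y: "sq_int N Y" and N: "sigma_finite_measure N"
  shows "trace_op (rv_gramian N X Y) = (\<integral>x. cinner (X x) (Y x) \<partial>N)"
proof -
  note [measurable] = sq_int_measurable[OF X] sq_int_measurable[OF Y]
  let ?B = "count_space (hbasis :: 'h set)"
  interpret N: sigma_finite_measure N by fact
  interpret B: sigma_finite_measure ?B
    by (rule sigma_finite_measure_count_space_countable[OF countable_hbasis])
  interpret pair_sigma_finite ?B N ..
  have cm: "cmod (cinner h k) = cmod (cinner k (h::'h))" for h k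
    by (metis cinner_commute complex_mod_cnj)
  have int: "integrable (?B \<Otimes>\<^sub>M N) (\<lambda>(e, x). cinner e (Y x) * cinner (X x) e)"
  proof (rule Bochner_Integration.integrable_bound)
    show "integrable (?B \<Otimes>\<^sub>M N) (\<lambda>z. (case z of (e, x) \<Rightarrow> (cmod (cinner (X x) e))\<^sup>2) + (case z of (e, x) \<Rightarrow> (cmod (cinner (Y x) e))\<^sup>2))"
      by (intro Bochner_Integration.integrable_add integrable_coefficients X Y N)
    show "(\<lambda>(e, x). cinner e (Y x) * cinner (X x) e) \<in> borel_measurable (?B \<Otimes>\<^sub>M N)"
      by (rule measurable_pair_measure_countable1[OF countable_hbasis]) simp
    show "AE z in ?B \<Otimes>\<^sub>M N. norm (case z of (e, x) \<Rightarrow> cinner e (Y x) * cinner (X x) e)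
        \<le> norm ((case z of (e, x) \<Rightarrow> (cmod (cinner (X x) e))\<^sup>2) + (case z of (e, x) \<Rightarrow> (cmod (cinner (Y x) e))\<^sup>2))"
    proof (intro always_eventually allI)
      fix z :: "'h \<times> 'n"
      show "norm (case z of (e, x) \<Rightarrow> cinner e (Y x) * cinner (X x) e)
        \<le> norm ((case z of (e, x) \<Rightarrow> (cmod (cinner (X x) e))\<^sup>2) + (case z of (e, x) \<Rightarrow> (cmod (cinner (Y x) e))\<^sup>2))"
        using norm_mult_le_sq[of "cinner (fst z) (Y (snd z))" "cinner (X (snd z)) (fst z)"]
        by (simp add: split_beta norm_mult cm[of "fst z" "Y _"] add.commute)
    qed
  qed
  have "trace_op (rv_gramian N X Y) = (\<Sum>\<^sub>\<infinity>e\<in>hbasis. \<integral>x. cinner e (Y x) * cinner (X x) e \<partial>N)"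
    unfolding trace_op_def rv_gramian_eq(2)[OF X Y] ..
  also have "\<dots> = (\<integral>e. (\<integral>x. cinner e (Y x) * cinner (X x) e \<partial>N) \<partial>?B)"
    by (intro infsumI integral_count_space_has_sum integrable_fst[OF int])
  also have "\<dots> = (\<integral>x. (\<integral>e. cinner e (Y x) * cinner (X x) e \<partial>?B) \<partial>N)"
    using Fubini_integral[OF int] by simp
  also have "\<dots> = (\<integral>x. cinner (X x) (Y x) \<partial>N)"
  proof (intro integral_cong_AE)
    have "AE x in N. integrable ?B (\<lambda>e. cinner e (Y x) * cinner (X x) e)"
      using AE_integrable_snd[OF int] .
    then show "AE x in N. (\<integral>e. cinner e (Y x) * cinner (X x) e \<partial>?B) = cinner (X x) (Y x)"
    proof eventually_elim
      case (elim x)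
      have "((\<lambda>e. cinner e (Y x) * cinner (X x) e) has_sum cinner (X x) (Y x)) hbasis"
        using cinner_hbasis_has_sum[of "X x" "Y x"] by (simp add: mult.commute)
      then show ?case
        using integral_count_space_has_sum[OF elim] has_sum_unique by blast
    qed
    show "(\<lambda>x. \<integral>e. cinner e (Y x) * cinner (X x) e \<partial>?B) \<in> borel_measurable N"
      using integrable_snd[OF int] by (rule borel_measurable_integrable)
  qed measurable
  finally show ?thesis .
qed

subsection \<open>Spaces of square integrable functions as abstract Hilbert spaces\<close>

text \<open>\<open>J p\<close> is a function representing \<open>p\<close>; the representatives form a closed subspace of the square
  integrable functions.\<close>

locale l2_model =
  fixes E :: "('x, 'm) ip_space_scheme" and N :: "'n measure"
    and J :: "'x \<Rightarrow> 'n \<Rightarrow> 'b::{complex_hilbert, second_countable_topology}"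
  assumes J_sq_int: "p \<in> carrier E \<Longrightarrow> sq_int N (J p)"
    and J_inject: "p \<in> carrier E \<Longrightarrow> q \<in> carrier E \<Longrightarrow> AE x in N. J p x = J q x \<Longrightarrow> p = q"
    and J_add: "p \<in> carrier E \<Longrightarrow> q \<in> carrier E \<Longrightarrow>
      vadd E p q \<in> carrier E \<and> (AE x in N. J (vadd E p q) x = J p x + J q x)"
    and J_scale: "p \<in> carrier E \<Longrightarrow> vscale E c p \<in> carrier E \<and> (AE x in N. J (vscale E c p) x = c *\<^sub>C J p x)"
    and J_ip: "p \<in> carrier E \<Longrightarrow> q \<in> carrier E \<Longrightarrow> ip E p q = (\<integral>x. cinner (J p x) (J q x) \<partial>N)"
    and J_limit: "(\<And>n::nat. s n \<in> carrier E) \<Longrightarrow> sq_int N g \<Longrightarrow>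
      (\<lambda>n. \<integral>x. (norm (J (s n) x - g x))\<^sup>2 \<partial>N) \<longlonglongrightarrow> 0 \<Longrightarrow> \<exists>p\<in>carrier E. AE x in N. J p x = g x"
begin

lemma J_measurable [measurable]: "p \<in> carrier E \<Longrightarrow> J p \<in> borel_measurable N"
  by (rule sq_int_measurable[OF J_sq_int])

lemma ip_cong:
  assumes p: "p \<in> carrier E" and q: "q \<in> carrier E" and f: "AE x in N. J p x = f x" "f \<in> borel_measurable N"
    and g: "AE x in N. J q x = g x" "g \<in> borel_measurable N"
  shows "ip E p q = (\<integral>x. cinner (f x) (g x) \<partial>N)"
  unfolding J_ip[OF p q]
proof (rule integral_cong_AE)
  show "AE x in N. cinner (J p x) (J q x) = cinner (f x) (g x)"
    using f(1) g(1) by eventually_elim simp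
qed (use p q f g in measurable)

lemma dist_J:
  assumes p: "p \<in> carrier E" and q: "q \<in> carrier E"
  shows "ip_dist E p q = sqrt (\<integral>x. (norm (J p x - J q x))\<^sup>2 \<partial>N)"
proof -
  let ?r = "vadd E p (vscale E (-1) q)"
  have r: "?r \<in> carrier E" using J_add[OF p] J_scale[OF q] by blast
  have "AE x in N. J ?r x = J p x + J (vscale E (-1) q) x" "AE x in N. J (vscale E (-1) q) x = (-1) *\<^sub>C J q x"
    using J_add[OF p] J_scale[OF q] by blast+
  then have rJ: "AE x in N. J ?r x = J p x - J q x"
    by eventually_elim simp
  have "ip E ?r ?r = (\<integral>x. cinner (J p x - J q x) (J p x - J q x) \<partial>N)"
    by (rule ip_cong[OF r r rJ _ rJ]) (use p q in measurable)
  also have "\<dots> = complex_of_real (\<integral>x. (norm (J p x - J q x))\<^sup>2 \<partial>N)"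
    by (intro integral_cinner_self sq_int_diff J_sq_int p q)
  finally show ?thesis by (simp add: ip_dist_def)
qed

text \<open>Completeness combines \<open>sq_int_complete\<close>, which supplies a limit function,
  with \<open>J_limit\<close>, by which this function represents a member of the space.\<close>

sublocale hilb E
proof
  fix p q assume p: "p \<in> carrier E" and q: "q \<in> carrier E"
  note [measurable] = J_measurable[OF p] J_measurable[OF q]
  show add: "vadd E p q \<in> carrier E" using J_add[OF p q] by blast
  show sc: "vscale E c p \<in> carrier E" for c using J_scale[OF p] by blast
  show "ip E p q = cnj (ip E q p)"
    unfolding J_ip[OF p q] J_ip[OF q p]
    unfolding Bochner_Integration.integral_cnj[symmetric] by (intro Bochner_Integration.integral_cong refl cinner_commute)
  show "ip E (vscale E c p) q = c * ip E p q" for c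
  proof -
    have "ip E (vscale E c p) q = (\<integral>x. cinner (c *\<^sub>C J p x) (J q x) \<partial>N)"
      using J_scale[OF p, of c] by (intro ip_cong sc q) auto
    then show ?thesis by (simp add: cinner_scaleC_left J_ip[OF p q])
  qed
  show "ip E (vadd E p q) r = ip E p r + ip E q r" if r: "r \<in> carrier E" for r
  proof -
    note [measurable] = J_measurable[OF r]
    have "ip E (vadd E p q) r = (\<integral>x. cinner (J p x + J q x) (J r x) \<partial>N)"
      using J_add[OF p q] by (intro ip_cong add r) auto
    then show ?thesis
      using sq_int_cinner[OF J_sq_int[OF p] J_sq_int[OF r]] sq_int_cinner[OF J_sq_int[OF q] J_sq_int[OF r]]
      by (simp add: cinner_add_left J_ip p q r)
  qed
  show "0 \<le> Re (ip E p p)"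
    unfolding J_ip[OF p p] integral_cinner_self[OF J_sq_int[OF p]] by simp
  show "p = q" if "ip_dist E p q = 0"
  proof (rule J_inject[OF p q])
    have "(\<integral>x. (norm (J p x - J q x))\<^sup>2 \<partial>N) = 0"
      using that by (simp add: dist_J p q)
    then have "AE x in N. (norm (J p x - J q x))\<^sup>2 = 0"
      using sq_int_integrable[OF sq_int_diff[OF J_sq_int[OF p] J_sq_int[OF q]]]
      by (subst (asm) integral_nonneg_eq_0_iff_AE) auto
    then show "AE x in N. J p x = J q x" by eventually_elim simp
  qed
next
  fix s :: "nat \<Rightarrow> 'x"
  assume s: "\<And>n. s n \<in> carrier E"
    and cauchy: "\<And>e. e > 0 \<Longrightarrow> \<exists>K. \<forall>m\<ge>K. \<forall>n\<ge>K. ip_dist E (s m) (s n) < e"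
  have "\<exists>K. \<forall>m\<ge>K. \<forall>n\<ge>K. (\<integral>x. (norm (J (s m) x - J (s n) x))\<^sup>2 \<partial>N) < e" if "e > 0" for e
    using cauchy[of "sqrt e"] that by (simp add: dist_J s)
  from sq_int_complete[OF J_sq_int[OF s] this]
  obtain g where g: "sq_int N g" "(\<lambda>n. \<integral>x. (norm (J (s n) x - g x))\<^sup>2 \<partial>N) \<longlonglongrightarrow> 0"
    by blast
  from J_limit[OF s this] obtain p where p: "p \<in> carrier E" "AE x in N. J p x = g x" by blast
  note [measurable] = J_measurable[OF s] J_measurable[OF p(1)] sq_int_measurable[OF g(1)]
  have "(\<integral>x. (norm (J (s n) x - J p x))\<^sup>2 \<partial>N) = (\<integral>x. (norm (J (s n) x - g x))\<^sup>2 \<partial>N)" for n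
    by (rule integral_cong_AE) (use p(2) in \<open>auto elim: eventually_mono\<close>)
  then have "(\<lambda>n. ip_dist E (s n) p) \<longlonglongrightarrow> sqrt 0"
    unfolding dist_J[OF s p(1)] using g(2) by (intro tendsto_intros) simp
  then show "\<exists>p\<in>carrier E. (\<lambda>n. ip_dist E (s n) p) \<longlonglongrightarrow> 0"
    using p by auto
qed

lemma J_add_AE: "p \<in> carrier E \<Longrightarrow> q \<in> carrier E \<Longrightarrow> AE x in N. J (vadd E p q) x = J p x + J q x"
  using J_add by blast

lemma J_scale_AE: "p \<in> carrier E \<Longrightarrow> AE x in N. J (vscale E c p) x = c *\<^sub>C J p x"
  using J_scale by blast

end

section \<open>Modules of square integrable functions\<close>

locale l2_module = l2_model E N J
  for E :: "('x, 'h::{complex_hilbert, second_countable_topology}) hilbert_module"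
    and N :: "'n measure" and J :: "'x \<Rightarrow> 'n \<Rightarrow> 'h" +
  assumes J_act: "bounded_clinear a \<Longrightarrow> p \<in> carrier E \<Longrightarrow>
      act E a p \<in> carrier E \<and> (AE x in N. J (act E a p) x = a (J p x))"
    and J_gram: "p \<in> carrier E \<Longrightarrow> q \<in> carrier E \<Longrightarrow> gram E p q = rv_gramian N (J p) (J q)"
begin

lemma act_closed: "bounded_clinear a \<Longrightarrow> p \<in> carrier E \<Longrightarrow> act E a p \<in> carrier E"
  using J_act by blast

lemma J_act_AE: "bounded_clinear a \<Longrightarrow> p \<in> carrier E \<Longrightarrow> AE x in N. J (act E a p) x = a (J p x)"
  using J_act by blast

lemma act_add:
  assumes a: "bounded_clinear a" and p: "p \<in> carrier E" and q: "q \<in> carrier E"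
  shows "act E a (vadd E p q) = vadd E (act E a p) (act E a q)"
proof (rule J_inject)
  show "AE x in N. J (act E a (vadd E p q)) x = J (vadd E (act E a p) (act E a q)) x"
    using J_act_AE[OF a add_closed[OF p q]] J_add_AE[OF p q] J_act_AE[OF a p] J_act_AE[OF a q]
      J_add_AE[OF act_closed[OF a p] act_closed[OF a q]]
    by eventually_elim (simp add: bounded_clinearD[OF a])
qed (auto intro: act_closed add_closed a p q)

lemma act_scale:
  assumes a: "bounded_clinear a" and p: "p \<in> carrier E"
  shows "act E a (vscale E c p) = vscale E c (act E a p)"
proof (rule J_inject)
  show "AE x in N. J (act E a (vscale E c p)) x = J (vscale E c (act E a p)) x"
    using J_act_AE[OF a scale_closed[OF p, of c]] J_scale_AE[OF p, of c] J_act_AE[OF a p]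
      J_scale_AE[OF act_closed[OF a p], of c]
    by eventually_elim (simp add: bounded_clinearD[OF a])
qed (auto intro: act_closed scale_closed a p)

lemma act_act:
  assumes a: "bounded_clinear a" and b: "bounded_clinear b" and p: "p \<in> carrier E"
  shows "act E a (act E b p) = act E (\<lambda>x. a (b x)) p"
proof (rule J_inject)
  note ab = bounded_clinear_compose[OF a b]
  show "AE x in N. J (act E a (act E b p)) x = J (act E (\<lambda>x. a (b x)) p) x"
    using J_act_AE[OF a act_closed[OF b p]] J_act_AE[OF b p] J_act_AE[OF ab p]
    by eventually_elim simp
  show "act E (\<lambda>x. a (b x)) p \<in> carrier E" by (rule act_closed[OF ab p])
qed (auto intro: act_closed a b p)

lemma converges_act:
  assumes a: "bounded_clinear a" and s: "converges s p"
  shows "converges (\<lambda>n. act E a (s n)) (act E a p)"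
proof -
  have cl: "p \<in> carrier E" "s n \<in> carrier E" for n using s by (auto simp: converges_def)
  obtain K where K: "K > 0" "\<And>x. norm (a x) \<le> K * norm x"
    using bounded_clinear_bound[OF a] by blast
  have le: "ip_dist E (act E a (s n)) (act E a p) \<le> K * ip_dist E (s n) p" for n
  proof -
    note sq = sq_int_integrable[OF sq_int_diff[OF J_sq_int J_sq_int]]
    have "(\<integral>x. (norm (J (act E a (s n)) x - J (act E a p) x))\<^sup>2 \<partial>N) \<le>
        (\<integral>x. K\<^sup>2 * (norm (J (s n) x - J p x))\<^sup>2 \<partial>N)"
    proof (rule integral_mono_AE)
      show "AE x in N. (norm (J (act E a (s n)) x - J (act E a p) x))\<^sup>2 \<le> K\<^sup>2 * (norm (J (s n) x - J p x))\<^sup>2"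
        using J_act_AE[OF a cl(2)[of n]] J_act_AE[OF a cl(1)]
      proof eventually_elim
        case (elim x)
        have "norm (a (J (s n) x - J p x)) \<le> K * norm (J (s n) x - J p x)" by (rule K)
        from power_mono[OF this norm_ge_zero, of 2] show ?case
          by (simp add: elim bounded_clinearD[OF a] power_mult_distrib)
      qed
    qed (auto intro!: sq act_closed a cl)
    also have "\<dots> = K\<^sup>2 * (\<integral>x. (norm (J (s n) x - J p x))\<^sup>2 \<partial>N)" by simp
    finally have "ip_dist E (act E a (s n)) (act E a p) \<le> sqrt (K\<^sup>2 * (\<integral>x. (norm (J (s n) x - J p x))\<^sup>2 \<partial>N))"
      unfolding dist_J[OF act_closed[OF a cl(2)] act_closed[OF a cl(1)]] by (rule real_sqrt_le_mono)
    then show ?thesis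
      using K(1) by (simp add: dist_J[OF cl(2) cl(1)] real_sqrt_mult)
  qed
  have "(\<lambda>n. ip_dist E (act E a (s n)) (act E a p)) \<longlonglongrightarrow> 0"
  proof (rule Lim_null_comparison, intro always_eventually allI)
    show "norm (ip_dist E (act E a (s n)) (act E a p)) \<le> K * ip_dist E (s n) p" for n
      using le[of n] dist_nonneg[OF act_closed[OF a cl(2)] act_closed[OF a cl(1)], of n] by simp
    show "(\<lambda>n. K * ip_dist E (s n) p) \<longlonglongrightarrow> 0"
      using s by (auto simp: converges_def intro!: tendsto_eq_intros)
  qed
  then show ?thesis
    using act_closed[OF a cl(2)] act_closed[OF a cl(1)] by (simp add: converges_def)
qed

text \<open>Together with \<open>ip_trace\<close> it reduces scalar products of the generators
  \<open>act E a p\<close> to gramians of the vectors before multiplication.\<close>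

lemma gram_act:
  assumes a: "bounded_clinear a" and b: "bounded_clinear b" and p: "p \<in> carrier E" and q: "q \<in> carrier E"
  shows "gram E (act E a p) (act E b q) = (\<lambda>h. a (gram E p q (adj b h)))"
proof
  fix h
  note P = J_sq_int[OF p] and Q = J_sq_int[OF q]
  note aP = sq_int_bounded_clinear[OF P a] and bQ = sq_int_bounded_clinear[OF Q b]
  have adjb: "cinner h (b x) = cinner (adj b h) x" for x
    using cinner_adj[OF b, of x h] cinner_commute by metis
  have gram: "gram E (act E a p) (act E b q) = rv_gramian N (\<lambda>x. a (J p x)) (\<lambda>x. b (J q x))"
    unfolding J_gram[OF act_closed[OF a p] act_closed[OF b q]]
    by (rule rv_gramian_cong_AE[OF J_sq_int[OF act_closed[OF a p]] aP J_act_AE[OF a p]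
          J_sq_int[OF act_closed[OF b q]] bQ J_act_AE[OF b q]])
  show "gram E (act E a p) (act E b q) h = a (gram E p q (adj b h))"
    by (rule cinner_extensionality)
      (simp add: gram rv_gramian_eq(2)[OF aP bQ] cinner_adj[OF a] J_gram[OF p q] rv_gramian_eq(2)[OF P Q] adjb)
qed

lemma ip_trace:
  assumes "sigma_finite_measure N" "p \<in> carrier E" "q \<in> carrier E"
  shows "ip E p q = trace_op (gram E p q)"
  using trace_rv_gramian[OF J_sq_int[OF assms(2)] J_sq_int[OF assms(3)] assms(1)]
  by (simp add: J_gram[OF assms(2,3)] J_ip[OF assms(2,3)])

lemma act_ident: "p \<in> carrier E \<Longrightarrow> act E (\<lambda>x. x) p = p"
  by (rule J_inject) (use act_closed J_act_AE bounded_clinear_ident in auto)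

text \<open>Acting with a rank one operator makes each matrix entry of the gramian a scalar product.
  Hence an isometry that respects the action preserves gramians.\<close>

lemma gram_ip:
  assumes p: "p \<in> carrier E" and q: "q \<in> carrier E"
  shows "cinner (gram E p q h) k = ip E (act E (\<lambda>x. cinner x k *\<^sub>C h) p) q"
proof -
  note [measurable] = J_measurable[OF p] J_measurable[OF q]
  have "ip E (act E (\<lambda>x. cinner x k *\<^sub>C h) p) q = (\<integral>x. cinner (cinner (J p x) k *\<^sub>C h) (J q x) \<partial>N)"
    using J_act[OF bounded_clinear_rank_one p, of k h] by (intro ip_cong q) auto
  then show ?thesis
    by (simp add: J_gram p q rv_gramian_eq(2)[OF J_sq_int J_sq_int] cinner_scaleC_left mult.commute)
qed

end

text \<open>The assumption \<open>act_families\<close> makes the generating family stable under the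
  action, so that the isometric extension commutes with the action.\<close>

locale module_families =
  M1: l2_module E1 N1 J1 + M2: l2_module E2 N2 J2 + isometric_families E1 E2 I u v
  for E1 :: "('x, 'h::{complex_hilbert, second_countable_topology}) hilbert_module"
    and N1 :: "'n1 measure" and J1
    and E2 :: "('y, 'h) hilbert_module" and N2 :: "'n2 measure" and J2
    and I :: "'i set" and u :: "'i \<Rightarrow> 'x" and v :: "'i \<Rightarrow> 'y" +
  assumes act_families: "bounded_clinear a \<Longrightarrow> i \<in> I \<Longrightarrow> \<exists>j\<in>I. act E1 a (u i) = u j \<and> act E2 a (v i) = v j"
begin

lemma span_graph_act:
  assumes a: "bounded_clinear a" and pq: "span_graph p q"
  shows "span_graph (act E1 a p) (act E2 a q)"
  using pq
proof (induction rule: span_graph.induct)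
  case (base i)
  then show ?case using act_families[OF a] span_graph.base by metis
next
  case (add p q p' q')
  then show ?case
    using span_graph_closed[OF add(1)] span_graph_closed[OF add(2)]
    by (simp add: M1.act_add[OF a] M2.act_add[OF a] span_graph.add)
next
  case (scale p q c)
  then show ?case
    using span_graph_closed[OF scale(1)]
    by (simp add: M1.act_scale[OF a] M2.act_scale[OF a] span_graph.scale)
qed

lemma graph_act:
  assumes a: "bounded_clinear a" and "graph p q"
  shows "graph (act E1 a p) (act E2 a q)"
proof -
  obtain s t where st: "\<forall>n. span_graph (s n) (t n)" "M1.converges s p" "M2.converges t q"
    using assms(2) unfolding graph_def by blast
  show ?thesis
    unfolding graph_def
    by (intro exI[of _ "\<lambda>n. act E1 a (s n)"] exI[of _ "\<lambda>n. act E2 a (t n)"] conjI allI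
        span_graph_act[OF a] M1.converges_act[OF a] M2.converges_act[OF a]) (use st in auto)
qed

lemma W_gramian_unitary: "gramian_unitary_iso (E1\<lparr>carrier := closed_span E1 (u ` I)\<rparr>) E2 W"
proof -
  have "gram E2 (W p) (W q) = gram E1 p q"
    if p: "p \<in> closed_span E1 (u ` I)" and q: "q \<in> closed_span E1 (u ` I)" for p q
  proof
    fix h
    note cl = graph_closed[OF W_graph[OF p]] graph_closed[OF W_graph[OF q]]
    show "gram E2 (W p) (W q) h = gram E1 p q h"
    proof (rule cinner_extensionality)
      fix k
      show "cinner (gram E2 (W p) (W q) h) k = cinner (gram E1 p q h) k"
        using graph_ip[OF graph_act[OF bounded_clinear_rank_one W_graph[OF p], of k h] W_graph[OF q]] cl
        by (simp add: M1.gram_ip M2.gram_ip)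
    qed
  qed
  then show ?thesis
    unfolding gramian_unitary_iso_def
    using W_bij W_eq[OF graph_add[OF W_graph W_graph]] W_eq[OF graph_scale[OF W_graph]]
      W_eq[OF graph_act[OF _ W_graph]] by simp
qed

end

section \<open>Test functions and their Fourier transforms\<close>

subsection \<open>Smooth functions\<close>

abbreviation pdiff :: "'d \<Rightarrow> (real^'d::finite \<Rightarrow> complex) \<Rightarrow> real^'d \<Rightarrow> complex" where
  "pdiff i f \<equiv> \<lambda>x. frechet_derivative f (at x) (axis i 1)"

lemma pdiff_eq: "(f has_derivative D) (at x) \<Longrightarrow> pdiff i f x = D (axis i 1)"
  using frechet_derivative_at by metis

text \<open>All iterated derivatives stay in a set that is stable under partial derivatives, so no
  formula for higher derivatives is needed. The smoothness proofs below choose a suitable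
  \<open>S\<close>.\<close>

lemma smooth_coinduct:
  assumes "f \<in> S" and "\<And>f x. f \<in> S \<Longrightarrow> f differentiable (at x)" and "\<And>f i. f \<in> S \<Longrightarrow> pdiff i f \<in> S"
  shows "smooth f"
proof -
  have "ipartial is f \<in> S" for "is"
    by (induction "is") (use assms in auto)
  then show ?thesis using assms(2) by (auto simp: smooth_def)
qed

lemma smooth_differentiable: "smooth f \<Longrightarrow> f differentiable (at x)"
  unfolding smooth_def by (metis ipartial.simps(1))

lemma smooth_has_derivative: "smooth f \<Longrightarrow> (f has_derivative frechet_derivative f (at x)) (at x)"
  using smooth_differentiable frechet_derivative_works by blast

lemma ipartial_append: "ipartial (js @ is) f = ipartial js (ipartial is f)"
  by (induction js) auto

lemma smooth_ipartial: "smooth f \<Longrightarrow> smooth (ipartial is f)"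
  unfolding smooth_def by (metis ipartial_append)

lemma smooth_pdiff: "smooth f \<Longrightarrow> smooth (pdiff i f)"
  using smooth_ipartial[of f "[i]"] by simp

lemma smooth_continuous: "smooth f \<Longrightarrow> continuous_on UNIV f"
  by (meson continuous_at_imp_continuous_on differentiable_imp_continuous_within smooth_differentiable)

text \<open>The product rule leads from one product to a sum of two, so stability under derivatives
  requires closing under sums.\<close>

inductive_set smooth_products :: "(real^'d::finite \<Rightarrow> complex) set" where
  mult: "smooth g \<Longrightarrow> smooth h \<Longrightarrow> (\<lambda>x. g x * h x) \<in> smooth_products"
| add: "f \<in> smooth_products \<Longrightarrow> g \<in> smooth_products \<Longrightarrow> (\<lambda>x. f x + g x) \<in> smooth_products"

lemma pdiff_add:
  assumes "\<And>x. f differentiable (at x)" "\<And>x. g differentiable (at x)"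
  shows "pdiff i (\<lambda>x. f x + g x) = (\<lambda>x. pdiff i f x + pdiff i g x)"
proof
  fix x
  have "((\<lambda>x. f x + g x) has_derivative (\<lambda>h. frechet_derivative f (at x) h + frechet_derivative g (at x) h)) (at x)"
    using assms frechet_derivative_works by (intro has_derivative_add) blast+
  from pdiff_eq[OF this] show "pdiff i (\<lambda>x. f x + g x) x = pdiff i f x + pdiff i g x" .
qed

lemma pdiff_mult:
  assumes "smooth g" "smooth h"
  shows "pdiff i (\<lambda>x. g x * h x) = (\<lambda>x. g x * pdiff i h x + pdiff i g x * h x)"
proof
  fix x
  from pdiff_eq[OF has_derivative_mult[OF smooth_has_derivative smooth_has_derivative], OF assms]
  show "pdiff i (\<lambda>x. g x * h x) x = g x * pdiff i h x + pdiff i g x * h x" .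
qed

lemma smooth_mult:
  assumes "smooth g" "smooth h"
  shows "smooth (\<lambda>x. g x * h x)"
proof (rule smooth_coinduct[of _ smooth_products])
  have *: "(\<forall>x. f differentiable (at x)) \<and> (\<forall>i. pdiff i f \<in> smooth_products)" if "f \<in> smooth_products"
    for f :: "real^'a \<Rightarrow> complex"
    using that
  proof induction
    case (mult g h)
    then show ?case
      using differentiable_mult[OF smooth_differentiable smooth_differentiable, of g h]
      by (auto simp: pdiff_mult intro!: smooth_products.add smooth_products.mult smooth_pdiff)
  next
    case (add f g)
    then show ?case
      by (auto simp: pdiff_add intro: smooth_products.intros)
  qed
  show "f differentiable (at x)" "pdiff i f \<in> smooth_products" if "f \<in> smooth_products"
    for f :: "real^'a \<Rightarrow> complex" and i x
    using *[OF that] by auto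
qed (use assms in \<open>rule smooth_products.mult\<close>)

lemma smooth_affine:
  assumes "smooth f"
  shows "smooth (\<lambda>x. d * f (c *\<^sub>R x + b))"
\<comment> \<open>The factor \<open>d\<close> absorbs the constants \<open>c\<close> that the chain
  rule produces.\<close>
proof (rule smooth_coinduct[of _ "{\<lambda>x. d * f (c *\<^sub>R x + b) | d f. smooth f}"])
  have D: "((\<lambda>x. d * f (c *\<^sub>R x + b)) has_derivative (\<lambda>h. d * frechet_derivative f (at (c *\<^sub>R x + b)) (c *\<^sub>R h))) (at x)"
    if f: "smooth f" for d x and f :: "real^'a \<Rightarrow> complex"
  proof -
    have "((\<lambda>x. c *\<^sub>R x + b) has_derivative (\<lambda>h. c *\<^sub>R h)) (at x)"
      by (auto intro!: derivative_eq_intros)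
    from has_derivative_compose[OF this smooth_has_derivative[OF f]] show ?thesis
      by (rule has_derivative_mult_right)
  qed
  fix g :: "real^'a \<Rightarrow> complex" assume "g \<in> {\<lambda>x. d * f (c *\<^sub>R x + b) | d f. smooth f}"
  then obtain d f where g: "g = (\<lambda>x. d * f (c *\<^sub>R x + b))" "smooth f" by blast
  show "g differentiable (at x)" for x
    using D[OF g(2)] unfolding g(1) differentiable_def by blast
  have "pdiff i g = (\<lambda>x. (d * complex_of_real c) * pdiff i f (c *\<^sub>R x + b))" for i
  proof
    fix x
    interpret bounded_linear "frechet_derivative f (at (c *\<^sub>R x + b))"
      by (rule has_derivative_bounded_linear[OF smooth_has_derivative[OF g(2)]])
    show "pdiff i g x = (d * complex_of_real c) * pdiff i f (c *\<^sub>R x + b)"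
      unfolding g(1) pdiff_eq[OF D[OF g(2)]] by (simp add: scaleR scaleR_conv_of_real[where 'a = complex])
  qed
  then show "pdiff i g \<in> {\<lambda>x. d * f (c *\<^sub>R x + b) | d f. smooth f}" for i
    using smooth_pdiff[OF g(2), of i] by (auto intro!: exI[of _ "d * complex_of_real c"])
qed (use assms in blast)

lemma smooth_const: "smooth (\<lambda>x. c)"
proof (rule smooth_coinduct[of _ "range (\<lambda>c x. c)"])
  fix f :: "real^'a \<Rightarrow> complex" and i assume "f \<in> range (\<lambda>c x. c)"
  then obtain c where c: "f = (\<lambda>x. c)" by blast
  show "pdiff i f \<in> range (\<lambda>c x. c)"
    unfolding c by (simp add: frechet_derivative_const)
qed auto

lemma smooth_coordinate: "smooth (\<lambda>x. complex_of_real (x $ i))"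
proof (rule smooth_coinduct[of _ "insert (\<lambda>x. complex_of_real (x $ i)) (Collect smooth)"])
  have D: "((\<lambda>x. complex_of_real (x $ i)) has_derivative (\<lambda>h. complex_of_real (h $ i))) (at x)" for x :: "real^'a"
    by (intro bounded_linear_imp_has_derivative bounded_linear_compose[OF bounded_linear_of_real] bounded_linear_vec_nth)
  fix f :: "real^'a \<Rightarrow> complex" assume f: "f \<in> insert (\<lambda>x. complex_of_real (x $ i)) (Collect smooth)"
  show "f differentiable (at x)" for x
    using f D smooth_differentiable unfolding differentiable_def by blast
  show "pdiff j f \<in> insert (\<lambda>x. complex_of_real (x $ i)) (Collect smooth)" for j
  proof (cases "smooth f")
    case False
    then have "pdiff j f = (\<lambda>x. complex_of_real (axis j 1 $ i))"
      using f pdiff_eq[OF D] by auto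
    then show ?thesis by (simp add: smooth_const)
  qed (simp add: smooth_pdiff)
qed simp

subsection \<open>A bump function\<close>

text \<open>For \<open>k = 0\<close> this is the classical function \<open>exp (- 1 / s)\<close>
  extended by zero. The powers of \<open>inverse s\<close> are those that differentiation
  introduces.\<close>

definition flat :: "nat \<Rightarrow> real \<Rightarrow> real" where
  "flat k s = (if s > 0 then (inverse s) ^ k * exp (- inverse s) else 0)"

text \<open>With \<open>y = inverse s\<close> and \<open>n = k + 2\<close>, the inequality
  \<open>(1 + y / n) ^ n \<le> exp y\<close> bounds \<open>y ^ n * exp (- y)\<close>. The two
  surplus powers leave the factor \<open>s\<^sup>2\<close>, which yields the derivative zero at the
  origin.\<close>

lemma flat_bound: "\<bar>flat k s\<bar> \<le> real ((k + 2) ^ (k + 2)) * s\<^sup>2"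
proof (cases "s > 0")
  case True
  define y where "y = inverse s"
  have y: "y > 0" "s * y = 1" using True by (auto simp: y_def)
  have "(y / real (k + 2)) ^ (k + 2) \<le> (1 + y / real (k + 2)) ^ (k + 2)"
    using y by (intro power_mono) auto
  also have "\<dots> \<le> exp y"
    by (rule exp_ge_one_plus_x_over_n_power_n) (use y in auto)
  finally have "y ^ (k + 2) \<le> real ((k + 2) ^ (k + 2)) * exp y"
    by (simp add: power_divide divide_simps mult.commute del: power_Suc power.simps)
  then have "y ^ (k + 2) * exp (- y) \<le> real ((k + 2) ^ (k + 2))"
    by (simp add: exp_minus divide_simps mult.commute)
  then have "y ^ (k + 2) * exp (- y) * s\<^sup>2 \<le> real ((k + 2) ^ (k + 2)) * s\<^sup>2"
    by (intro mult_right_mono) auto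
  moreover have "y ^ (k + 2) * exp (- y) * s\<^sup>2 = flat k s"
  proof -
    have "y ^ (k + 2) * exp (- y) * s\<^sup>2 = y ^ k * exp (- y) * (s * y)\<^sup>2"
      by (simp add: power_add power_mult_distrib power2_eq_square mult_ac)
    then show ?thesis using True y by (simp add: flat_def y_def)
  qed
  ultimately have "flat k s \<le> real ((k + 2) ^ (k + 2)) * s\<^sup>2" by (simp only:)
  moreover have "0 \<le> flat k s" by (simp add: flat_def)
  ultimately show ?thesis by (simp only: abs_of_nonneg)
qed (simp add: flat_def)

lemma flat_derivative:
  "(flat k has_real_derivative (flat (k + 2) s - real k * flat (k + 1) s)) (at s)"
proof -
  consider "s > 0" | "s < 0" | "s = 0" by linarith
  then show ?thesis
  proof cases
    case 1
    have "((\<lambda>s. (inverse s) ^ k * exp (- inverse s)) has_real_derivative (flat (k + 2) s - real k * flat (k + 1) s)) (at s)"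
    proof (cases k)
      case 0
      show ?thesis using 1 unfolding 0
        by (auto intro!: derivative_eq_intros simp: flat_def power2_eq_square)
    next
      case (Suc m)
      \<comment> \<open>The power rule leaves the exponent \<open>m - Suc 0\<close>, which is
        truncated for \<open>m = 0\<close>.\<close>
      have "m = 0 \<or> inverse s ^ m = inverse s * inverse s ^ (m - Suc 0)" by (cases m) auto
      then show ?thesis using 1 unfolding Suc
        by (auto intro!: derivative_eq_intros simp: flat_def power2_eq_square algebra_simps)
    qed
    then show ?thesis
      by (rule has_field_derivative_transform_within_open[where S = "{0<..}"]) (use 1 in \<open>auto simp: flat_def\<close>)
  next
    case 2
    have "((\<lambda>s. 0) has_real_derivative 0) (at s)" by simp
    then have "(flat k has_real_derivative 0) (at s)"
      by (rule has_field_derivative_transform_within_open[where S = "{..<0}"]) (use 2 in \<open>auto simp: flat_def\<close>)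
    then show ?thesis using 2 by (simp add: flat_def)
  next
    case 3
    have "(\<lambda>h. (flat k (0 + h) - flat k 0) / h) \<midarrow>0\<rightarrow> 0"
    proof (rule Lim_null_comparison)
      show "\<forall>\<^sub>F h in at 0. norm ((flat k (0 + h) - flat k 0) / h) \<le> real ((k + 2) ^ (k + 2)) * \<bar>h\<bar>"
      proof (intro always_eventually allI)
        fix h :: real
        have "\<bar>flat k h\<bar> \<le> (real ((k + 2) ^ (k + 2)) * \<bar>h\<bar>) * \<bar>h\<bar>"
          using flat_bound[of k h] by (simp add: power2_eq_square mult.assoc)
        then have "\<bar>flat k h\<bar> / \<bar>h\<bar> \<le> real ((k + 2) ^ (k + 2)) * \<bar>h\<bar>"
          by (cases "h = 0") (simp_all add: divide_le_eq)
        then show "norm ((flat k (0 + h) - flat k 0) / h) \<le> real ((k + 2) ^ (k + 2)) * \<bar>h\<bar>"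
          by (simp add: flat_def[of k 0])
      qed
      have "((\<lambda>h. real ((k + 2) ^ (k + 2)) * \<bar>h\<bar>) \<longlongrightarrow> real ((k + 2) ^ (k + 2)) * \<bar>0\<bar>) (at 0)"
        by (intro tendsto_intros)
      then show "((\<lambda>h. real ((k + 2) ^ (k + 2)) * \<bar>h\<bar>) \<longlongrightarrow> 0) (at 0)" by simp
    qed
    then have "(flat k has_real_derivative 0) (at 0)"
      unfolding DERIV_def .
    then show ?thesis using 3 by (simp add: flat_def)
  qed
qed

text \<open>A derivative raises \<open>k\<close> by one or two, multiplies by polynomials and
  differentiates \<open>p\<close>. Arbitrary smooth coefficients and sums keep all this inside the
  set.\<close>

inductive_set bumps :: "(real^'d::finite \<Rightarrow> complex) set" where
  base: "smooth p \<Longrightarrow> (\<lambda>x. p x * complex_of_real (flat k (1 - x \<bullet> x))) \<in> bumps"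
| add: "f \<in> bumps \<Longrightarrow> g \<in> bumps \<Longrightarrow> (\<lambda>x. f x + g x) \<in> bumps"

lemma bump_derivative:
  assumes "smooth p"
  shows "((\<lambda>x. p x * complex_of_real (flat k (1 - x \<bullet> x))) has_derivative
    (\<lambda>h. p x * complex_of_real ((flat (k + 2) (1 - x \<bullet> x) - real k * flat (k + 1) (1 - x \<bullet> x)) * (- 2 * (x \<bullet> h)))
      + frechet_derivative p (at x) h * complex_of_real (flat k (1 - x \<bullet> x)))) (at x)"
proof -
  have q: "((\<lambda>x. 1 - x \<bullet> x) has_derivative (\<lambda>h. - 2 * (x \<bullet> h))) (at x)"
    by (auto intro!: derivative_eq_intros simp: inner_commute)
  have "(flat k has_derivative (*) (flat (k + 2) (1 - x \<bullet> x) - real k * flat (k + 1) (1 - x \<bullet> x))) (at (1 - x \<bullet> x))"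
    using flat_derivative[of k "1 - x \<bullet> x"] unfolding has_field_derivative_def .
  from has_derivative_of_real[OF has_derivative_compose[OF q this]]
  show ?thesis
    by (rule has_derivative_mult[OF smooth_has_derivative[OF assms]])
qed

lemma smooth_bump: "f \<in> bumps \<Longrightarrow> smooth f"
proof (rule smooth_coinduct[of _ bumps])
  have *: "(\<forall>x. f differentiable (at x)) \<and> (\<forall>i. pdiff i f \<in> bumps)" if "f \<in> bumps"
    for f :: "real^'a \<Rightarrow> complex"
    using that
  proof induction
    case (base p k)
    have "pdiff i (\<lambda>x. p x * complex_of_real (flat k (1 - x \<bullet> x))) =
      (\<lambda>x. (((p x * (- 2)) * complex_of_real (x $ i)) * complex_of_real (flat (k + 2) (1 - x \<bullet> x)) +
        ((p x * (2 * of_nat k)) * complex_of_real (x $ i)) * complex_of_real (flat (k + 1) (1 - x \<bullet> x))) +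
        pdiff i p x * complex_of_real (flat k (1 - x \<bullet> x)))" for i
      unfolding pdiff_eq[OF bump_derivative[OF base]] by (simp add: inner_axis algebra_simps)
    then have "pdiff i (\<lambda>x. p x * complex_of_real (flat k (1 - x \<bullet> x))) \<in> bumps" for i
      by (simp only:) (intro bumps.intros smooth_mult smooth_pdiff smooth_const smooth_coordinate base)
    then show ?case
      using bump_derivative[OF base] unfolding differentiable_def by blast
  next
    case (add f g)
    then show ?case
      by (auto simp: pdiff_add intro: bumps.intros)
  qed
  show "f differentiable (at x)" "pdiff i f \<in> bumps" if "f \<in> bumps"
    for f :: "real^'a \<Rightarrow> complex" and i x
    using *[OF that] by auto
qed

definition bump :: "real^'d::finite \<Rightarrow> complex" where
  "bump x = complex_of_real (flat 0 (1 - x \<bullet> x))"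

lemma smooth_bump_function: "smooth bump"
proof -
  have "(\<lambda>x::real^'a. 1 * complex_of_real (flat 0 (1 - x \<bullet> x))) \<in> bumps"
    by (rule bumps.base[OF smooth_const])
  from smooth_bump[OF this] show ?thesis by (simp add: bump_def[abs_def])
qed

subsection \<open>Test functions\<close>

lemma compact_supp_bounded:
  assumes "bounded {x. f x \<noteq> 0}"
  shows "compact (supp f)"
  unfolding supp_def compact_eq_bounded_closed using bounded_closure[OF assms] by simp

lemma test_funs_smooth: "\<phi> \<in> test_funs \<Longrightarrow> smooth \<phi>"
  by (simp add: test_funs_def)

lemma test_funs_continuous: "\<phi> \<in> test_funs \<Longrightarrow> continuous_on UNIV \<phi>"
  by (simp add: test_funs_def smooth_continuous)

lemma test_funs_radius:
  assumes "\<phi> \<in> test_funs"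
  obtains R where "R > 0" "\<And>x. norm x > R \<Longrightarrow> \<phi> x = 0"
proof -
  have "bounded (supp \<phi>)" using assms by (simp add: test_funs_def compact_imp_bounded)
  then obtain R where R: "R > 0" "\<And>x. x \<in> supp \<phi> \<Longrightarrow> norm x \<le> R"
    unfolding bounded_pos by blast
  show ?thesis
  proof (rule that[OF R(1)])
    fix x :: "real^'a" assume "norm x > R"
    then have "x \<notin> supp \<phi>" using R(2) by force
    then show "\<phi> x = 0"
      using closure_subset[of "{x. \<phi> x \<noteq> 0}"] by (auto simp: supp_def)
  qed
qed

lemma test_funsI:
  assumes "smooth \<phi>" "\<And>x. norm x > R \<Longrightarrow> \<phi> x = 0"
  shows "\<phi> \<in> test_funs"
proof -
  have "{x. \<phi> x \<noteq> 0} \<subseteq> cball 0 R" using assms(2) by force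
  then have "bounded {x. \<phi> x \<noteq> 0}" using bounded_subset bounded_cball by blast
  then show ?thesis using assms(1) by (simp add: test_funs_def compact_supp_bounded)
qed

lemma test_funs_pdiff:
  assumes "\<phi> \<in> test_funs"
  shows "pdiff i \<phi> \<in> test_funs"
proof -
  obtain R where R: "R > 0" "\<And>x. norm x > R \<Longrightarrow> \<phi> x = 0" using test_funs_radius[OF assms] by blast
  have zero: "pdiff i \<phi> x = 0" if "norm x > R" for x
  proof -
    have "((\<lambda>x. 0) has_derivative (\<lambda>h. 0)) (at x)" by simp
    then have "(\<phi> has_derivative (\<lambda>h. 0)) (at x)"
      by (rule has_derivative_transform_within_open[where s = "- cball 0 R"])
        (use that R in \<open>auto simp: open_Compl\<close>)
    from pdiff_eq[OF this] show ?thesis .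
  qed
  show ?thesis by (rule test_funsI[OF smooth_pdiff[OF test_funs_smooth[OF assms]] zero])
qed

lemma test_funs_mult_smooth:
  assumes "\<phi> \<in> test_funs" "smooth p"
  shows "(\<lambda>x. p x * \<phi> x) \<in> test_funs"
proof -
  obtain R where R: "R > 0" "\<And>x. norm x > R \<Longrightarrow> \<phi> x = 0" using test_funs_radius[OF assms(1)] by blast
  show ?thesis
    by (rule test_funsI[OF smooth_mult[OF assms(2) test_funs_smooth[OF assms(1)]], of R]) (simp add: R(2))
qed

lemma test_funs_affine:
  assumes "\<phi> \<in> test_funs" and c: "c \<noteq> 0"
  shows "(\<lambda>x. \<phi> (c *\<^sub>R x + b)) \<in> test_funs"
proof -
  obtain R where R: "R > 0" "\<And>x. norm x > R \<Longrightarrow> \<phi> x = 0" using test_funs_radius[OF assms(1)] by blast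
  show ?thesis
  proof (rule test_funsI[where R = "(R + norm b) / \<bar>c\<bar>"])
    show "smooth (\<lambda>x. \<phi> (c *\<^sub>R x + b))"
      using smooth_affine[OF test_funs_smooth[OF assms(1)], of 1 c b] by simp
    fix x :: "real^'a" assume "norm x > (R + norm b) / \<bar>c\<bar>"
    then have "norm (c *\<^sub>R x) > R + norm b" using c by (simp add: divide_simps mult.commute)
    moreover have "norm (c *\<^sub>R x) \<le> norm (c *\<^sub>R x + b) + norm b"
      using norm_triangle_ineq[of "c *\<^sub>R x + b" "- b"] by simp
    ultimately show "\<phi> (c *\<^sub>R x + b) = 0" using R by simp
  qed
qed

lemma test_funs_translate: "\<phi> \<in> test_funs \<Longrightarrow> translate x \<phi> \<in> test_funs"
  using test_funs_affine[of \<phi> 1 "-x"] by (simp add: translate_def)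

lemma bump_test_fun: "bump \<in> test_funs"
proof (rule test_funsI[OF smooth_bump_function, of 1])
  fix x :: "real^'a" assume "1 < norm x"
  then have "1\<^sup>2 < (norm x)\<^sup>2" by (intro power_strict_mono) auto
  then show "bump x = 0" by (simp add: bump_def flat_def power2_norm_eq_inner)
qed

lemma test_funs_bounded:
  assumes "\<phi> \<in> test_funs"
  obtains B where "B > 0" "\<And>x. cmod (\<phi> x) \<le> B"
proof -
  obtain R where R: "R > 0" "\<And>x. norm x > R \<Longrightarrow> \<phi> x = 0" using test_funs_radius[OF assms] by blast
  have "compact (\<phi> ` cball 0 R)"
    by (intro compact_continuous_image continuous_on_subset[OF test_funs_continuous[OF assms]]) auto
  then obtain B where B: "B > 0" "\<And>x. x \<in> cball 0 R \<Longrightarrow> cmod (\<phi> x) \<le> B"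
    using compact_imp_bounded[of "\<phi> ` cball 0 R"] unfolding bounded_pos by blast
  have "cmod (\<phi> x) \<le> B" for x
    using B R(2)[of x] by (cases "norm x > R") auto
  then show ?thesis using that B by blast
qed

lemma test_funs_measurable: "\<phi> \<in> test_funs \<Longrightarrow> \<phi> \<in> borel_measurable borel"
  by (intro borel_measurable_continuous_onI test_funs_continuous)

lemma integrable_bounded_support:
  fixes f :: "real^'d::finite \<Rightarrow> 'b::{banach, second_countable_topology}"
  assumes "f \<in> borel_measurable borel" "\<And>x. norm x > R \<Longrightarrow> f x = 0" "\<And>x. norm (f x) \<le> B"
  shows "integrable lborel f"
proof (rule Bochner_Integration.integrable_bound)
  show "integrable lborel (\<lambda>x. indicator (cball (0::real^'d) R) x * B)"
    using emeasure_bounded_finite[OF bounded_cball, of "0::real^'d" R]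
    by (intro integrable_mult_left integrable_real_indicator) auto
  have "norm (f x) \<le> norm (indicator (cball (0::real^'d) R) x * B)" for x
    using assms(2,3)[of x] order_trans[OF norm_ge_zero assms(3)[of x]]
    by (cases "norm x > R") (auto simp: indicator_def)
  then show "AE x in lborel. norm (f x) \<le> norm (indicator (cball (0::real^'d) R) x * B)" by simp
qed (use assms in simp)

lemma test_funs_integrable:
  assumes "\<phi> \<in> test_funs"
  shows "integrable lborel \<phi>"
proof -
  obtain R where R: "R > 0" "\<And>x. norm x > R \<Longrightarrow> \<phi> x = 0" using test_funs_radius[OF assms] by blast
  obtain B where B: "B > 0" "\<And>x. cmod (\<phi> x) \<le> B" using test_funs_bounded[OF assms] by blast
  show ?thesis by (rule integrable_bounded_support[OF test_funs_measurable[OF assms] R(2) B(2)])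
qed

subsection \<open>The Fourier transform of a test function\<close>

lemma borel_measurable_cis [measurable]:
  assumes "f \<in> borel_measurable N" shows "(\<lambda>x. cis (f x)) \<in> borel_measurable N"
  by (rule borel_measurable_continuous_on[OF _ assms]) (intro continuous_intros)

lemma integral_translate:
  fixes f :: "real^'d::finite \<Rightarrow> 'b::{banach, second_countable_topology}"
  assumes "f \<in> borel_measurable borel"
  shows "(\<integral>x. f (c + x) \<partial>lborel) = (\<integral>x. f x \<partial>lborel)"
  using integral_distr[of "(+) c" lborel borel f] assms by (simp add: lborel_distr_plus)

lemma integral_reflect:
  fixes f :: "real^'d::finite \<Rightarrow> 'b::{banach, second_countable_topology}"
  assumes "f \<in> borel_measurable borel"
  shows "(\<integral>x. f (c - x) \<partial>lborel) = (\<integral>x. f x \<partial>lborel)"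
proof -
  have "(lborel :: (real^'d) measure) = distr lborel borel (\<lambda>x. c - x)"
    using lborel_affine[of "-1" c] by (simp add: density_1)
  then show ?thesis
    using integral_distr[of "(\<lambda>x. c - x)" lborel borel f] assms by simp
qed

abbreviation phase :: "real^'d::finite \<Rightarrow> real^'d \<Rightarrow> complex" where
  "phase x t \<equiv> cis (- 2 * pi * (x \<bullet> t))"

lemma phase_add: "phase (x + y) t = phase x t * phase y t"
  by (simp add: cis_mult inner_add_left algebra_simps)

lemma integrable_phase:
  assumes "integrable lborel f"
  shows "integrable lborel (\<lambda>x. phase x t * f x)"
  by (rule Bochner_Integration.integrable_bound[OF assms]) (use assms in \<open>auto simp: norm_mult\<close>)

lemma cmod_fourier_le:
  assumes "\<phi> \<in> test_funs"
  shows "cmod (fourier \<phi> t) \<le> (\<integral>x. cmod (\<phi> x) \<partial>lborel)"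
proof -
  have "cmod (fourier \<phi> t) \<le> (\<integral>x. cmod (phase x t * \<phi> x) \<partial>lborel)"
    unfolding fourier_def by (rule integral_norm_bound)
  then show ?thesis by (simp add: norm_mult)
qed

lemma fourier_translate:
  assumes \<phi>: "\<phi> \<in> test_funs"
  shows "fourier (translate y \<phi>) t = phase y t * fourier \<phi> t"
proof -
  note [measurable] = test_funs_measurable[OF \<phi>]
  have "fourier (translate y \<phi>) t = (\<integral>x. phase (y + x) t * \<phi> (y + x - y) \<partial>lborel)"
    unfolding fourier_def translate_def by (rule integral_translate[symmetric]) measurable
  also have "\<dots> = (\<integral>x. phase y t * (phase x t * \<phi> x) \<partial>lborel)"
    by (rule Bochner_Integration.integral_cong[OF refl], subst phase_add)
      (simp only: mult.assoc add_diff_cancel_left')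
  finally show ?thesis by (simp add: fourier_def)
qed

definition moment :: "'d \<Rightarrow> (real^'d::finite \<Rightarrow> complex) \<Rightarrow> real^'d \<Rightarrow> complex" where
  "moment i \<phi> = (\<lambda>x. (- 2 * pi * \<i>) * complex_of_real (x $ i) * \<phi> x)"

lemma moment_test_funs: "\<phi> \<in> test_funs \<Longrightarrow> moment i \<phi> \<in> test_funs"
  unfolding moment_def by (intro test_funs_mult_smooth smooth_mult smooth_const smooth_coordinate)

text \<open>The bound \<open>\<theta>\<^sup>2 / 2\<close> for the first order Taylor remainder of
  \<open>cis\<close> is applied to the phase \<open>\<theta> = - 2 * pi * (x \<bullet> v)\<close>,
  which on the support of \<open>\<phi>\<close> is at most \<open>2 * pi * R * norm v\<close> in
  absolute value. Integration bounds the remainder by \<open>C * (norm v)\<^sup>2\<close>.\<close>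

lemma fourier_has_derivative:
  assumes \<phi>: "\<phi> \<in> test_funs"
  shows "(fourier \<phi> has_derivative (\<lambda>v. \<Sum>i\<in>UNIV. complex_of_real (v $ i) * fourier (moment i \<phi>) t)) (at t)"
proof -
  note [measurable] = test_funs_measurable[OF \<phi>]
  let ?L = "\<lambda>v. \<Sum>i\<in>UNIV. complex_of_real (v $ i) * fourier (moment i \<phi>) t"
  obtain R where R: "R > 0" "\<And>x. norm x > R \<Longrightarrow> \<phi> x = 0" using test_funs_radius[OF \<phi>] by blast
  define C where "C = (2 * pi * R)\<^sup>2 / 2 * (\<integral>x. cmod (\<phi> x) \<partial>lborel)"
  have L: "?L v = (\<integral>x. phase x t * ((\<i> * complex_of_real (- 2 * pi * (x \<bullet> v))) * \<phi> x) \<partial>lborel)" for v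
  proof -
    have "?L v = (\<Sum>i\<in>UNIV. \<integral>x. complex_of_real (v $ i) * (phase x t * moment i \<phi> x) \<partial>lborel)"
      unfolding fourier_def by simp
    also have "\<dots> = (\<integral>x. (\<Sum>i\<in>UNIV. complex_of_real (v $ i) * (phase x t * moment i \<phi> x)) \<partial>lborel)"
      by (rule Bochner_Integration.integral_sum[symmetric])
        (intro integrable_mult_right integrable_phase test_funs_integrable moment_test_funs \<phi>)
    also have "\<dots> = (\<integral>x. phase x t * ((\<i> * complex_of_real (- 2 * pi * (x \<bullet> v))) * \<phi> x) \<partial>lborel)"
    proof (rule Bochner_Integration.integral_cong[OF refl])
      fix x :: "real^'a"
      have "complex_of_real (x \<bullet> v) = (\<Sum>i\<in>UNIV. complex_of_real (x $ i) * complex_of_real (v $ i))"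
        by (simp add: inner_vec_def)
      then show "(\<Sum>i\<in>UNIV. complex_of_real (v $ i) * (phase x t * moment i \<phi> x)) =
          phase x t * ((\<i> * complex_of_real (- 2 * pi * (x \<bullet> v))) * \<phi> x)"
        by (simp add: moment_def sum_distrib_left sum_distrib_right sum_negf mult_ac)
    qed
    finally show ?thesis .
  qed
  have rem: "cmod (fourier \<phi> (t + v) - fourier \<phi> t - ?L v) \<le> C * (norm v)\<^sup>2" for v
  proof -
    let ?\<theta> = "\<lambda>x. - 2 * pi * (x \<bullet> v)"
    obtain B where B: "B > 0" "\<And>x. cmod (\<phi> x) \<le> B" using test_funs_bounded[OF \<phi>] by blast
    have i3: "integrable lborel (\<lambda>x. phase x t * ((\<i> * complex_of_real (?\<theta> x)) * \<phi> x))"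
    proof (rule integrable_phase, rule integrable_bounded_support[where R = R])
      show "norm (\<i> * complex_of_real (?\<theta> x) * \<phi> x) \<le> (2 * pi * (R * norm v)) * B" for x
      proof (cases "norm x > R")
        case False
        have "\<bar>x \<bullet> v\<bar> \<le> R * norm v"
          using Cauchy_Schwarz_ineq2[of x v] False by (meson linorder_not_le mult_right_mono norm_ge_zero order_trans)
        then have "(2 * pi * \<bar>x \<bullet> v\<bar>) * cmod (\<phi> x) \<le> (2 * pi * (R * norm v)) * B"
          using B(2)[of x] R(1) by (intro mult_mono[OF mult_left_mono]) auto
        then show ?thesis by (simp add: norm_mult abs_mult)
      qed (use R B in \<open>simp add: mult_nonneg_nonneg\<close>)
    qed (use R(2) in auto)
    have diff: "fourier \<phi> (t + v) - fourier \<phi> t - ?L v =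
        (\<integral>x. phase x (t + v) * \<phi> x - phase x t * \<phi> x - phase x t * ((\<i> * complex_of_real (?\<theta> x)) * \<phi> x) \<partial>lborel)"
      unfolding L unfolding fourier_def using i3 integrable_phase[OF test_funs_integrable[OF \<phi>]]
      by simp
    have "cmod (fourier \<phi> (t + v) - fourier \<phi> t - ?L v) \<le>
        (\<integral>x. (2 * pi * R)\<^sup>2 / 2 * (norm v)\<^sup>2 * cmod (\<phi> x) \<partial>lborel)"
      unfolding diff
    proof (rule Bochner_Integration.integral_norm_bound_integral)
      show "integrable lborel (\<lambda>x. phase x (t + v) * \<phi> x - phase x t * \<phi> x - phase x t * ((\<i> * complex_of_real (?\<theta> x)) * \<phi> x))"
        by (intro Bochner_Integration.integrable_diff integrable_phase[OF test_funs_integrable[OF \<phi>]] i3)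
      show "integrable lborel (\<lambda>x. (2 * pi * R)\<^sup>2 / 2 * (norm v)\<^sup>2 * cmod (\<phi> x))"
        by (intro integrable_mult_right integrable_norm test_funs_integrable \<phi>)
      fix x :: "real^'a"
      have "phase x (t + v) = phase x t * cis (?\<theta> x)"
        by (simp add: cis_mult inner_add_right algebra_simps)
      then have "phase x (t + v) * \<phi> x - phase x t * \<phi> x - phase x t * ((\<i> * complex_of_real (?\<theta> x)) * \<phi> x) =
          phase x t * (cis (?\<theta> x) - (1 + \<i> * complex_of_real (?\<theta> x))) * \<phi> x"
        by (simp add: algebra_simps)
      then have eq: "cmod (phase x (t + v) * \<phi> x - phase x t * \<phi> x - phase x t * ((\<i> * complex_of_real (?\<theta> x)) * \<phi> x)) =
          cmod (cis (?\<theta> x) - (1 + \<i> * complex_of_real (?\<theta> x))) * cmod (\<phi> x)"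
        by (simp only: norm_mult norm_cis mult_1_left)
      show "cmod (phase x (t + v) * \<phi> x - phase x t * \<phi> x - phase x t * ((\<i> * complex_of_real (?\<theta> x)) * \<phi> x))
          \<le> (2 * pi * R)\<^sup>2 / 2 * (norm v)\<^sup>2 * cmod (\<phi> x)"
      proof (cases "norm x > R")
        case False
        have "cmod (cis (?\<theta> x) - (1 + \<i> * complex_of_real (?\<theta> x))) \<le> \<bar>?\<theta> x\<bar>\<^sup>2 / 2"
          using iexp_approx1[of "?\<theta> x" 1] by (simp add: cis_conv_exp numeral_2_eq_2)
        also have "\<bar>?\<theta> x\<bar>\<^sup>2 / 2 \<le> (2 * pi * (R * norm v))\<^sup>2 / 2"
        proof (intro divide_right_mono power_mono)
          have "\<bar>x \<bullet> v\<bar> \<le> R * norm v"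
            using Cauchy_Schwarz_ineq2[of x v] False by (meson linorder_not_le mult_right_mono norm_ge_zero order_trans)
          then show "\<bar>?\<theta> x\<bar> \<le> 2 * pi * (R * norm v)" by (simp add: abs_mult)
        qed auto
        finally have "cmod (cis (?\<theta> x) - (1 + \<i> * complex_of_real (?\<theta> x))) \<le> (2 * pi * R)\<^sup>2 / 2 * (norm v)\<^sup>2"
          by (simp add: power_mult_distrib mult_ac)
        then show ?thesis unfolding eq by (rule mult_right_mono) simp
      qed (simp add: R(2))
    qed
    also have "\<dots> = C * (norm v)\<^sup>2"
      unfolding C_def Bochner_Integration.integral_mult_right_zero by (simp only: mult_ac)
    finally show ?thesis .
  qed
  have bl: "bounded_linear ?L"
    by (rule bounded_linear_sum)
      (rule bounded_linear_compose[OF bounded_linear_mult_left bounded_linear_compose[OF bounded_linear_of_real bounded_linear_vec_nth]])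
  show ?thesis
    unfolding has_derivative_at
  proof (intro conjI bl)
    show "(\<lambda>v. norm (fourier \<phi> (t + v) - fourier \<phi> t - ?L v) / norm v) \<midarrow>0\<rightarrow> 0"
    proof (rule Lim_null_comparison)
      show "\<forall>\<^sub>F v in at 0. norm (norm (fourier \<phi> (t + v) - fourier \<phi> t - ?L v) / norm v) \<le> C * norm v"
      proof (intro always_eventually allI)
        fix v :: "real^'a"
        show "norm (norm (fourier \<phi> (t + v) - fourier \<phi> t - ?L v) / norm v) \<le> C * norm v"
          using rem[of v] by (cases "v = 0") (simp_all add: divide_le_eq power2_eq_square mult.assoc)
      qed
      have "((\<lambda>v::real^'a. C * norm v) \<longlongrightarrow> C * norm (0::real^'a)) (at 0)"
        by (rule tendsto_mult[OF tendsto_const tendsto_norm[OF tendsto_ident_at]])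
      then show "((\<lambda>v::real^'a. C * norm v) \<longlongrightarrow> 0) (at 0)" by simp
    qed
  qed
qed

lemma pdiff_fourier:
  assumes "\<phi> \<in> test_funs"
  shows "pdiff i (fourier \<phi>) = fourier (moment i \<phi>)"
proof
  fix t
  have "(\<Sum>j\<in>UNIV. complex_of_real (axis i 1 $ j) * fourier (moment j \<phi>) t) =
      (\<Sum>j\<in>UNIV. if j = i then fourier (moment j \<phi>) t else 0)"
    by (intro sum.cong) (auto simp: axis_def)
  then show "pdiff i (fourier \<phi>) t = fourier (moment i \<phi>) t"
    unfolding pdiff_eq[OF fourier_has_derivative[OF assms]] by simp
qed

text \<open>Derivatives of a transform are transforms of moments, which are again test functions.
  Estimates for all derivatives thus reduce to estimates for transforms.\<close>

lemma ipartial_fourier: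
  assumes "\<phi> \<in> test_funs"
  shows "\<exists>\<psi>\<in>test_funs. ipartial is (fourier \<phi>) = fourier \<psi>"
proof (induction "is")
  case (Cons i "is")
  then obtain \<psi> where "\<psi> \<in> test_funs" "ipartial is (fourier \<phi>) = fourier \<psi>" by blast
  then show ?case using pdiff_fourier moment_test_funs by (intro bexI[of _ "moment i \<psi>"]) auto
qed (use assms in auto)

lemma smooth_fourier:
  assumes "\<phi> \<in> test_funs"
  shows "smooth (fourier \<phi>)"
proof (rule smooth_coinduct[of _ "fourier ` test_funs"])
  fix f :: "real^'a \<Rightarrow> complex" assume "f \<in> fourier ` test_funs"
  then obtain \<psi> where \<psi>: "f = fourier \<psi>" "\<psi> \<in> test_funs" by blast
  show "f differentiable (at x)" for x
    using fourier_has_derivative[OF \<psi>(2)] unfolding \<psi>(1) differentiable_def by blast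
  show "pdiff i f \<in> fourier ` test_funs" for i
    unfolding \<psi>(1) using pdiff_fourier[OF \<psi>(2)] moment_test_funs[OF \<psi>(2)] by simp
qed (use assms in blast)

text \<open>The mean value inequality along a coordinate line, uniform in the base point. It
  dominates the difference quotients in \<open>fourier_pdiff\<close>.\<close>

lemma test_funs_increment_bound:
  assumes \<psi>: "\<psi> \<in> test_funs"
  obtains B where "B > 0" "\<And>x h. cmod (\<psi> (x + h *\<^sub>R axis i 1) - \<psi> x) \<le> B * \<bar>h\<bar>"
proof -
  obtain B where B: "B > 0" "\<And>x. cmod (pdiff i \<psi> x) \<le> B"
    using test_funs_bounded[OF test_funs_pdiff[OF \<psi>]] by blast
  have "cmod (\<psi> (x + h *\<^sub>R axis i 1) - \<psi> x) \<le> B * \<bar>h\<bar>" for x h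
  proof -
    have D: "((\<lambda>s. \<psi> (x + s *\<^sub>R axis i 1)) has_derivative (\<lambda>s. s *\<^sub>R pdiff i \<psi> (x + u *\<^sub>R axis i 1))) (at u)" for u
    proof -
      have "((\<lambda>s. x + s *\<^sub>R axis i 1) has_derivative (\<lambda>s. s *\<^sub>R axis i (1::real))) (at u)"
        by (auto intro!: derivative_eq_intros)
      from has_derivative_compose[OF this smooth_has_derivative[OF test_funs_smooth[OF \<psi>]]]
      show ?thesis
        using linear_scale[OF has_derivative_linear[OF smooth_has_derivative[OF test_funs_smooth[OF \<psi>]]]] by simp
    qed
    have "norm (\<psi> (x + h *\<^sub>R axis i 1) - \<psi> (x + 0 *\<^sub>R axis i 1)) \<le> B * norm (h - 0)"
    proof (rule differentiable_bound[where S = UNIV and f = "\<lambda>s. \<psi> (x + s *\<^sub>R axis i 1)"])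
      fix u :: real
      show "((\<lambda>s. \<psi> (x + s *\<^sub>R axis i 1)) has_derivative (\<lambda>s. s *\<^sub>R pdiff i \<psi> (x + u *\<^sub>R axis i 1))) (at u within UNIV)"
        using D[of u] by simp
      show "onorm (\<lambda>s. s *\<^sub>R pdiff i \<psi> (x + u *\<^sub>R axis i 1)) \<le> B"
      proof (rule onorm_le)
        show "norm (s *\<^sub>R pdiff i \<psi> (x + u *\<^sub>R axis i 1)) \<le> B * norm s" for s
          using mult_left_mono[OF B(2)[of "x + u *\<^sub>R axis i 1"] abs_ge_zero[of s]] by (simp add: mult.commute)
      qed
    qed auto
    then show ?thesis by simp
  qed
  then show ?thesis using that B(1) by blast
qed

text \<open>Difference quotients of translates replace integration by parts.\<close>

lemma fourier_pdiff:
  assumes \<psi>: "\<psi> \<in> test_funs"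
  shows "fourier (pdiff i \<psi>) t = (2 * pi * \<i>) * complex_of_real (t $ i) * fourier \<psi> t"
proof -
  note [measurable] = test_funs_measurable[OF \<psi>] test_funs_measurable[OF test_funs_pdiff[OF \<psi>]]
  let ?e = "axis i (1::real)"
  define h where "h n = inverse (real (Suc n))" for n
  have h: "h n > 0" "h n \<le> 1" for n by (auto simp: h_def divide_simps)
  have hlim: "h \<longlonglongrightarrow> 0" unfolding h_def[abs_def] by (rule LIMSEQ_inverse_real_of_nat)
  obtain R where R: "R > 0" "\<And>x. norm x > R \<Longrightarrow> \<psi> x = 0" using test_funs_radius[OF \<psi>] by blast
  obtain B where B: "B > 0" "\<And>x h. cmod (\<psi> (x + h *\<^sub>R ?e) - \<psi> x) \<le> B * \<bar>h\<bar>"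
    using test_funs_increment_bound[OF \<psi>, of i] by blast
  have "(\<lambda>n. \<integral>x. phase x t * ((\<psi> (x + h n *\<^sub>R ?e) - \<psi> x) /\<^sub>R h n) \<partial>lborel) \<longlonglongrightarrow> (\<integral>x. phase x t * pdiff i \<psi> x \<partial>lborel)"
  proof (rule integral_dominated_convergence)
    \<comment> \<open>The steps \<open>h n\<close> are at most one, so the translated functions
      vanish outside the ball of radius \<open>R + 1\<close>.\<close>
    show "integrable lborel (\<lambda>x. indicator (cball (0::real^'a) (R + 1)) x * B)"
      using emeasure_bounded_finite[OF bounded_cball, of "0::real^'a" "R + 1"]
      by (intro integrable_mult_left integrable_real_indicator) auto
    show "AE x in lborel. norm (phase x t * ((\<psi> (x + h n *\<^sub>R ?e) - \<psi> x) /\<^sub>R h n)) \<le> indicator (cball (0::real^'a) (R + 1)) x * B" for n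
    proof (intro always_eventually allI)
      fix x :: "real^'a"
      show "norm (phase x t * ((\<psi> (x + h n *\<^sub>R ?e) - \<psi> x) /\<^sub>R h n)) \<le> indicator (cball (0::real^'a) (R + 1)) x * B"
      proof (cases "norm x > R + 1")
        case True
        have "norm x \<le> norm (x + h n *\<^sub>R ?e) + norm (h n *\<^sub>R ?e)"
          using norm_triangle_ineq4[of "x + h n *\<^sub>R ?e" "h n *\<^sub>R ?e"] by simp
        moreover have "norm (h n *\<^sub>R ?e) \<le> 1" using h[of n] by simp
        ultimately have "\<psi> (x + h n *\<^sub>R ?e) = 0" "\<psi> x = 0" using True R(2) by auto
        then show ?thesis using B(1) by simp
      next
        case False
        have "cmod (\<psi> (x + h n *\<^sub>R ?e) - \<psi> x) / h n \<le> B"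
          using B(2)[of x "h n"] h[of n] by (simp add: divide_le_eq)
        then show ?thesis using False h[of n] by (simp add: norm_mult divide_inverse mult.commute)
      qed
    qed
    show "AE x in lborel. (\<lambda>n. phase x t * ((\<psi> (x + h n *\<^sub>R ?e) - \<psi> x) /\<^sub>R h n)) \<longlonglongrightarrow> phase x t * pdiff i \<psi> x"
    proof (intro always_eventually allI)
      fix x :: "real^'a"
      have "((\<lambda>s. x + s *\<^sub>R ?e) has_derivative (\<lambda>s. s *\<^sub>R ?e)) (at 0)"
        by (auto intro!: derivative_eq_intros)
      from has_derivative_compose[OF this smooth_has_derivative[OF test_funs_smooth[OF \<psi>]]]
      have "((\<lambda>s. \<psi> (x + s *\<^sub>R ?e)) has_derivative (\<lambda>s. s *\<^sub>R pdiff i \<psi> x)) (at 0)"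
        using linear_scale[OF has_derivative_linear[OF smooth_has_derivative[OF test_funs_smooth[OF \<psi>]]]]
        by simp
      then have "(\<lambda>s. norm (\<psi> (x + s *\<^sub>R ?e) - \<psi> x - s *\<^sub>R pdiff i \<psi> x) / norm s) \<midarrow>0\<rightarrow> 0"
        by (simp add: has_derivative_at)
      then have "(\<lambda>s. norm ((\<psi> (x + s *\<^sub>R ?e) - \<psi> x) /\<^sub>R s - pdiff i \<psi> x)) \<midarrow>0\<rightarrow> 0"
      proof (rule Lim_transform_eventually)
        show "\<forall>\<^sub>F s in at 0. norm (\<psi> (x + s *\<^sub>R ?e) - \<psi> x - s *\<^sub>R pdiff i \<psi> x) / norm s =
            norm ((\<psi> (x + s *\<^sub>R ?e) - \<psi> x) /\<^sub>R s - pdiff i \<psi> x)"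
          unfolding eventually_at_filter
        proof (intro always_eventually allI impI)
          fix s :: real assume "s \<noteq> 0"
          then have "(\<psi> (x + s *\<^sub>R ?e) - \<psi> x) /\<^sub>R s - pdiff i \<psi> x =
              (\<psi> (x + s *\<^sub>R ?e) - \<psi> x - s *\<^sub>R pdiff i \<psi> x) /\<^sub>R s"
            by (simp add: scaleR_diff_right)
          then show "norm (\<psi> (x + s *\<^sub>R ?e) - \<psi> x - s *\<^sub>R pdiff i \<psi> x) / norm s =
            norm ((\<psi> (x + s *\<^sub>R ?e) - \<psi> x) /\<^sub>R s - pdiff i \<psi> x)"
            by (simp add: divide_inverse mult.commute)
        qed
      qed
      then have "(\<lambda>s. (\<psi> (x + s *\<^sub>R ?e) - \<psi> x) /\<^sub>R s) \<midarrow>0\<rightarrow> pdiff i \<psi> x"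
        by (rule LIM_zero_cancel[OF tendsto_norm_zero_cancel])
      moreover have "h n \<noteq> 0" for n using h(1)[of n] by simp
      then have "filterlim h (at 0) sequentially"
        using hlim by (simp add: filterlim_at)
      ultimately have "(\<lambda>n. (\<psi> (x + h n *\<^sub>R ?e) - \<psi> x) /\<^sub>R h n) \<longlonglongrightarrow> pdiff i \<psi> x"
        by (rule filterlim_compose)
      then show "(\<lambda>n. phase x t * ((\<psi> (x + h n *\<^sub>R ?e) - \<psi> x) /\<^sub>R h n)) \<longlonglongrightarrow> phase x t * pdiff i \<psi> x"
        by (intro tendsto_intros)
    qed
  qed measurable
  moreover have "(\<integral>x. phase x t * ((\<psi> (x + h n *\<^sub>R ?e) - \<psi> x) /\<^sub>R h n) \<partial>lborel) =
      ((phase (- (h n *\<^sub>R ?e)) t - 1) /\<^sub>R h n) * fourier \<psi> t" for n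
  proof -
    have tr: "translate (- (h n *\<^sub>R ?e)) \<psi> \<in> test_funs" by (rule test_funs_translate[OF \<psi>])
    have "(\<integral>x. phase x t * ((\<psi> (x + h n *\<^sub>R ?e) - \<psi> x) /\<^sub>R h n) \<partial>lborel) =
        (\<integral>x. (phase x t * translate (- (h n *\<^sub>R ?e)) \<psi> x - phase x t * \<psi> x) /\<^sub>R h n \<partial>lborel)"
      by (simp add: translate_def right_diff_distrib)
    also have "\<dots> = (fourier (translate (- (h n *\<^sub>R ?e)) \<psi>) t - fourier \<psi> t) /\<^sub>R h n"
      using integrable_phase[OF test_funs_integrable[OF tr], of t] integrable_phase[OF test_funs_integrable[OF \<psi>], of t]
      unfolding fourier_def by simp
    also have "\<dots> = ((phase (- (h n *\<^sub>R ?e)) t - 1) /\<^sub>R h n) * fourier \<psi> t"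
      unfolding fourier_translate[OF \<psi>] by (simp add: left_diff_distrib)
    finally show ?thesis .
  qed
  ultimately have 1: "(\<lambda>n. ((phase (- (h n *\<^sub>R ?e)) t - 1) /\<^sub>R h n) * fourier \<psi> t) \<longlonglongrightarrow> fourier (pdiff i \<psi>) t"
    unfolding fourier_def[of "pdiff i \<psi>"] by (simp only:)
  have ph: "phase (- (h n *\<^sub>R ?e)) t = cis (h n * (2 * pi * t $ i))" for n
    by (simp add: inner_axis' mult_ac)
  \<comment> \<open>The second order estimate for \<open>cis\<close> differentiates the phase factor
    at zero; the error is at most a constant times \<open>h n\<close>.\<close>
  have "(\<lambda>n. (cis (h n * (2 * pi * t $ i)) - 1) /\<^sub>R h n - \<i> * complex_of_real (2 * pi * t $ i)) \<longlonglongrightarrow> 0"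
  proof (rule Lim_null_comparison)
    show "\<forall>\<^sub>F n in sequentially. norm ((cis (h n * (2 * pi * t $ i)) - 1) /\<^sub>R h n - \<i> * complex_of_real (2 * pi * t $ i))
        \<le> h n * (2 * pi * t $ i)\<^sup>2"
    proof (intro always_eventually allI)
      fix n
      define c where "c = 2 * pi * t $ i"
      define z where "z = cis (h n * c) - (1 + \<i> * complex_of_real (h n * c))"
      have "(cis (h n * c) - 1) /\<^sub>R h n - \<i> * complex_of_real c = z /\<^sub>R h n"
        unfolding z_def using h(1)[of n] by (simp add: scaleR_conv_of_real field_simps)
      then have "norm ((cis (h n * c) - 1) /\<^sub>R h n - \<i> * complex_of_real c) = norm z / h n"
        using h(1)[of n] by (simp add: divide_inverse mult.commute)
      also have "\<dots> \<le> ((h n * c)\<^sup>2 / 2) / h n"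
      proof (rule divide_right_mono)
        show "norm z \<le> (h n * c)\<^sup>2 / 2"
          using iexp_approx1[of "h n * c" 1] by (simp add: z_def cis_conv_exp numeral_2_eq_2)
      qed (rule less_imp_le[OF h(1)])
      also have "((h n * c)\<^sup>2 / 2) / h n = (h n * c\<^sup>2) / 2"
        using h(1)[of n] by (simp add: power2_eq_square)
      also have "\<dots> \<le> h n * c\<^sup>2"
        using h(1)[of n] by simp
      finally show "norm ((cis (h n * (2 * pi * t $ i)) - 1) /\<^sub>R h n - \<i> * complex_of_real (2 * pi * t $ i))
        \<le> h n * (2 * pi * t $ i)\<^sup>2" unfolding c_def .
    qed
    show "(\<lambda>n. h n * (2 * pi * t $ i)\<^sup>2) \<longlonglongrightarrow> 0"
      using tendsto_mult[OF hlim tendsto_const[of "(2 * pi * t $ i)\<^sup>2"]] by simp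
  qed
  then have "(\<lambda>n. ((phase (- (h n *\<^sub>R ?e)) t - 1) /\<^sub>R h n) * fourier \<psi> t) \<longlonglongrightarrow> (\<i> * complex_of_real (2 * pi * t $ i)) * fourier \<psi> t"
    unfolding ph by (intro tendsto_mult tendsto_const) (rule LIM_zero_cancel)
  from LIMSEQ_unique[OF 1 this] show ?thesis by (simp add: mult_ac)
qed

text \<open>A factor \<open>t $ i\<close> is paid for by passing to \<open>pdiff i \<psi>\<close>,
  again a test function, and \<open>norm t\<close> is at most the sum of the absolute coordinates.
  Each further power therefore follows from the preceding one for \<open>\<psi>\<close> and its
  partial derivatives.\<close>

lemma fourier_decay:
  assumes "\<psi> \<in> test_funs"
  shows "\<exists>C. \<forall>t. (1 + norm t) ^ k * cmod (fourier \<psi> t) \<le> C"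
  using assms
proof (induction k arbitrary: \<psi>)
  case 0
  then show ?case using cmod_fourier_le by auto
next
  case (Suc k)
  obtain C where C: "\<And>t. (1 + norm t) ^ k * cmod (fourier \<psi> t) \<le> C"
    using Suc.IH[OF Suc.prems] by blast
  have "\<forall>i. \<exists>C. \<forall>t. (1 + norm t) ^ k * cmod (fourier (pdiff i \<psi>) t) \<le> C"
    using Suc.IH[OF test_funs_pdiff[OF Suc.prems]] by blast
  from choice[OF this] obtain D where D: "\<And>i t. (1 + norm t) ^ k * cmod (fourier (pdiff i \<psi>) t) \<le> D i"
    by blast
  have "(1 + norm t) ^ Suc k * cmod (fourier \<psi> t) \<le> C + (\<Sum>i\<in>UNIV. D i)" for t
  proof -
    have coord: "(1 + norm t) ^ k * (\<bar>t $ i\<bar> * cmod (fourier \<psi> t)) \<le> D i" for i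
    proof -
      have "cmod (fourier (pdiff i \<psi>) t) = 2 * pi * (\<bar>t $ i\<bar> * cmod (fourier \<psi> t))"
        unfolding fourier_pdiff[OF Suc.prems] by (simp add: norm_mult)
      moreover have "1 * (\<bar>t $ i\<bar> * cmod (fourier \<psi> t)) \<le> 2 * pi * (\<bar>t $ i\<bar> * cmod (fourier \<psi> t))"
        using pi_gt3 by (intro mult_right_mono) auto
      ultimately have "\<bar>t $ i\<bar> * cmod (fourier \<psi> t) \<le> cmod (fourier (pdiff i \<psi>) t)" by simp
      then have "(1 + norm t) ^ k * (\<bar>t $ i\<bar> * cmod (fourier \<psi> t)) \<le> (1 + norm t) ^ k * cmod (fourier (pdiff i \<psi>) t)"
        by (intro mult_left_mono) auto
      then show ?thesis using D[of t i] by linarith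
    qed
    have "(1 + norm t) ^ Suc k * cmod (fourier \<psi> t) =
        (1 + norm t) ^ k * cmod (fourier \<psi> t) + norm t * ((1 + norm t) ^ k * cmod (fourier \<psi> t))"
      by (simp add: algebra_simps)
    also have "\<dots> \<le> C + (\<Sum>i\<in>UNIV. \<bar>t $ i\<bar>) * ((1 + norm t) ^ k * cmod (fourier \<psi> t))"
      by (intro add_mono C mult_right_mono norm_le_l1_cart) auto
    also have "\<dots> = C + (\<Sum>i\<in>UNIV. (1 + norm t) ^ k * (\<bar>t $ i\<bar> * cmod (fourier \<psi> t)))"
      by (simp add: sum_distrib_left sum_distrib_right mult_ac)
    also have "\<dots> \<le> C + (\<Sum>i\<in>UNIV. D i)"
      by (intro add_mono order_refl sum_mono coord)
    finally show ?thesis .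
  qed
  then show ?case by blast
qed

text \<open>Tempered measures integrate Schwartz functions by definition; membership in this class
  is what makes the integrals against the representing measures exist.\<close>

lemma fourier_schwartz:
  assumes "\<phi> \<in> test_funs"
  shows "fourier \<phi> \<in> schwartz"
proof -
  have "bounded (range (\<lambda>x. complex_of_real ((1 + norm x) ^ k) * ipartial is (fourier \<phi>) x))" for "is" k
  proof -
    obtain \<psi> where \<psi>: "\<psi> \<in> test_funs" "ipartial is (fourier \<phi>) = fourier \<psi>"
      using ipartial_fourier[OF assms] by blast
    obtain C where C: "\<And>t. (1 + norm t) ^ k * cmod (fourier \<psi> t) \<le> C"
      using fourier_decay[OF \<psi>(1)] by blast
    have "cmod (complex_of_real ((1 + norm t) ^ k) * fourier \<psi> t) = (1 + norm t) ^ k * cmod (fourier \<psi> t)" for t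
      by (simp add: norm_mult norm_power flip: of_real_power)
    then show ?thesis
      unfolding \<psi>(2) bounded_iff using C by (intro exI[of _ C]) auto
  qed
  then show ?thesis using smooth_fourier[OF assms] by (simp add: schwartz_def)
qed

lemma borel_measurable_cnj [measurable]:
  assumes "f \<in> borel_measurable N" shows "(\<lambda>x. cnj (f x)) \<in> borel_measurable N"
  by (rule borel_measurable_continuous_on[OF _ assms]) (intro continuous_intros)

text \<open>Fubini, then the substitution \<open>x = y - z\<close>, under which the phase splits
  into a factor for \<open>y\<close> and a conjugate factor for \<open>z\<close>.\<close>

lemma fourier_convolution:
  assumes \<phi>: "\<phi> \<in> test_funs" and \<psi>: "\<psi> \<in> test_funs"
  shows "fourier (convol \<phi> (tilde \<psi>)) t = fourier \<phi> t * cnj (fourier \<psi> t)"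
proof -
  note [measurable] = test_funs_measurable[OF \<phi>] test_funs_measurable[OF \<psi>]
  let ?k = "\<lambda>y x. phase x t * (\<phi> y * cnj (\<psi> (y - x)))"
  have inner: "integrable lborel (\<lambda>x. \<psi> (y - x))" for y
    using test_funs_integrable[OF test_funs_affine[OF \<psi>, of "-1" y]] by simp
  have int: "integrable (lborel \<Otimes>\<^sub>M lborel) (case_prod ?k)"
  proof (rule lborel_pair.Fubini_integrable)
    show "case_prod ?k \<in> borel_measurable (lborel \<Otimes>\<^sub>M lborel)"
      by measurable
    have "(\<integral>x. cmod (\<psi> (y - x)) \<partial>lborel) = (\<integral>x. cmod (\<psi> x) \<partial>lborel)" for y
      by (rule integral_reflect) measurable
    then have "(\<integral>x. norm (case (y, x) of (y, x) \<Rightarrow> ?k y x) \<partial>lborel) = cmod (\<phi> y) * (\<integral>x. cmod (\<psi> x) \<partial>lborel)" for y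
      by (simp add: norm_mult)
    then show "integrable lborel (\<lambda>y. \<integral>x. norm (case (y, x) of (y, x) \<Rightarrow> ?k y x) \<partial>lborel)"
      using integrable_norm[OF test_funs_integrable[OF \<phi>]] by simp
    have "integrable lborel (\<lambda>x. ?k y x)" for y
      by (intro integrable_phase integrable_mult_right integrable_cnj inner)
    then show "AE y in lborel. integrable lborel (\<lambda>x. case (y, x) of (y, x) \<Rightarrow> ?k y x)" by simp
  qed
  have "fourier (convol \<phi> (tilde \<psi>)) t = (\<integral>x. (\<integral>y. ?k y x \<partial>lborel) \<partial>lborel)"
    unfolding fourier_def convol_def tilde_def by simp
  also have "\<dots> = (\<integral>y. (\<integral>x. ?k y x \<partial>lborel) \<partial>lborel)"
    using lborel_pair.Fubini_integral[OF int] by simp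
  also have "\<dots> = (\<integral>y. phase y t * \<phi> y * cnj (fourier \<psi> t) \<partial>lborel)"
  proof (rule Bochner_Integration.integral_cong[OF refl])
    fix y :: "real^'a"
    have "(\<integral>x. ?k y x \<partial>lborel) = (\<integral>z. ?k y (y - z) \<partial>lborel)"
      by (rule integral_reflect[symmetric]) measurable
    also have "\<dots> = (\<integral>z. (phase y t * \<phi> y) * cnj (phase z t * \<psi> z) \<partial>lborel)"
    proof (rule Bochner_Integration.integral_cong[OF refl])
      fix z :: "real^'a"
      have "phase (y - z) t = phase y t * cnj (phase z t)"
        by (simp add: cis_cnj cis_mult inner_diff_left algebra_simps)
      then show "?k y (y - z) = (phase y t * \<phi> y) * cnj (phase z t * \<psi> z)"
        by simp
    qed
    also have "\<dots> = (phase y t * \<phi> y) * cnj (fourier \<psi> t)"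
      unfolding fourier_def Bochner_Integration.integral_cnj[symmetric] by simp
    finally show "(\<integral>x. ?k y x \<partial>lborel) = phase y t * \<phi> y * cnj (fourier \<psi> t)" .
  qed
  also have "\<dots> = fourier \<phi> t * cnj (fourier \<psi> t)"
    unfolding fourier_def by simp
  finally show ?thesis .
qed

text \<open>A test function supported in the ball of radius \<open>1 / (n + 1)\<close>, on which the real part of the
  Fourier kernel is positive if \<open>n\<close> is large compared with \<open>t\<close>.\<close>

definition small_bump :: "nat \<Rightarrow> real^'d::finite \<Rightarrow> complex" where
  "small_bump n x = bump (real (Suc n) *\<^sub>R x)"

lemma small_bump_test_fun: "small_bump n \<in> test_funs"
  unfolding small_bump_def[abs_def] using test_funs_affine[OF bump_test_fun, of "real (Suc n)" 0] by simp

lemma fourier_small_bump: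
  "\<exists>n. fourier (small_bump n) t \<noteq> 0" for t :: "real^'d::finite"
proof -
  \<comment> \<open>On the support of the bump \<open>n * norm x \<le> 1\<close>, so
    \<open>\<bar>x \<bullet> t\<bar>\<close> is at most \<open>1/8\<close>. Any value below
    \<open>1/4\<close> keeps the phase within \<open>pi / 2\<close> and its cosine positive.\<close>
  obtain n :: nat where n: "8 * norm t < real n" using reals_Archimedean2 by blast
  let ?b = "\<lambda>x::real^'d. flat 0 (1 - (real (Suc n) *\<^sub>R x) \<bullet> (real (Suc n) *\<^sub>R x))"
  have b: "small_bump n x = complex_of_real (?b x)" for x by (simp add: small_bump_def bump_def)
  let ?f = "\<lambda>x. cos (- 2 * pi * (x \<bullet> t)) * ?b x"
  have int: "integrable lborel (\<lambda>x. phase x t * small_bump n x)"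
    by (intro integrable_phase test_funs_integrable small_bump_test_fun)
  have Re: "Re (phase x t * small_bump n x) = ?f x" for x by (simp add: b)
  have intf: "integrable lborel ?f"
    using integrable_Re[OF int] unfolding Re .
  have pos: "0 \<le> ?f x" "?b x > 0 \<Longrightarrow> ?f x > 0" for x
  proof -
    have "?f x > 0" if "?b x > 0"
    proof -
      have "(real (Suc n) *\<^sub>R x) \<bullet> (real (Suc n) *\<^sub>R x) < 1"
        using that by (simp add: flat_def split: if_splits)
      then have "norm (real (Suc n) *\<^sub>R x) < 1"
        unfolding power2_norm_eq_inner[symmetric] by (simp add: power_less_one_iff)
      then have "norm x + real n * norm x < 1" by (simp add: distrib_right)
      then have "real n * norm x \<le> 1" using norm_ge_zero[of x] by linarith
      moreover have "8 * norm t * norm x \<le> real n * norm x"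
        using n by (intro mult_right_mono) auto
      moreover have "\<bar>x \<bullet> t\<bar> \<le> norm t * norm x"
        using Cauchy_Schwarz_ineq2[of x t] by (simp add: mult.commute)
      ultimately have "\<bar>x \<bullet> t\<bar> < 1/4" by linarith
      then have "2 * pi * \<bar>x \<bullet> t\<bar> < 2 * pi * (1/4)" by (intro mult_strict_left_mono) auto
      moreover have "\<bar>- 2 * pi * (x \<bullet> t)\<bar> = 2 * pi * \<bar>x \<bullet> t\<bar>" by (simp add: abs_mult)
      ultimately have "\<bar>- 2 * pi * (x \<bullet> t)\<bar> < pi / 2" by linarith
      then have "- (pi / 2) < - 2 * pi * (x \<bullet> t)" "- 2 * pi * (x \<bullet> t) < pi / 2" by linarith+
      then have "cos (- 2 * pi * (x \<bullet> t)) > 0" by (rule cos_gt_zero_pi)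
      then show ?thesis using that by (rule mult_pos_pos)
    qed
    then show "?b x > 0 \<Longrightarrow> ?f x > 0" .
    moreover have "?b x \<ge> 0" by (simp add: flat_def)
    ultimately show "0 \<le> ?f x" by (metis less_eq_real_def mult_zero_right)
  qed
  have "(\<integral>x. ?f x \<partial>lborel) \<noteq> 0"
  proof
    assume "(\<integral>x. ?f x \<partial>lborel) = 0"
    then have "AE x in lborel. ?f x = 0"
      using integral_nonneg_eq_0_iff_AE[OF intf] pos(1) by simp
    \<comment> \<open>A nonnegative function with integral zero vanishes almost everywhere, but this
      one is positive on a ball.\<close>
    then have ae: "AE x in lborel. \<not> (x \<in> ball (0::real^'d) (1 / real (Suc n)))"
    proof eventually_elim
      case (elim x)
      have "\<not> ?b x > 0" using elim pos(2)[of x] by linarith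
      show ?case
      proof
        assume "x \<in> ball 0 (1 / real (Suc n))"
        then have "norm (real (Suc n) *\<^sub>R x) < 1"
          by (simp add: divide_simps mult.commute)
        then have "(norm (real (Suc n) *\<^sub>R x))\<^sup>2 < 1" by (intro power_less_one_iff[THEN iffD2]) auto
        then show False
          using \<open>\<not> ?b x > 0\<close> unfolding power2_norm_eq_inner by (simp add: flat_def)
      qed
    qed
    have "emeasure lborel (ball (0::real^'d) (1 / real (Suc n))) = 0"
      using ae by (subst (asm) AE_iff_measurable[OF _ refl]) (auto simp: ball_def)
    then have "negligible (ball (0::real^'d) (1 / real (Suc n)))"
      by (intro null_sets_completionI negligible_iff_null_sets[THEN iffD2] null_setsI) auto
    then show False using open_not_negligible[of "ball (0::real^'d) (1 / real (Suc n))"] by simp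
  qed
  moreover have "Re (fourier (small_bump n) t) = (\<integral>x. ?f x \<partial>lborel)"
    unfolding fourier_def integral_Re[OF int, symmetric] Re ..
  ultimately show ?thesis by (metis zero_complex.sel(1))
qed

subsection \<open>Uniqueness of Fourier transforms\<close>

text \<open>The functions obtained from the characters by linear combinations and bounded pointwise limits.
  They form an algebra and include \<open>exp(-exp(-s(t\<^sub>i - a)))\<close>, hence the indicators of half-spaces.\<close>

inductive trig :: "(real^'d::finite \<Rightarrow> complex) \<Rightarrow> bool" where
  char: "trig (phase x)"
| add: "trig f \<Longrightarrow> trig g \<Longrightarrow> trig (\<lambda>t. f t + g t)"
| scale: "trig f \<Longrightarrow> trig (\<lambda>t. c * f t)"
| lim: "(\<And>n::nat. trig (f n)) \<Longrightarrow> (\<And>n t. cmod (f n t) \<le> B) \<Longrightarrow> (\<And>t. (\<lambda>n. f n t) \<longlonglongrightarrow> g t) \<Longrightarrow> trig g"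

lemma trig_bounded: "trig f \<Longrightarrow> \<exists>B. \<forall>t. cmod (f t) \<le> B"
proof (induction rule: trig.induct)
  case (char x)
  show ?case by (intro exI[of _ 1]) simp
next
  case (add f g)
  then obtain A B where "\<And>t. cmod (f t) \<le> A" "\<And>t. cmod (g t) \<le> B" by blast
  then show ?case by (intro exI[of _ "A + B"] allI) (meson add_mono norm_triangle_le)
next
  case (scale f c)
  then obtain A where "\<And>t. cmod (f t) \<le> A" by blast
  then show ?case by (intro exI[of _ "cmod c * A"]) (simp add: norm_mult mult_left_mono)
next
  case (lim f B g)
  have "cmod (g t) \<le> B" for t
    by (rule LIMSEQ_le_const2[OF tendsto_norm[OF lim(3)[of t]]]) (use lim(2) in blast)
  then show ?case by blast
qed

lemma trig_measurable: "trig f \<Longrightarrow> f \<in> borel_measurable borel"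
proof (induction rule: trig.induct)
  case (lim f B g)
  then show ?case by (intro borel_measurable_LIMSEQ_metric[of f borel g]) auto
qed (auto intro!: borel_measurable_continuous_onI continuous_intros)

text \<open>The inner induction treats the product with a fixed character, the outer one an
  arbitrary first factor. In its limit case \<open>trig_bounded\<close> supplies the uniform bound
  for the products.\<close>

lemma trig_mult:
  assumes f: "trig f" and g: "trig g"
  shows "trig (\<lambda>t. f t * g t)"
  using f
proof (induction rule: trig.induct)
  case (char x)
  show ?case
    using g
  proof (induction rule: trig.induct)
    case (char y)
    have "(\<lambda>t. phase x t * phase y t) = phase (x + y)"
      by (intro ext) (rule phase_add[symmetric])
    then show ?case using trig.char by metis
  next
    case (add f g)
    from trig.add[OF add.IH] show ?case by (simp add: algebra_simps)
  next
    case (scale f c)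
    from trig.scale[OF scale.IH, of c] show ?case by (simp add: mult.left_commute)
  next
    case (lim f B g)
    show ?case
    proof (rule trig.lim[of "\<lambda>n t. phase x t * f n t" B])
      show "cmod (phase x t * f n t) \<le> B" for n t using lim.hyps(2)[of n t] by (simp add: norm_mult)
      show "(\<lambda>n. phase x t * f n t) \<longlonglongrightarrow> phase x t * g t" for t
        by (intro tendsto_mult tendsto_const lim.hyps(3))
    qed (rule lim.IH)
  qed
next
  case (add f1 f2)
  from trig.add[OF add.IH] show ?case by (simp add: algebra_simps)
next
  case (scale f c)
  from trig.scale[OF scale.IH, of c] show ?case by (simp add: mult.assoc)
next
  case (lim f B h)
  obtain A where A: "\<And>t. cmod (g t) \<le> A" using trig_bounded[OF g] by blast
  show ?case
  proof (rule trig.lim[of "\<lambda>n t. f n t * g t" "B * A"])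
    show "cmod (f n t * g t) \<le> B * A" for n t
      unfolding norm_mult using lim.hyps(2)[of n t] A[of t]
      by (intro mult_mono) (auto intro: order_trans[OF norm_ge_zero])
    show "(\<lambda>n. f n t * g t) \<longlonglongrightarrow> h t * g t" for t
      by (intro tendsto_mult tendsto_const lim.hyps(3))
  qed (rule lim.IH)
qed

lemma trig_one: "trig (\<lambda>t. 1)"
  using trig.char[of 0] by simp

lemma trig_const: "trig (\<lambda>t. c)"
  using trig.scale[OF trig_one, of c] by simp

lemma trig_diff: "trig f \<Longrightarrow> trig g \<Longrightarrow> trig (\<lambda>t. f t - g t)"
  using trig.add[OF _ trig.scale[of g "-1"], of f] by simp

lemma trig_power: "trig f \<Longrightarrow> trig (\<lambda>t. f t ^ n)"
  by (induction n) (auto intro: trig_one trig_mult)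

lemma trig_sum: "(\<And>k. trig (f k)) \<Longrightarrow> trig (\<lambda>t. \<Sum>k<(n::nat). f k t)"
proof (induction n)
  case 0
  show ?case using trig_const[of 0] by simp
next
  case (Suc n)
  from trig.add[OF Suc.IH[OF Suc.prems] Suc.prems[of n]] show ?case by simp
qed

lemma trig_exp:
  assumes f: "trig f"
  shows "trig (\<lambda>t. exp (f t))"
proof -
  obtain A where A: "\<And>t. cmod (f t) \<le> A" using trig_bounded[OF f] by blast
  have A0: "A \<ge> 0" using order_trans[OF norm_ge_zero A] .
  show ?thesis
  \<comment> \<open>The partial sums of the exponential series are bounded by \<open>exp A\<close>,
    uniformly in \<open>n\<close> and \<open>t\<close>.\<close>
  proof (rule trig.lim[of "\<lambda>n t. \<Sum>k<n. (1 / fact k) * f t ^ k" "exp A"])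
    show "trig (\<lambda>t. \<Sum>k<n. (1 / fact k) * f t ^ k)" for n
      by (intro trig_sum trig.scale trig_power f)
    show "cmod (\<Sum>k<n. (1 / fact k) * f t ^ k) \<le> exp A" for n t
    proof -
      have "cmod (\<Sum>k<n. (1 / fact k) * f t ^ k) \<le> (\<Sum>k<n. inverse (fact k) *\<^sub>R A ^ k)"
      proof (rule sum_norm_le)
        fix k
        have "cmod (f t) ^ k \<le> A ^ k" using A by (intro power_mono) auto
        then show "cmod ((1 / fact k) * f t ^ k) \<le> inverse (fact k) *\<^sub>R A ^ k"
          by (simp add: norm_mult norm_divide norm_power norm_inverse norm_fact divide_inverse mult_left_mono)
      qed
      also have "\<dots> \<le> (\<Sum>k. inverse (fact k) *\<^sub>R A ^ k)"
        using A0 by (intro sum_le_suminf summable_exp_generic) auto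
      finally show ?thesis by (simp add: exp_def)
    qed
    show "(\<lambda>n. \<Sum>k<n. (1 / fact k) * f t ^ k) \<longlonglongrightarrow> exp (f t)" for t
      using exp_converges[of "f t"] unfolding sums_def
      by (simp add: scaleR_conv_of_real divide_inverse)
  qed
qed

text \<open>A coordinate is unbounded and therefore out of reach of bounded limits. The functions
  \<open>f n\<close> converge to it, and composing them with the bounded continuous
  \<open>g s\<close> before the passage to the limit provides the uniform bound.\<close>

lemma trig_halfspace:
  fixes i :: "'d::finite"
  shows "trig (\<lambda>t::real^'d. of_bool (a < t $ i))"
proof -
  define f where "f n t = real (Suc n) * sin (t $ i / real (Suc n))" for n and t :: "real^'d"
  have f_lim: "(\<lambda>n. f n t) \<longlonglongrightarrow> t $ i" for t
  proof -
    let ?c = "t $ i"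
    have "((\<lambda>x. sin (?c * x)) has_real_derivative ?c) (at 0)"
      by (auto intro!: derivative_eq_intros)
    then have "(\<lambda>h. (sin (?c * (0 + h)) - sin (?c * 0)) / h) \<midarrow>0\<rightarrow> ?c"
      unfolding DERIV_def .
    moreover have "filterlim (\<lambda>n. inverse (real (Suc n))) (at 0) sequentially"
      using LIMSEQ_inverse_real_of_nat by (simp add: filterlim_at)
    ultimately have "(\<lambda>n. (sin (?c * (0 + inverse (real (Suc n)))) - sin (?c * 0)) / inverse (real (Suc n))) \<longlonglongrightarrow> ?c"
      by (rule filterlim_compose)
    then show ?thesis
      by (simp add: f_def divide_inverse mult.commute)
  qed
  have sin_trig: "trig (\<lambda>t. complex_of_real (f n t))" for n
  proof -
    define x :: "real^'d" where "x = axis i (1 / (2 * pi * real (Suc n)))"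
    have ph: "phase x t = cis (- (t $ i / real (Suc n)))" "phase (- x) t = cis (t $ i / real (Suc n))" for t
      by (simp_all add: x_def inner_axis')
    have "complex_of_real (f n t) = (real (Suc n) / (2 * \<i>)) * (phase (- x) t - phase x t)" for t
      unfolding ph f_def by (simp add: complex_eq_iff Re_divide Im_divide)
    then show ?thesis
      by (simp only:) (intro trig.scale trig_diff trig.char)
  qed
  define g where "g s u = exp (- exp (- (real s * (u - a))))" for s :: nat and u :: real
  have g_bound: "0 \<le> g s u" "g s u \<le> 1" for s u by (simp_all add: g_def)
  have "trig (\<lambda>t. complex_of_real (g s (f n t)))" for s n
  proof -
    have "trig (\<lambda>t. exp ((-1) * exp ((- of_nat s) * (complex_of_real (f n t) - complex_of_real a))))"
      by (intro trig_exp trig.scale trig_diff sin_trig trig_const)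
    moreover have "exp ((-1) * exp ((- of_nat s) * (complex_of_real (f n t) - complex_of_real a))) =
        complex_of_real (g s (f n t))" for t
      by (simp add: g_def flip: exp_of_real)
    ultimately show ?thesis by simp
  qed
  then have 1: "trig (\<lambda>t. complex_of_real (g s (t $ i)))" for s
  proof (rule trig.lim[where B = 1])
    show "cmod (complex_of_real (g s (f n t))) \<le> 1" for n t using g_bound by simp
    show "(\<lambda>n. complex_of_real (g s (f n t))) \<longlonglongrightarrow> complex_of_real (g s (t $ i))" for t
      unfolding g_def by (intro tendsto_intros f_lim)
  qed
  \<comment> \<open>This is the limit of \<open>g s\<close> for large \<open>s\<close>. It is the
    step function except for the value \<open>exp (-1)\<close> at the boundary, which powers of
    \<open>h\<close> remove, leaving the open half-space.\<close>
  define h where "h u = (if a < u then 1 else if u = a then exp (-1) else (0::real))" for u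
  have "(\<lambda>s. g s u) \<longlonglongrightarrow> h u" for u
  proof -
    consider "a < u" | "u = a" | "u < a" by linarith
    then show ?thesis
    proof cases
      case 1
      have "(\<lambda>s. exp (- exp (- (real s * (u - a))))) \<longlonglongrightarrow> exp (- 0)"
        using 1 by (intro tendsto_intros filterlim_compose[OF exp_at_bot]) real_asymp
      then show ?thesis using 1 by (simp add: g_def h_def)
    next
      case 2
      then show ?thesis by (simp add: g_def h_def)
    next
      case 3
      have "(\<lambda>s. exp (- exp (real s * (a - u)))) \<longlonglongrightarrow> 0"
        using 3 by real_asymp
      then show ?thesis using 3 by (simp add: g_def h_def algebra_simps)
    qed
  qed
  then have "(\<lambda>s. complex_of_real (g s u)) \<longlonglongrightarrow> complex_of_real (h u)" for u by (rule tendsto_of_real)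
  then have 2: "trig (\<lambda>t. complex_of_real (h (t $ i)))"
    using g_bound by (intro trig.lim[OF 1, where B = 1]) simp_all
  have h_bound: "0 \<le> h u" "h u \<le> 1" for u by (simp_all add: h_def)
  have "(\<lambda>n. h u ^ n) \<longlonglongrightarrow> of_bool (a < u)" for u
  proof -
    have "norm (exp (-1::real)) < 1" by simp
    then have "(\<lambda>n. exp (-1::real) ^ n) \<longlonglongrightarrow> 0" by (rule LIMSEQ_power_zero)
    moreover have "(\<lambda>n. (0::real) ^ n) \<longlonglongrightarrow> 0" by (rule LIMSEQ_power_zero) simp
    ultimately show ?thesis by (auto simp: h_def)
  qed
  then have hl: "(\<lambda>n. complex_of_real (h u ^ n)) \<longlonglongrightarrow> complex_of_real (of_bool (a < u))" for u by (rule tendsto_of_real)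
  have lim: "(\<lambda>n. complex_of_real (h u) ^ n) \<longlonglongrightarrow> of_bool (a < u)" for u
    using hl[of u] by (cases "a < u") simp_all
  show ?thesis
  proof (rule trig.lim[of "\<lambda>n t. complex_of_real (h (t $ i)) ^ n" 1])
    show "cmod (complex_of_real (h (t $ i)) ^ n) \<le> 1" for n and t :: "real^'d"
      using h_bound by (simp add: norm_power power_le_one)
  qed (intro trig_power 2 lim)+
qed

text \<open>Products, complements to one and bounded limits of indicators make the sets with
  indicator in \<open>trig\<close> a \<sigma>-algebra, and half-spaces generate the Borel
  sets.\<close>

lemma trig_indicator:
  assumes "A \<in> sets (borel :: (real^'d::finite) measure)"
  shows "trig (\<lambda>t. of_bool (t \<in> A))"
proof -
  define S where "S = {A :: (real^'d) set. trig (\<lambda>t. of_bool (t \<in> A))}"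
  have comp: "- A \<in> S" if "A \<in> S" for A
  proof -
    have "trig (\<lambda>t. 1 - of_bool (t \<in> A))"
      using that by (intro trig_diff trig_one) (simp add: S_def)
    moreover have "1 - of_bool (t \<in> A) = (of_bool (t \<in> - A) :: complex)" for t by simp
    ultimately show ?thesis by (simp add: S_def)
  qed
  have inter: "A \<inter> B \<in> S" if "A \<in> S" "B \<in> S" for A B
  proof -
    have "trig (\<lambda>t. of_bool (t \<in> A) * of_bool (t \<in> B))"
      using that by (intro trig_mult) (simp_all add: S_def)
    moreover have "of_bool (t \<in> A) * of_bool (t \<in> B) = (of_bool (t \<in> A \<inter> B) :: complex)" for t by simp
    ultimately show ?thesis by (simp add: S_def)
  qed
  have empty: "{} \<in> S" using trig_const[of 0] by (simp add: S_def)
  have union: "A \<union> B \<in> S" if "A \<in> S" "B \<in> S" for A B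
    using comp[OF inter[OF comp[OF that(1)] comp[OF that(2)]]] by simp
  have Union: "(\<Union>i. A i) \<in> S" if A: "\<And>i. A i \<in> S" for A :: "nat \<Rightarrow> (real^'d) set"
  proof -
    have "(\<Union>i<n. A i) \<in> S" for n
      by (induction n) (auto simp: empty lessThan_Suc intro!: union A)
    then have tr: "trig (\<lambda>t. of_bool (t \<in> (\<Union>i<n. A i)))" for n by (simp add: S_def)
    have "trig (\<lambda>t. of_bool (t \<in> (\<Union>i. A i)))"
    proof (rule trig.lim[OF tr, where B = 1])
      show "(\<lambda>n. of_bool (t \<in> (\<Union>i<n. A i))) \<longlonglongrightarrow> (of_bool (t \<in> (\<Union>i. A i)) :: complex)" for t
      proof (cases "t \<in> (\<Union>i. A i)")
        case True
        then obtain i where i: "t \<in> A i" by blast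
        have "\<forall>\<^sub>F n in sequentially. of_bool (t \<in> (\<Union>i. A i)) = (of_bool (t \<in> (\<Union>i<n. A i)) :: complex)"
          by (rule eventually_mono[OF eventually_gt_at_top[of i]]) (use i in auto)
        then show ?thesis by (rule Lim_transform_eventually[OF tendsto_const])
      qed auto
    qed auto
    then show ?thesis by (simp add: S_def)
  qed
  have half: "{x. a < x \<bullet> b} \<in> S" if b: "b \<in> Basis" for a and b :: "real^'d"
  proof -
    obtain i where "b = axis i 1" using b by (auto simp: Basis_vec_def)
    then show ?thesis using trig_halfspace[of a i] by (simp add: S_def inner_axis)
  qed
  have "A \<in> sigma_sets UNIV ((\<lambda>(a, i). {x::real^'d. a < x \<bullet> i}) ` (UNIV \<times> Basis))"
    using assms by (subst (asm) borel_eq_halfspace_greater) simp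
  then have "A \<in> S"
  proof (induction rule: sigma_sets.induct)
    case (Basic a)
    then show ?case using half by auto
  next
    case (Compl a)
    then show ?case using comp by (simp add: Compl_eq_Diff_UNIV)
  qed (auto intro: empty Union)
  then show ?thesis by (simp add: S_def)
qed

text \<open>The integral of \<open>f t * g t\<close> is linear in \<open>f\<close> and, by dominated
  convergence with majorant \<open>B * cmod (g t)\<close>, respects bounded limits. It vanishes on
  characters, hence on \<open>trig\<close>, hence on indicators of Borel sets.\<close>

lemma fourier_unique:
  fixes \<nu> :: "(real^'d::finite) measure"
  assumes "sigma_finite_measure \<nu>" and sets: "sets \<nu> = sets borel" and g: "integrable \<nu> g"
    and zero: "\<And>x. (\<integral>t. phase x t * g t \<partial>\<nu>) = 0"
  shows "AE t in \<nu>. g t = 0"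
proof (rule sigma_finite_measure.density_zero[OF assms(1) g])
  have meas: "f \<in> borel_measurable \<nu>" if "trig f" for f
    using trig_measurable[OF that] measurable_cong_sets[OF sets refl] by blast
  have int: "integrable \<nu> (\<lambda>t. f t * g t)" if "trig f" for f
  proof -
    obtain B where B: "\<And>t. cmod (f t) \<le> B" using trig_bounded[OF \<open>trig f\<close>] by blast
    show ?thesis
    proof (rule Bochner_Integration.integrable_bound)
      show "integrable \<nu> (\<lambda>t. complex_of_real B * g t)" using g by simp
      show "(\<lambda>t. f t * g t) \<in> borel_measurable \<nu>"
        using meas[OF that] g by measurable
      have "cmod (f t * g t) \<le> cmod (complex_of_real B * g t)" for t
        unfolding norm_mult using B[of t] by (intro mult_right_mono) auto
      then show "AE t in \<nu>. cmod (f t * g t) \<le> cmod (complex_of_real B * g t)" by simp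
    qed
  qed
  have trig0: "(\<integral>t. f t * g t \<partial>\<nu>) = 0" if "trig f" for f
    using that
  proof (induction rule: trig.induct)
    case (char x)
    show ?case by (rule zero)
  next
    case (add f1 f2)
    then show ?case using int by (simp add: distrib_right)
  next
    case (lim f B h)
    have "(\<lambda>n. \<integral>t. f n t * g t \<partial>\<nu>) \<longlonglongrightarrow> (\<integral>t. h t * g t \<partial>\<nu>)"
    proof (rule integral_dominated_convergence)
      show "integrable \<nu> (\<lambda>t. B * cmod (g t))" using g by simp
      show "AE t in \<nu>. cmod (f n t * g t) \<le> B * cmod (g t)" for n
        using lim.hyps(2) by (simp add: norm_mult mult_right_mono)
      show "AE t in \<nu>. (\<lambda>n. f n t * g t) \<longlonglongrightarrow> h t * g t"
        by (intro always_eventually allI tendsto_mult tendsto_const lim.hyps(3))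
      have h: "trig h" by (rule trig.lim[OF lim.hyps])
      show "(\<lambda>t. h t * g t) \<in> borel_measurable \<nu>" using meas[OF h] g by measurable
      show "(\<lambda>t. f n t * g t) \<in> borel_measurable \<nu>" for n using meas[OF lim.hyps(1)] g by measurable
    qed
    then show ?case using lim.IH by (simp add: LIMSEQ_const_iff)
  qed (simp add: mult.assoc)
  fix A assume "A \<in> sets \<nu>"
  then have "(\<integral>t. of_bool (t \<in> A) * g t \<partial>\<nu>) = 0"
    using trig0[OF trig_indicator] sets by blast
  moreover have "indicator A t *\<^sub>R g t = of_bool (t \<in> A) * g t" for t
    by (cases "t \<in> A") auto
  ultimately show "set_lebesgue_integral \<nu> A g = 0"
    unfolding set_lebesgue_integral_def by simp
qed

section \<open>The concrete spaces\<close>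

lemma rep_quotient:
  assumes "equiv S r" "p \<in> S // r"
  shows "rep p \<in> S" "r `` {rep p} = p"
proof -
  obtain x where x: "x \<in> S" "p = r `` {x}" using assms(2) by (rule quotientE)
  then have "x \<in> p" using equiv_class_self[OF assms(1)] by blast
  then have "rep p \<in> p" unfolding rep_def by (rule someI)
  then have xr: "(x, rep p) \<in> r" using x by blast
  then show "rep p \<in> S" using equivE[OF assms(1)] x by (metis equiv_class_eq_iff assms(1))
  show "r `` {rep p} = p" using equiv_class_eq[OF assms(1) xr] x by simp
qed

lemma rep_class:
  assumes "equiv S r" "f \<in> S"
  shows "r `` {f} \<in> S // r" "(rep (r `` {f}), f) \<in> r"
proof -
  show q: "r `` {f} \<in> S // r" by (rule quotientI[OF assms(2)])
  have "r `` {rep (r `` {f})} = r `` {f}" "rep (r `` {f}) \<in> S" by (rule rep_quotient[OF assms(1) q])+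
  then show "(rep (r `` {f}), f) \<in> r" using eq_equiv_class[OF _ assms(1) assms(2)] by blast
qed

lemma equiv_AE:
  assumes "\<And>f g. (f, g) \<in> r \<longleftrightarrow> f \<in> S \<and> g \<in> S \<and> (AE x in N. K f x = K g x)"
  shows "equiv S r"
proof (rule equivI)
  show "r \<subseteq> S \<times> S" "refl_on S r" using assms by (auto simp: refl_on_def)
  show "sym r" unfolding sym_def assms by (auto elim: eventually_mono)
  show "trans r" unfolding trans_def assms by (auto elim: eventually_elim2)
qed

text \<open>The three concrete spaces are quotients of the same kind: \<open>K\<close> sends a
  representative to a square integrable function, and equality almost everywhere of these functions
  is the equivalence. The operations go through chosen representatives, so their effect is known
  only almost everywhere.\<close>

lemma l2_model_quotient:
  fixes E :: "('f set, 'm) ip_space_scheme" and K :: "'f \<Rightarrow> 'n \<Rightarrow> 'b::{complex_hilbert, second_countable_topology}"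
  assumes rel: "\<And>f g. (f, g) \<in> r \<longleftrightarrow> f \<in> S \<and> g \<in> S \<and> (AE x in N. K f x = K g x)"
    and carrier: "carrier E = S // r"
    and vadd: "\<And>p q. vadd E p q = r `` {pl (rep p) (rep q)}"
    and vscale: "\<And>c p. vscale E c p = r `` {sc c (rep p)}"
    and sq: "\<And>f. f \<in> S \<Longrightarrow> sq_int N (K f)"
    and pl: "\<And>f g. f \<in> S \<Longrightarrow> g \<in> S \<Longrightarrow> pl f g \<in> S \<and> (AE x in N. K (pl f g) x = K f x + K g x)"
    and sc: "\<And>c f. f \<in> S \<Longrightarrow> sc c f \<in> S \<and> (AE x in N. K (sc c f) x = c *\<^sub>C K f x)"
    and ip: "\<And>p q. rep p \<in> S \<Longrightarrow> rep q \<in> S \<Longrightarrow> ip E p q = (\<integral>x. cinner (K (rep p) x) (K (rep q) x) \<partial>N)"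
    and limit: "\<And>f g. (\<And>n::nat. f n \<in> S) \<Longrightarrow> sq_int N g \<Longrightarrow>
      (\<lambda>n. \<integral>x. (norm (K (f n) x - g x))\<^sup>2 \<partial>N) \<longlonglongrightarrow> 0 \<Longrightarrow> \<exists>h\<in>S. AE x in N. K h x = g x"
  shows "l2_model E N (\<lambda>p. K (rep p))"
proof -
  have eq: "equiv S r" using rel by (rule equiv_AE)
  have repS: "rep p \<in> S" if "p \<in> carrier E" for p using rep_quotient(1)[OF eq] that carrier by simp
  have cls: "r `` {f} \<in> carrier E \<and> (AE x in N. K (rep (r `` {f})) x = K f x)" if "f \<in> S" for f
    using rep_class[OF eq that] unfolding carrier rel by blast
  show ?thesis
  proof
    fix p q assume p: "p \<in> carrier E" and q: "q \<in> carrier E"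
    show "sq_int N (K (rep p))" by (rule sq[OF repS[OF p]])
    show "p = q" if "AE x in N. K (rep p) x = K (rep q) x"
    proof -
      have "(rep p, rep q) \<in> r" using that repS p q rel by blast
      then have "r `` {rep p} = r `` {rep q}" by (rule equiv_class_eq[OF eq])
      then show ?thesis using rep_quotient(2)[OF eq] p q carrier by simp
    qed
    show "vadd E p q \<in> carrier E \<and> (AE x in N. K (rep (vadd E p q)) x = K (rep p) x + K (rep q) x)"
    proof -
      note 1 = pl[OF repS[OF p] repS[OF q]]
      note 2 = cls[OF 1[THEN conjunct1]]
      have "AE x in N. K (rep (vadd E p q)) x = K (rep p) x + K (rep q) x"
        using 1[THEN conjunct2] 2[THEN conjunct2] unfolding vadd by eventually_elim simp
      then show ?thesis using 2 by (simp add: vadd)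
    qed
    show "vscale E c p \<in> carrier E \<and> (AE x in N. K (rep (vscale E c p)) x = c *\<^sub>C K (rep p) x)" for c
    proof -
      note 1 = sc[OF repS[OF p], of c]
      note 2 = cls[OF 1[THEN conjunct1]]
      have "AE x in N. K (rep (vscale E c p)) x = c *\<^sub>C K (rep p) x"
        using 1[THEN conjunct2] 2[THEN conjunct2] unfolding vscale by eventually_elim simp
      then show ?thesis using 2 by (simp add: vscale)
    qed
    show "ip E p q = (\<integral>x. cinner (K (rep p) x) (K (rep q) x) \<partial>N)" by (rule ip[OF repS[OF p] repS[OF q]])
  next
    fix s :: "nat \<Rightarrow> 'f set" and g
    assume s: "\<And>n. s n \<in> carrier E" and g: "sq_int N g"
      and lim: "(\<lambda>n. \<integral>x. (norm (K (rep (s n)) x - g x))\<^sup>2 \<partial>N) \<longlonglongrightarrow> 0"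
    from limit[OF repS[OF s] g lim] obtain h where h: "h \<in> S" "AE x in N. K h x = g x" by blast
    note 2 = cls[OF h(1)]
    have "AE x in N. K (rep (r `` {h})) x = g x"
      using 2[THEN conjunct2] h(2) by eventually_elim simp
    then show "\<exists>p\<in>carrier E. AE x in N. K (rep p) x = g x" using 2 by blast
  qed
qed

lemma l2_module_quotient:
  fixes E :: "('f set, 'h::{complex_hilbert, second_countable_topology}) hilbert_module" and K :: "'f \<Rightarrow> 'n \<Rightarrow> 'h"
  assumes model: "l2_model E N (\<lambda>p. K (rep p))"
    and rel: "\<And>f g. (f, g) \<in> r \<longleftrightarrow> f \<in> S \<and> g \<in> S \<and> (AE x in N. K f x = K g x)"
    and carrier: "carrier E = S // r"
    and act: "\<And>a p. act E a p = r `` {ac a (rep p)}"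
    and ac: "\<And>a f. bounded_clinear a \<Longrightarrow> f \<in> S \<Longrightarrow> ac a f \<in> S \<and> (AE x in N. K (ac a f) x = a (K f x))"
    and gram: "\<And>p q. rep p \<in> S \<Longrightarrow> rep q \<in> S \<Longrightarrow> gram E p q = rv_gramian N (K (rep p)) (K (rep q))"
  shows "l2_module E N (\<lambda>p. K (rep p))"
proof -
  interpret l2_model E N "\<lambda>p. K (rep p)" by (rule model)
  have eq: "equiv S r" using rel by (rule equiv_AE)
  have repS: "rep p \<in> S" if "p \<in> carrier E" for p using rep_quotient(1)[OF eq] that carrier by simp
  have cls: "r `` {f} \<in> carrier E \<and> (AE x in N. K (rep (r `` {f})) x = K f x)" if "f \<in> S" for f
    using rep_class[OF eq that] unfolding carrier rel by blast
  show ?thesis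
  proof
    fix p q assume p: "p \<in> carrier E"
    show "gram E p q = rv_gramian N (K (rep p)) (K (rep q))" if "q \<in> carrier E"
      by (rule gram[OF repS[OF p] repS[OF that]])
    fix a :: "'h \<Rightarrow> 'h" assume a: "bounded_clinear a"
    note 1 = ac[OF a repS[OF p]]
    note 2 = cls[OF 1[THEN conjunct1]]
    have "AE x in N. K (rep (act E a p)) x = a (K (rep p) x)"
      using 1[THEN conjunct2] 2[THEN conjunct2] unfolding act by eventually_elim simp
    then show "act E a p \<in> carrier E \<and> (AE x in N. K (rep (act E a p)) x = a (K (rep p) x))"
      using 2 by (simp add: act)
  qed
qed

subsection \<open>Random variables\<close>

lemma rv2_iff: "X \<in> rv2 M \<longleftrightarrow> sq_int M X \<and> (\<integral>\<omega>. X \<omega> \<partial>M) = 0"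
  by (auto simp: rv2_def sq_int_def)

context
  fixes M :: "'w measure"
  assumes M: "prob_space M"
begin

interpretation prob_space M by (rule M)

lemma sq_int_imp_integrable:
  assumes f: "sq_int M f"
  shows "integrable M f"
proof (rule Bochner_Integration.integrable_bound)
  show "integrable M (\<lambda>x. 1 + (norm (f x))\<^sup>2)" using sq_int_integrable[OF f] by simp
  have "norm (f x) \<le> 1 + (norm (f x))\<^sup>2" for x
    using zero_le_power2[of "norm (f x) - 1"] unfolding power2_diff by (simp add: power2_eq_square) (smt (verit) norm_ge_zero)
  then show "AE x in M. norm (f x) \<le> norm (1 + (norm (f x))\<^sup>2)" by (simp add: abs_of_nonneg)
qed (rule sq_int_measurable[OF f])

text \<open>Integrate \<open>s \<le> e + s\<^sup>2 / e\<close> for \<open>s = norm (f x)\<close>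
  over the probability space. As \<open>e\<close> is free, convergence in mean square implies
  convergence of the means.\<close>

lemma norm_integral_le:
  assumes f: "sq_int M f" and e: "e > 0"
  shows "norm (\<integral>x. f x \<partial>M) \<le> e + (\<integral>x. (norm (f x))\<^sup>2 \<partial>M) / e"
proof -
  have le: "norm (f x) \<le> e + (norm (f x))\<^sup>2 / e" for x
  proof (cases "norm (f x) \<le> e")
    case True
    then show ?thesis using e by (intro add_increasing2) auto
  next
    case False
    then have "norm (f x) * e \<le> norm (f x) * norm (f x)" by (intro mult_left_mono) auto
    then have "norm (f x) \<le> (norm (f x))\<^sup>2 / e" using e by (simp add: power2_eq_square le_divide_eq)
    then show ?thesis using e by linarith
  qed
  have int: "integrable M (\<lambda>x. e + (norm (f x))\<^sup>2 / e)" using sq_int_integrable[OF f] by simp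
  have "norm (\<integral>x. f x \<partial>M) \<le> (\<integral>x. norm (f x) \<partial>M)" by (rule Bochner_Integration.integral_norm_bound)
  also have "\<dots> \<le> (\<integral>x. e + (norm (f x))\<^sup>2 / e \<partial>M)"
    by (intro integral_mono integrable_norm sq_int_imp_integrable f int le)
  also have "\<dots> = e + (\<integral>x. (norm (f x))\<^sup>2 \<partial>M) / e"
    using sq_int_integrable[OF f] prob_space by simp
  finally show ?thesis .
qed

text \<open>The point specific to random variables is closedness: a limit in mean square of
  variables with mean zero has mean zero.\<close>

lemma rv2_model: "l2_module (RV2 M :: (('w \<Rightarrow> 'h::{complex_hilbert, second_countable_topology}) set, 'h) hilbert_module) M rep"
proof -
  let ?E = "RV2 M :: (('w \<Rightarrow> 'h) set, 'h) hilbert_module"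
  have rel: "(f, g) \<in> rv2_rel M \<longleftrightarrow> f \<in> rv2 M \<and> g \<in> rv2 M \<and> (AE x in M. f x = g x)" for f g :: "'w \<Rightarrow> 'h"
    by (auto simp: rv2_rel_def)
  have act: "(\<lambda>\<omega>. a (f \<omega>)) \<in> rv2 M" if a: "bounded_clinear a" and f: "f \<in> rv2 M" for a and f :: "'w \<Rightarrow> 'h"
  proof -
    have sq: "sq_int M f" using f by (simp add: rv2_iff)
    have "(\<integral>\<omega>. a (f \<omega>) \<partial>M) = a (\<integral>\<omega>. f \<omega> \<partial>M)"
      by (rule integral_bounded_linear[OF bounded_clinearD(6)[OF a] sq_int_imp_integrable[OF sq]])
    then show ?thesis
      using f sq_int_bounded_clinear[OF sq a] by (simp add: rv2_iff bounded_clinearD(4)[OF a])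
  qed
  have model: "l2_model ?E M (\<lambda>p. rep p)"
  proof (rule l2_model_quotient[where K = "\<lambda>f. f" and S = "rv2 M" and r = "rv2_rel M"
        and pl = "\<lambda>f g \<omega>. f \<omega> + g \<omega>" and sc = "\<lambda>c f \<omega>. c *\<^sub>C f \<omega>"])
    show "(f, g) \<in> rv2_rel M \<longleftrightarrow> f \<in> rv2 M \<and> g \<in> rv2 M \<and> (AE x in M. f x = g x)" for f g :: "'w \<Rightarrow> 'h"
      by (rule rel)
    show "sq_int M f" if "f \<in> rv2 M" for f :: "'w \<Rightarrow> 'h" using that by (simp add: rv2_iff)
    show "(\<lambda>\<omega>. f \<omega> + g \<omega>) \<in> rv2 M \<and> (AE x in M. f x + g x = f x + g x)" if "f \<in> rv2 M" "g \<in> rv2 M" for f g :: "'w \<Rightarrow> 'h"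
      using that sq_int_add[of M f g] sq_int_imp_integrable[of f] sq_int_imp_integrable[of g]
      by (simp add: rv2_iff)
    show "(\<lambda>\<omega>. c *\<^sub>C f \<omega>) \<in> rv2 M \<and> (AE x in M. c *\<^sub>C f x = c *\<^sub>C f x)" if "f \<in> rv2 M" for c and f :: "'w \<Rightarrow> 'h"
      using act[OF bounded_clinear_scaleC[OF bounded_clinear_ident] that, of c] by simp
    show "ip ?E p q = (\<integral>x. cinner (rep p x) (rep q x) \<partial>M)" if "rep p \<in> rv2 M" "rep q \<in> rv2 M" for p q
      using that trace_rv_gramian[of M "rep p" "rep q"] sigma_finite_measure_axioms by (simp add: RV2_def rv2_iff)
    fix f :: "nat \<Rightarrow> 'w \<Rightarrow> 'h" and g :: "'w \<Rightarrow> 'h"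
    assume f: "\<And>n. f n \<in> rv2 M" and g: "sq_int M g" and lim: "(\<lambda>n. \<integral>x. (norm (f n x - g x))\<^sup>2 \<partial>M) \<longlonglongrightarrow> 0"
    have fsq: "sq_int M (f n)" for n using f by (simp add: rv2_iff)
    \<comment> \<open>For fixed \<open>e\<close> the index \<open>n\<close> tends to infinity in
      \<open>norm_integral_le\<close>; afterwards \<open>e\<close> is made arbitrarily
      small.\<close>
    have "norm (\<integral>x. g x \<partial>M) \<le> e" if e: "e > 0" for e
    proof -
      have "norm (\<integral>x. g x \<partial>M) \<le> e + (\<integral>x. (norm (f n x - g x))\<^sup>2 \<partial>M) / e" for n
      proof -
        have "(\<integral>x. f n x - g x \<partial>M) = - (\<integral>x. g x \<partial>M)"
          using f[of n] sq_int_imp_integrable[OF fsq] sq_int_imp_integrable[OF g] by (simp add: rv2_iff)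
        then show ?thesis using norm_integral_le[OF sq_int_diff[OF fsq g] e, of n] by simp
      qed
      moreover have "(\<lambda>n. e + (\<integral>x. (norm (f n x - g x))\<^sup>2 \<partial>M) / e) \<longlonglongrightarrow> e + 0 / e"
        by (intro tendsto_intros lim) (use e in auto)
      ultimately show ?thesis using LIMSEQ_le_const[of _ "e + 0 / e" "norm (\<integral>x. g x \<partial>M)"] by auto
    qed
    then have "norm (\<integral>x. g x \<partial>M) \<le> 0" by (rule field_le_epsilon) simp
    then show "\<exists>h\<in>rv2 M. AE x in M. h x = g x"
      using g by (intro bexI[of _ g]) (auto simp: rv2_iff)
  qed (simp_all add: RV2_def)
  show ?thesis
    by (rule l2_module_quotient[where K = "\<lambda>f. f" and S = "rv2 M" and r = "rv2_rel M"
        and ac = "\<lambda>a f \<omega>. a (f \<omega>)", OF model rel])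
      (simp_all add: RV2_def act)
qed

end

subsection \<open>The vector time domain\<close>

lemma l2_iff: "f \<in> l2 \<nu> \<longleftrightarrow> sq_int \<nu> f"
  by (simp add: l2_def sq_int_def)

lemma l2_relD: "(f, g) \<in> l2_rel \<nu> \<Longrightarrow> AE t in \<nu>. f t = g t"
  by (simp add: l2_rel_def)

lemma L2_model: "l2_model (L2 \<nu>) \<nu> rep"
proof (rule l2_model_quotient[where K = "\<lambda>f. f" and S = "l2 \<nu>" and r = "l2_rel \<nu>"
      and pl = "\<lambda>f g t. f t + g t" and sc = "\<lambda>c f t. c * f t"])
  show "(\<lambda>t. c * f t) \<in> l2 \<nu> \<and> (AE x in \<nu>. c * f x = c *\<^sub>C f x)" if "f \<in> l2 \<nu>" for c f
    using that sq_int_scaleC[of \<nu> f c] by (simp add: l2_iff scaleC_complex_def)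
  show "\<exists>h\<in>l2 \<nu>. AE x in \<nu>. h x = g x" if "sq_int \<nu> g" for g
    using that by (intro bexI[of _ g]) (auto simp: l2_iff)
qed (auto simp: L2_def l2_rel_def l2_iff sq_int_add cinner_complex_def)

lemma tempered_sigma_finite:
  assumes "sets \<nu> = sets borel" "\<And>A. A \<in> sets borel \<Longrightarrow> bounded A \<Longrightarrow> emeasure \<nu> A < \<infinity>"
  shows "sigma_finite_measure (\<nu> :: (real^'d::finite) measure)"
proof
  have "(\<Union>n::nat. cball (0::real^'d) (real n)) = UNIV"
    using real_arch_simple by (auto simp: set_eq_iff)
  then show "\<exists>A. countable A \<and> A \<subseteq> sets \<nu> \<and> \<Union> A = space \<nu> \<and> (\<forall>a\<in>A. emeasure \<nu> a \<noteq> \<infinity>)"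
    using assms sets_eq_imp_space_eq[OF assms(1)]
    by (intro exI[of _ "range (\<lambda>n::nat. cball 0 (real n))"]) (auto simp: less_top)
qed

text \<open>The transform is bounded by the integral of \<open>cmod (\<phi> x)\<close>, and a
  bounded integrable function is square integrable.\<close>

lemma fourier_integrable:
  assumes "\<And>\<phi>. \<phi> \<in> schwartz \<Longrightarrow> integrable \<nu> \<phi>" and \<phi>: "\<phi> \<in> test_funs"
  shows "integrable \<nu> (fourier \<phi>)" "sq_int \<nu> (fourier \<phi>)"
proof -
  show int: "integrable \<nu> (fourier \<phi>)" using assms(1)[OF fourier_schwartz[OF \<phi>]] .
  have "integrable \<nu> (\<lambda>t. (cmod (fourier \<phi> t))\<^sup>2)"
  proof (rule Bochner_Integration.integrable_bound)
    let ?C = "\<integral>x. cmod (\<phi> x) \<partial>lborel"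
    show "integrable \<nu> (\<lambda>t. ?C * cmod (fourier \<phi> t))" using int by simp
    show "(\<lambda>t. (cmod (fourier \<phi> t))\<^sup>2) \<in> borel_measurable \<nu>"
      using borel_measurable_integrable[OF int] by measurable
    have "(cmod (fourier \<phi> t))\<^sup>2 \<le> ?C * cmod (fourier \<phi> t)" for t
      unfolding power2_eq_square by (intro mult_right_mono cmod_fourier_le \<phi>) simp
    then show "AE t in \<nu>. norm ((cmod (fourier \<phi> t))\<^sup>2) \<le> norm (?C * cmod (fourier \<phi> t))"
      by (intro always_eventually allI) (metis abs_le_self_iff abs_of_nonneg order_trans real_norm_def zero_le_power2 abs_ge_self)
  qed
  then show "sq_int \<nu> (fourier \<phi>)"
    using borel_measurable_integrable[OF int] by (simp add: sq_int_def)
qed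

text \<open>The products \<open>\<F>\<phi> \<sqdot> g\<close> with translates of \<open>\<phi>\<close> have Fourier transform zero; the small bumps leave
  no common zero.\<close>

lemma fourier_orthogonal_zero:
  fixes \<nu> :: "(real^'d::finite) measure"
  assumes \<nu>: "sigma_finite_measure \<nu>" "sets \<nu> = sets borel"
    and int: "\<And>\<phi>. \<phi> \<in> test_funs \<Longrightarrow> integrable \<nu> (\<lambda>t. fourier \<phi> t * g t)"
    and zero: "\<And>\<phi>. \<phi> \<in> test_funs \<Longrightarrow> (\<integral>t. fourier \<phi> t * g t \<partial>\<nu>) = 0"
  shows "AE t in \<nu>. g t = 0"
proof -
  have "AE t in \<nu>. fourier \<phi> t * g t = 0" if \<phi>: "\<phi> \<in> test_funs" for \<phi>
  proof (rule fourier_unique[OF \<nu> int[OF \<phi>]])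
    show "(\<integral>t. phase x t * (fourier \<phi> t * g t) \<partial>\<nu>) = 0" for x
      using zero[OF test_funs_translate[OF \<phi>, of x]] by (simp add: fourier_translate[OF \<phi>] mult.assoc)
  qed
  then have "AE t in \<nu>. fourier (small_bump n) t * g t = 0" for n
    using small_bump_test_fun by blast
  then have "AE t in \<nu>. \<forall>n. fourier (small_bump n) t * g t = 0"
    unfolding AE_all_countable by blast
  then show ?thesis
  proof eventually_elim
    case (elim t)
    obtain n where "fourier (small_bump n) t \<noteq> 0" using fourier_small_bump by blast
    then show ?case using elim by (metis mult_eq_0_iff)
  qed
qed

theorem vector_domain_isomorphism:
  fixes M :: "'w measure" and U :: "(real^'d::finite \<Rightarrow> complex) \<Rightarrow> ('w \<Rightarrow> 'h::{complex_hilbert, second_countable_topology}) set"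
  assumes M: "prob_space M" and U: "U \<in> distributions (RV2 M)" and \<nu>: "representing_measure M U \<nu>"
  shows "\<exists>W. unitary_iso (vector_domain M U) (L2 \<nu>) W \<and> (\<forall>\<phi>\<in>test_funs. W (U \<phi>) = l2_rel \<nu> `` {fourier \<phi>})"
proof -
  let ?E1 = "RV2 M :: (('w \<Rightarrow> 'h) set, 'h) hilbert_module"
  let ?v = "\<lambda>\<phi>. l2_rel \<nu> `` {fourier \<phi>}"
  have sets: "sets \<nu> = sets borel" and bd: "\<And>A. A \<in> sets borel \<Longrightarrow> bounded A \<Longrightarrow> emeasure \<nu> A < \<infinity>"
    and sch: "\<And>\<phi>. \<phi> \<in> schwartz \<Longrightarrow> integrable \<nu> \<phi>"
    using \<nu> by (auto simp: representing_measure_def tempered_measure_def)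
  have sf: "sigma_finite_measure \<nu>" using tempered_sigma_finite[OF sets bd] .
  have eqv: "equiv (l2 \<nu>) (l2_rel \<nu>)"
    by (rule equiv_AE[where K = "\<lambda>f. f" and N = \<nu>]) (auto simp: l2_rel_def)
  have Fl2: "fourier \<phi> \<in> l2 \<nu>" if "\<phi> \<in> test_funs" for \<phi>
    using fourier_integrable(2)[OF sch that] by (simp add: l2_iff)
  interpret M1: l2_module ?E1 M rep by (rule rv2_model[OF M])
  interpret M2: l2_model "L2 \<nu>" \<nu> rep by (rule L2_model)
  have v_carrier: "?v \<phi> \<in> carrier (L2 \<nu>)" if "\<phi> \<in> test_funs" for \<phi>
    using rep_class(1)[OF eqv Fl2[OF that]] by (simp add: L2_def)
  have v_rep: "AE t in \<nu>. rep (?v \<phi>) t = fourier \<phi> t" if "\<phi> \<in> test_funs" for \<phi>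
    by (rule l2_relD[OF rep_class(2)[OF eqv Fl2[OF that]]])
  have Fmeas: "fourier \<phi> \<in> borel_measurable \<nu>" if "\<phi> \<in> test_funs" for \<phi>
    by (rule sq_int_measurable[OF fourier_integrable(2)[OF sch that]])
  interpret isometric_families ?E1 "L2 \<nu>" test_funs U ?v
  proof
    show "U ` test_funs \<subseteq> carrier ?E1" using U by (auto simp: distributions_def)
    show vsub: "?v ` test_funs \<subseteq> carrier (L2 \<nu>)" using v_carrier by blast
    show "ip ?E1 (U \<phi>) (U \<psi>) = ip (L2 \<nu>) (?v \<phi>) (?v \<psi>)" if \<phi>: "\<phi> \<in> test_funs" and \<psi>: "\<psi> \<in> test_funs" for \<phi> \<psi>
    proof -
      have "ip (L2 \<nu>) (?v \<phi>) (?v \<psi>) = (\<integral>t. cinner (fourier \<phi> t) (fourier \<psi> t) \<partial>\<nu>)"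
        by (rule M2.ip_cong[OF v_carrier[OF \<phi>] v_carrier[OF \<psi>] v_rep[OF \<phi>] Fmeas[OF \<phi>] v_rep[OF \<psi>] Fmeas[OF \<psi>]])
      also have "\<dots> = (\<integral>t. fourier (convol \<phi> (tilde \<psi>)) t \<partial>\<nu>)"
        by (simp add: fourier_convolution[OF \<phi> \<psi>] cinner_complex_def)
      also have "\<dots> = ip ?E1 (U \<phi>) (U \<psi>)"
        using \<nu> \<phi> \<psi> by (simp add: representing_measure_def)
      finally show ?thesis ..
    qed
    show "closed_span (L2 \<nu>) (?v ` test_funs) = carrier (L2 \<nu>)"
    proof (rule ccontr)
      assume "closed_span (L2 \<nu>) (?v ` test_funs) \<noteq> carrier (L2 \<nu>)"
      moreover have "?v ` test_funs \<noteq> {}" using bump_test_fun by blast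
      ultimately obtain z where z: "z \<in> carrier (L2 \<nu>)" "M2.nrm z \<noteq> 0"
        and orth: "\<And>a. a \<in> ?v ` test_funs \<Longrightarrow> ip (L2 \<nu>) a z = 0"
        using M2.exists_orthogonal[OF vsub] by blast
      have zsq: "sq_int \<nu> (rep z)" by (rule M2.J_sq_int[OF z(1)])
      \<comment> \<open>The scalar product with \<open>z\<close> integrates
        \<open>fourier \<phi> t * cnj (rep z t)\<close>, so the conjugate takes the place of
        \<open>g\<close>.\<close>
      have "AE t in \<nu>. cnj (rep z t) = 0"
      proof (rule fourier_orthogonal_zero[OF sf sets])
        fix \<phi> :: "real^'d \<Rightarrow> complex" assume \<phi>: "\<phi> \<in> test_funs"
        show "integrable \<nu> (\<lambda>t. fourier \<phi> t * cnj (rep z t))"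
          using sq_int_cinner[OF fourier_integrable(2)[OF sch \<phi>] zsq] by (simp add: cinner_complex_def)
        have "ip (L2 \<nu>) (?v \<phi>) z = (\<integral>t. cinner (fourier \<phi> t) (rep z t) \<partial>\<nu>)"
          by (rule M2.ip_cong[OF v_carrier[OF \<phi>] z(1) v_rep[OF \<phi>] Fmeas[OF \<phi>]]) (use sq_int_measurable[OF zsq] in auto)
        then show "(\<integral>t. fourier \<phi> t * cnj (rep z t) \<partial>\<nu>) = 0"
          using orth[of "?v \<phi>"] \<phi> by (simp add: cinner_complex_def)
      qed
      then have "(\<integral>t. cinner (rep z t) (rep z t) \<partial>\<nu>) = 0"
        by (intro integral_eq_zero_AE) (auto elim: eventually_mono)
      then show False using z M2.J_ip[OF z(1) z(1)] by (simp add: M2.nrm_def)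
    qed
  qed
  have "unitary_iso (vector_domain M U) (L2 \<nu>) W"
    by (rule W_unitary) (simp_all add: vector_domain_def image_def Collect_conj_eq conj_commute Bex_def)
  then show ?thesis using W_base by blast
qed

section \<open>Hilbert--Schmidt operators\<close>

lemma hilbert_schmidtD: "hilbert_schmidt T \<Longrightarrow> bounded_clinear T"
  by (simp add: hilbert_schmidt_def)

lemma hs_norm_has_sum:
  assumes "hilbert_schmidt T"
  shows "((\<lambda>e. (norm (T e))\<^sup>2) has_sum (hs_norm T)\<^sup>2) hbasis"
proof -
  have "0 \<le> (\<Sum>\<^sub>\<infinity>e\<in>hbasis. (norm (T e))\<^sup>2)" by (rule infsum_nonneg) simp
  moreover have "((\<lambda>e. (norm (T e))\<^sup>2) has_sum (\<Sum>\<^sub>\<infinity>e\<in>hbasis. (norm (T e))\<^sup>2)) hbasis"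
    using assms by (intro has_sum_infsum) (simp add: hilbert_schmidt_def)
  ultimately show ?thesis by (simp add: hs_norm_def)
qed

lemma hs_norm_eqI: "((\<lambda>e. (norm (T e))\<^sup>2) has_sum s) hbasis \<Longrightarrow> hs_norm T = sqrt s"
  unfolding hs_norm_def by (simp add: infsumI)

lemma hs_norm_nonneg: "0 \<le> hs_norm T"
  unfolding hs_norm_def by (intro real_sqrt_ge_zero infsum_nonneg) simp

lemma hilbert_schmidt_compose:
  assumes a: "bounded_clinear a" and T: "hilbert_schmidt T"
  shows "hilbert_schmidt (\<lambda>h. a (T h))"
  unfolding hilbert_schmidt_def
proof
  obtain K where K: "K > 0" "\<And>x. norm (a x) \<le> K * norm x" using bounded_clinear_bound[OF a] by blast
  show "(\<lambda>e. (norm (a (T e)))\<^sup>2) summable_on hbasis"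
  proof (rule summable_on_comparison_test)
    show "(\<lambda>e. K\<^sup>2 * (norm (T e))\<^sup>2) summable_on hbasis"
      using T by (intro summable_on_cmult_right) (simp add: hilbert_schmidt_def)
    show "(norm (a (T e)))\<^sup>2 \<le> K\<^sup>2 * (norm (T e))\<^sup>2" for e
      using power_mono[OF K(2) norm_ge_zero, of "T e" 2] by (simp add: power_mult_distrib)
  qed simp
qed (rule bounded_clinear_compose[OF a hilbert_schmidtD[OF T]])

lemma hilbert_schmidt_add:
  assumes S: "hilbert_schmidt S" and T: "hilbert_schmidt T"
  shows "hilbert_schmidt (\<lambda>h. S h + T h)"
  unfolding hilbert_schmidt_def
proof
  show "(\<lambda>e. (norm (S e + T e))\<^sup>2) summable_on hbasis"
  proof (rule summable_on_comparison_test)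
    show "(\<lambda>e. 2 * (norm (S e))\<^sup>2 + 2 * (norm (T e))\<^sup>2) summable_on hbasis"
      using S T by (intro summable_on_add summable_on_cmult_right) (simp_all add: hilbert_schmidt_def)
  qed (simp_all add: norm_add_sq_le)
qed (rule bounded_clinear_add[OF hilbert_schmidtD[OF S] hilbert_schmidtD[OF T]])

lemma hilbert_schmidt_scaleC: "hilbert_schmidt T \<Longrightarrow> hilbert_schmidt (\<lambda>h. c *\<^sub>C T h)"
  using hilbert_schmidt_compose[OF bounded_clinear_scaleC[OF bounded_clinear_ident]] .

lemma hilbert_schmidt_diff:
  assumes "hilbert_schmidt S" "hilbert_schmidt T"
  shows "hilbert_schmidt (\<lambda>h. S h - T h)"
  using hilbert_schmidt_add[OF assms(1) hilbert_schmidt_scaleC[OF assms(2), of "-1"]] by simp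

lemma hilbert_schmidt_zero: "hilbert_schmidt (\<lambda>h. 0)"
  by (simp add: hilbert_schmidt_def bounded_clinear_zero)

text \<open>Cauchy--Schwarz for finite sums, combined with Bessel's inequality for the coefficients
  of \<open>h\<close>. The bound is independent of \<open>F\<close>.\<close>

lemma coefficient_sum_le:
  fixes g :: "'h::complex_hilbert \<Rightarrow> 'h"
  assumes g: "((\<lambda>e. (norm (g e))\<^sup>2) has_sum s) hbasis" and F: "finite F" "F \<subseteq> hbasis"
  shows "(\<Sum>e\<in>F. norm (cinner h e *\<^sub>C g e)) \<le> norm h * sqrt s"
proof -
  have "(\<Sum>e\<in>F. norm (cinner h e *\<^sub>C g e)) = (\<Sum>e\<in>F. \<bar>cmod (cinner h e)\<bar> * \<bar>norm (g e)\<bar>)"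
    by (simp add: norm_scaleC)
  also have "\<dots> \<le> L2_set (\<lambda>e. cmod (cinner h e)) F * L2_set (\<lambda>e. norm (g e)) F"
    by (rule L2_set_mult_ineq)
  also have "\<dots> \<le> norm h * sqrt s"
  proof (rule mult_mono)
    have "(\<Sum>e\<in>F. (cmod (cinner h e))\<^sup>2) \<le> (norm h)\<^sup>2"
      using norm_hbasis_has_sum[of h] F by (intro has_sum_mono_neutral[OF has_sum_finite]) auto
    then show "L2_set (\<lambda>e. cmod (cinner h e)) F \<le> norm h"
      unfolding L2_set_def by (metis norm_ge_zero real_sqrt_le_mono real_sqrt_unique)
    have "(\<Sum>e\<in>F. (norm (g e))\<^sup>2) \<le> s"
      using g F by (intro has_sum_mono_neutral[OF has_sum_finite]) auto
    then show "L2_set (\<lambda>e. norm (g e)) F \<le> sqrt s"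
      unfolding L2_set_def by (rule real_sqrt_le_mono)
  qed (auto simp: L2_set_nonneg)
  finally show ?thesis .
qed

lemma has_sum_norm_le:
  fixes f :: "'i \<Rightarrow> 'b::real_normed_vector"
  assumes "(f has_sum s) A" and "\<And>F. finite F \<Longrightarrow> F \<subseteq> A \<Longrightarrow> norm (sum f F) \<le> C"
  shows "norm s \<le> C"
proof (rule tendsto_upperbound)
  show "((\<lambda>F. norm (sum f F)) \<longlongrightarrow> norm s) (finite_subsets_at_top A)"
    using assms(1) unfolding has_sum_def by (rule tendsto_norm)
  show "\<forall>\<^sub>F F in finite_subsets_at_top A. norm (sum f F) \<le> C"
    by (rule eventually_finite_subsets_at_top_weakI) (rule assms(2))
qed simp

lemma hs_norm_bound:
  assumes T: "hilbert_schmidt T"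
  shows "norm (T h) \<le> hs_norm T * norm h"
proof (rule has_sum_norm_le[OF bounded_clinear_has_sum[OF hilbert_schmidtD[OF T]]])
  fix F assume F: "finite F" "F \<subseteq> (hbasis :: 'a set)"
  have "norm (\<Sum>e\<in>F. cinner h e *\<^sub>C T e) \<le> (\<Sum>e\<in>F. norm (cinner h e *\<^sub>C T e))" by (rule norm_sum)
  also have "\<dots> \<le> norm h * sqrt ((hs_norm T)\<^sup>2)"
    by (rule coefficient_sum_le[OF hs_norm_has_sum[OF T] F])
  finally show "norm (\<Sum>e\<in>F. cinner h e *\<^sub>C T e) \<le> hs_norm T * norm h"
    by (simp add: hs_norm_nonneg mult.commute)
qed

text \<open>The series of the vectors \<open>cinner h e *\<^sub>C g e\<close> converges absolutely
  by \<open>coefficient_sum_le\<close>. This turns a square integrable function on the product space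
  back into an operator function.\<close>

lemma hilbert_schmidt_exists:
  fixes g :: "'h::complex_hilbert \<Rightarrow> 'h"
  assumes g: "(\<lambda>e. (norm (g e))\<^sup>2) summable_on hbasis"
  shows "\<exists>T. hilbert_schmidt T \<and> (\<forall>e\<in>hbasis. T e = g e)"
proof -
  have gs: "((\<lambda>e. (norm (g e))\<^sup>2) has_sum (\<Sum>\<^sub>\<infinity>e\<in>hbasis. (norm (g e))\<^sup>2)) hbasis" (is "(_ has_sum ?s) _")
    by (rule has_sum_infsum[OF g])
  define T where "T h = (\<Sum>\<^sub>\<infinity>e\<in>hbasis. cinner h e *\<^sub>C g e)" for h
  have T: "((\<lambda>e. cinner h e *\<^sub>C g e) has_sum T h) hbasis" for h
    unfolding T_def
  proof (rule has_sum_infsum[OF abs_summable_summable], rule nonneg_bdd_above_summable_on)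
    show "bdd_above (sum (\<lambda>e. norm (cinner h e *\<^sub>C g e)) ` {F. F \<subseteq> hbasis \<and> finite F})"
      by (rule bdd_aboveI2[where M = "norm h * sqrt ?s"]) (use coefficient_sum_le[OF gs] in auto)
  qed simp
  have "bounded_clinear T"
  proof (rule bounded_clinearI)
    show "T (x + y) = T x + T y" for x y
      using has_sum_add[OF T[of x] T[of y]] T[of "x + y"] has_sum_unique
      by (fastforce simp: cinner_add_left scaleC_add_left)
    show "T (c *\<^sub>C x) = c *\<^sub>C T x" for c x
      using has_sum_bounded_linear[OF bounded_linear_scaleC_right T[of x], of c] T[of "c *\<^sub>C x"] has_sum_unique
      by (fastforce simp: cinner_scaleC_left scaleC_scaleC)
    show "norm (T x) \<le> norm x * sqrt ?s" for x
      by (rule has_sum_norm_le[OF T]) (rule order_trans[OF norm_sum coefficient_sum_le[OF gs]])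
  qed
  moreover have Te: "T e = g e" if e: "e \<in> hbasis" for e
  proof (rule has_sum_unique[OF T])
    show "((\<lambda>f. cinner e f *\<^sub>C g f) has_sum g e) hbasis"
      by (rule has_sum_finite_neutralI[of "{e}"])
        (use orthonormal_hbasis e in \<open>auto simp: orthonormal_def\<close>)
  qed
  ultimately show ?thesis
    using g by (intro exI[of _ T]) (simp add: hilbert_schmidt_def cong: summable_on_cong)
qed

subsection \<open>Measurability\<close>

text \<open>Pettis: weak measurability suffices in a separable Hilbert space.\<close>

lemma weakly_measurable:
  fixes f :: "'t \<Rightarrow> 'h::{complex_hilbert, second_countable_topology}"
  assumes weak: "\<And>k. (\<lambda>t. cinner (f t) k) \<in> borel_measurable N"
  shows "f \<in> borel_measurable N"
proof -
  \<comment> \<open>An increasing sequence of finite sets exhausting the basis. It is cofinal among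
    the finite subsets, so unordered convergence yields an ordinary sequence of measurable partial
    sums.\<close>
  define B where "B n = {e \<in> hbasis :: 'h set. to_nat_on hbasis e < n}" for n :: nat
  have "finite (B n)" for n
    using inj_on_to_nat_on[OF countable_hbasis] by (intro inj_on_finite[of "to_nat_on hbasis" "B n" "{..<n}"])
      (auto simp: B_def inj_on_def)
  have ftop: "filterlim B (finite_subsets_at_top hbasis) sequentially"
    unfolding filterlim_def le_filter_def eventually_filtermap
  proof (intro allI impI)
    fix P assume "eventually P (finite_subsets_at_top (hbasis :: 'h set))"
    then have "\<exists>X. finite X \<and> X \<subseteq> hbasis \<and> (\<forall>Y. finite Y \<and> X \<subseteq> Y \<and> Y \<subseteq> hbasis \<longrightarrow> P Y)"
      by (simp only: eventually_finite_subsets_at_top)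
    then obtain X where "finite X \<and> X \<subseteq> hbasis \<and> (\<forall>Y. finite Y \<and> X \<subseteq> Y \<and> Y \<subseteq> hbasis \<longrightarrow> P Y)" ..
    then have X: "finite X" "X \<subseteq> hbasis" "\<And>Y. finite Y \<Longrightarrow> X \<subseteq> Y \<Longrightarrow> Y \<subseteq> hbasis \<Longrightarrow> P Y"
      by simp_all
    have "P (B n)" if n: "n \<ge> Suc (Max (insert 0 (to_nat_on hbasis ` X)))" for n
    proof (rule X(3)[OF \<open>finite (B n)\<close>])
      show "X \<subseteq> B n"
      proof
        fix e assume e: "e \<in> X"
        have "to_nat_on hbasis e \<le> Max (insert 0 (to_nat_on hbasis ` X))" using X(1) e by (intro Max_ge) auto
        then show "e \<in> B n" using n e X(2) by (auto simp: B_def)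
      qed
    qed (auto simp: B_def)
    then show "\<forall>\<^sub>F n in sequentially. P (B n)" unfolding eventually_sequentially by blast
  qed
  show ?thesis
  proof (rule borel_measurable_LIMSEQ_metric)
    show "(\<lambda>t. \<Sum>e\<in>B n. cinner (f t) e *\<^sub>C e) \<in> borel_measurable N" for n
      using weak by measurable
    show "(\<lambda>n. \<Sum>e\<in>B n. cinner (f t) e *\<^sub>C e) \<longlonglongrightarrow> f t" for t
      using filterlim_compose[OF hbasis_has_sum[of "f t", unfolded has_sum_def] ftop] by (simp add: o_def)
  qed
qed

lemma nn_integral_hs_norm:
  assumes "hilbert_schmidt T"
  shows "(\<integral>\<^sup>+e. ennreal ((norm (T e))\<^sup>2) \<partial>count_space hbasis) = ennreal ((hs_norm T)\<^sup>2)"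
  by (rule nn_integral_count_space_has_sum[OF hs_norm_has_sum[OF assms]]) simp

text \<open>By Tonelli the squared norm is an integral over the counting measure; joint
  measurability needs only the columns because the basis is countable.\<close>

lemma measurable_hs_norm:
  fixes G :: "'t \<Rightarrow> 'h::{complex_hilbert, second_countable_topology} \<Rightarrow> 'h"
  assumes hs: "\<And>t. t \<in> space \<mu> \<Longrightarrow> hilbert_schmidt (G t)"
    and meas: "\<And>e. e \<in> hbasis \<Longrightarrow> (\<lambda>t. G t e) \<in> borel_measurable \<mu>"
  shows "(\<lambda>t. hs_norm (G t)) \<in> borel_measurable \<mu>"
proof -
  interpret B: sigma_finite_measure "count_space (hbasis :: 'h set)"
    by (rule sigma_finite_measure_count_space_countable[OF countable_hbasis])
  have "(\<lambda>(e, t). ennreal ((norm (G t e))\<^sup>2)) \<in> borel_measurable (count_space hbasis \<Otimes>\<^sub>M \<mu>)"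
  proof (rule measurable_pair_measure_countable1[OF countable_hbasis])
    fix e :: 'h assume e: "e \<in> hbasis"
    note [measurable] = meas[OF e]
    show "(\<lambda>t. case (e, t) of (e, t) \<Rightarrow> ennreal ((norm (G t e))\<^sup>2)) \<in> borel_measurable \<mu>"
      unfolding split_conv by measurable
  qed
  from measurable_pair_swap[OF this] have "(\<lambda>t. \<integral>\<^sup>+e. ennreal ((norm (G t e))\<^sup>2) \<partial>count_space hbasis) \<in> borel_measurable \<mu>"
    using B.borel_measurable_nn_integral by (simp add: split_beta')
  then have "(\<lambda>t. sqrt (enn2real (\<integral>\<^sup>+e. ennreal ((norm (G t e))\<^sup>2) \<partial>count_space hbasis))) \<in> borel_measurable \<mu>"
    by measurable
  then show ?thesis
    by (rule measurable_cong[THEN iffD1, rotated]) (simp add: nn_integral_hs_norm[OF hs] hs_norm_nonneg)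
qed

text \<open>Evaluation at a unit vector is bounded by the Hilbert--Schmidt norm, hence continuous
  for the topology that generates \<open>hs_borel\<close>.\<close>

lemma measurable_hs_coefficient:
  fixes G :: "'t \<Rightarrow> 'h::{complex_hilbert, second_countable_topology} \<Rightarrow> 'h"
  assumes G: "G \<in> measurable \<mu> hs_borel" and e: "e \<in> hbasis"
  shows "(\<lambda>t. G t e) \<in> borel_measurable \<mu>"
proof -
  have e1: "norm e = 1" by (rule orthonormal_norm[OF orthonormal_hbasis e])
  have "(\<lambda>T. T e) \<in> measurable hs_borel borel"
  proof (rule borel_measurableI)
    fix V :: "'h set" assume V: "open V"
    let ?W = "{T. hilbert_schmidt T \<and> T e \<in> V}"
    have "\<exists>r>0. \<forall>S. hilbert_schmidt S \<and> hs_norm (\<lambda>h. S h - T h) < r \<longrightarrow> S \<in> ?W" if T: "T \<in> ?W" for T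
    proof -
      obtain r where r: "r > 0" "\<And>y. dist y (T e) < r \<Longrightarrow> y \<in> V" using V T unfolding open_dist by blast
      have "S \<in> ?W" if S: "hilbert_schmidt S" "hs_norm (\<lambda>h. S h - T h) < r" for S
        using hs_norm_bound[OF hilbert_schmidt_diff[OF S(1)], of T e] T S e1 r(2)[of "S e"] by (simp add: dist_norm)
      then show ?thesis using r(1) by blast
    qed
    then have "?W \<in> sets (hs_borel :: ('h \<Rightarrow> 'h) measure)"
      unfolding hs_borel_def by (subst sets_measure_of) (auto intro!: sigma_sets.Basic)
    moreover have "(\<lambda>T. T e) -` V \<inter> space hs_borel = ?W"
      unfolding hs_borel_def by (subst space_measure_of) auto
    ultimately show "(\<lambda>T. T e) -` V \<inter> space hs_borel \<in> sets (hs_borel :: ('h \<Rightarrow> 'h) measure)" by simp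
  qed
  from measurable_compose[OF G this] show ?thesis .
qed

text \<open>The finite rank operators with data in a countable dense set are dense in the Hilbert--Schmidt
  class, so its open sets are countable unions of balls.\<close>

definition hs_finite :: "('h::complex_hilbert \<times> 'h) set \<Rightarrow> 'h \<Rightarrow> 'h" where
  "hs_finite Q h = (\<Sum>(e, d)\<in>Q. cinner h e *\<^sub>C d)"

lemma hs_finite_graph:
  assumes F: "finite F" "F \<subseteq> hbasis" and e: "e \<in> hbasis"
  shows "hs_finite ((\<lambda>e. (e, d e)) ` F) e = (if e \<in> F then d e else 0)"
proof -
  have "hs_finite ((\<lambda>e. (e, d e)) ` F) e = (\<Sum>f\<in>F. cinner e f *\<^sub>C d f)"
    unfolding hs_finite_def by (subst sum.reindex) (auto simp: inj_on_def)
  also have "\<dots> = (\<Sum>f\<in>F. if f = e then d e else 0)"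
    using F e orthonormal_hbasis by (intro sum.cong) (auto simp: orthonormal_def)
  finally show ?thesis using F by simp
qed

lemma hilbert_schmidt_hs_finite:
  assumes "finite Q"
  shows "hilbert_schmidt (hs_finite Q)"
  using assms
proof (induction Q)
  case empty
  show ?case using hilbert_schmidt_zero by (simp add: hs_finite_def[abs_def])
next
  case (insert z Q)
  obtain e d where z: "z = (e, d)" by fastforce
  have "hilbert_schmidt (\<lambda>h. cinner h e *\<^sub>C d)"
    unfolding hilbert_schmidt_def
  proof
    have "(\<lambda>f. (cmod (cinner f e))\<^sup>2) summable_on hbasis"
      using norm_hbasis_has_sum[of e] cinner_commute unfolding summable_on_def
      by (metis (no_types, lifting) complex_mod_cnj has_sum_cong)
    from summable_on_cmult_left[OF this, of "(norm d)\<^sup>2"]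
    show "(\<lambda>f. (norm (cinner f e *\<^sub>C d))\<^sup>2) summable_on hbasis" by (simp add: norm_scaleC power_mult_distrib)
  qed (rule bounded_clinear_rank_one)
  from hilbert_schmidt_add[OF this insert.IH] show ?case
    using insert.hyps by (simp add: hs_finite_def[abs_def] z)
qed

lemma hs_finite_dense:
  fixes T :: "'h::complex_hilbert \<Rightarrow> 'h"
  assumes T: "hilbert_schmidt T" and D: "\<And>x r. r > 0 \<Longrightarrow> \<exists>d\<in>D. dist d x < r" and r: "r > 0"
  shows "\<exists>Q. finite Q \<and> Q \<subseteq> hbasis \<times> D \<and> hs_norm (\<lambda>h. T h - hs_finite Q h) < r"
proof -
  let ?n = "\<lambda>e. (norm (T e))\<^sup>2"
  obtain F where F: "finite F" "F \<subseteq> hbasis" "dist (sum ?n F) ((hs_norm T)\<^sup>2) \<le> r\<^sup>2 / 4"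
    using has_sum_finite_approximation[OF hs_norm_has_sum[OF T], of "r\<^sup>2 / 4"] r by auto
  \<comment> \<open>With this \<open>c\<close> the \<open>card F\<close> squared errors sum to at
    most \<open>r\<^sup>2 / 4\<close>, which is also the bound for the neglected tail. The summand
    \<open>1\<close> covers an empty \<open>F\<close>.\<close>
  define c where "c = r / (2 * sqrt (real (card F) + 1))"
  have c: "c > 0" using r by (simp add: c_def)
  have "\<forall>e. \<exists>d. d \<in> D \<and> dist d (T e) < c" using D[OF c] by blast
  from choice[OF this] obtain d where "\<forall>e. d e \<in> D \<and> dist (d e) (T e) < c" ..
  then have d: "\<And>e. d e \<in> D" "\<And>e. dist (d e) (T e) < c" by simp_all
  let ?Q = "(\<lambda>e. (e, d e)) ` F"
  let ?R = "\<lambda>h. T h - hs_finite ?Q h"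
  have Q: "finite ?Q" "?Q \<subseteq> hbasis \<times> D" using F d by auto
  have "((\<lambda>e. ?n e) has_sum ((hs_norm T)\<^sup>2 - sum ?n F)) (hbasis - F)"
    by (rule has_sum_Diff[OF hs_norm_has_sum[OF T] has_sum_finite]) (use F in auto)
  then have 1: "((\<lambda>e. (norm (?R e))\<^sup>2) has_sum ((hs_norm T)\<^sup>2 - sum ?n F)) (hbasis - F)"
    using hs_finite_graph[OF F(1,2)] by (subst has_sum_cong[of _ _ ?n]) auto
  have 2: "((\<lambda>e. (norm (?R e))\<^sup>2) has_sum (\<Sum>e\<in>F. (norm (?R e))\<^sup>2)) F"
    by (rule has_sum_finite[OF F(1)])
  have "((\<lambda>e. (norm (?R e))\<^sup>2) has_sum ((hs_norm T)\<^sup>2 - sum ?n F + (\<Sum>e\<in>F. (norm (?R e))\<^sup>2))) ((hbasis - F) \<union> F)"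
    by (rule has_sum_Un_disjoint[OF 1 2]) auto
  moreover have "(hbasis - F) \<union> F = hbasis" using F by auto
  ultimately have "hs_norm ?R = sqrt ((hs_norm T)\<^sup>2 - sum ?n F + (\<Sum>e\<in>F. (norm (?R e))\<^sup>2))"
    using hs_norm_eqI[of ?R] by simp
  also have "\<dots> < sqrt (r\<^sup>2)"
  proof (rule real_sqrt_less_mono)
    have "(\<Sum>e\<in>F. (norm (?R e))\<^sup>2) \<le> (\<Sum>e\<in>F. c\<^sup>2)"
    proof (rule sum_mono)
      fix e assume e: "e \<in> F"
      have "norm (?R e) < c"
        using d(2)[of e] hs_finite_graph[OF F(1,2), of e d] e F by (auto simp: dist_norm norm_minus_commute)
      then show "(norm (?R e))\<^sup>2 \<le> c\<^sup>2" by (intro power_mono) auto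
    qed
    also have "\<dots> = real (card F) * (r\<^sup>2 / (4 * (real (card F) + 1)))"
      by (simp add: c_def power_divide power_mult_distrib)
    also have "\<dots> \<le> r\<^sup>2 / 4"
      by (simp add: divide_simps mult_left_mono) (simp add: algebra_simps)
    finally show "(hs_norm T)\<^sup>2 - sum ?n F + (\<Sum>e\<in>F. (norm (?R e))\<^sup>2) < r\<^sup>2"
      using F(3) r zero_less_power2[of r] unfolding dist_real_def by linarith
  qed
  finally show ?thesis using Q r by (intro exI[of _ ?Q]) simp
qed

lemma measurable_hs_borelI:
  fixes G :: "'t \<Rightarrow> 'h::{complex_hilbert, second_countable_topology} \<Rightarrow> 'h"
  assumes hs: "\<And>t. t \<in> space \<mu> \<Longrightarrow> hilbert_schmidt (G t)"
    and meas: "\<And>e. e \<in> hbasis \<Longrightarrow> (\<lambda>t. G t e) \<in> borel_measurable \<mu>"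
  shows "G \<in> measurable \<mu> hs_borel"
  unfolding hs_borel_def
proof (rule measurable_measure_of)
  fix W :: "('h \<Rightarrow> 'h) set"
  assume "W \<in> {W. W \<subseteq> Collect hilbert_schmidt \<and>
         (\<forall>T\<in>W. \<exists>r>0. \<forall>S. hilbert_schmidt S \<and> hs_norm (\<lambda>h. S h - T h) < r \<longrightarrow> S \<in> W)}"
  then have W: "\<And>T. T \<in> W \<Longrightarrow> hilbert_schmidt T"
    "\<And>T. T \<in> W \<Longrightarrow> \<exists>r>0. \<forall>S. hilbert_schmidt S \<and> hs_norm (\<lambda>h. S h - T h) < r \<longrightarrow> S \<in> W" by auto
  obtain D :: "'h set" where D: "countable D" "\<And>X. open X \<Longrightarrow> X \<noteq> {} \<Longrightarrow> \<exists>d\<in>D. d \<in> X"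
    using countable_dense_exists by blast
  have dense: "\<exists>d\<in>D. dist d x < r" if "r > 0" for x r
    using D(2)[of "ball x r"] that by (auto simp: dist_commute)
  let ?Q = "{Q. finite Q \<and> Q \<subseteq> (hbasis :: 'h set) \<times> D}"
  let ?ball = "\<lambda>Q n. {S. hilbert_schmidt S \<and> hs_norm (\<lambda>h. S h - hs_finite Q h) < inverse (real (Suc n))}"
  define P where "P = {(Q, n). Q \<in> ?Q \<and> ?ball Q n \<subseteq> W}"
  have "countable ?Q"
    by (rule countable_Collect_finite_subset) (intro countable_SIGMA countable_hbasis D(1))
  then have "countable (?Q \<times> (UNIV :: nat set))" by (intro countable_SIGMA) auto
  then have countP: "countable P" by (rule countable_subset[rotated]) (auto simp: P_def)
  have WP: "W = (\<Union>(Q, n)\<in>P. ?ball Q n)"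
  proof (intro equalityI subsetI)
    fix T assume T: "T \<in> W"
    obtain r where r: "r > 0" "\<And>S. hilbert_schmidt S \<Longrightarrow> hs_norm (\<lambda>h. S h - T h) < r \<Longrightarrow> S \<in> W"
      using W(2)[OF T] by blast
    \<comment> \<open>A radius below \<open>r / 2\<close> keeps the ball around an approximation of
      \<open>T\<close> inside the ball of radius \<open>r\<close> around \<open>T\<close>, hence
      inside \<open>W\<close>.\<close>
    obtain n where n: "inverse (real (Suc n)) < r / 2" using reals_Archimedean[of "r / 2"] r(1) by auto
    obtain Q where Q: "finite Q" "Q \<subseteq> hbasis \<times> D" "hs_norm (\<lambda>h. T h - hs_finite Q h) < inverse (real (Suc n))"
      using hs_finite_dense[OF W(1)[OF T] dense, of "inverse (real (Suc n))"] by auto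
    have "?ball Q n \<subseteq> W"
    proof
      fix S assume "S \<in> ?ball Q n"
      then have S: "hilbert_schmidt S" "hs_norm (\<lambda>h. S h - hs_finite Q h) < inverse (real (Suc n))" by auto
      have "hs_norm (\<lambda>h. S h - T h) < r"
      proof -
        let ?A = "\<lambda>h. S h - hs_finite Q h" and ?B = "\<lambda>h. T h - hs_finite Q h"
        have hsA: "hilbert_schmidt ?A" and hsB: "hilbert_schmidt ?B"
          using S(1) W(1)[OF T] hilbert_schmidt_hs_finite[OF Q(1)] hilbert_schmidt_diff by auto
        have hsC: "hilbert_schmidt (\<lambda>h. S h - T h)" using S(1) W(1)[OF T] hilbert_schmidt_diff by auto
        \<comment> \<open>The squared form \<open>2 * a\<^sup>2 + 2 * b\<^sup>2\<close> replaces the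
          triangle inequality; with \<open>a\<close> and \<open>b\<close> below \<open>r / 2\<close>
          it still gives \<open>r\<^sup>2\<close>.\<close>
        have "(hs_norm (\<lambda>h. S h - T h))\<^sup>2 \<le> 2 * (hs_norm ?A)\<^sup>2 + 2 * (hs_norm ?B)\<^sup>2"
        proof (rule has_sum_mono[OF hs_norm_has_sum[OF hsC]])
          show "((\<lambda>e. 2 * (norm (?A e))\<^sup>2 + 2 * (norm (?B e))\<^sup>2) has_sum 2 * (hs_norm ?A)\<^sup>2 + 2 * (hs_norm ?B)\<^sup>2) hbasis"
            by (intro has_sum_add has_sum_cmult_right hs_norm_has_sum hsA hsB)
          show "(norm (S e - T e))\<^sup>2 \<le> 2 * (norm (?A e))\<^sup>2 + 2 * (norm (?B e))\<^sup>2" for e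
            using norm_add_sq_le[of "?A e" "- ?B e"] by (simp add: norm_minus_commute)
        qed
        also have "\<dots> < 2 * (r / 2)\<^sup>2 + 2 * (r / 2)\<^sup>2"
          using S(2) Q(3) n hs_norm_nonneg[of ?A] hs_norm_nonneg[of ?B]
          by (intro add_strict_mono mult_strict_left_mono power_strict_mono) auto
        also have "\<dots> = r\<^sup>2" by (simp add: power2_eq_square)
        finally show ?thesis using r(1) by (simp add: power2_less_imp_less)
      qed
      then show "S \<in> W" using r(2) S(1) by blast
    qed
    then have "(Q, n) \<in> P" using Q by (simp add: P_def)
    then show "T \<in> (\<Union>(Q, n)\<in>P. ?ball Q n)" using Q(3) W(1)[OF T] by blast
  qed (auto simp: P_def)
  have "G -` ?ball Q n \<inter> space \<mu> \<in> sets \<mu>" if "(Q, n) \<in> P" for Q n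
  proof -
    have Q: "finite Q" using that by (simp add: P_def)
    have "(\<lambda>t. hs_norm (\<lambda>h. G t h - hs_finite Q h)) \<in> borel_measurable \<mu>"
      by (rule measurable_hs_norm[of \<mu> "\<lambda>t h. G t h - hs_finite Q h"])
        (use hs hilbert_schmidt_diff hilbert_schmidt_hs_finite[OF Q] meas in auto)
    then have "{t \<in> space \<mu>. hs_norm (\<lambda>h. G t h - hs_finite Q h) < inverse (real (Suc n))} \<in> sets \<mu>" by measurable
    also have "{t \<in> space \<mu>. hs_norm (\<lambda>h. G t h - hs_finite Q h) < inverse (real (Suc n))} = G -` ?ball Q n \<inter> space \<mu>"
      using hs by auto
    finally show ?thesis .
  qed
  then have "(\<Union>(Q, n)\<in>P. G -` ?ball Q n \<inter> space \<mu>) \<in> sets \<mu>"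
    by (intro sets.countable_UN''[OF countP]) auto
  moreover have "(\<Union>(Q, n)\<in>P. G -` ?ball Q n \<inter> space \<mu>) = G -` W \<inter> space \<mu>" by (subst WP) auto
  ultimately show "G -` W \<inter> space \<mu> \<in> sets \<mu>" by simp
qed (use hs in auto)

section \<open>Operator measures with a trace density\<close>

lemma sets_borel_ext [simp]: "sets (borel_ext m) = sets borel"
  unfolding borel_ext_def using sets.sigma_sets_eq[of borel] by (simp add: sets_measure_of_conv)

text \<open>Exhaustion by balls determines a Borel measure from its bounded sets, and
  \<open>borel_ext\<close> is the same supremum. Given a candidate \<nu>, comparison on bounded sets
  thus identifies the extension.\<close>

lemma borel_ext_eq:
  fixes \<nu> :: "(real^'d::finite) measure"
  assumes sets: "sets \<nu> = sets borel"
    and eq: "\<And>A. A \<in> sets borel \<Longrightarrow> bounded A \<Longrightarrow> ennreal (m A) = emeasure \<nu> A"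
  shows "borel_ext m = \<nu>"
proof -
  have space: "space \<nu> = UNIV" using sets_eq_imp_space_eq[OF sets] by simp
  have "(SUP n. ennreal (m (A \<inter> cball 0 (real n)))) = emeasure \<nu> A" if A: "A \<in> sets borel" for A
  proof -
    have An: "A \<inter> cball 0 (real n) \<in> sets borel" "bounded (A \<inter> cball 0 (real n))" for n
      using A by (auto intro: bounded_subset[OF bounded_cball])
    have UN: "(\<Union>n. A \<inter> cball 0 (real n)) = A"
    proof (intro equalityI subsetI)
      fix x assume x: "x \<in> A"
      obtain n where "norm x \<le> real n" using real_arch_simple by blast
      then show "x \<in> (\<Union>n. A \<inter> cball 0 (real n))" using x by auto
    qed auto
    have "(SUP n. emeasure \<nu> (A \<inter> cball 0 (real n))) = emeasure \<nu> (\<Union>n. A \<inter> cball 0 (real n))"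
    proof (rule SUP_emeasure_incseq)
      show "range (\<lambda>n. A \<inter> cball 0 (real n)) \<subseteq> sets \<nu>" using An(1) sets by blast
      show "incseq (\<lambda>n. A \<inter> cball 0 (real n))" unfolding incseq_def by auto
    qed
    then show ?thesis unfolding eq[OF An] UN .
  qed
  then have "borel_ext m = measure_of UNIV (sets borel) (emeasure \<nu>)"
    unfolding borel_ext_def using sets.sigma_sets_eq[of borel] by (intro measure_of_eq) auto
  also have "\<dots> = \<nu>" using measure_of_of_measure[of \<nu>] by (simp add: space sets)
  finally show ?thesis .
qed

lemma positive_op_trace_has_sum:
  assumes T: "positive_op T" "trace_class T"
  shows "((\<lambda>e. Re (cinner (T e) e)) has_sum Re (trace_op T)) hbasis"
  using has_sum_bounded_linear[OF bounded_linear_Re has_sum_infsum[of "\<lambda>e. cinner (T e) e" hbasis]] assms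
  by (simp add: trace_op_def trace_class_positive)

lemma hilbert_schmidt_op_sqrt:
  assumes T: "positive_op T" "trace_class T"
  shows "hilbert_schmidt (op_sqrt T)" "(hs_norm (op_sqrt T))\<^sup>2 = Re (trace_op T)"
proof -
  have *: "((\<lambda>e. (norm (op_sqrt T e))\<^sup>2) has_sum Re (trace_op T)) hbasis"
    using positive_op_trace_has_sum[OF T] by (simp add: norm_op_sqrt[OF T(1)])
  then show hs: "hilbert_schmidt (op_sqrt T)"
    using op_sqrt(1)[OF T(1)] by (auto simp: hilbert_schmidt_def positive_op_def summable_on_def)
  show "(hs_norm (op_sqrt T))\<^sup>2 = Re (trace_op T)"
    using has_sum_unique[OF hs_norm_has_sum[OF hs] *] .
qed

text \<open>The form of \<open>T\<close> is the squared norm of its root, and the Hilbert--Schmidt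
  norm of the root dominates its operator norm.\<close>

lemma positive_op_le_trace:
  assumes T: "positive_op T" "trace_class T"
  shows "Re (cinner (T h) h) \<le> Re (trace_op T) * (norm h)\<^sup>2"
proof -
  have "(norm (op_sqrt T h))\<^sup>2 \<le> (hs_norm (op_sqrt T) * norm h)\<^sup>2"
    by (intro power_mono hs_norm_bound hilbert_schmidt_op_sqrt(1) T) simp
  then show ?thesis
    by (simp add: norm_op_sqrt[OF T(1)] power_mult_distrib hilbert_schmidt_op_sqrt(2)[OF T])
qed

locale op_density =
  fixes F :: "(real^'d::finite) set \<Rightarrow> 'h::{complex_hilbert, second_countable_topology} \<Rightarrow> 'h"
    and F' :: "real^'d \<Rightarrow> 'h \<Rightarrow> 'h"
  assumes pos: "A \<in> sets borel \<Longrightarrow> bounded A \<Longrightarrow> positive_op (F A) \<and> trace_class (F A)"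
    and density: "is_trace_density F F'"
begin

abbreviation \<mu> :: "(real^'d) measure" where "\<mu> \<equiv> trace_measure F"

section \<open>The trace of the density\<close>

definition \<tau> :: "real^'d \<Rightarrow> real" where "\<tau> t = Re (trace_op (F' t))"

lemma sets_mu [measurable_cong, simp]: "sets \<mu> = sets borel"
  by (simp add: trace_measure_def)

lemma space_mu [simp]: "space \<mu> = UNIV"
  using sets_eq_imp_space_eq[OF sets_mu] by simp

lemma F'_pos: "positive_op (F' t)" and F'_trace: "trace_class (F' t)"
  using density by (auto simp: is_trace_density_def)

lemma tau_has_sum: "((\<lambda>e. Re (cinner (F' t e) e)) has_sum \<tau> t) hbasis"
  unfolding \<tau>_def by (rule positive_op_trace_has_sum[OF F'_pos F'_trace])

lemma F'_nonneg: "0 \<le> Re (cinner (F' t h) h)" "Im (cinner (F' t h) h) = 0"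
  using F'_pos[of t] by (auto simp: positive_op_def complex_is_Real_iff)

lemma tau_nonneg: "0 \<le> \<tau> t"
  by (rule has_sum_nonneg[OF tau_has_sum]) (rule F'_nonneg)

lemma F'_le: "Re (cinner (F' t h) h) \<le> \<tau> t * (norm h)\<^sup>2"
  unfolding \<tau>_def by (rule positive_op_le_trace[OF F'_pos F'_trace])

lemma F'_measurable_weak [measurable]: "(\<lambda>t. cinner (F' t h) k) \<in> borel_measurable \<mu>"
  using density by (simp add: is_trace_density_def)

lemma F'_measurable [measurable]: "(\<lambda>t. F' t h) \<in> borel_measurable \<mu>"
  by (rule weakly_measurable) (rule F'_measurable_weak)

text \<open>Symmetry moves \<open>F' t\<close> onto the fixed vector \<open>k\<close>, where
  measurability is known.\<close>

lemma F'_apply_measurable: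
  assumes [measurable]: "v \<in> borel_measurable \<mu>"
  shows "(\<lambda>t. F' t (v t)) \<in> borel_measurable \<mu>"
proof (rule weakly_measurable)
  show "(\<lambda>t. cinner (F' t (v t)) k) \<in> borel_measurable \<mu>" for k
    unfolding positive_op_symmetric[OF F'_pos] by measurable
qed

lemma nn_integral_tau:
  "ennreal (\<tau> t) = (\<integral>\<^sup>+e. ennreal (Re (cinner (F' t e) e)) \<partial>count_space hbasis)"
  by (rule nn_integral_count_space_has_sum[OF tau_has_sum, symmetric]) (rule F'_nonneg)

lemma tau_measurable [measurable]: "\<tau> \<in> borel_measurable \<mu>"
proof -
  interpret B: sigma_finite_measure "count_space (hbasis :: 'h set)"
    by (rule sigma_finite_measure_count_space_countable[OF countable_hbasis])
  have "(\<lambda>(e, t). ennreal (Re (cinner (F' t e) e))) \<in> borel_measurable (count_space hbasis \<Otimes>\<^sub>M \<mu>)"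
  proof (rule measurable_pair_measure_countable1[OF countable_hbasis])
    show "(\<lambda>t. case (e, t) of (e, t) \<Rightarrow> ennreal (Re (cinner (F' t e) e))) \<in> borel_measurable \<mu>" for e
      unfolding split_conv by measurable
  qed
  from measurable_pair_swap[OF this]
  have "(\<lambda>t. \<integral>\<^sup>+e. ennreal (Re (cinner (F' t e) e)) \<partial>count_space hbasis) \<in> borel_measurable \<mu>"
    using B.borel_measurable_nn_integral by (simp add: split_beta')
  then have "(\<lambda>t. enn2real (ennreal (\<tau> t))) \<in> borel_measurable \<mu>"
    unfolding nn_integral_tau by measurable
  then show ?thesis by (simp add: tau_nonneg)
qed

lemma integrable_tau:
  assumes "A \<in> sets borel" "bounded A"
  shows "integrable \<mu> (\<lambda>t. indicator A t * \<tau> t)"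
  using density assms by (simp add: is_trace_density_def \<tau>_def trace_norm_positive[OF F'_pos])

lemma nn_integral_quadratic:
  assumes A: "A \<in> sets borel" "bounded A"
  shows "ennreal (Re (cinner (F A h) h)) = (\<integral>\<^sup>+t. ennreal (Re (cinner (F' t h) h)) * indicator A t \<partial>\<mu>)"
proof -
  have int: "integrable \<mu> (\<lambda>t. indicator A t * cinner (F' t h) h)"
  proof (rule Bochner_Integration.integrable_bound)
    show "integrable \<mu> (\<lambda>t. indicator A t * \<tau> t * (norm h)\<^sup>2)" using integrable_tau[OF A] by simp
    show "(\<lambda>t. indicator A t * cinner (F' t h) h) \<in> borel_measurable \<mu>" using A by measurable
    have "norm (indicator A t * cinner (F' t h) h) \<le> norm (indicator A t * \<tau> t * (norm h)\<^sup>2)" for t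
    proof -
      have "cmod (cinner (F' t h) h) = Re (cinner (F' t h) h)"
        using F'_nonneg[of t h] by (simp add: cmod_eq_Re)
      then show ?thesis
        using F'_le[of t h] tau_nonneg[of t] by (simp add: norm_mult indicator_def)
    qed
    then show "AE t in \<mu>. norm (indicator A t * cinner (F' t h) h) \<le> norm (indicator A t * \<tau> t * (norm h)\<^sup>2)" by simp
  qed
  have Re: "Re (indicator A t * cinner (F' t h) h) = Re (cinner (F' t h) h) * indicator A t" for t
    by (simp add: indicator_def)
  have "cinner (F A h) h = (\<integral>t. indicator A t * cinner (F' t h) h \<partial>\<mu>)"
    using density A by (simp add: is_trace_density_def)
  then have "Re (cinner (F A h) h) = (\<integral>t. Re (cinner (F' t h) h) * indicator A t \<partial>\<mu>)"
    using integral_Re[OF int] by (simp only: Re)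
  then have "ennreal (Re (cinner (F A h) h)) = (\<integral>\<^sup>+t. ennreal (Re (cinner (F' t h) h) * indicator A t) \<partial>\<mu>)"
    using integrable_Re[OF int] F'_nonneg by (subst nn_integral_eq_integral) (auto simp only: Re, simp)
  moreover have "ennreal (Re (cinner (F' t h) h) * indicator A t) = ennreal (Re (cinner (F' t h) h)) * indicator A t" for t
    by (simp add: indicator_def)
  ultimately show ?thesis by simp
qed

text \<open>The formula for quadratic forms is summed over the countable basis, and Tonelli
  exchanges sum and integral.\<close>

lemma nn_integral_trace:
  assumes A: "A \<in> sets borel" "bounded A"
  shows "ennreal (Re (trace_op (F A))) = (\<integral>\<^sup>+t. ennreal (\<tau> t) * indicator A t \<partial>\<mu>)"
proof -
  note FA = pos[OF A, THEN conjunct1] pos[OF A, THEN conjunct2]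
  have "ennreal (Re (trace_op (F A))) = (\<integral>\<^sup>+e. ennreal (Re (cinner (F A e) e)) \<partial>count_space hbasis)"
    using FA(1) by (intro nn_integral_count_space_has_sum[OF positive_op_trace_has_sum[OF FA], symmetric])
      (simp add: positive_op_def)
  also have "\<dots> = (\<integral>\<^sup>+e. \<integral>\<^sup>+t. ennreal (Re (cinner (F' t e) e)) * indicator A t \<partial>\<mu> \<partial>count_space hbasis)"
    by (intro nn_integral_cong nn_integral_quadratic A)
  also have "\<dots> = (\<integral>\<^sup>+t. \<integral>\<^sup>+e. ennreal (Re (cinner (F' t e) e)) * indicator A t \<partial>count_space hbasis \<partial>\<mu>)"
  proof (rule nn_integral_count_space_nn_integral[symmetric, OF countable_hbasis])
    note [measurable] = A(1)
    show "(\<lambda>t. ennreal (Re (cinner (F' t e) e)) * indicator A t) \<in> borel_measurable \<mu>" for e by measurable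
  qed
  also have "\<dots> = (\<integral>\<^sup>+t. ennreal (\<tau> t) * indicator A t \<partial>\<mu>)"
    unfolding nn_integral_tau by (intro nn_integral_cong nn_integral_multc) simp
  finally show ?thesis .
qed

text \<open>The traces of \<open>F\<close> on bounded sets are integrals of \<tau> against \<mu>,
  while \<mu> is by definition the extension of these same traces. Finiteness of \<mu> on bounded
  sets and \<open>\<tau> t = 1\<close> almost everywhere are read off from this.\<close>

lemma mu_eq_density: "\<mu> = density \<mu> (\<lambda>t. ennreal (\<tau> t))"
proof -
  have "borel_ext (\<lambda>A. Re (trace_op (F A))) = density \<mu> (\<lambda>t. ennreal (\<tau> t))"
    by (rule borel_ext_eq) (simp_all add: nn_integral_trace emeasure_density)
  then show ?thesis unfolding trace_measure_def .
qed

lemma mu_finite: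
  assumes A: "A \<in> sets borel" "bounded A"
  shows "emeasure \<mu> A < \<infinity>"
proof -
  have "emeasure \<mu> A = emeasure (density \<mu> (\<lambda>t. ennreal (\<tau> t))) A" using mu_eq_density by simp
  also have "\<dots> = ennreal (Re (trace_op (F A)))" using A by (simp add: emeasure_density nn_integral_trace)
  finally show ?thesis by simp
qed

sublocale mu: sigma_finite_measure \<mu>
  by (rule tempered_sigma_finite[OF sets_mu mu_finite])

text \<open>Densities with respect to a \<sigma>-finite measure are unique up to null sets, and
  \<mu> has both \<tau> and one as density with respect to itself.\<close>

lemma tau_one: "AE t in \<mu>. \<tau> t = 1"
proof -
  have "AE t in \<mu>. ennreal (\<tau> t) = 1"
    using mu_eq_density by (intro mu.density_unique) (simp_all add: density_1)
  then show ?thesis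
    by eventually_elim (use tau_nonneg in \<open>metis ennreal_1 ennreal_inj zero_le_one\<close>)
qed

lemma borel_ext_quadratic: "borel_ext (\<lambda>A. Re (cinner (F A h) h)) = density \<mu> (\<lambda>t. ennreal (Re (cinner (F' t h) h)))"
  by (rule borel_ext_eq) (simp_all add: nn_integral_quadratic emeasure_density)

section \<open>The square root of the density\<close>

definition S :: "real^'d \<Rightarrow> 'h \<Rightarrow> 'h" where "S t = op_sqrt (F' t)"

lemma S_pos: "positive_op (S t)" and S_S: "S t (S t h) = F' t h"
  unfolding S_def by (rule op_sqrt[OF F'_pos])+

lemma S_bounded_clinear: "bounded_clinear (S t)"
  using S_pos by (simp add: positive_op_def)

lemma S_hilbert_schmidt: "hilbert_schmidt (S t)" and S_norm: "(hs_norm (S t))\<^sup>2 = \<tau> t"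
  unfolding S_def \<tau>_def by (rule hilbert_schmidt_op_sqrt[OF F'_pos F'_trace])+

lemma sqrt_iter_measurable:
  "v \<in> borel_measurable \<mu> \<Longrightarrow> (\<lambda>t. sqrt_iter (\<lambda>h. h - F' t h) n (v t)) \<in> borel_measurable \<mu>"
proof (induction n arbitrary: v)
  case (Suc n)
  note [measurable] = Suc.prems F'_apply_measurable[OF Suc.prems] Suc.IH[OF Suc.IH[OF Suc.prems]]
  show ?case by simp
qed simp

text \<open>Where its trace is one, \<open>F' t\<close> is a contraction and its square root a limit of measurable iterates.\<close>

definition S1 :: "real^'d \<Rightarrow> 'h \<Rightarrow> 'h" where "S1 t = (if \<tau> t = 1 then S t else (\<lambda>h. 0))"

lemma S1_AE: "AE t in \<mu>. S1 t = S t"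
  using tau_one by eventually_elim (simp add: S1_def)

lemma S1_hilbert_schmidt: "hilbert_schmidt (S1 t)"
  by (simp add: S1_def S_hilbert_schmidt hilbert_schmidt_zero)

lemma S1_hs_norm: "hs_norm (S1 t) \<le> 1"
proof (cases "\<tau> t = 1")
  case True
  then have "(hs_norm (S1 t))\<^sup>2 = 1\<^sup>2" using S_norm[of t] by (simp add: S1_def)
  then show ?thesis by (metis hs_norm_nonneg order_refl power2_eq_imp_eq zero_le_one)
next
  case False
  then show ?thesis by (simp add: S1_def hs_norm_def)
qed

lemma S1_measurable [measurable]: "(\<lambda>t. S1 t h) \<in> borel_measurable \<mu>"
proof -
  let ?R = "\<lambda>t. h - lim (\<lambda>n. sqrt_iter (\<lambda>h. h - F' t h) n h)"
  have "S t h = ?R t" if "\<tau> t = 1" for t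
  proof -
    have le: "Re (cinner (F' t h) h) \<le> (norm h)\<^sup>2" for h using F'_le[of t h] that by simp
    \<comment> \<open>Here \<open>refl\<close> takes the limit formula itself as the root;
      uniqueness identifies it with \<open>S t\<close>.\<close>
    note R = positive_contraction_sqrt[OF F'_pos le refl]
    show ?thesis
      unfolding S_def op_sqrt_unique[OF R(1,2)] sqrt_lim_def[OF positive_contraction_complement(1,2)[OF F'_pos le]] ..
  qed
  then have "(\<lambda>t. S1 t h) = (\<lambda>t. if \<tau> t = 1 then ?R t else 0)"
    by (intro ext) (simp add: S1_def)
  moreover have [measurable]: "(\<lambda>t. sqrt_iter (\<lambda>h. h - F' t h) n h) \<in> borel_measurable \<mu>" for n
    by (rule sqrt_iter_measurable) simp
  have "(\<lambda>t. if \<tau> t = 1 then ?R t else 0) \<in> borel_measurable \<mu>" by measurable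
  ultimately show ?thesis by simp
qed

end

section \<open>Square integrable operator functions\<close>

text \<open>In the completion all subsets of null sets are measurable, so \<open>f\<close> inherits
  measurability from \<open>g\<close>. It is applied to integrands built from
  \<open>times_sqrt\<close>, which are controlled only up to null sets.\<close>

lemma integral_completion_AE:
  fixes f g :: "'t \<Rightarrow> 'b::{banach, second_countable_topology}"
  assumes g: "g \<in> borel_measurable M" and ae: "AE t in M. f t = g t"
  shows "integral\<^sup>L (completion M) f = integral\<^sup>L M g"
proof -
  obtain Z where Z: "Z \<in> null_sets M" "{t \<in> space M. f t \<noteq> g t} \<subseteq> Z"
    using ae unfolding eventually_ae_filter by blast
  have gc: "g \<in> borel_measurable (completion M)" by (rule measurable_completion[OF g])
  have "f \<in> borel_measurable (completion M)"
  proof (rule borel_measurableI)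
    fix V :: "'b set" assume V: "open V"
    have fg: "f x = g x" if "x \<in> space M" "x \<notin> Z" for x using Z(2) that by blast
    have "f -` V \<inter> space (completion M) = ((g -` V \<inter> space (completion M)) - Z) \<union> (f -` V \<inter> space M \<inter> Z)"
    proof (rule set_eqI)
      fix x
      show "x \<in> f -` V \<inter> space (completion M) \<longleftrightarrow>
          x \<in> ((g -` V \<inter> space (completion M)) - Z) \<union> (f -` V \<inter> space M \<inter> Z)"
        using fg[of x] by (cases "x \<in> Z") auto
    qed
    moreover have "f -` V \<inter> space M \<inter> Z \<in> sets (completion M)"
    proof (rule null_setsD2, rule null_sets_completion_subset)
      show "f -` V \<inter> space M \<inter> Z \<subseteq> Z" by (rule Int_lower2)
      show "Z \<in> null_sets (completion M)" by (rule null_sets_completionI[OF Z(1)])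
    qed
    moreover have "(g -` V \<inter> space (completion M)) - Z \<in> sets (completion M)"
    proof (rule sets.Diff)
      show "g -` V \<inter> space (completion M) \<in> sets (completion M)"
        by (rule measurable_sets[OF gc borel_open[OF V]])
      show "Z \<in> sets (completion M)" by (rule null_setsD2[OF null_sets_completionI[OF Z(1)]])
    qed
    ultimately show "f -` V \<inter> space (completion M) \<in> sets (completion M)"
      by (simp only: sets.Un)
  qed
  then have "integral\<^sup>L (completion M) f = integral\<^sup>L (completion M) g"
    by (rule integral_cong_AE[OF _ gc AE_completion[OF ae]])
  then show ?thesis by (simp only: integral_completion[OF g])
qed

text \<open>Expanding \<open>adj H h\<close> in the basis matches the integrand of
  \<open>op_gramian\<close> with the terms that occur in \<open>rv_gramian\<close> for column
  functions.\<close>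

lemma hs_pairing_has_sum:
  assumes G: "hilbert_schmidt G" and H: "bounded_clinear H"
  shows "((\<lambda>e. cinner h (H e) * cinner (G e) k) has_sum cinner (G (adj H h)) k) hbasis"
proof -
  have "cinner (adj H h) e = cinner h (H e)" for e
    using cinner_adj[OF H, of e h] cinner_commute by metis
  then show ?thesis
    using has_sum_bounded_linear[OF bounded_linear_cinner_left bounded_clinear_has_sum[OF hilbert_schmidtD[OF G], of "adj H h"], of k]
    by (simp add: cinner_scaleC_left)
qed

lemma space_hs_borel: "space hs_borel = Collect hilbert_schmidt"
  by (simp add: hs_borel_def space_measure_of_conv)

context op_density
begin

declare sets_mu [measurable_cong del]

text \<open>By this encoding, square integrable Hilbert--Schmidt valued functions are square integrable
  vector functions on the product of the counting measure of the basis with \<open>\<mu>\<close>.\<close>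

definition coef :: "(real^'d \<Rightarrow> 'h \<Rightarrow> 'h) \<Rightarrow> 'h \<times> (real^'d) \<Rightarrow> 'h" where
  "coef G z = G (snd z) (fst z)"

abbreviation B :: "'h measure" where "B \<equiv> count_space hbasis"
abbreviation N :: "('h \<times> (real^'d)) measure" where "N \<equiv> B \<Otimes>\<^sub>M \<mu>"

sublocale B: sigma_finite_measure B
  by (rule sigma_finite_measure_count_space_countable[OF countable_hbasis])

sublocale N: pair_sigma_finite B \<mu> ..

lemma sigma_finite_N: "sigma_finite_measure N"
  by (rule N.sigma_finite_measure_axioms)

text \<open>Points of the counting measure have positive mass, so a null set of the product has only
  null slices. Conversely, countably many null slices form a null set.\<close>

lemma AE_N_iff: "(AE z in N. P z) \<longleftrightarrow> (\<forall>e\<in>hbasis. AE t in \<mu>. P (e, t))"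
proof
  assume "AE z in N. P z"
  then have "AE e in B. AE t in \<mu>. P (e, t)" by (rule N.AE_pair)
  then show "\<forall>e\<in>hbasis. AE t in \<mu>. P (e, t)" by (simp add: AE_count_space)
next
  assume ae: "\<forall>e\<in>hbasis. AE t in \<mu>. P (e, t)"
  have "\<forall>e\<in>hbasis. \<exists>Z. Z \<in> null_sets \<mu> \<and> {t. \<not> P (e, t)} \<subseteq> Z"
    using ae unfolding eventually_ae_filter by auto
  from bchoice[OF this] obtain Z where Z: "\<And>e. e \<in> hbasis \<Longrightarrow> Z e \<in> null_sets \<mu>"
    "\<And>e. e \<in> hbasis \<Longrightarrow> {t. \<not> P (e, t)} \<subseteq> Z e" by blast
  have "{e} \<times> Z e \<in> null_sets N" if e: "e \<in> hbasis" for e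
  proof (rule null_setsI)
    have "Z e \<in> sets \<mu>" "emeasure \<mu> (Z e) = 0" using Z(1)[OF e] by auto
    then show "emeasure N ({e} \<times> Z e) = 0" "{e} \<times> Z e \<in> sets N"
      using e by (auto simp: mu.emeasure_pair_measure_Times)
  qed
  then have "(\<Union>e\<in>hbasis. {e} \<times> Z e) \<in> null_sets N"
    by (intro null_sets_UN' countable_hbasis)
  moreover have "{z \<in> space N. \<not> P z} \<subseteq> (\<Union>e\<in>hbasis. {e} \<times> Z e)"
    using Z(2) by (auto simp: space_pair_measure)
  ultimately show "AE z in N. P z" unfolding eventually_ae_filter by blast
qed

lemma coef_measurable:
  assumes "\<And>e. e \<in> hbasis \<Longrightarrow> (\<lambda>t. G t e) \<in> borel_measurable \<mu>"
  shows "coef G \<in> borel_measurable N"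
  by (rule measurable_pair_measure_countable1[OF countable_hbasis]) (simp add: coef_def assms)

lemma section_measurable:
  fixes g :: "'h \<times> (real^'d) \<Rightarrow> 'x::topological_space"
  assumes "g \<in> borel_measurable N" "e \<in> hbasis"
  shows "(\<lambda>t. g (e, t)) \<in> borel_measurable \<mu>"
  using measurable_compose[OF measurable_Pair1'[of e B \<mu>] assms(1)] assms(2) by simp

lemma nn_integral_coef:
  assumes "\<And>t. hilbert_schmidt (G t)" "coef G \<in> borel_measurable N"
  shows "(\<integral>\<^sup>+z. ennreal ((norm (coef G z))\<^sup>2) \<partial>N) = (\<integral>\<^sup>+t. ennreal ((hs_norm (G t))\<^sup>2) \<partial>\<mu>)"
proof -
  have "(\<integral>\<^sup>+z. ennreal ((norm (coef G z))\<^sup>2) \<partial>N) = (\<integral>\<^sup>+t. \<integral>\<^sup>+e. ennreal ((norm (coef G (e, t)))\<^sup>2) \<partial>B \<partial>\<mu>)"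
    using assms(2) by (intro N.nn_integral_snd[symmetric]) measurable
  also have "\<dots> = (\<integral>\<^sup>+t. ennreal ((hs_norm (G t))\<^sup>2) \<partial>\<mu>)"
    by (simp add: coef_def nn_integral_hs_norm[OF assms(1)])
  finally show ?thesis .
qed

text \<open>The encoding by columns loses nothing: measurability into the Hilbert--Schmidt class
  amounts to measurability of the columns, and by Tonelli the norms agree.\<close>

lemma l2_hs_iff: "G \<in> l2_hs \<mu> \<longleftrightarrow> (\<forall>t. hilbert_schmidt (G t)) \<and> sq_int N (coef G)"
proof
  assume G: "G \<in> l2_hs \<mu>"
  then have meas: "G \<in> measurable \<mu> hs_borel" and int: "integrable \<mu> (\<lambda>t. (hs_norm (G t))\<^sup>2)"
    by (auto simp: l2_hs_def)
  have hs: "hilbert_schmidt (G t)" for t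
    using measurable_space[OF meas, of t] by (simp add: space_hs_borel)
  have cm: "coef G \<in> borel_measurable N"
    by (rule coef_measurable) (rule measurable_hs_coefficient[OF meas])
  have "(\<integral>\<^sup>+z. ennreal ((norm (coef G z))\<^sup>2) \<partial>N) < \<infinity>"
    unfolding nn_integral_coef[OF hs cm] using int by (simp add: nn_integral_eq_integral)
  then have "integrable N (\<lambda>z. (norm (coef G z))\<^sup>2)"
    using cm by (intro integrableI_nonneg) auto
  then show "(\<forall>t. hilbert_schmidt (G t)) \<and> sq_int N (coef G)"
    using hs cm by (simp add: sq_int_def)
next
  assume "(\<forall>t. hilbert_schmidt (G t)) \<and> sq_int N (coef G)"
  then have hs: "\<And>t. hilbert_schmidt (G t)" and sq: "sq_int N (coef G)" by auto
  note cm = sq_int_measurable[OF sq]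
  have me: "(\<lambda>t. G t e) \<in> borel_measurable \<mu>" if "e \<in> hbasis" for e
    using section_measurable[OF cm that] by (simp add: coef_def)
  have "(\<integral>\<^sup>+t. ennreal ((hs_norm (G t))\<^sup>2) \<partial>\<mu>) < \<infinity>"
    unfolding nn_integral_coef[OF hs cm, symmetric] using sq_int_integrable[OF sq] by (simp add: nn_integral_eq_integral)
  then have "integrable \<mu> (\<lambda>t. (hs_norm (G t))\<^sup>2)"
    using measurable_hs_norm[of \<mu> G] hs me by (intro integrableI_nonneg) auto
  then show "G \<in> l2_hs \<mu>"
    using measurable_hs_borelI[of \<mu> G] hs me by (simp add: l2_hs_def)
qed

lemma l2_hsD: "G \<in> l2_hs \<mu> \<Longrightarrow> hilbert_schmidt (G t)" "G \<in> l2_hs \<mu> \<Longrightarrow> sq_int N (coef G)"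
  by (auto simp: l2_hs_iff)

lemma integral_coef:
  assumes "G \<in> l2_hs \<mu>"
  shows "(\<integral>z. (norm (coef G z))\<^sup>2 \<partial>N) = (\<integral>t. (hs_norm (G t))\<^sup>2 \<partial>\<mu>)"
proof -
  have 1: "integrable \<mu> (\<lambda>t. (hs_norm (G t))\<^sup>2)" using assms by (simp add: l2_hs_def)
  note 2 = sq_int_integrable[OF l2_hsD(2)[OF assms]]
  have "ennreal (\<integral>z. (norm (coef G z))\<^sup>2 \<partial>N) = ennreal (\<integral>t. (hs_norm (G t))\<^sup>2 \<partial>\<mu>)"
    using nn_integral_coef[OF l2_hsD(1)[OF assms] sq_int_measurable[OF l2_hsD(2)[OF assms]]] 1 2
    by (simp add: nn_integral_eq_integral)
  then show ?thesis by (subst (asm) ennreal_inj) auto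
qed

lemma l2_hs_compose:
  fixes G :: "real^'d \<Rightarrow> 'h \<Rightarrow> 'h"
  assumes a: "bounded_clinear a" and G: "G \<in> l2_hs \<mu>"
  shows "(\<lambda>t h. a (G t h)) \<in> l2_hs \<mu>"
  using sq_int_bounded_clinear[OF l2_hsD(2)[OF G] a] hilbert_schmidt_compose[OF a l2_hsD(1)[OF G]]
  by (simp add: l2_hs_iff coef_def[abs_def])

lemma l2_hs_add:
  fixes G :: "real^'d \<Rightarrow> 'h \<Rightarrow> 'h"
  assumes G: "G \<in> l2_hs \<mu>" and H: "H \<in> l2_hs \<mu>"
  shows "(\<lambda>t h. G t h + H t h) \<in> l2_hs \<mu>"
  using sq_int_add[OF l2_hsD(2)[OF G] l2_hsD(2)[OF H]] hilbert_schmidt_add[OF l2_hsD(1)[OF G] l2_hsD(1)[OF H]]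
  by (simp add: l2_hs_iff coef_def[abs_def])

lemma l2_hs_diff:
  fixes G :: "real^'d \<Rightarrow> 'h \<Rightarrow> 'h"
  assumes G: "G \<in> l2_hs \<mu>" and H: "H \<in> l2_hs \<mu>"
  shows "(\<lambda>t h. G t h - H t h) \<in> l2_hs \<mu>"
  using sq_int_diff[OF l2_hsD(2)[OF G] l2_hsD(2)[OF H]] hilbert_schmidt_diff[OF l2_hsD(1)[OF G] l2_hsD(1)[OF H]]
  by (simp add: l2_hs_iff coef_def[abs_def])

text \<open>An operator is determined by its columns, and the exceptional sets of countably many
  columns can be united.\<close>

lemma coef_AE_iff:
  assumes G: "G \<in> l2_hs \<mu>" and H: "H \<in> l2_hs \<mu>"
  shows "(AE z in N. coef G z = coef H z) \<longleftrightarrow> (AE t in \<mu>. G t = H t)"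
proof -
  have "G t = H t \<longleftrightarrow> (\<forall>e\<in>hbasis. G t e = H t e)" for t
    using bounded_clinear_ext[OF hilbert_schmidtD[OF l2_hsD(1)[OF G]] hilbert_schmidtD[OF l2_hsD(1)[OF H]]] by metis
  then show ?thesis
    unfolding AE_N_iff by (simp add: coef_def AE_ball_countable[OF countable_hbasis])
qed

text \<open>Almost every slice of \<open>g\<close> is square summable over the basis and hence the
  column family of a Hilbert--Schmidt operator. Columns determine the operator, so the choice does
  not endanger measurability.\<close>

lemma l2_hs_reconstruct:
  assumes g: "sq_int N g"
  shows "\<exists>G\<in>l2_hs \<mu>. AE z in N. coef G z = g z"
proof -
  note gm = sq_int_measurable[OF g]
  let ?I = "\<lambda>t. \<integral>\<^sup>+e. ennreal ((norm (g (e, t)))\<^sup>2) \<partial>B"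
  have Im: "?I \<in> borel_measurable \<mu>"
  proof -
    have "(\<lambda>z. ennreal ((norm (g z))\<^sup>2)) \<in> borel_measurable N" using gm by measurable
    from measurable_pair_swap'[THEN measurable_compose, OF this] show ?thesis
      using B.borel_measurable_nn_integral[of "\<lambda>t e. ennreal ((norm (g (e, t)))\<^sup>2)" \<mu>] by (simp add: split_beta')
  qed
  \<comment> \<open>The zero operator is the default on the measurable null set where the slice is
    not square summable, so that every \<open>G t\<close> is Hilbert--Schmidt.\<close>
  define G where "G t = (if ?I t < \<infinity> then (SOME T. hilbert_schmidt T \<and> (\<forall>e\<in>hbasis. T e = g (e, t))) else (\<lambda>h. 0))" for t
  have ex: "\<exists>T. hilbert_schmidt T \<and> (\<forall>e\<in>hbasis. T e = g (e, t))" if "?I t < \<infinity>" for t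
  proof (rule hilbert_schmidt_exists)
    have "integrable B (\<lambda>e. (norm (g (e, t)))\<^sup>2)" using that by (intro integrableI_nonneg) auto
    from integral_count_space_has_sum[OF this] show "(\<lambda>e. (norm (g (e, t)))\<^sup>2) summable_on hbasis"
      unfolding summable_on_def by (rule exI)
  qed
  have Gt: "hilbert_schmidt (G t)" "e \<in> hbasis \<Longrightarrow> G t e = (if ?I t < \<infinity> then g (e, t) else 0)" for t e
  proof -
    show "hilbert_schmidt (G t)"
      using someI_ex[OF ex, of t] by (simp add: G_def hilbert_schmidt_zero)
    show "G t e = (if ?I t < \<infinity> then g (e, t) else 0)" if "e \<in> hbasis"
      using someI_ex[OF ex, of t] that by (simp add: G_def)
  qed
  have Gm: "coef G \<in> borel_measurable N"
  proof (rule coef_measurable)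
    fix e :: 'h assume e: "e \<in> hbasis"
    note [measurable] = Im section_measurable[OF gm e]
    have "(\<lambda>t. if ?I t < \<infinity> then g (e, t) else 0) \<in> borel_measurable \<mu>" by measurable
    then show "(\<lambda>t. G t e) \<in> borel_measurable \<mu>" by (simp add: Gt(2)[OF e])
  qed
  have "AE t in \<mu>. ?I t < \<infinity>"
  proof -
    have "(\<integral>\<^sup>+t. ?I t \<partial>\<mu>) = (\<integral>\<^sup>+z. ennreal ((norm (g z))\<^sup>2) \<partial>N)"
      using gm by (intro N.nn_integral_snd) measurable
    also have "\<dots> = ennreal (\<integral>z. (norm (g z))\<^sup>2 \<partial>N)"
      using sq_int_integrable[OF g] by (intro nn_integral_eq_integral) auto
    finally have "(\<integral>\<^sup>+t. ?I t \<partial>\<mu>) \<noteq> \<infinity>" by simp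
    from nn_integral_PInf_AE[OF Im this] show ?thesis by eventually_elim (simp add: less_top)
  qed
  then have eq: "AE z in N. coef G z = g z"
    unfolding AE_N_iff
  proof (intro ballI)
    fix e :: 'h assume e: "e \<in> hbasis"
    show "AE t in \<mu>. coef G (e, t) = g (e, t)"
      using \<open>AE t in \<mu>. ?I t < \<infinity>\<close> by eventually_elim (simp add: coef_def Gt(2)[OF e])
  qed
  have "sq_int N (coef G)" by (rule sq_int_cong_AE[OF g Gm eq])
  then have "G \<in> l2_hs \<mu>" using Gt(1) by (simp add: l2_hs_iff)
  with eq show ?thesis by blast
qed

text \<open>\<^const>\<open>times_sqrt\<close> is measurable only up to a null set; \<open>product\<close> is a measurable version.\<close>

definition represents :: "(real^'d \<Rightarrow> 'h \<rightharpoonup> 'h) \<Rightarrow> (real^'d \<Rightarrow> 'h \<Rightarrow> 'h) \<Rightarrow> bool" where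
  "represents \<Phi> G \<longleftrightarrow> G \<in> l2_hs \<mu> \<and> (AE t in \<mu>. range (S t) \<subseteq> dom (\<Phi> t) \<and> times_sqrt F' \<Phi> t = G t)"

definition product :: "(real^'d \<Rightarrow> 'h \<rightharpoonup> 'h) \<Rightarrow> real^'d \<Rightarrow> 'h \<Rightarrow> 'h" where
  "product \<Phi> = (SOME G. represents \<Phi> G)"

lemma l2_op_iff: "\<Phi> \<in> l2_op F F' \<longleftrightarrow> (\<forall>t. partial_clinear (\<Phi> t)) \<and> (\<exists>G. represents \<Phi> G)"
  by (auto simp: l2_op_def represents_def S_def)

lemma represents_product:
  assumes "\<Phi> \<in> l2_op F F'"
  shows "represents \<Phi> (product \<Phi>)"
proof -
  have "\<exists>G. represents \<Phi> G" using assms unfolding l2_op_iff by (rule conjunct2)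
  then show ?thesis unfolding product_def by (rule someI_ex)
qed

lemma times_sqrt_S: "times_sqrt F' \<Phi> t h = the (\<Phi> t (S t h))"
  by (simp add: times_sqrt_def S_def)

lemma product_l2_hs: "\<Phi> \<in> l2_op F F' \<Longrightarrow> product \<Phi> \<in> l2_hs \<mu>"
  using represents_product by (simp add: represents_def)

lemma product_AE: "\<Phi> \<in> l2_op F F' \<Longrightarrow> AE t in \<mu>. range (S t) \<subseteq> dom (\<Phi> t) \<and> times_sqrt F' \<Phi> t = product \<Phi> t"
  using represents_product by (simp add: represents_def)

lemma coef_represents:
  assumes "\<Phi> \<in> l2_op F F'" "represents \<Phi> G"
  shows "AE z in N. coef (product \<Phi>) z = coef G z"
proof -
  have G: "G \<in> l2_hs \<mu>" using assms(2) by (simp add: represents_def)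
  have "AE t in \<mu>. times_sqrt F' \<Phi> t = G t" using assms(2) unfolding represents_def by (auto elim: eventually_mono)
  then have "AE t in \<mu>. product \<Phi> t = G t"
    using product_AE[OF assms(1)] by eventually_elim simp
  then show ?thesis unfolding coef_AE_iff[OF product_l2_hs[OF assms(1)] G] .
qed

lemma l2_op_rel_iff:
  "(\<Phi>, \<Psi>) \<in> l2_op_rel F F' \<longleftrightarrow> \<Phi> \<in> l2_op F F' \<and> \<Psi> \<in> l2_op F F' \<and> (AE z in N. coef (product \<Phi>) z = coef (product \<Psi>) z)"
proof -
  have "(AE t in \<mu>. times_sqrt F' \<Phi> t = times_sqrt F' \<Psi> t) \<longleftrightarrow> (AE z in N. coef (product \<Phi>) z = coef (product \<Psi>) z)"
    if "\<Phi> \<in> l2_op F F'" "\<Psi> \<in> l2_op F F'"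
    unfolding coef_AE_iff[OF product_l2_hs[OF that(1)] product_l2_hs[OF that(2)]]
  proof
    assume "AE t in \<mu>. times_sqrt F' \<Phi> t = times_sqrt F' \<Psi> t"
    then show "AE t in \<mu>. product \<Phi> t = product \<Psi> t"
      using product_AE[OF that(1)] product_AE[OF that(2)] by eventually_elim simp
  next
    assume "AE t in \<mu>. product \<Phi> t = product \<Psi> t"
    then show "AE t in \<mu>. times_sqrt F' \<Phi> t = times_sqrt F' \<Psi> t"
      using product_AE[OF that(1)] product_AE[OF that(2)] by eventually_elim simp
  qed
  then show ?thesis by (auto simp: l2_op_rel_def)
qed

section \<open>Module operations on operator functions\<close>

lemma partial_clinear_add:
  assumes "partial_clinear X" "partial_clinear Y"
  shows "partial_clinear (partial_add X Y)"
proof -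
  have dom: "dom (partial_add X Y) = dom X \<inter> dom Y" by (auto simp: partial_add_def dom_def)
  have the: "the (partial_add X Y h) = the (X h) + the (Y h)" if "h \<in> dom X \<inter> dom Y" for h
    using that by (simp add: partial_add_def)
  have sub: "scaleC.subspace (dom X \<inter> dom Y)"
    using assms by (intro scaleC.subspace_inter) (auto simp: partial_clinear_def)
  show ?thesis
    unfolding partial_clinear_def dom
  proof (intro conjI ballI allI sub)
    fix x y assume xy: "x \<in> dom X \<inter> dom Y" "y \<in> dom X \<inter> dom Y"
    show "the (partial_add X Y (x + y)) = the (partial_add X Y x) + the (partial_add X Y y)"
      unfolding the[OF scaleC.subspace_add[OF sub xy]] the[OF xy(1)] the[OF xy(2)]
      using xy assms by (simp add: partial_clinear_def)
  next
    fix c x assume x: "x \<in> dom X \<inter> dom Y"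
    show "the (partial_add X Y (c *\<^sub>C x)) = c *\<^sub>C the (partial_add X Y x)"
      unfolding the[OF scaleC.subspace_scale[OF sub x]] the[OF x]
      using x assms by (simp add: partial_clinear_def scaleC_add_right)
  qed
qed

lemma partial_clinear_map:
  assumes X: "partial_clinear X" and a: "bounded_clinear a"
  shows "partial_clinear (\<lambda>h. map_option a (X h))"
proof -
  have dom: "dom (\<lambda>h. map_option a (X h)) = dom X" by (auto simp: dom_def)
  have the: "the (map_option a (X h)) = a (the (X h))" if "h \<in> dom X" for h
    using that by auto
  have sub: "scaleC.subspace (dom X)" using X by (simp add: partial_clinear_def)
  show ?thesis
    unfolding partial_clinear_def dom
  proof (intro conjI ballI allI sub)
    fix x y assume xy: "x \<in> dom X" "y \<in> dom X"
    show "the (map_option a (X (x + y))) = the (map_option a (X x)) + the (map_option a (X y))"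
      unfolding the[OF scaleC.subspace_add[OF sub xy]] the[OF xy(1)] the[OF xy(2)]
      using xy X by (simp add: partial_clinear_def bounded_clinearD[OF a])
  next
    fix c x assume x: "x \<in> dom X"
    show "the (map_option a (X (c *\<^sub>C x))) = c *\<^sub>C the (map_option a (X x))"
      unfolding the[OF scaleC.subspace_scale[OF sub x]] the[OF x]
      using x X by (simp add: partial_clinear_def bounded_clinearD[OF a])
  qed
qed

lemma partial_clinear_zero: "partial_clinear X \<Longrightarrow> the (X 0) = 0"
proof -
  assume X: "partial_clinear X"
  then have "0 \<in> dom X" using scaleC.subspace_0 by (auto simp: partial_clinear_def)
  then have "the (X (0 *\<^sub>C 0)) = 0 *\<^sub>C the (X 0)" using X unfolding partial_clinear_def by blast
  then show ?thesis by simp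
qed

lemma represents_add:
  assumes "\<Phi> \<in> l2_op F F'" "\<Psi> \<in> l2_op F F'"
  shows "represents (\<lambda>t. partial_add (\<Phi> t) (\<Psi> t)) (\<lambda>t h. product \<Phi> t h + product \<Psi> t h)"
  unfolding represents_def
proof
  show "(\<lambda>t h. product \<Phi> t h + product \<Psi> t h) \<in> l2_hs \<mu>" by (intro l2_hs_add product_l2_hs assms)
  show "AE t in \<mu>. range (S t) \<subseteq> dom (partial_add (\<Phi> t) (\<Psi> t)) \<and>
      times_sqrt F' (\<lambda>t. partial_add (\<Phi> t) (\<Psi> t)) t = (\<lambda>h. product \<Phi> t h + product \<Psi> t h)"
    using product_AE[OF assms(1)] product_AE[OF assms(2)]
  proof eventually_elim
    case (elim t)
    have dom: "S t h \<in> dom (\<Phi> t) \<inter> dom (\<Psi> t)" for h using elim by blast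
    have "times_sqrt F' (\<lambda>t. partial_add (\<Phi> t) (\<Psi> t)) t h = product \<Phi> t h + product \<Psi> t h" for h
    proof -
      have "times_sqrt F' \<Phi> t h = product \<Phi> t h" "times_sqrt F' \<Psi> t h = product \<Psi> t h" using elim by auto
      then show ?thesis unfolding times_sqrt_S partial_add_def using dom[of h] by simp
    qed
    moreover have "range (S t) \<subseteq> dom (partial_add (\<Phi> t) (\<Psi> t))"
      using dom by (auto simp: partial_add_def dom_def)
    ultimately show ?case by blast
  qed
qed

lemma represents_map:
  assumes \<Phi>: "\<Phi> \<in> l2_op F F'" and a: "bounded_clinear a"
  shows "represents (\<lambda>t h. map_option a (\<Phi> t h)) (\<lambda>t h. a (product \<Phi> t h))"
  unfolding represents_def
proof
  show "(\<lambda>t h. a (product \<Phi> t h)) \<in> l2_hs \<mu>" by (rule l2_hs_compose[OF a product_l2_hs[OF \<Phi>]])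
  show "AE t in \<mu>. range (S t) \<subseteq> dom (\<lambda>h. map_option a (\<Phi> t h)) \<and>
      times_sqrt F' (\<lambda>t h. map_option a (\<Phi> t h)) t = (\<lambda>h. a (product \<Phi> t h))"
    using product_AE[OF \<Phi>]
  proof eventually_elim
    case (elim t)
    have dom: "S t h \<in> dom (\<Phi> t)" for h using elim by blast
    have "times_sqrt F' (\<lambda>t h. map_option a (\<Phi> t h)) t h = a (product \<Phi> t h)" for h
    proof -
      have "times_sqrt F' \<Phi> t h = product \<Phi> t h" using elim by auto
      then show ?thesis unfolding times_sqrt_S using dom[of h] by auto
    qed
    moreover have "range (S t) \<subseteq> dom (\<lambda>h. map_option a (\<Phi> t h))" using elim by auto
    ultimately show ?case by blast
  qed
qed

lemma l2_op_add:
  assumes "\<Phi> \<in> l2_op F F'" "\<Psi> \<in> l2_op F F'"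
  shows "(\<lambda>t. partial_add (\<Phi> t) (\<Psi> t)) \<in> l2_op F F'"
  using assms represents_add[OF assms] by (auto simp: l2_op_iff intro: partial_clinear_add)

lemma l2_op_map:
  assumes "\<Phi> \<in> l2_op F F'" "bounded_clinear a"
  shows "(\<lambda>t h. map_option a (\<Phi> t h)) \<in> l2_op F F'"
  using assms represents_map[OF assms] by (auto simp: l2_op_iff intro: partial_clinear_map)

text \<open>\<open>\<Phi> t\<close> is applied to \<open>S t h\<close> only, and a linear partial
  map sends zero to zero. Together with \<open>exists_l2_op\<close> this characterises the functions
  that arise as products.\<close>

lemma product_kernel:
  assumes \<Phi>: "\<Phi> \<in> l2_op F F'"
  shows "AE t in \<mu>. \<forall>h. S t h = 0 \<longrightarrow> product \<Phi> t h = 0"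
  using product_AE[OF \<Phi>]
proof eventually_elim
  case (elim t)
  show ?case
  proof (intro allI impI)
    fix h assume "S t h = 0"
    then have "times_sqrt F' \<Phi> t h = 0"
      using \<Phi> by (simp add: times_sqrt_S l2_op_iff partial_clinear_zero)
    then show "product \<Phi> t h = 0" using elim by auto
  qed
qed

text \<open>Completeness of the space of operator functions rests on this lemma. The operators \<open>\<Phi>(t)\<close> are
  unbounded in general: they are defined on the range of the square root only.\<close>

lemma exists_l2_op:
  assumes G: "G \<in> l2_hs \<mu>" and ker: "AE t in \<mu>. \<forall>h. S t h = 0 \<longrightarrow> G t h = 0"
  shows "\<exists>\<Phi>\<in>l2_op F F'. represents \<Phi> G"
proof -
  \<comment> \<open>A preimage is chosen for each \<open>y\<close>, and the kernel condition makes
    the value independent of the choice. Elsewhere the zero operator on the whole space keeps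
    \<open>\<Phi> t\<close> linear for every \<open>t\<close>.\<close>
  define \<Phi> where "\<Phi> t = (if \<forall>h. S t h = 0 \<longrightarrow> G t h = 0
    then (\<lambda>y. if y \<in> range (S t) then Some (G t (SOME h. S t h = y)) else None) else (\<lambda>y. Some 0))" for t
  note GD = bounded_clinearD[OF hilbert_schmidtD[OF l2_hsD(1)[OF G]]]
  note SD = bounded_clinearD[OF S_bounded_clinear]
  have dom: "dom (\<Phi> t) = range (S t)" and val: "the (\<Phi> t (S t h)) = G t h"
    if k: "\<forall>h. S t h = 0 \<longrightarrow> G t h = 0" for t h
  proof -
    have \<Phi>t: "\<Phi> t = (\<lambda>y. if y \<in> range (S t) then Some (G t (SOME h. S t h = y)) else None)"
      unfolding \<Phi>_def using k by simp
    show "dom (\<Phi> t) = range (S t)" unfolding \<Phi>t dom_def by (auto split: if_splits)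
    have "S t (SOME h'. S t h' = S t h) = S t h" by (rule someI) simp
    then have "S t ((SOME h'. S t h' = S t h) - h) = 0" by (simp add: SD)
    then have "G t ((SOME h'. S t h' = S t h) - h) = 0" using k by blast
    then have "G t (SOME h'. S t h' = S t h) = G t h" by (simp add: GD)
    then show "the (\<Phi> t (S t h)) = G t h" unfolding \<Phi>t by simp
  qed
  have "partial_clinear (\<Phi> t)" for t
  proof (cases "\<forall>h. S t h = 0 \<longrightarrow> G t h = 0")
    case True
    have sub: "scaleC.subspace (range (S t))"
      unfolding scaleC.subspace_def by (auto simp flip: SD) (metis SD(4) rangeI)+
    show ?thesis
      unfolding partial_clinear_def dom[OF True]
    proof (intro conjI ballI allI sub)
      fix x y assume "x \<in> range (S t)" "y \<in> range (S t)"
      then obtain h k where hk: "x = S t h" "y = S t k" by blast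
      show "the (\<Phi> t (x + y)) = the (\<Phi> t x) + the (\<Phi> t y)"
        unfolding hk SD(1)[symmetric] val[OF True] by (rule GD)
    next
      fix c x assume "x \<in> range (S t)"
      then obtain h where h: "x = S t h" by blast
      show "the (\<Phi> t (c *\<^sub>C x)) = c *\<^sub>C the (\<Phi> t x)"
        unfolding h SD(3)[symmetric] val[OF True] by (rule GD)
    qed
  next
    case False
    then have "\<Phi> t = (\<lambda>y. Some 0)" unfolding \<Phi>_def by (simp only: if_False)
    then show ?thesis by (simp add: partial_clinear_def scaleC.subspace_UNIV dom_def)
  qed
  moreover have "represents \<Phi> G"
    unfolding represents_def
  proof (intro conjI G)
    show "AE t in \<mu>. range (S t) \<subseteq> dom (\<Phi> t) \<and> times_sqrt F' \<Phi> t = G t"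
    using ker
  proof eventually_elim
    case (elim t)
    show ?case using dom[OF elim] val[OF elim] by (auto simp: times_sqrt_S fun_eq_iff)
  qed
  qed
  ultimately have "\<Phi> \<in> l2_op F F'" "represents \<Phi> G" unfolding l2_op_iff by auto
  then show ?thesis by (rule_tac bexI)
qed
text \<open>Convergence in mean square yields a subsequence that converges in Hilbert--Schmidt norm
  at almost every \<open>t\<close>, so vanishing on the kernel of \<open>S t\<close> passes to the
  limit and \<open>exists_l2_op\<close> applies.\<close>

lemma l2_op_limit:
  assumes f: "\<And>n::nat. f n \<in> l2_op F F'" and g: "sq_int N g"
    and lim: "(\<lambda>n. \<integral>z. (norm (coef (product (f n)) z - g z))\<^sup>2 \<partial>N) \<longlonglongrightarrow> 0"
  shows "\<exists>\<Phi>\<in>l2_op F F'. AE z in N. coef (product \<Phi>) z = g z"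
proof -
  obtain G where G: "G \<in> l2_hs \<mu>" "AE z in N. coef G z = g z" using l2_hs_reconstruct[OF g] by blast
  let ?P = "\<lambda>n. product (f n)"
  let ?D = "\<lambda>n t. (hs_norm (\<lambda>h. ?P n t h - G t h))\<^sup>2"
  note P = product_l2_hs[OF f]
  note D = l2_hs_diff[OF P G(1)]
  have "(\<integral>z. (norm (coef (?P n) z - g z))\<^sup>2 \<partial>N) = (\<integral>t. ?D n t \<partial>\<mu>)" for n
  proof -
    note [measurable] = sq_int_measurable[OF l2_hsD(2)[OF P]] sq_int_measurable[OF g] sq_int_measurable[OF l2_hsD(2)[OF D]]
    have "(\<integral>z. (norm (coef (?P n) z - g z))\<^sup>2 \<partial>N) = (\<integral>z. (norm (coef (\<lambda>t h. ?P n t h - G t h) z))\<^sup>2 \<partial>N)"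
    proof (rule integral_cong_AE)
      show "AE z in N. (norm (coef (?P n) z - g z))\<^sup>2 = (norm (coef (\<lambda>t h. ?P n t h - G t h) z))\<^sup>2"
        using G(2) by eventually_elim (simp add: coef_def)
    qed measurable
    then show ?thesis by (simp add: integral_coef[OF D])
  qed
  then have "(\<lambda>n. \<integral>t. ?D n t \<partial>\<mu>) \<longlonglongrightarrow> 0" using lim by simp
  then have "(\<lambda>n. \<integral>t. norm (?D n t) \<partial>\<mu>) \<longlonglongrightarrow> 0" by simp
  moreover have "integrable \<mu> (?D n)" for n using D[of n] by (simp add: l2_hs_def)
  ultimately obtain r :: "nat \<Rightarrow> nat" where r: "AE t in \<mu>. (\<lambda>n. ?D (r n) t) \<longlonglongrightarrow> 0"
    using tendsto_L1_AE_subseq[of \<mu> ?D] by blast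
  have "AE t in \<mu>. \<forall>n. \<forall>h. S t h = 0 \<longrightarrow> ?P n t h = 0"
    unfolding AE_all_countable using product_kernel[OF f] by blast
  then have "AE t in \<mu>. \<forall>h. S t h = 0 \<longrightarrow> G t h = 0"
    using r
  proof eventually_elim
    case (elim t)
    have "(\<lambda>n. sqrt (?D (r n) t)) \<longlonglongrightarrow> sqrt 0" by (intro tendsto_real_sqrt elim)
    then have lim0: "(\<lambda>n. hs_norm (\<lambda>h. ?P (r n) t h - G t h)) \<longlonglongrightarrow> 0" by (simp add: hs_norm_nonneg)
    show ?case
    proof (intro allI impI)
      fix h assume h: "S t h = 0"
      have "norm (G t h) \<le> hs_norm (\<lambda>h. ?P (r n) t h - G t h) * norm h" for n
        using hs_norm_bound[OF l2_hsD(1)[OF D], of "r n" t h] elim(1) h by simp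
      moreover have "(\<lambda>n. hs_norm (\<lambda>h. ?P (r n) t h - G t h) * norm h) \<longlonglongrightarrow> 0 * norm h"
        by (intro tendsto_mult lim0 tendsto_const)
      ultimately have "norm (G t h) \<le> 0 * norm h" by (intro LIMSEQ_le_const) auto
      then show "G t h = 0" by simp
    qed
  qed
  from exists_l2_op[OF G(1) this] obtain \<Phi> where \<Phi>: "\<Phi> \<in> l2_op F F'" "represents \<Phi> G" by (rule bexE)
  have "AE z in N. coef (product \<Phi>) z = g z"
    using coef_represents[OF \<Phi>] G(2) by eventually_elim simp
  then show ?thesis using \<Phi>(1) by (rule bexI)
qed

text \<open>Fubini on the product, with the inner sum over the basis evaluated by
  \<open>hs_pairing_has_sum\<close>. The integrability part also supplies the measurability of an
  expression that contains an adjoint.\<close>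

lemma rv_gramian_coef:
  assumes G: "G \<in> l2_hs \<mu>" and H: "H \<in> l2_hs \<mu>"
  shows "integrable \<mu> (\<lambda>t. cinner (G t (adj (H t) h)) k)"
    and "cinner (rv_gramian N (coef G) (coef H) h) k = (\<integral>t. cinner (G t (adj (H t) h)) k \<partial>\<mu>)"
proof -
  have sq: "sq_int B (G t)" if "G \<in> l2_hs \<mu>" for G t
  proof -
    have "integrable B (\<lambda>e. (norm (G t e))\<^sup>2)"
      by (rule integrableI_bounded) (simp_all add: nn_integral_hs_norm[OF l2_hsD(1)[OF that]])
    then show ?thesis by (simp add: sq_int_def)
  qed
  have int: "integrable N (\<lambda>(e, t). cinner h (H t e) * cinner (G t e) k)"
    using rv_gramian_integrable[OF l2_hsD(2)[OF G] l2_hsD(2)[OF H], of h k]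
    by (simp add: coef_def split_beta')
  have pairing: "(\<integral>e. cinner h (H t e) * cinner (G t e) k \<partial>B) = cinner (G t (adj (H t) h)) k" for t
    by (rule has_sum_unique[OF integral_count_space_has_sum[OF rv_gramian_integrable[OF sq[OF G] sq[OF H]]]
          hs_pairing_has_sum[OF l2_hsD(1)[OF G] hilbert_schmidtD[OF l2_hsD(1)[OF H]]]])
  show "integrable \<mu> (\<lambda>t. cinner (G t (adj (H t) h)) k)"
    using N.integrable_snd[OF int] unfolding pairing .
  show "cinner (rv_gramian N (coef G) (coef H) h) k = (\<integral>t. cinner (G t (adj (H t) h)) k \<partial>\<mu>)"
    using N.integral_snd[OF int]
    by (simp add: pairing rv_gramian_eq(2)[OF l2_hsD(2)[OF G] l2_hsD(2)[OF H]] coef_def split_beta')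
qed

text \<open>Both sides are determined by sesquilinear forms, and these agree once the integrand over
  the completion is replaced by its measurable version.\<close>

lemma op_gramian_eq:
  assumes \<Phi>: "\<Phi> \<in> l2_op F F'" and \<Psi>: "\<Psi> \<in> l2_op F F'"
  shows "op_gramian F F' \<Phi> \<Psi> = rv_gramian N (coef (product \<Phi>)) (coef (product \<Psi>))"
proof -
  note G = product_l2_hs[OF \<Phi>] and H = product_l2_hs[OF \<Psi>]
  have "(\<integral>t. cinner (times_sqrt F' \<Phi> t (adj (times_sqrt F' \<Psi> t) h)) k \<partial>completion \<mu>) =
      (\<integral>z. cinner h (coef (product \<Psi>) z) * cinner (coef (product \<Phi>) z) k \<partial>N)" for h k
  proof -
    have "(\<integral>t. cinner (times_sqrt F' \<Phi> t (adj (times_sqrt F' \<Psi> t) h)) k \<partial>completion \<mu>) =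
        (\<integral>t. cinner (product \<Phi> t (adj (product \<Psi> t) h)) k \<partial>\<mu>)"
    proof (rule integral_completion_AE[OF borel_measurable_integrable[OF rv_gramian_coef(1)[OF G H]]])
      show "AE t in \<mu>. cinner (times_sqrt F' \<Phi> t (adj (times_sqrt F' \<Psi> t) h)) k =
          cinner (product \<Phi> t (adj (product \<Psi> t) h)) k"
        using product_AE[OF \<Phi>] product_AE[OF \<Psi>] by eventually_elim simp
    qed
    then show ?thesis
      unfolding rv_gramian_coef(2)[OF G H, symmetric] rv_gramian_eq(2)[OF l2_hsD(2)[OF G] l2_hsD(2)[OF H]] .
  qed
  then show ?thesis unfolding op_gramian_def rv_gramian_def by simp
qed

lemma L2op_module: "l2_module (L2op F F') N (\<lambda>p. coef (product (rep p)))"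
proof -
  have gram: "gram (L2op F F') p q = rv_gramian N (coef (product (rep p))) (coef (product (rep q)))"
    if "rep p \<in> l2_op F F'" "rep q \<in> l2_op F F'" for p q
    using op_gramian_eq[OF that] by (simp add: L2op_def)
  have sc: "(\<lambda>t h. map_option a (\<Phi> t h)) \<in> l2_op F F' \<and>
      (AE z in N. coef (product (\<lambda>t h. map_option a (\<Phi> t h))) z = a (coef (product \<Phi>) z))"
    if a: "bounded_clinear a" and \<Phi>: "\<Phi> \<in> l2_op F F'" for a \<Phi>
    using l2_op_map[OF \<Phi> a] coef_represents[OF l2_op_map[OF \<Phi> a] represents_map[OF \<Phi> a]]
    by (simp add: coef_def)
  have model: "l2_model (L2op F F') N (\<lambda>p. coef (product (rep p)))"
  proof (rule l2_model_quotient[where K = "\<lambda>\<Phi>. coef (product \<Phi>)" and S = "l2_op F F'" and r = "l2_op_rel F F'"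
        and pl = "\<lambda>\<Phi> \<Psi> t. partial_add (\<Phi> t) (\<Psi> t)" and sc = "\<lambda>c \<Phi> t h. map_option ((*\<^sub>C) c) (\<Phi> t h)"])
    show "(\<Phi>, \<Psi>) \<in> l2_op_rel F F' \<longleftrightarrow> \<Phi> \<in> l2_op F F' \<and> \<Psi> \<in> l2_op F F' \<and>
        (AE z in N. coef (product \<Phi>) z = coef (product \<Psi>) z)" for \<Phi> \<Psi>
      by (rule l2_op_rel_iff)
    show "sq_int N (coef (product \<Phi>))" if "\<Phi> \<in> l2_op F F'" for \<Phi> by (rule l2_hsD(2)[OF product_l2_hs[OF that]])
    show "(\<lambda>t. partial_add (\<Phi> t) (\<Psi> t)) \<in> l2_op F F' \<and>
        (AE z in N. coef (product (\<lambda>t. partial_add (\<Phi> t) (\<Psi> t))) z = coef (product \<Phi>) z + coef (product \<Psi>) z)"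
      if "\<Phi> \<in> l2_op F F'" "\<Psi> \<in> l2_op F F'" for \<Phi> \<Psi>
      using l2_op_add[OF that] coef_represents[OF l2_op_add[OF that] represents_add[OF that]] by (simp add: coef_def)
    show "(\<lambda>t h. map_option ((*\<^sub>C) c) (\<Phi> t h)) \<in> l2_op F F' \<and>
        (AE z in N. coef (product (\<lambda>t h. map_option ((*\<^sub>C) c) (\<Phi> t h))) z = c *\<^sub>C coef (product \<Phi>) z)"
      if "\<Phi> \<in> l2_op F F'" for c \<Phi>
      by (rule sc[OF bounded_clinear_scaleC[OF bounded_clinear_ident] that])
    show "ip (L2op F F') p q = (\<integral>z. cinner (coef (product (rep p)) z) (coef (product (rep q)) z) \<partial>N)"
      if "rep p \<in> l2_op F F'" "rep q \<in> l2_op F F'" for p q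
    proof -
      have "ip (L2op F F') p q = trace_op (gram (L2op F F') p q)" by (simp add: L2op_def)
      then show ?thesis
        unfolding gram[OF that] using trace_rv_gramian[OF l2_hsD(2)[OF product_l2_hs[OF that(1)]]
          l2_hsD(2)[OF product_l2_hs[OF that(2)]] sigma_finite_N] by simp
    qed
    show "\<exists>h\<in>l2_op F F'. AE x in N. coef (product h) x = g x"
      if "\<And>n::nat. f n \<in> l2_op F F'" "sq_int N g"
        "(\<lambda>n. \<integral>x. (norm (coef (product (f n)) x - g x))\<^sup>2 \<partial>N) \<longlonglongrightarrow> 0" for f g
      by (rule l2_op_limit[OF that])
  qed (simp_all add: L2op_def)
  show ?thesis
    by (rule l2_module_quotient[where K = "\<lambda>\<Phi>. coef (product \<Phi>)" and S = "l2_op F F'" and r = "l2_op_rel F F'"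
        and ac = "\<lambda>a \<Phi> t h. map_option a (\<Phi> t h)", OF model l2_op_rel_iff _ _ sc gram])
      (simp_all add: L2op_def)
qed

text \<open>The scalar measures in \<open>op_integral\<close> have the densities
  \<open>Re (cinner (F' t h) h)\<close> with respect to \<mu>, so quadratic forms can be compared
  under \<mu>; polarization then determines the operator.\<close>

lemma op_integral_eq:
  assumes T: "bounded_clinear T" and w: "w \<in> borel_measurable \<mu>"
    and eq: "\<And>h. cinner (T h) h = (\<integral>t. w t * cinner (F' t h) h \<partial>\<mu>)"
  shows "op_integral F w = T"
proof -
  have int: "cinner (T h) h = (\<integral>t. w t \<partial>borel_ext (\<lambda>A. Re (cinner (F A h) h)))" for h
  proof -
    have *: "cinner (F' t h) h = complex_of_real (Re (cinner (F' t h) h))" for t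
      using F'_nonneg(2)[of t h] by (simp add: complex_eq_iff)
    have "(\<integral>t. w t \<partial>borel_ext (\<lambda>A. Re (cinner (F A h) h))) = (\<integral>t. Re (cinner (F' t h) h) *\<^sub>R w t \<partial>\<mu>)"
      unfolding borel_ext_quadratic by (rule integral_density[OF w]) (simp_all add: F'_nonneg)
    moreover have "Re (cinner (F' t h) h) *\<^sub>R w t = w t * cinner (F' t h) h" for t
      by (subst *) (simp add: scaleR_conv_of_real mult.commute)
    ultimately show ?thesis by (simp add: eq)
  qed
  show ?thesis
    unfolding op_integral_def
  proof (rule the_equality)
    show "bounded_clinear T \<and> (\<forall>h. cinner (T h) h = (\<integral>t. w t \<partial>borel_ext (\<lambda>A. Re (cinner (F A h) h))))"
      by (intro conjI T allI int)
    fix T' assume T': "bounded_clinear T' \<and> (\<forall>h. cinner (T' h) h = (\<integral>t. w t \<partial>borel_ext (\<lambda>A. Re (cinner (F A h) h))))"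
    show "T' = T"
      by (rule quadratic_form_unique[OF _ T]) (use T' in \<open>simp_all add: int\<close>)
  qed
qed

subsection \<open>Scalar functions\<close>

definition scalar :: "(real^'d \<Rightarrow> complex) \<Rightarrow> real^'d \<Rightarrow> 'h \<rightharpoonup> 'h" where
  "scalar f = (\<lambda>t h. Some (f t *\<^sub>C h))"

text \<open>\<open>S1 t\<close> has Hilbert--Schmidt norm at most one for every \<open>t\<close>, so
  square integrability of \<open>f\<close> is enough.\<close>

lemma scalar_l2_hs:
  assumes f: "sq_int \<mu> f"
  shows "(\<lambda>t h. f t *\<^sub>C S1 t h) \<in> l2_hs \<mu>"
proof -
  let ?G = "\<lambda>t h. f t *\<^sub>C S1 t h"
  note [measurable] = sq_int_measurable[OF f]
  have hs: "hilbert_schmidt (?G t)" for t by (rule hilbert_schmidt_scaleC[OF S1_hilbert_schmidt])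
  have meas: "coef ?G \<in> borel_measurable N" by (rule coef_measurable) measurable
  have le: "(hs_norm (?G t))\<^sup>2 \<le> (cmod (f t))\<^sup>2" for t
  proof -
    have "((\<lambda>e. (cmod (f t))\<^sup>2 * (norm (S1 t e))\<^sup>2) has_sum (cmod (f t))\<^sup>2 * (hs_norm (S1 t))\<^sup>2) hbasis"
      by (rule has_sum_cmult_right[OF hs_norm_has_sum[OF S1_hilbert_schmidt]])
    then have "(hs_norm (?G t))\<^sup>2 = (cmod (f t))\<^sup>2 * (hs_norm (S1 t))\<^sup>2"
      using has_sum_unique[OF hs_norm_has_sum[OF hs[of t]]] by (simp add: norm_scaleC power_mult_distrib)
    moreover have "(hs_norm (S1 t))\<^sup>2 \<le> 1"
      using power_le_one[OF hs_norm_nonneg S1_hs_norm] .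
    ultimately show ?thesis by (simp add: mult_left_le)
  qed
  have "(\<integral>\<^sup>+z. ennreal ((norm (coef ?G z))\<^sup>2) \<partial>N) \<le> (\<integral>\<^sup>+t. ennreal ((cmod (f t))\<^sup>2) \<partial>\<mu>)"
    unfolding nn_integral_coef[OF hs meas] by (intro nn_integral_mono ennreal_leI le)
  also have "\<dots> < \<infinity>" using sq_int_integrable[OF f] by (simp add: nn_integral_eq_integral)
  finally have "integrable N (\<lambda>z. (norm (coef ?G z))\<^sup>2)"
    using meas by (intro integrableI_bounded) simp_all
  then show ?thesis using hs meas by (simp add: l2_hs_iff sq_int_def)
qed

lemma scalar_represents:
  assumes f: "sq_int \<mu> f"
  shows "represents (scalar f) (\<lambda>t h. f t *\<^sub>C S1 t h)"
  unfolding represents_def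
proof (rule conjI[OF scalar_l2_hs[OF f]])
  show "AE t in \<mu>. range (S t) \<subseteq> dom (scalar f t) \<and> times_sqrt F' (scalar f) t = (\<lambda>h. f t *\<^sub>C S1 t h)"
    using S1_AE by eventually_elim (auto simp: scalar_def times_sqrt_S fun_eq_iff)
qed

lemma scalar_l2_op:
  assumes f: "sq_int \<mu> f"
  shows "scalar f \<in> l2_op F F'"
proof -
  have "partial_clinear (scalar f t)" for t
    by (simp add: partial_clinear_def scalar_def dom_def scaleC.subspace_UNIV scaleC_add_right scaleC_scaleC mult.commute)
  then show ?thesis using scalar_represents[OF f] unfolding l2_op_iff by blast
qed

lemma l2_op_equiv: "equiv (l2_op F F') (l2_op_rel F F')"
  by (rule equiv_AE[where K = "\<lambda>\<Phi>. coef (product \<Phi>)" and N = N]) (rule l2_op_rel_iff)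

lemma scalar_class_AE:
  assumes f: "sq_int \<mu> f"
  shows "AE z in N. coef (product (rep (l2_op_rel F F' `` {scalar f}))) z = coef (\<lambda>t h. f t *\<^sub>C S1 t h) z"
proof -
  have "(rep (l2_op_rel F F' `` {scalar f}), scalar f) \<in> l2_op_rel F F'"
    by (rule rep_class(2)[OF l2_op_equiv scalar_l2_op[OF f]])
  then have "AE z in N. coef (product (rep (l2_op_rel F F' `` {scalar f}))) z = coef (product (scalar f)) z"
    by (simp only: l2_op_rel_iff)
  then show ?thesis
    using coef_represents[OF scalar_l2_op[OF f] scalar_represents[OF f]] by eventually_elim simp
qed

text \<open>As \<open>S t\<close> is symmetric with square \<open>F' t\<close>, the product of
  \<open>f t *\<^sub>C S t\<close> with the adjoint of \<open>g t *\<^sub>C S t\<close> is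
  \<open>f t * cnj (g t)\<close> times \<open>F' t\<close>.\<close>

lemma scalar_gramian:
  assumes f: "sq_int \<mu> f" and g: "sq_int \<mu> g"
  shows "rv_gramian N (coef (\<lambda>t h. f t *\<^sub>C S1 t h)) (coef (\<lambda>t h. g t *\<^sub>C S1 t h)) = op_integral F (\<lambda>t. f t * cnj (g t))"
    (is "?T = _")
proof -
  note fS = scalar_l2_hs[OF f] and gS = scalar_l2_hs[OF g]
  have meas: "(\<lambda>t. f t * cnj (g t)) \<in> borel_measurable \<mu>"
    by (rule borel_measurable_times[OF _ borel_measurable_cnj]) (rule sq_int_measurable[OF f], rule sq_int_measurable[OF g])
  have adj: "adj (\<lambda>h. g t *\<^sub>C S t h) = (\<lambda>h. cnj (g t) *\<^sub>C S t h)" for t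
    by (rule adj_unique) (simp add: cinner_scaleC_left cinner_scaleC_right positive_op_symmetric[OF S_pos])
  have "cinner (?T h) h = (\<integral>t. f t * cnj (g t) * cinner (F' t h) h \<partial>\<mu>)" for h
  proof -
    let ?Q = "\<lambda>t. cinner (f t *\<^sub>C S1 t (adj (\<lambda>h. g t *\<^sub>C S1 t h) h)) h"
    have "cinner (?T h) h = (\<integral>t. ?Q t \<partial>\<mu>)" by (rule rv_gramian_coef(2)[OF fS gS])
    moreover have "(\<integral>t. ?Q t \<partial>\<mu>) = (\<integral>t. f t * cnj (g t) * cinner (F' t h) h \<partial>\<mu>)"
    proof (rule integral_cong_AE)
      show "?Q \<in> borel_measurable \<mu>" by (rule borel_measurable_integrable[OF rv_gramian_coef(1)[OF fS gS]])
      show "AE t in \<mu>. ?Q t = f t * cnj (g t) * cinner (F' t h) h"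
        using S1_AE
        by eventually_elim
          (simp add: adj cinner_scaleC_left bounded_clinearD[OF S_bounded_clinear] S_S mult.assoc)
      show "(\<lambda>t. f t * cnj (g t) * cinner (F' t h) h) \<in> borel_measurable \<mu>"
        by (rule borel_measurable_times[OF meas F'_measurable_weak])
    qed
    ultimately show ?thesis by simp
  qed
  then have "op_integral F (\<lambda>t. f t * cnj (g t)) = ?T"
    by (rule op_integral_eq[OF bounded_clinear_rv_gramian[OF l2_hsD(2)[OF fS] l2_hsD(2)[OF gS]] meas])
  then show ?thesis by (rule sym)
qed

lemma scalar_orthogonal_zero:
  assumes sch: "\<And>\<phi>. \<phi> \<in> schwartz \<Longrightarrow> integrable \<mu> \<phi>" and G: "G \<in> l2_hs \<mu>"
    and ker: "AE t in \<mu>. \<forall>h. S t h = 0 \<longrightarrow> G t h = 0"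
    and zero: "\<And>\<phi> h k. \<phi> \<in> test_funs \<Longrightarrow>
      cinner (rv_gramian N (coef (\<lambda>t h. fourier \<phi> t *\<^sub>C S1 t h)) (coef G) h) k = 0"
  shows "AE z in N. coef G z = 0"
proof -
  have "AE t in \<mu>. cinner (S1 t (adj (G t) h)) k = 0" for h k
  proof (rule fourier_orthogonal_zero[OF mu.sigma_finite_measure_axioms sets_mu])
    fix \<phi> :: "real^'d \<Rightarrow> complex" assume \<phi>: "\<phi> \<in> test_funs"
    note fS = scalar_l2_hs[OF fourier_integrable(2)[OF sch \<phi>]]
    show "integrable \<mu> (\<lambda>t. fourier \<phi> t * cinner (S1 t (adj (G t) h)) k)"
      using rv_gramian_coef(1)[OF fS G, of h k] by (simp only: cinner_scaleC_left)
    show "(\<integral>t. fourier \<phi> t * cinner (S1 t (adj (G t) h)) k \<partial>\<mu>) = 0"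
      using rv_gramian_coef(2)[OF fS G, of h k] by (simp only: cinner_scaleC_left zero[OF \<phi>])
  qed
  \<comment> \<open>Each pair \<open>h\<close>, \<open>k\<close> has its own exceptional set;
    restricting both to the countable basis leaves one common null set.\<close>
  then have "AE t in \<mu>. \<forall>h\<in>hbasis. \<forall>k\<in>hbasis. cinner (S1 t (adj (G t) h)) k = 0"
    by (simp add: AE_ball_countable[OF countable_hbasis])
  then have G0: "AE t in \<mu>. \<forall>e\<in>hbasis. G t e = 0"
    using S1_AE ker
  proof eventually_elim
    case (elim t)
    note adj = cinner_adj[OF hilbert_schmidtD[OF l2_hsD(1)[OF G]]]
    have adj0: "adj (G t) h = 0" if h: "h \<in> hbasis" for h
    proof -
      have "S t (adj (G t) h) = 0"
        by (rule hbasis_ext_zero) (use elim(1,2) h in auto)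
      \<comment> \<open>The kernel condition is applied to \<open>adj (G t) h\<close>; pairing the
        result with \<open>h\<close> produces the squared norm of
        \<open>adj (G t) h\<close>.\<close>
      then have "G t (adj (G t) h) = 0" using elim(3) by blast
      then have "cinner (adj (G t) h) (adj (G t) h) = 0" using adj[of t "adj (G t) h" h] by simp
      then show ?thesis by (simp add: cinner_self)
    qed
    show ?case
    proof
      fix e :: 'h assume "e \<in> hbasis"
      show "G t e = 0" by (rule hbasis_ext_zero) (simp add: adj adj0)
    qed
  qed
  show ?thesis
    unfolding AE_N_iff
  proof
    fix e :: 'h assume e: "e \<in> hbasis"
    show "AE t in \<mu>. coef G (e, t) = 0"
      using G0 by eventually_elim (simp add: coef_def e)
  qed
qed

end

section \<open>The modular time domain\<close>

theorem modular_domain_isomorphism: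
  fixes M :: "'w measure" and U :: "(real^'d::finite \<Rightarrow> complex) \<Rightarrow> ('w \<Rightarrow> 'h::{complex_hilbert, second_countable_topology}) set"
  assumes M: "prob_space M" and U: "U \<in> distributions (RV2 M)" and F: "representing_op_measure M U F"
    and F': "is_trace_density F F'"
  shows "\<exists>W. gramian_unitary_iso (modular_domain M U) (L2op F F') W \<and>
    (\<forall>\<phi>\<in>test_funs. W (U \<phi>) = l2_op_rel F F' `` {\<lambda>t h. Some (fourier \<phi> t *\<^sub>C h)})"
proof -
  interpret op_density F F'
    using F F' by unfold_locales (simp_all add: representing_op_measure_def tempered_op_measure_def positive_op_measure_def)
  let ?E1 = "RV2 M :: (('w \<Rightarrow> 'h) set, 'h) hilbert_module"
  let ?E2 = "L2op F F'"
  have sch: "\<And>\<phi>. \<phi> \<in> schwartz \<Longrightarrow> integrable \<mu> \<phi>"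
    using F by (auto simp: representing_op_measure_def tempered_op_measure_def)
  have Fsq: "sq_int \<mu> (fourier \<phi>)" if "\<phi> \<in> test_funs" for \<phi>
    by (rule fourier_integrable(2)[OF sch that])
  interpret M1: l2_module ?E1 M rep by (rule rv2_model[OF M])
  interpret M2: l2_module ?E2 N "\<lambda>p. coef (product (rep p))" by (rule L2op_module)
  define v where "v \<phi> = l2_op_rel F F' `` {scalar (fourier \<phi>)}" for \<phi>
  have v_carrier: "v \<phi> \<in> carrier ?E2" if "\<phi> \<in> test_funs" for \<phi>
    using rep_class(1)[OF l2_op_equiv scalar_l2_op[OF Fsq[OF that]]] by (simp add: L2op_def v_def)
  have U_carrier: "U \<phi> \<in> carrier ?E1" if "\<phi> \<in> test_funs" for \<phi>
    using U that by (simp add: distributions_def)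
  have v_gram: "gram ?E2 (v \<phi>) p = rv_gramian N (coef (\<lambda>t h. fourier \<phi> t *\<^sub>C S1 t h)) (coef (product (rep p)))"
    if \<phi>: "\<phi> \<in> test_funs" and p: "p \<in> carrier ?E2" for \<phi> p
    unfolding M2.J_gram[OF v_carrier[OF \<phi>] p]
    by (rule rv_gramian_cong_AE[OF M2.J_sq_int[OF v_carrier[OF \<phi>]] l2_hsD(2)[OF scalar_l2_hs[OF Fsq[OF \<phi>]]]
          scalar_class_AE[OF Fsq[OF \<phi>], folded v_def] M2.J_sq_int[OF p] M2.J_sq_int[OF p]]) simp
  have gram_eq: "gram ?E1 (U \<phi>) (U \<psi>) = gram ?E2 (v \<phi>) (v \<psi>)" if \<phi>: "\<phi> \<in> test_funs" and \<psi>: "\<psi> \<in> test_funs" for \<phi> \<psi>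
  proof -
    note sq = l2_hsD(2)[OF scalar_l2_hs[OF Fsq]]
    have "gram ?E2 (v \<phi>) (v \<psi>) =
        rv_gramian N (coef (\<lambda>t h. fourier \<phi> t *\<^sub>C S1 t h)) (coef (\<lambda>t h. fourier \<psi> t *\<^sub>C S1 t h))"
      unfolding v_gram[OF \<phi> v_carrier[OF \<psi>]]
      by (rule rv_gramian_cong_AE[OF sq[OF \<phi>] sq[OF \<phi>] _ M2.J_sq_int[OF v_carrier[OF \<psi>]] sq[OF \<psi>]
            scalar_class_AE[OF Fsq[OF \<psi>], folded v_def]]) simp
    moreover have "(\<lambda>t. fourier \<phi> t * cnj (fourier \<psi> t)) = fourier (convol \<phi> (tilde \<psi>))"
      by (rule ext) (rule fourier_convolution[OF \<phi> \<psi>, symmetric])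
    moreover have "gram ?E1 (U \<phi>) (U \<psi>) = op_integral F (fourier (convol \<phi> (tilde \<psi>)))"
      using F \<phi> \<psi> by (simp add: representing_op_measure_def)
    ultimately show ?thesis by (simp only: scalar_gramian[OF Fsq[OF \<phi>] Fsq[OF \<psi>]])
  qed
  \<comment> \<open>Indexing by pairs of an operator and a test function makes the generating family
    stable under the action.\<close>
  define I :: "(('h \<Rightarrow> 'h) \<times> (real^'d \<Rightarrow> complex)) set" where "I = Collect bounded_clinear \<times> test_funs"
  define u2 where "u2 i = act ?E1 (fst i) (U (snd i))" for i
  define v2 where "v2 i = act ?E2 (fst i) (v (snd i))" for i
  have I: "(a, \<phi>) \<in> I \<longleftrightarrow> bounded_clinear a \<and> \<phi> \<in> test_funs" for a \<phi> by (simp add: I_def)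
  have v2_sub: "v2 ` I \<subseteq> carrier ?E2"
    by (auto simp: v2_def I intro!: M2.act_closed v_carrier)
  have sfM: "sigma_finite_measure M" using prob_space_imp_sigma_finite[OF M] .
  interpret module_families ?E1 M rep ?E2 N "\<lambda>p. coef (product (rep p))" I u2 v2
  proof
    show "u2 ` I \<subseteq> carrier ?E1" by (auto simp: u2_def I intro!: M1.act_closed U_carrier)
    show "v2 ` I \<subseteq> carrier ?E2" by (rule v2_sub)
    show "ip ?E1 (u2 i) (u2 j) = ip ?E2 (v2 i) (v2 j)" if "i \<in> I" "j \<in> I" for i j
    proof -
      obtain a \<phi> b \<psi> where ij: "i = (a, \<phi>)" "j = (b, \<psi>)" by (cases i, cases j) simp
      have a: "bounded_clinear a" and \<phi>: "\<phi> \<in> test_funs" and b: "bounded_clinear b" and \<psi>: "\<psi> \<in> test_funs"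
        using that unfolding ij I by auto
      \<comment> \<open>Both scalar products are traces of the same expression in gramians of the
        vectors before multiplication, which agree by \<open>gram_eq\<close>.\<close>
      have "ip ?E1 (u2 i) (u2 j) = trace_op (\<lambda>h. a (gram ?E1 (U \<phi>) (U \<psi>) (adj b h)))"
        using M1.ip_trace[OF sfM M1.act_closed[OF a U_carrier[OF \<phi>]] M1.act_closed[OF b U_carrier[OF \<psi>]]]
        by (simp only: ij u2_def fst_conv snd_conv M1.gram_act[OF a b U_carrier[OF \<phi>] U_carrier[OF \<psi>]])
      moreover have "ip ?E2 (v2 i) (v2 j) = trace_op (\<lambda>h. a (gram ?E2 (v \<phi>) (v \<psi>) (adj b h)))"
        using M2.ip_trace[OF sigma_finite_N M2.act_closed[OF a v_carrier[OF \<phi>]] M2.act_closed[OF b v_carrier[OF \<psi>]]]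
        by (simp only: ij v2_def fst_conv snd_conv M2.gram_act[OF a b v_carrier[OF \<phi>] v_carrier[OF \<psi>]])
      ultimately show ?thesis by (simp only: gram_eq[OF \<phi> \<psi>])
    qed
    show "closed_span ?E2 (v2 ` I) = carrier ?E2"
    proof (rule ccontr)
      assume ne: "closed_span ?E2 (v2 ` I) \<noteq> carrier ?E2"
      have "I \<noteq> {}" using bounded_clinear_ident bump_test_fun unfolding I_def by blast
      then have nonempty: "v2 ` I \<noteq> {}" by simp
      obtain z where z: "z \<in> carrier ?E2" "M2.nrm z \<noteq> 0" and orth: "\<forall>q\<in>v2 ` I. ip ?E2 q z = 0"
        using M2.exists_orthogonal[OF v2_sub nonempty ne] by blast
      have zop: "rep z \<in> l2_op F F'"
        using rep_quotient(1)[OF l2_op_equiv, of z] z(1) by (simp add: L2op_def)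
      have "AE y in N. coef (product (rep z)) y = 0"
      proof (rule scalar_orthogonal_zero[OF sch product_l2_hs[OF zop] product_kernel[OF zop]])
        fix \<phi> :: "real^'d \<Rightarrow> complex" and h k :: 'h assume \<phi>: "\<phi> \<in> test_funs"
        \<comment> \<open>Orthogonality to the multiples by rank one operators gives every matrix
          entry of the gramian with \<open>z\<close>, by \<open>gram_ip\<close>.\<close>
        have "((\<lambda>x. cinner x k *\<^sub>C h), \<phi>) \<in> I" by (simp add: I bounded_clinear_rank_one \<phi>)
        from imageI[OF this, of v2] have "act ?E2 (\<lambda>x. cinner x k *\<^sub>C h) (v \<phi>) \<in> v2 ` I"
          by (simp only: v2_def fst_conv snd_conv)
        with orth have "ip ?E2 (act ?E2 (\<lambda>x. cinner x k *\<^sub>C h) (v \<phi>)) z = 0" by (rule bspec)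
        then show "cinner (rv_gramian N (coef (\<lambda>t h. fourier \<phi> t *\<^sub>C S1 t h)) (coef (product (rep z))) h) k = 0"
          by (simp only: M2.gram_ip[OF v_carrier[OF \<phi>] z(1), symmetric] v_gram[OF \<phi> z(1)])
      qed
      then have "AE y in N. cinner (coef (product (rep z)) y) (coef (product (rep z)) y) = 0"
        by eventually_elim simp
      then have "ip ?E2 z z = 0" unfolding M2.J_ip[OF z(1) z(1)] by (rule integral_eq_zero_AE)
      then show False using z(2) by (simp add: M2.nrm_def)
    qed
    show "\<exists>j\<in>I. act ?E1 a (u2 i) = u2 j \<and> act ?E2 a (v2 i) = v2 j" if a: "bounded_clinear a" and "i \<in> I" for a i
    proof -
      obtain b \<phi> where i: "i = (b, \<phi>)" by (cases i)
      have b: "bounded_clinear b" and \<phi>: "\<phi> \<in> test_funs" using \<open>i \<in> I\<close> unfolding i I by auto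
      show ?thesis
      proof (rule bexI[of _ "(\<lambda>x. a (b x), \<phi>)"])
        show "act ?E1 a (u2 i) = u2 (\<lambda>x. a (b x), \<phi>) \<and> act ?E2 a (v2 i) = v2 (\<lambda>x. a (b x), \<phi>)"
          by (simp only: i u2_def v2_def fst_conv snd_conv M1.act_act[OF a b U_carrier[OF \<phi>]]
              M2.act_act[OF a b v_carrier[OF \<phi>]] simp_thms)
        show "(\<lambda>x. a (b x), \<phi>) \<in> I" by (simp add: I bounded_clinear_compose[OF a b] \<phi>)
      qed
    qed
  qed
  have "u2 ` I = {act (RV2 M) a (U \<phi>) | a \<phi>. bounded_clinear a \<and> \<phi> \<in> test_funs}"
  proof (intro equalityI subsetI)
    fix p assume "p \<in> u2 ` I"
    then obtain a \<phi> where "(a, \<phi>) \<in> I" "p = u2 (a, \<phi>)" by (metis imageE surj_pair)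
    then show "p \<in> {act (RV2 M) a (U \<phi>) | a \<phi>. bounded_clinear a \<and> \<phi> \<in> test_funs}"
      unfolding u2_def I fst_conv snd_conv by blast
  next
    fix p assume "p \<in> {act (RV2 M) a (U \<phi>) | a \<phi>. bounded_clinear a \<and> \<phi> \<in> test_funs}"
    then obtain a \<phi> where "p = u2 (a, \<phi>)" "(a, \<phi>) \<in> I" unfolding u2_def I fst_conv snd_conv by blast
    then show "p \<in> u2 ` I" by (rule image_eqI)
  qed
  then have "gramian_unitary_iso (modular_domain M U) ?E2 W"
    using W_gramian_unitary by (simp only: modular_domain_def)
  moreover have "W (U \<phi>) = l2_op_rel F F' `` {\<lambda>t h. Some (fourier \<phi> t *\<^sub>C h)}" if \<phi>: "\<phi> \<in> test_funs" for \<phi>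
  proof -
    \<comment> \<open>The identity operator recovers \<open>U \<phi>\<close> among the
      generators.\<close>
    have "(\<lambda>x. x, \<phi>) \<in> I" by (simp add: I bounded_clinear_ident \<phi>)
    from W_base[OF this] show ?thesis
      by (simp only: u2_def v2_def fst_conv snd_conv M1.act_ident[OF U_carrier[OF \<phi>]]
          M2.act_ident[OF v_carrier[OF \<phi>]]) (simp only: v_def scalar_def)
  qed
  ultimately show ?thesis by (intro exI conjI ballI)
qed

theorem theorem3p3:
  fixes M :: "'w measure"
    and U :: "(real^'d::finite \<Rightarrow> complex) \<Rightarrow>
               ('w \<Rightarrow> 'h::{complex_hilbert, second_countable_topology}) set"
  assumes "prob_space M"
    and infinite_dimensional: "\<forall>B::'h set. finite B \<longrightarrow> module.span (*\<^sub>C) B \<noteq> UNIV"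
    and "U \<in> distributions (RV2 M)"
  shows
    "(stationary M U \<longrightarrow>
       (\<forall>\<nu>. representing_measure M U \<nu> \<longrightarrow>
         (\<exists>W. unitary_iso (vector_domain M U) (L2 \<nu>) W \<and>
              (\<forall>\<phi>\<in>test_funs. W (U \<phi>) = l2_rel \<nu> `` {fourier \<phi>}))))
     \<and>
     (operator_stationary M U \<longrightarrow>
       (\<forall>F F'. representing_op_measure M U F \<and> is_trace_density F F' \<longrightarrow>
         (\<exists>W. gramian_unitary_iso (modular_domain M U) (L2op F F') W \<and>
              (\<forall>\<phi>\<in>test_funs. W (U \<phi>) =
                 l2_op_rel F F' `` {\<lambda>t h. Some (fourier \<phi> t *\<^sub>C h)}))))"
proof (intro conjI impI allI)
  fix \<nu> assume "representing_measure M U \<nu>"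
  with assms(1,3) show "\<exists>W. unitary_iso (vector_domain M U) (L2 \<nu>) W \<and>
      (\<forall>\<phi>\<in>test_funs. W (U \<phi>) = l2_rel \<nu> `` {fourier \<phi>})"
    by (rule vector_domain_isomorphism)
next
  fix F F' assume "representing_op_measure M U F \<and> is_trace_density F F'"
  then show "\<exists>W. gramian_unitary_iso (modular_domain M U) (L2op F F') W \<and>
      (\<forall>\<phi>\<in>test_funs. W (U \<phi>) = l2_op_rel F F' `` {\<lambda>t h. Some (fourier \<phi> t *\<^sub>C h)})"
    by (elim conjE) (rule modular_domain_isomorphism[OF assms(1,3)])
qed

end
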